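(* Let $\alpha,\beta,\gamma,\delta\in\mathbb C$ be given, with associated $\theta_0,\theta_x,\theta_1,\theta_\infty$. Let $\sigma,\phi\in\mathbb C$ with $\Re\sigma=0$, $\sigma\ne0$. Set $$B=\frac{\theta_0^2-\theta_x^2+\sigma^2}{2\sigma^2}=\frac{\sigma^2-2\beta-1+2\delta}{2\sigma^2},$$ $$A=\frac{\sqrt{[\sigma^2-(\theta_0+\theta_x)^2]\,[(\theta_0-\theta_x)^2-\sigma^2]}}{2\sigma^2}=\sqrt{\frac{\theta_0^2}{\sigma^2}-B^2}=\sqrt{-\frac{2\beta}{\sigma^2}-B^2}$$ (any sign of the square root), and assume $A\ne0$, i.e. $\sigma\notin\{\pm(\theta_0+\theta_x),\pm(\theta_0-\theta_x)\}$. Then the equation PVI admits a solution with a branch at $x=0$ having the following behavior when $x\to0$ with $\arg x$ bounded: $$y(x)=x\bigl\{iA\sin(i\sigma\ln x+\phi)+B+\delta^*(x)\bigr\},\qquad\delta^*(x)=O(x).$$ The term $\delta^*(x)$ has an expansion, convergent for $0<|x|<\epsilon$ with $\epsilon$ sufficiently small ($\arg x$ bounded), of the form $$\delta^*(x)=\sum_{n=1}^\infty x^n\sum_{m=-n-1}^{n+1}b_{nm}\,x^{m\sigma}=\sum_{m_2=1}^\infty\ \sum_{m_1=-1}^{2m_2+1}a_{m_1m_2}\,x^{m_1\sigma}x^{m_2(1-\sigma)},\qquad a_{m_1m_2}=b_{m_2,m_1-m_2}.$$ The constant $\sigma$ is related to the monodromy data associated to $y(x)$ by $2\cos(\pi\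sigma)=p_{0x}>2$.
   Context: PVI is the equation $$y''=\tfrac12\Bigl[\tfrac1y+\tfrac1{y-1}+\tfrac1{y-x}\Bigr](y')^2-\Bigl[\tfrac1x+\tfrac1{x-1}+\tfrac1{y-x}\Bigr]y'+\frac{y(y-1)(y-x)}{x^2(x-1)^2}\Bigl[\alpha+\beta\frac{x}{y^2}+\gamma\frac{x-1}{(y-1)^2}+\delta\frac{x(x-1)}{(y-x)^2}\Bigr].$$ Its solutions extend meromorphically to the universal covering of $\mathbb C\setminus\{0,1\}$; a branch is a determination for $|\arg x|<\pi$, $|\arg(1-x)|<\pi$. Parameters: $\theta_0^2=-2\beta$, $\theta_x^2=1-2\delta$, $\theta_1^2=2\gamma$, $(\theta_\infty-1)^2=2\alpha$, $\theta_\infty\ne0$. Monodromy data: PVI is the isomonodromy condition of $\frac{d\Psi}{d\lambda}=\Bigl[\frac{A_0(x)}{\lambda}+\frac{A_x(x)}{\lambda-x}+\frac{A_1(x)}{\lambda-1}\Bigr]\Psi$ with traceless $2\times2$ matrices $A_i$ having eigenvalues $\pm\theta_i/2$ ($i=0,x,1$), $A_0+A_x+A_1=-\frac{\theta_\infty}2\,\mathrm{diag}(1,-1)$, and satisfying the Schlesinger equations in $x$; the solution of PVI associated to such a system is $y(x)=\dfrac{x(A_0)_{12}}{x[(A_0)_{12}+(A_1)_{12}]-(A_1)_{12}}$. Under continuation of $\lambda$ along counterclockwise loops $\gamma_0,\gamma_x,\gamma_1$ around $0,x,1$ one has $\Psi\mapsto\Psi M_i$, $i=0,x,1$, the $M_i$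 being independent of $x$. $p_{0x}=\mathrm{Tr}(M_0M_x)$, where $\gamma_0,\gamma_x$ are chosen so that, for small $x$, $\gamma_0\gamma_x$ is homotopic to a simple loop enclosing $0$ and $x$ (and the segment joining them) but not $1$. *)

theory Defs
  imports "HOL-Complex_Analysis.Complex_Analysis" "HOL-Library.Landau_Symbols"
begin

text \<open>
  Functions on (parts of) the universal covering of the punctured plane are written in the global
  coordinate $s = \ln x$ of the covering, so the point with coordinate \<open>s\<close> lies over \<open>x = exp s\<close>,
  \<open>Im s\<close> is the (unrestricted) argument of \<open>x\<close>, and $x^c$ is \<open>exp (c * s)\<close>. The principal branch of
  such a function \<open>f\<close> is \<open>\<lambda>x. f (Ln x)\<close>.
\<close>

definition log_sector :: "real \<Rightarrow> real \<Rightarrow> complex set" where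
  "log_sector \<epsilon> \<Theta> = {s. Re s < ln \<epsilon> \<and> \<bar>Im s\<bar> < \<Theta>}"

text \<open>The filter for \<open>x \<rightarrow> 0\<close> with \<open>\<bar>arg x\<bar> < \<Theta>\<close>.\<close>

definition at_log_zero :: "real \<Rightarrow> complex filter" where
  "at_log_zero \<Theta> = inf (filtercomap Re at_bot) (principal {s. \<bar>Im s\<bar> < \<Theta>})"

text \<open>The derivation $d/dx$, lifted to the covering.\<close>

definition x_deriv :: "(complex \<Rightarrow> complex) \<Rightarrow> complex \<Rightarrow> complex" where
  "x_deriv f s = deriv f s / exp s"

lemma deriv_principal_branch:
  assumes "x \<notin> \<real>\<^sub>\<le>\<^sub>0" "f field_differentiable at (Ln x)"
  shows "deriv (\<lambda>x. f (Ln x)) x = x_deriv f (Ln x)"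
proof -
  have "x \<noteq> 0" using assms(1) by auto
  have "(f has_field_derivative deriv f (Ln x)) (at (Ln x))"
    using assms(2) by (simp add: field_differentiable_derivI)
  from DERIV_chain2[OF this has_field_derivative_Ln[OF assms(1)]]
  have "deriv (\<lambda>x. f (Ln x)) x = deriv f (Ln x) * inverse x"
    by (rule DERIV_imp_deriv)
  then show ?thesis
    using \<open>x \<noteq> 0\<close> by (simp add: x_deriv_def field_simps)
qed


definition PVI_rhs ::
  "complex \<Rightarrow> complex \<Rightarrow> complex \<Rightarrow> complex \<Rightarrow> complex \<Rightarrow> complex \<Rightarrow> complex \<Rightarrow> complex" where
  "PVI_rhs \<alpha> \<beta> \<gamma> \<delta> x y y' =
     1/2 * (1/y + 1/(y - 1) + 1/(y - x)) * y'^2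
     - (1/x + 1/(x - 1) + 1/(y - x)) * y'
     + y * (y - 1) * (y - x) / (x^2 * (x - 1)^2)
       * (\<alpha> + \<beta> * (x / y^2) + \<gamma> * ((x - 1) / (y - 1)^2) + \<delta> * (x * (x - 1) / (y - x)^2))"

text \<open>
  A holomorphic solution may take the values \<open>0\<close>, \<open>1\<close>, \<open>x\<close>, at which the right-hand side is not
  defined, as long as it is not identically equal to one of them; the equation is required at all
  other points.
\<close>

definition PVI_solution_on ::
  "complex \<Rightarrow> complex \<Rightarrow> complex \<Rightarrow> complex \<Rightarrow> (complex \<Rightarrow> complex) \<Rightarrow> complex set \<Rightarrow> bool" where
  "PVI_solution_on \<alpha> \<beta> \<gamma> \<delta> Y W \<longleftrightarrow>
     open W \<and> connected W \<and> Y holomorphic_on W \<and>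
     (\<exists>s\<in>W. Y s \<notin> {0, 1, exp s}) \<and>
     (\<forall>s\<in>W. Y s \<notin> {0, 1, exp s} \<longrightarrow>
        x_deriv (x_deriv Y) s = PVI_rhs \<alpha> \<beta> \<gamma> \<delta> (exp s) (Y s) (x_deriv Y s))"


definition eigenvalues :: "complex^2^2 \<Rightarrow> complex set" where
  "eigenvalues A = {c. \<exists>v. v \<noteq> 0 \<and> A *v v = c *s v}"

definition commutator :: "complex^2^2 \<Rightarrow> complex^2^2 \<Rightarrow> complex^2^2" where
  "commutator A B = A ** B - B ** A"

definition matrix_holomorphic_on :: "(complex \<Rightarrow> complex^2^2) \<Rightarrow> complex set \<Rightarrow> bool" where
  "matrix_holomorphic_on F U \<longleftrightarrow> (\<forall>i j. (\<lambda>z. F z $ i $ j) holomorphic_on U)"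

text \<open>The coefficients are functions of the covering coordinate \<open>s\<close>.\<close>

definition schlesinger_system ::
  "complex \<Rightarrow> complex \<Rightarrow> complex \<Rightarrow> complex \<Rightarrow>
   (complex \<Rightarrow> complex^2^2) \<Rightarrow> (complex \<Rightarrow> complex^2^2) \<Rightarrow> (complex \<Rightarrow> complex^2^2) \<Rightarrow>
   complex set \<Rightarrow> bool" where
  "schlesinger_system \<theta>0 \<theta>x \<theta>1 \<theta>inf A0 Ax A1 W \<longleftrightarrow>
     matrix_holomorphic_on A0 W \<and> matrix_holomorphic_on Ax W \<and> matrix_holomorphic_on A1 W \<and>
     (\<forall>s\<in>W.
        trace (A0 s) = 0 \<and> eigenvalues (A0 s) = {\<theta>0/2, - \<theta>0/2} \<and>
        trace (Ax s) = 0 \<and> eigenvalues (Ax s) = {\<theta>x/2, - \<theta>x/2} \<and>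
        trace (A1 s) = 0 \<and> eigenvalues (A1 s) = {\<theta>1/2, - \<theta>1/2} \<and>
        A0 s + Ax s + A1 s = vector [vector [- \<theta>inf/2, 0], vector [0, \<theta>inf/2]] \<and>
        (\<forall>i j.
           x_deriv (\<lambda>s. A0 s $ i $ j) s = commutator (Ax s) (A0 s) $ i $ j / exp s \<and>
           x_deriv (\<lambda>s. A1 s $ i $ j) s = commutator (A1 s) (Ax s) $ i $ j / (1 - exp s) \<and>
           x_deriv (\<lambda>s. Ax s $ i $ j) s =
             commutator (A0 s) (Ax s) $ i $ j / exp s
             + commutator (A1 s) (Ax s) $ i $ j / (exp s - 1)))"

definition PVI_associated ::
  "(complex \<Rightarrow> complex^2^2) \<Rightarrow> (complex \<Rightarrow> complex^2^2) \<Rightarrow> (complex \<Rightarrow> complex) \<Rightarrow>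
   complex set \<Rightarrow> bool" where
  "PVI_associated A0 A1 Y W \<longleftrightarrow>
     (\<forall>s\<in>W. let d = exp s * (A0 s $ 1 $ 2 + A1 s $ 1 $ 2) - A1 s $ 1 $ 2 in
              d \<noteq> 0 \<and> Y s = exp s * A0 s $ 1 $ 2 / d)"


definition fuchsian_coeff ::
  "complex^2^2 \<Rightarrow> complex^2^2 \<Rightarrow> complex^2^2 \<Rightarrow> complex \<Rightarrow> complex \<Rightarrow> complex^2^2" where
  "fuchsian_coeff A0 Ax A1 x l =
     (\<chi> i j. A0 $ i $ j / l + Ax $ i $ j / (l - x) + A1 $ i $ j / (l - 1))"

definition fundamental_solution_on ::
  "complex^2^2 \<Rightarrow> complex^2^2 \<Rightarrow> complex^2^2 \<Rightarrow> complex \<Rightarrow> (complex \<Rightarrow> complex^2^2) \<Rightarrow>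
   complex set \<Rightarrow> bool" where
  "fundamental_solution_on A0 Ax A1 x \<Psi> U \<longleftrightarrow>
     open U \<and> U \<subseteq> - {0, x, 1} \<and>
     (\<forall>l\<in>U. det (\<Psi> l) \<noteq> 0 \<and>
        (\<forall>i j. ((\<lambda>l. \<Psi> l $ i $ j) has_field_derivative
                 (fuchsian_coeff A0 Ax A1 x l ** \<Psi> l) $ i $ j) (at l)))"

text \<open>
  Analytic continuation of the germ of \<open>F\<close> at \<open>g 0\<close> along the path \<open>g\<close>, with the germ of \<open>G\<close> at
  \<open>g 1\<close> as result; \<open>\<Phi> t\<close> represents the germ at \<open>g t\<close>.
\<close>

definition continues_along ::
  "(real \<Rightarrow> complex) \<Rightarrow> (complex \<Rightarrow> complex^2^2) \<Rightarrow> (complex \<Rightarrow> complex^2^2) \<Rightarrow> bool" where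
  "continues_along g F G \<longleftrightarrow>
     (\<exists>\<Phi> :: real \<Rightarrow> complex \<Rightarrow> complex^2^2.
        (\<forall>t\<in>{0..1}. \<exists>r>0. \<exists>d>0.
           matrix_holomorphic_on (\<Phi> t) (ball (g t) r) \<and>
           (\<forall>u\<in>{0..1}. \<bar>u - t\<bar> < d \<longrightarrow>
              g u \<in> ball (g t) r \<and> (\<forall>\<^sub>F l in nhds (g u). \<Phi> u l = \<Phi> t l))) \<and>
        (\<forall>\<^sub>F l in nhds (g 0). \<Phi> 0 l = F l) \<and>
        (\<forall>\<^sub>F l in nhds (g 1). \<Phi> 1 l = G l))"

definition has_monodromy ::
  "(complex \<Rightarrow> complex^2^2) \<Rightarrow> (real \<Rightarrow> complex) \<Rightarrow> complex^2^2 \<Rightarrow> bool" where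
  "has_monodromy \<Psi> g M \<longleftrightarrow> continues_along g \<Psi> (\<lambda>l. \<Psi> l ** M)"

definition ccw_loop_around :: "(real \<Rightarrow> complex) \<Rightarrow> complex set \<Rightarrow> complex set \<Rightarrow> bool" where
  "ccw_loop_around g P Q \<longleftrightarrow>
     simple_path g \<and> pathfinish g = pathstart g \<and>
     P \<subseteq> inside (path_image g) \<and> Q \<subseteq> outside (path_image g) \<and>
     (\<forall>z\<in>P. winding_number g z = 1)"

text \<open>
  \<open>p\<close> is a value of $p_{0x}$ for the Fuchsian system with the given residues: the trace of
  \<open>M0 ** Mx\<close> for some admissible choice of the two loops and of the fundamental solution. That this
  value does not depend on the choices is not built into the definition. Requiring the whole
  segment inside the loop \<open>h\<close> fixes its free homotopy class; enclosing its endpoints would not.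
\<close>

definition is_p0x ::
  "complex^2^2 \<Rightarrow> complex^2^2 \<Rightarrow> complex^2^2 \<Rightarrow> complex \<Rightarrow> complex \<Rightarrow> bool" where
  "is_p0x A0 Ax A1 x p \<longleftrightarrow>
     (\<exists>g0 gx h \<Psi> U M0 Mx.
        ccw_loop_around g0 {0} {x, 1} \<and>
        ccw_loop_around gx {x} {0, 1} \<and>
        ccw_loop_around h (closed_segment 0 x) {1} \<and>
        pathstart gx = pathstart g0 \<and> pathstart h = pathstart g0 \<and>
        homotopic_paths (- {0, x, 1}) (g0 +++ gx) h \<and>
        pathstart g0 \<in> U \<and> fundamental_solution_on A0 Ax A1 x \<Psi> U \<and>
        has_monodromy \<Psi> g0 M0 \<and> has_monodromy \<Psi> gx Mx \<and>
        p = trace (M0 ** Mx))"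

end

theory Submission
  imports Defs
begin

text \<open>
  Put $w = x^\sigma$ and $v = x^{1-\sigma}$, so that $vw = x$, and conjugate the residues so that
  $A_0 + A_x$ tends to $\mathrm{diag}(\sigma/2, -\sigma/2)$. The Schlesinger equations then have a
  solution in power series in $v$ whose coefficients are polynomials in $w$. The divisors that occur,
  $n(1-\sigma) + (k-j)\sigma$ with $n \ge 1$, have modulus at least $1$ because $\Re\sigma = 0$, so the
  series converge where $v$ is small and $w$ bounded, i.e. for small $x$ with bounded argument. The
  leading terms $p$, $qw$, $r/w$ of $A_0$ give the amplitude and the phase of $y$.

  For the monodromy, $p_{0x}$ is the trace of the transport of the Fuchsian system along any loop
  around the segment from $0$ to $x$: every such loop is homotopic to a confocal ellipse. This trace is
  constant in $x$. On the circle of radius $|x|^{1/2}$ the system tends to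
  $\lambda \Psi' = \Lambda \Psi$ with $\Lambda$ similar to $\mathrm{diag}(\sigma/2, -\sigma/2)$, whose
  monodromy has the trace $2\cos\pi\sigma$. Any other system with the same $y$ is conjugate to the
  constructed one by a diagonal matrix at the points where $y \notin \{0, 1, x\}$.
\<close>

text \<open>The loops and the fundamental solution in \<open>is_p0x\<close> are arbitrary, so the
  value must be found for every admissible choice. An admissible loop is only a Jordan curve; the
  covering \<open>t \<mapsto> x/2 * (1 + cosh t)\<close> of the complement of the segment turns it
  into a path from \<open>t0\<close> to \<open>t0 + 2 * pi * \<i>\<close> in a half plane. To keep
  the puncture 1 away, the preimages of a curve from 1 to infinity are deleted there, and the
  component that contains the lift is simply connected. Constancy of the trace is shown without
  differentiating solutions in \<open>x\<close>: for nearby \<open>x\<close> and \<open>x'\<close>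
  the factor \<open>1 + (x' - x) * Ax / (l - x)\<close> intertwines the two systems up to o(x' - x),
  by the Schlesinger equations. Because \<open>A0\<close> contains \<open>r/w\<close>, the unknowns
  of the formal problem are the entries of \<open>w * A0\<close>. The entry 12 of \<open>A1\<close>
  is normalized to tend to -1, so that the denominator of \<open>y\<close> is \<open>1 - g\<close>
  with small \<open>g\<close>. The condition \<open>\<theta>inf \<noteq> 0\<close> acts twice: it
  determines the limit of \<open>A1\<close>, and it makes \<open>y\<close> and its derivative
  determine the residues up to diagonal conjugation.\<close>

no_notation fps_nth (infixl "$" 75)

section \<open>Linear systems with holomorphic coefficients\<close>

definition lin_sol :: "(complex \<Rightarrow> complex^2^2) \<Rightarrow> (complex \<Rightarrow> complex^2^2) \<Rightarrow> complex set \<Rightarrow> bool" where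
  "lin_sol A S U \<longleftrightarrow> (\<forall>l\<in>U. \<forall>i j. ((\<lambda>l. S l $ i $ j) has_field_derivative (A l ** S l) $ i $ j) (at l))"

lemma mat2_mult_nth: "(X ** Y) $ i $ j = X $ i $ 1 * Y $ 1 $ j + X $ i $ 2 * Y $ 2 $ j"
  for X Y :: "'a::comm_semiring_1^2^2"
  by (simp add: matrix_matrix_mult_def sum_2)

lemma bounded_bilinear_mat2: "bounded_bilinear (\<lambda>(X::complex^2^2) (Y::complex^2^2). X ** Y)"
proof -
  have "bilinear (\<lambda>(X::complex^2^2) (Y::complex^2^2). X ** Y)"
    unfolding bilinear_def linear_iff
    by (auto simp: vec_eq_iff mat2_mult_nth algebra_simps)
  then show ?thesis by (simp add: bilinear_conv_bounded_bilinear)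
qed

text \<open>Picard iteration, run on the increments: \<open>D (Suc n)\<close> is the primitive of
  the right-hand side at \<open>D n\<close> that vanishes at \<open>p\<close>. Two terms bounded
  through \<open>M\<close> and a distance below \<open>\<rho>\<close> give the factor
  \<open>2 * M * \<rho>\<close>, at most 1/2, so the increments are dominated by a geometric series
  and may be summed and differentiated termwise.\<close>

lemma picard_ball:
  fixes a :: "2 \<Rightarrow> 2 \<Rightarrow> complex \<Rightarrow> complex" and v :: "2 \<Rightarrow> complex"
  assumes hol: "\<And>i j. a i j holomorphic_on ball p \<rho>" and \<rho>: "\<rho> > 0"
    and bd: "\<And>i j l. l \<in> ball p \<rho> \<Longrightarrow> norm (a i j l) \<le> M" and M: "4 * M * \<rho> \<le> 1"
  shows "\<exists>f :: 2 \<Rightarrow> complex \<Rightarrow> complex. (\<forall>i. f i p = v i) \<and>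
    (\<forall>l\<in>ball p \<rho>. \<forall>i. (f i has_field_derivative (a i 1 l * f 1 l + a i 2 l * f 2 l)) (at l))"
proof -
  have M0: "M \<ge> 0" using bd[of p 1 1] \<rho> by (meson centre_in_ball norm_ge_zero order_trans)
  define K where "K = norm (v 1) + norm (v 2)"
  let ?B = "ball p \<rho>"
  define P where "P = (\<lambda>(n::nat) (D :: 2 \<Rightarrow> complex \<Rightarrow> complex).
     (\<forall>i. D i holomorphic_on ?B \<and> (\<forall>l\<in>?B. norm (D i l) \<le> K * (1/2)^n)))"
  define Q where "Q = (\<lambda>(n::nat) (D :: 2 \<Rightarrow> complex \<Rightarrow> complex) (E :: 2 \<Rightarrow> complex \<Rightarrow> complex).
     (\<forall>i. E i p = 0 \<and> (\<forall>l\<in>?B. (E i has_field_derivative (a i 1 l * D 1 l + a i 2 l * D 2 l)) (at l))))"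
  have step: "\<exists>E. P (Suc n) E \<and> Q n D E" if PD: "P n D" for n D
  proof -
    have "\<exists>g. g p = 0 \<and> (\<forall>l\<in>?B. (g has_field_derivative (a i 1 l * D 1 l + a i 2 l * D 2 l)) (at l))" for i
    proof -
      have "(\<lambda>l. a i 1 l * D 1 l + a i 2 l * D 2 l) holomorphic_on ?B"
        using PD hol by (auto simp: P_def intro!: holomorphic_intros)
      then obtain g where g: "\<And>x. x \<in> ?B \<Longrightarrow> (g has_field_derivative (a i 1 x * D 1 x + a i 2 x * D 2 x)) (at x within ?B)"
        using holomorphic_convex_primitive'[OF convex_ball open_ball] by blast
      have "((\<lambda>x. g x - g p) has_field_derivative (a i 1 x * D 1 x + a i 2 x * D 2 x)) (at x)" if "x \<in> ?B" for x
        using g[OF that] that by (auto simp: at_within_open[OF _ open_ball] intro!: derivative_eq_intros)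
      then show ?thesis by (intro exI[of _ "\<lambda>x. g x - g p"]) auto
    qed
    then obtain E where E0: "\<And>i. E i p = 0"
      and E: "\<And>i l. l \<in> ?B \<Longrightarrow> (E i has_field_derivative (a i 1 l * D 1 l + a i 2 l * D 2 l)) (at l)"
      by metis
    have "norm (E i l) \<le> K * (1/2)^Suc n" if l: "l \<in> ?B" for i l
    proof -
      have "norm (E i l - E i p) \<le> (2 * M * (K * (1/2)^n)) * norm (l - p)"
      proof (rule field_differentiable_bound[OF convex_ball])
        show "(E i has_field_derivative (a i 1 z * D 1 z + a i 2 z * D 2 z)) (at z within ?B)" if "z \<in> ?B" for z
          using E[OF that] by (rule has_field_derivative_at_within)
        show "norm (a i 1 z * D 1 z + a i 2 z * D 2 z) \<le> 2 * M * (K * (1/2)^n)" if z: "z \<in> ?B" for z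
        proof -
          have "norm (a i j z * D j z) \<le> M * (K * (1/2)^n)" for j
            using PD z bd[OF z] M0 unfolding P_def norm_mult by (intro mult_mono) auto
          from this[of 1] this[of 2] show ?thesis
            by (intro order_trans[OF norm_triangle_ineq]) simp
        qed
      qed (use l \<rho> in auto)
      also have "\<dots> \<le> (2 * M * (K * (1/2)^n)) * \<rho>"
        using l M0 by (intro mult_left_mono) (auto simp: dist_norm norm_minus_commute K_def)
      also have "\<dots> = (4 * M * \<rho>) * (K * (1/2)^Suc n)" by simp
      also have "\<dots> \<le> 1 * (K * (1/2)^Suc n)"
        using M by (intro mult_right_mono) (auto simp: K_def)
      finally show ?thesis by (simp add: E0)
    qed
    then have "P (Suc n) E"
      using E unfolding P_def holomorphic_on_open[OF open_ball] by blast
    moreover have "Q n D E" using E E0 by (auto simp: Q_def)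
    ultimately show ?thesis by blast
  qed
  define D0 where "D0 = (\<lambda>(i::2) (l::complex). v i)"
  have P0: "P 0 D0"
  proof -
    have "norm (v i) \<le> K" for i
      using exhaust_2[of i] by (auto simp: K_def)
    then show ?thesis by (auto simp: P_def D0_def)
  qed
  have "\<exists>D. \<forall>n. (P n (D n) \<and> (n = 0 \<longrightarrow> D n = D0)) \<and> Q n (D n) (D (Suc n))"
    by (rule dependent_nat_choice) (use P0 step in auto)
  then obtain D where DP: "\<And>n. P n (D n)" and DQ: "\<And>n. Q n (D n) (D (Suc n))" and D0: "D 0 = D0"
    by metis
  \<comment> \<open>Derivative of the increment \<open>D n\<close>: zero for the constant
    \<open>D 0\<close> and otherwise shifted by one, so that its sum reproduces the coefficients
    applied to the sum of all \<open>D n\<close>.\<close>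
  define f' where "f' = (\<lambda>i n l. if n = 0 then 0 else a i 1 l * D (n-1) 1 l + a i 2 l * D (n-1) 2 l)"
  have "\<exists>g g'. \<forall>x \<in> ?B. ((\<lambda>n. D n i x) sums g x) \<and> ((\<lambda>n. f' i n x) sums g' x) \<and> (g has_field_derivative g' x) (at x)" for i
  proof (rule series_and_derivative_comparison_complex[OF open_ball])
    show "(D n i has_field_derivative f' i n x) (at x)" if "x \<in> ?B" for n x
    proof (cases n)
      case 0 then show ?thesis by (simp add: D0 D0_def f'_def)
    next
      case (Suc m) then show ?thesis using DQ[of m] that by (auto simp: Q_def f'_def)
    qed
    show "\<exists>d h. 0 < d \<and> summable h \<and> range h \<subseteq> \<real>\<^sub>\<ge>\<^sub>0 \<and> (\<forall>\<^sub>F n in sequentially. \<forall>y\<in>ball x d \<inter> ?B. cmod (D n i y) \<le> cmod (h n))" for x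
      using DP by (intro exI[of _ 1] exI[of _ "\<lambda>n. of_real (K * (1/2)^n)"])
        (auto simp: P_def K_def summable_of_real_iff norm_mult norm_power nonneg_Reals_of_real_iff simp del: of_real_mult of_real_add of_real_power intro!: summable_mult summable_geometric)
  qed
  then obtain g g' where g: "\<And>i x. x \<in> ?B \<Longrightarrow> (\<lambda>n. D n i x) sums g i x"
    and g': "\<And>i x. x \<in> ?B \<Longrightarrow> (\<lambda>n. f' i n x) sums g' i x"
    and gd: "\<And>i x. x \<in> ?B \<Longrightarrow> (g i has_field_derivative g' i x) (at x)"
    by metis
  have "g' i x = a i 1 x * g 1 x + a i 2 x * g 2 x" if x: "x \<in> ?B" for i x
  proof -
    have "(\<lambda>n. f' i (Suc n) x) sums (a i 1 x * g 1 x + a i 2 x * g 2 x)"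
      unfolding f'_def using g[OF x] by (auto intro!: sums_add sums_mult)
    then have "(\<lambda>n. f' i n x) sums (a i 1 x * g 1 x + a i 2 x * g 2 x)"
      by (subst (asm) sums_Suc_iff) (simp add: f'_def)
    with g'[OF x] show ?thesis using sums_unique2 by blast
  qed
  moreover have "g i p = v i" for i
  proof -
    have "(\<lambda>n. D n i p) = (\<lambda>n. if n = 0 then v i else 0)"
    proof
      fix n show "D n i p = (if n = 0 then v i else 0)"
        using DQ[of "n-1"] by (cases n) (auto simp: Q_def D0 D0_def)
    qed
    with g[of p i] \<rho> show ?thesis
      using sums_single[of 0 "\<lambda>n. v i"] sums_unique2 by fastforce
  qed
  ultimately show ?thesis using gd by (intro exI[of _ g]) auto
qed

lemma lin_sol_subset: "lin_sol A S U \<Longrightarrow> V \<subseteq> U \<Longrightarrow> lin_sol A S V"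
  by (auto simp: lin_sol_def)

lemma lin_sol_holomorphic:
  assumes "lin_sol A S U" "open U"
  shows "(\<lambda>l. S l $ i $ j) holomorphic_on U"
  using assms by (auto simp: lin_sol_def holomorphic_on_open)

lemma lin_sol_right_mult:
  assumes "lin_sol A S U"
  shows "lin_sol A (\<lambda>l. S l ** M) U"
  unfolding lin_sol_def
proof (intro ballI allI)
  fix l i j assume l: "l \<in> U"
  have d: "((\<lambda>l. S l $ i $ k) has_field_derivative (A l ** S l) $ i $ k) (at l)" for k
    using assms l by (auto simp: lin_sol_def)
  show "((\<lambda>l. (S l ** M) $ i $ j) has_field_derivative (A l ** (S l ** M)) $ i $ j) (at l)"
    unfolding mat2_mult_nth[of "S _" M]
    by (rule derivative_eq_intros d refl | simp add: mat2_mult_nth algebra_simps)+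
qed

lemma lin_sol_cong_ev:
  assumes "lin_sol A S U" "open U" "\<And>l. l \<in> U \<Longrightarrow> S l = S' l"
  shows "lin_sol A S' U"
  unfolding lin_sol_def
proof (intro ballI allI)
  fix l i j assume l: "l \<in> U"
  have "((\<lambda>l. S l $ i $ j) has_field_derivative (A l ** S' l) $ i $ j) (at l)"
    using assms(1) l assms(3)[OF l] by (auto simp: lin_sol_def)
  then show "((\<lambda>l. S' l $ i $ j) has_field_derivative (A l ** S' l) $ i $ j) (at l)"
    by (rule has_field_derivative_transform_within_open[OF _ assms(2) l]) (simp add: assms(3))
qed

text \<open>The radius in the Picard argument depends only on a bound for \<open>A\<close>, and a
  compact thickening of \<open>K\<close> provides one bound for all centres. Continuation along
  paths and the comparison of neighbouring paths rest on this uniformity.\<close>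

lemma lin_sol_local_exists:
  assumes hol: "matrix_holomorphic_on A \<Omega>" and op: "open \<Omega>" and K: "compact K" "K \<subseteq> \<Omega>"
  shows "\<exists>\<rho>>0. \<forall>p\<in>K. ball p \<rho> \<subseteq> \<Omega> \<and> (\<forall>V0. \<exists>S. lin_sol A S (ball p \<rho>) \<and> S p = V0)"
proof (cases "K = {}")
  case True then show ?thesis by (auto intro: exI[of _ 1])
next
  case False
  obtain e where e: "e > 0" "\<And>p. p \<in> K \<Longrightarrow> cball p e \<subseteq> \<Omega>"
    using compact_subset_open_imp_cball_epsilon_subset[OF K(1) op K(2)]
    by (metis UN_subset_iff)
  define C where "C = (\<Union>p\<in>K. cball p e)"
  have C: "compact C" "C \<subseteq> \<Omega>"
  proof -
    \<comment> \<open>The thickening is a Minkowski sum of two compact sets, hence compact.\<close>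
    have "C = {x + y |x y. x \<in> K \<and> y \<in> cball 0 e}"
    proof safe
      fix z assume "z \<in> C" then obtain p where "p \<in> K" "dist p z \<le> e" by (auto simp: C_def)
      then show "\<exists>x y. z = x + y \<and> x \<in> K \<and> y \<in> cball 0 e"
        by (intro exI[of _ p] exI[of _ "z - p"]) (auto simp: dist_norm norm_minus_commute)
    next
      fix x y :: complex assume "x \<in> K" "y \<in> cball 0 e"
      then show "x + y \<in> C" by (auto simp: C_def dist_norm intro!: bexI[of _ x])
    qed
    then show "compact C" using compact_sums[OF K(1) compact_cball[of 0 e]] by argo
    show "C \<subseteq> \<Omega>" using e by (auto simp: C_def)
  qed
  have "\<exists>M. \<forall>l\<in>C. norm (A l $ i $ j) \<le> M" for i j
  proof -
    have "continuous_on C (\<lambda>l. A l $ i $ j)"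
      using hol C(2) unfolding matrix_holomorphic_on_def
      by (meson continuous_on_subset holomorphic_on_imp_continuous_on)
    then have "bounded ((\<lambda>l. A l $ i $ j) ` C)"
      using C(1) compact_continuous_image compact_imp_bounded by blast
    then show ?thesis by (auto simp: bounded_iff)
  qed
  then obtain M where M: "\<And>i j l. l \<in> C \<Longrightarrow> norm (A l $ i $ j) \<le> M i j" by metis
  define m where "m = \<bar>M 1 1\<bar> + \<bar>M 1 2\<bar> + \<bar>M 2 1\<bar> + \<bar>M 2 2\<bar> + 1"
  have m: "norm (A l $ i $ j) \<le> m" if "l \<in> C" for l i j
    using M[OF that, of i j] exhaust_2[of i] exhaust_2[of j] by (auto simp: m_def)
  have m1: "m \<ge> 1" by (auto simp: m_def)
  define \<rho> where "\<rho> = min e (1 / (4 * m))"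
  have \<rho>: "\<rho> > 0" "\<rho> \<le> e" "4 * m * \<rho> \<le> 1"
  proof -
    show "\<rho> > 0" "\<rho> \<le> e" using e m1 by (auto simp: \<rho>_def)
    have "\<rho> \<le> 1 / (4 * m)" by (simp add: \<rho>_def)
    then show "4 * m * \<rho> \<le> 1" using m1 by (simp add: field_simps)
  qed
  show ?thesis
  proof (intro exI[of _ \<rho>] conjI ballI allI \<rho>(1))
    fix p assume p: "p \<in> K"
    have sub: "ball p \<rho> \<subseteq> C" using p \<rho>(2) by (auto simp: C_def intro!: bexI[of _ p])
    then show "ball p \<rho> \<subseteq> \<Omega>" using C(2) by auto
    fix V0 :: "complex^2^2"
    have "\<exists>f :: 2 \<Rightarrow> complex \<Rightarrow> complex. (\<forall>i. f i p = V0 $ i $ k) \<and>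
      (\<forall>l\<in>ball p \<rho>. \<forall>i. (f i has_field_derivative (A l $ i $ 1 * f 1 l + A l $ i $ 2 * f 2 l)) (at l))" for k
    proof (rule picard_ball[where M = m])
      show "(\<lambda>l. A l $ i $ j) holomorphic_on ball p \<rho>" for i j
        using hol sub C(2) unfolding matrix_holomorphic_on_def by (meson holomorphic_on_subset order_trans)
    qed (use m sub \<rho> in auto)
    then obtain f :: "2 \<Rightarrow> 2 \<Rightarrow> complex \<Rightarrow> complex" where f: "\<And>k i. f k i p = V0 $ i $ k"
      "\<And>k l i. l \<in> ball p \<rho> \<Longrightarrow> (f k i has_field_derivative (A l $ i $ 1 * f k 1 l + A l $ i $ 2 * f k 2 l)) (at l)"
      by metis
    show "\<exists>S. lin_sol A S (ball p \<rho>) \<and> S p = V0"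
      by (intro exI[of _ "\<lambda>l. \<chi> i k. f k i l"])
        (use f in \<open>auto simp: lin_sol_def mat2_mult_nth vec_eq_iff\<close>)
  qed
qed

text \<open>On a ball with \<open>4 * m * r \<le> 1\<close> each entry of the difference is at most
  a quarter of the maximal norm of its column, which forces the column to vanish; the identity
  theorem carries this over to the connected set \<open>B\<close>.\<close>

lemma lin_sol_unique:
  assumes hol: "matrix_holomorphic_on A B" and op: "open B" and B: "connected B" and p: "p \<in> B"
    and S: "lin_sol A S B" and S': "lin_sol A S' B" and eq: "S p = S' p" and l: "l \<in> B"
  shows "S l = S' l"
proof -
  define X where "X = (\<lambda>i j l. S l $ i $ j - S' l $ i $ j)"
  have Xd: "(X i j has_field_derivative (A l $ i $ 1 * X 1 j l + A l $ i $ 2 * X 2 j l)) (at l)"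
    if "l \<in> B" for i j l
  proof -
    have "((\<lambda>l. S l $ i $ j - S' l $ i $ j) has_field_derivative ((A l ** S l) $ i $ j - (A l ** S' l) $ i $ j)) (at l)"
      using S S' that by (auto simp: lin_sol_def intro!: derivative_intros)
    then show ?thesis by (simp add: X_def mat2_mult_nth algebra_simps)
  qed
  obtain e where e: "e > 0" "cball p e \<subseteq> B" using op p open_contains_cball by blast
  have "\<exists>M. \<forall>l\<in>cball p e. norm (A l $ i $ j) \<le> M" for i j
  proof -
    have "continuous_on (cball p e) (\<lambda>l. A l $ i $ j)"
      using hol e unfolding matrix_holomorphic_on_def
      by (meson continuous_on_subset holomorphic_on_imp_continuous_on)
    then have "bounded ((\<lambda>l. A l $ i $ j) ` cball p e)"
      using compact_continuous_image compact_imp_bounded compact_cball by blast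
    then show ?thesis by (auto simp: bounded_iff)
  qed
  then obtain M where M: "\<And>i j l. l \<in> cball p e \<Longrightarrow> norm (A l $ i $ j) \<le> M i j" by metis
  define m where "m = \<bar>M 1 1\<bar> + \<bar>M 1 2\<bar> + \<bar>M 2 1\<bar> + \<bar>M 2 2\<bar> + 1"
  have m: "norm (A l $ i $ j) \<le> m" if "l \<in> cball p e" for l i j
    using M[OF that, of i j] exhaust_2[of i] exhaust_2[of j] by (auto simp: m_def)
  have m1: "m \<ge> 1" by (auto simp: m_def)
  define r where "r = min e (1 / (4 * m))"
  have r: "r > 0" "r \<le> e" "4 * m * r \<le> 1"
  proof -
    show "r > 0" "r \<le> e" using e m1 by (auto simp: r_def)
    have "r \<le> 1 / (4 * m)" by (simp add: r_def)
    then show "4 * m * r \<le> 1" using m1 by (simp add: field_simps)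
  qed
  have sub: "cball p r \<subseteq> B" using r(2) e by auto
  have X0: "X i j l = 0" if l: "l \<in> cball p r" for i j l
  proof -
    define n where "n = (\<lambda>l. norm (X 1 j l) + norm (X 2 j l))"
    have "continuous_on (cball p r) (X i j)" for i
      using Xd sub by (meson DERIV_isCont continuous_at_imp_continuous_on subsetD)
    then have "continuous_on (cball p r) n" unfolding n_def by (intro continuous_intros)
    then obtain q where q: "q \<in> cball p r" "\<And>l. l \<in> cball p r \<Longrightarrow> n l \<le> n q"
      using continuous_attains_sup[of "cball p r" n] r(1) by (auto simp: compact_cball)
    have b: "norm (X i j l) \<le> n q / 4" if l: "l \<in> cball p r" for i l
    proof -
      have "norm (X i j l - X i j p) \<le> (m * n q) * norm (l - p)"
      proof (rule field_differentiable_bound[OF convex_cball])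
        show "(X i j has_field_derivative (A z $ i $ 1 * X 1 j z + A z $ i $ 2 * X 2 j z)) (at z within cball p r)"
          if "z \<in> cball p r" for z
          using Xd that sub has_field_derivative_at_within by blast
        show "norm (A z $ i $ 1 * X 1 j z + A z $ i $ 2 * X 2 j z) \<le> m * n q" if z: "z \<in> cball p r" for z
        proof -
          have "norm (A z $ i $ 1 * X 1 j z + A z $ i $ 2 * X 2 j z) \<le> m * norm (X 1 j z) + m * norm (X 2 j z)"
            using m[of z i] z r(2)
            by (intro order_trans[OF norm_triangle_ineq] add_mono) (auto simp: norm_mult intro!: mult_right_mono)
          also have "\<dots> = m * n z" by (simp add: n_def algebra_simps)
          also have "\<dots> \<le> m * n q" using q(2)[OF z] m1 by (intro mult_left_mono) auto
          finally show ?thesis .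
        qed
      qed (use l r in auto)
      also have "\<dots> \<le> (m * n q) * r"
        using l m1 by (intro mult_left_mono) (auto simp: dist_norm norm_minus_commute n_def)
      also have "\<dots> = (4 * m * r) * (n q / 4)" by simp
      also have "\<dots> \<le> 1 * (n q / 4)" using r(3) by (intro mult_right_mono) (auto simp: n_def)
      finally show ?thesis using eq by (simp add: X_def)
    qed
    have "n q \<le> n q / 4 + n q / 4" using b[OF q(1), of 1] b[OF q(1), of 2] unfolding n_def by simp
    then have "n q \<le> 0" by simp
    then have "norm (X i j l) \<le> 0" using b[OF l, of i] by linarith
    then show ?thesis by (simp only: norm_le_zero_iff)
  qed
  have "X i j l = 0" for i j
  proof (rule analytic_continuation_open[where s = "ball p r" and s' = B and f = "X i j" and g = "\<lambda>_. 0" and z = l])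
    show "X i j holomorphic_on B" using Xd op unfolding holomorphic_on_open[OF op] by blast
    show "ball p r \<subseteq> B" using sub by auto
  qed (use X0 r op B l in auto)
  then show ?thesis by (auto simp: X_def vec_eq_iff)
qed

lemma lin_sol_unique_ball:
  assumes "matrix_holomorphic_on A \<Omega>" "ball p r \<subseteq> \<Omega>" "c \<in> ball p r"
    and "lin_sol A S (ball p r)" "lin_sol A S' (ball p r)" "S c = S' c" "l \<in> ball p r"
  shows "S l = S' l"
proof (rule lin_sol_unique[of A "ball p r" c])
  show "matrix_holomorphic_on A (ball p r)"
    using assms(1,2) by (auto simp: matrix_holomorphic_on_def intro: holomorphic_on_subset)
qed (use assms in auto)

section \<open>Transport along paths\<close>

text \<open>Continuation along a path that is merely continuous, recorded by its values only: near
  each parameter \<open>V\<close> is one single-valued local solution composed with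
  \<open>g\<close>. Self-intersections of \<open>g\<close> impose no condition on
  \<open>V\<close>.\<close>

definition lift_on :: "(complex \<Rightarrow> complex^2^2) \<Rightarrow> complex set \<Rightarrow> (real \<Rightarrow> complex) \<Rightarrow> real \<Rightarrow> real \<Rightarrow>
    (real \<Rightarrow> complex^2^2) \<Rightarrow> bool" where
  "lift_on A \<Omega> g a b V \<longleftrightarrow> (\<forall>t\<in>{a..b}. \<exists>S r d. 0 < r \<and> 0 < d \<and> ball (g t) r \<subseteq> \<Omega> \<and>
     lin_sol A S (ball (g t) r) \<and> (\<forall>u\<in>{a..b}. \<bar>u - t\<bar> < d \<longrightarrow> g u \<in> ball (g t) r \<and> V u = S (g u)))"

lemma lift_onE:
  assumes "lift_on A \<Omega> g a b V" "t \<in> {a..b}"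
  obtains S r d where "0 < r" "0 < d" "ball (g t) r \<subseteq> \<Omega>" "lin_sol A S (ball (g t) r)"
    "\<And>u. u \<in> {a..b} \<Longrightarrow> \<bar>u - t\<bar> < d \<Longrightarrow> g u \<in> ball (g t) r \<and> V u = S (g u)"
  using assms unfolding lift_on_def by meson

lemma lift_on_cong:
  assumes "lift_on A \<Omega> g a b V" "\<And>t. t \<in> {a..b} \<Longrightarrow> g t = g' t" "\<And>t. t \<in> {a..b} \<Longrightarrow> V t = V' t"
  shows "lift_on A \<Omega> g' a b V'"
  using assms unfolding lift_on_def by auto

lemma ex_pos2I: "(0::real) < r \<Longrightarrow> (0::real) < d \<Longrightarrow> P r d \<Longrightarrow> \<exists>r>0. \<exists>d>0. P r d"
  by blast

text \<open>Reparametrization by any continuous self-map of the interval, monotone or not. With the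
  maps onto the two halves it restricts a lift to the pieces of a joined path; with a constant map
  it handles constant paths.\<close>

lemma lift_on_compose:
  assumes V: "lift_on A \<Omega> g 0 1 V" and f: "continuous_on {0..1} f" "f ` {0..1} \<subseteq> {0..1::real}"
  shows "lift_on A \<Omega> (g \<circ> f) 0 1 (V \<circ> f)"
  unfolding lift_on_def
proof
  fix t :: real assume t: "t \<in> {0..1}"
  then have ft: "f t \<in> {0..1}" using f(2) by blast
  obtain S r d where S: "0 < r" "0 < d" "ball (g (f t)) r \<subseteq> \<Omega>" "lin_sol A S (ball (g (f t)) r)"
    "\<And>u. u \<in> {0..1} \<Longrightarrow> \<bar>u - f t\<bar> < d \<Longrightarrow> g u \<in> ball (g (f t)) r \<and> V u = S (g u)"
    by (rule lift_onE[OF V ft]) blast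
  obtain d' where d': "d' > 0" "\<And>u. u \<in> {0..1} \<Longrightarrow> dist u t < d' \<Longrightarrow> dist (f u) (f t) < d"
    using f(1) t S(2) unfolding continuous_on_iff by meson
  show "\<exists>S r d. 0 < r \<and> 0 < d \<and> ball ((g \<circ> f) t) r \<subseteq> \<Omega> \<and> lin_sol A S (ball ((g \<circ> f) t) r) \<and>
     (\<forall>u\<in>{0..1}. \<bar>u - t\<bar> < d \<longrightarrow> (g \<circ> f) u \<in> ball ((g \<circ> f) t) r \<and> (V \<circ> f) u = S ((g \<circ> f) u))"
  proof (rule exI[of _ S], rule exI[of _ r], rule exI[of _ d'], intro conjI ballI impI)
    fix u :: real assume u: "u \<in> {0..1}" "\<bar>u - t\<bar> < d'"
    then have "\<bar>f u - f t\<bar> < d" using d'(2)[of u] by (auto simp: dist_real_def)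
    moreover have "f u \<in> {0..1}" using f(2) u by blast
    ultimately have "f u \<in> {0..1}" "\<bar>f u - f t\<bar> < d" by auto
    from S(5)[OF this] have "(g \<circ> f) u \<in> ball ((g \<circ> f) t) r \<and> (V \<circ> f) u = S ((g \<circ> f) u)" by auto
    then show "(g \<circ> f) u \<in> ball ((g \<circ> f) t) r" "(V \<circ> f) u = S ((g \<circ> f) u)" by auto
  qed (use S d' in auto)
qed

context
  fixes A :: "complex \<Rightarrow> complex^2^2" and \<Omega> :: "complex set"
  assumes hol: "matrix_holomorphic_on A \<Omega>" and op: "open \<Omega>"
begin

lemma lift_on_right_mult: "lift_on A \<Omega> g a b V \<Longrightarrow> lift_on A \<Omega> g a b (\<lambda>t. V t ** M)"
  unfolding lift_on_def
proof (intro ballI)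
  fix t assume "\<forall>t\<in>{a..b}. \<exists>S r d. 0 < r \<and> 0 < d \<and> ball (g t) r \<subseteq> \<Omega> \<and>
     lin_sol A S (ball (g t) r) \<and> (\<forall>u\<in>{a..b}. \<bar>u - t\<bar> < d \<longrightarrow> g u \<in> ball (g t) r \<and> V u = S (g u))"
    and "t \<in> {a..b}"
  then obtain S r d where S: "0 < r" "0 < d" "ball (g t) r \<subseteq> \<Omega>" "lin_sol A S (ball (g t) r)"
    "\<forall>u\<in>{a..b}. \<bar>u - t\<bar> < d \<longrightarrow> g u \<in> ball (g t) r \<and> V u = S (g u)" by blast
  then show "\<exists>S r d. 0 < r \<and> 0 < d \<and> ball (g t) r \<subseteq> \<Omega> \<and>
     lin_sol A S (ball (g t) r) \<and> (\<forall>u\<in>{a..b}. \<bar>u - t\<bar> < d \<longrightarrow> g u \<in> ball (g t) r \<and> V u ** M = S (g u))"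
    using lin_sol_right_mult[OF S(4), of M]
    by (intro exI[of _ "\<lambda>l. S l ** M"] exI[of _ r] exI[of _ d]) auto
qed

text \<open>Bisection reduces to short intervals around \<open>x\<close>, where both lifts come from
  solutions on one ball; equality at the left end makes these solutions equal on the whole
  ball.\<close>

lemma lift_on_unique:
  assumes V: "lift_on A \<Omega> g 0 1 V" and V': "lift_on A \<Omega> g 0 1 V'" and eq: "V 0 = V' 0" and t: "t \<in> {0..1}"
  shows "V t = V' t"
proof -
  have "0 \<le> (0::real) \<and> t \<le> 1 \<longrightarrow> V 0 = V' 0 \<longrightarrow> V t = V' t"
  proof (rule Bolzano[where P = "\<lambda>a b. 0 \<le> a \<and> b \<le> 1 \<longrightarrow> V a = V' a \<longrightarrow> V b = V' b"])
    fix x assume x: "0 \<le> x" "x \<le> t"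
    then have x1: "x \<in> {0..1}" using t by auto
    obtain S r d where S: "0 < r" "0 < d" "ball (g x) r \<subseteq> \<Omega>" "lin_sol A S (ball (g x) r)"
      "\<And>u. u \<in> {0..1} \<Longrightarrow> \<bar>u - x\<bar> < d \<Longrightarrow> g u \<in> ball (g x) r \<and> V u = S (g u)"
      by (rule lift_onE[OF V x1]) blast
    obtain S' r' d' where S': "0 < r'" "0 < d'" "ball (g x) r' \<subseteq> \<Omega>" "lin_sol A S' (ball (g x) r')"
      "\<And>u. u \<in> {0..1} \<Longrightarrow> \<bar>u - x\<bar> < d' \<Longrightarrow> g u \<in> ball (g x) r' \<and> V' u = S' (g u)"
      by (rule lift_onE[OF V' x1]) blast
    show "\<exists>d>0. \<forall>a b. a \<le> x \<and> x \<le> b \<and> b - a < d \<longrightarrow> 0 \<le> a \<and> b \<le> 1 \<longrightarrow> V a = V' a \<longrightarrow> V b = V' b"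
    proof (intro exI[of _ "min d d'"] conjI allI impI)
      fix a b assume ab: "a \<le> x \<and> x \<le> b \<and> b - a < min d d'" "0 \<le> a \<and> b \<le> 1" "V a = V' a"
      then have a: "a \<in> {0..1}" "\<bar>a - x\<bar> < d" "\<bar>a - x\<bar> < d'" and b: "b \<in> {0..1}" "\<bar>b - x\<bar> < d" "\<bar>b - x\<bar> < d'"
        by auto
      let ?r = "min r r'"
      have "S l = S' l" if "l \<in> ball (g x) ?r" for l
      proof (rule lin_sol_unique_ball[OF hol, of "g x" ?r "g a" S S' l])
        show "S (g a) = S' (g a)" using S(5)[OF a(1,2)] S'(5)[OF a(1,3)] ab by auto
        show "g a \<in> ball (g x) ?r" using S(5)[OF a(1,2)] S'(5)[OF a(1,3)] by auto
        show "lin_sol A S (ball (g x) ?r)" by (rule lin_sol_subset[OF S(4)]) auto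
        show "lin_sol A S' (ball (g x) ?r)" by (rule lin_sol_subset[OF S'(4)]) auto
      qed (use S(3) that in auto)
      moreover have "g b \<in> ball (g x) ?r" using S(5)[OF b(1,2)] S'(5)[OF b(1,3)] by auto
      ultimately show "V b = V' b" using S(5)[OF b(1,2)] S'(5)[OF b(1,3)] by auto
    qed (use S S' in auto)
  qed (use t in auto)
  with t eq show ?thesis by auto
qed

text \<open>Bisection with the initial value quantified inside, so that the lift on the second half
  can start where the first one ended. On short intervals a single local solution does.\<close>

lemma lift_on_exists:
  assumes g: "path g" "path_image g \<subseteq> \<Omega>"
  shows "\<exists>V. lift_on A \<Omega> g 0 1 V \<and> V 0 = V0"
proof -
  have cg: "continuous_on {0..1} g" using g(1) by (simp add: path_def)
  obtain \<rho> where \<rho>: "\<rho> > 0" "\<And>p. p \<in> path_image g \<Longrightarrow> ball p \<rho> \<subseteq> \<Omega>"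
    "\<And>p V0. p \<in> path_image g \<Longrightarrow> \<exists>S. lin_sol A S (ball p \<rho>) \<and> S p = V0"
    using lin_sol_local_exists[OF hol op compact_path_image[OF g(1)] g(2)] by meson
  have "uniformly_continuous_on {0..1} g" using cg compact_uniformly_continuous by blast
  then obtain d where d: "d > 0" "\<And>u v. u \<in> {0..1} \<Longrightarrow> v \<in> {0..1} \<Longrightarrow> dist u v < d \<Longrightarrow> dist (g u) (g v) < \<rho>/2"
    using \<rho>(1) unfolding uniformly_continuous_on_def by (meson half_gt_zero)
  have "0 \<le> (0::real) \<and> (1::real) \<le> 1 \<longrightarrow> (\<forall>V0. \<exists>V. lift_on A \<Omega> g 0 1 V \<and> V 0 = V0)"
  proof (rule Bolzano[where P = "\<lambda>a b. 0 \<le> a \<and> b \<le> 1 \<longrightarrow> (\<forall>V0. \<exists>V. lift_on A \<Omega> g a b V \<and> V a = V0)"])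
    fix a b c :: real
    assume ab: "0 \<le> a \<and> b \<le> 1 \<longrightarrow> (\<forall>V0. \<exists>V. lift_on A \<Omega> g a b V \<and> V a = V0)"
      and bc: "0 \<le> b \<and> c \<le> 1 \<longrightarrow> (\<forall>V0. \<exists>V. lift_on A \<Omega> g b c V \<and> V b = V0)" and le: "a \<le> b" "b \<le> c"
    show "0 \<le> a \<and> c \<le> 1 \<longrightarrow> (\<forall>V0. \<exists>V. lift_on A \<Omega> g a c V \<and> V a = V0)"
    proof (intro impI allI)
      fix V0 assume ac: "0 \<le> a \<and> c \<le> 1"
      obtain V1 where V1: "lift_on A \<Omega> g a b V1" "V1 a = V0" using ab ac le by auto
      obtain V2 where V2: "lift_on A \<Omega> g b c V2" "V2 b = V1 b" using bc ac le by auto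
      define V where "V = (\<lambda>t. if t \<le> b then V1 t else V2 t)"
      have Vb: "V u = V2 u" if "u \<ge> b" for u using that V2(2) by (auto simp: V_def)
      have "lift_on A \<Omega> g a c V"
        unfolding lift_on_def
      proof
        fix t assume t: "t \<in> {a..c}"
        consider "t < b" | "t > b" | "t = b" by linarith
        then show "\<exists>S r d. 0 < r \<and> 0 < d \<and> ball (g t) r \<subseteq> \<Omega> \<and>
          lin_sol A S (ball (g t) r) \<and> (\<forall>u\<in>{a..c}. \<bar>u - t\<bar> < d \<longrightarrow> g u \<in> ball (g t) r \<and> V u = S (g u))"
        proof cases
          case 1
          then have "t \<in> {a..b}" using t by auto
          then obtain S r d where "0 < r" "0 < d" "ball (g t) r \<subseteq> \<Omega>" "lin_sol A S (ball (g t) r)"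
            "\<And>u. u \<in> {a..b} \<Longrightarrow> \<bar>u - t\<bar> < d \<Longrightarrow> g u \<in> ball (g t) r \<and> V1 u = S (g u)"
            by (rule lift_onE[OF V1(1)]) blast
          then show ?thesis using 1
            by (intro exI[of _ S] exI[of _ r] exI[of _ "min d (b - t)"]) (auto simp: V_def)
        next
          case 2
          then have "t \<in> {b..c}" using t by auto
          then obtain S r d where "0 < r" "0 < d" "ball (g t) r \<subseteq> \<Omega>" "lin_sol A S (ball (g t) r)"
            "\<And>u. u \<in> {b..c} \<Longrightarrow> \<bar>u - t\<bar> < d \<Longrightarrow> g u \<in> ball (g t) r \<and> V2 u = S (g u)"
            by (rule lift_onE[OF V2(1)]) blast
          then show ?thesis using 2
            by (intro exI[of _ S] exI[of _ r] exI[of _ "min d (t - b)"]) (auto simp: V_def)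
        next
          case 3
          obtain S1 r1 d1 where 1: "0 < r1" "0 < d1" "ball (g t) r1 \<subseteq> \<Omega>" "lin_sol A S1 (ball (g t) r1)"
            "\<And>u. u \<in> {a..b} \<Longrightarrow> \<bar>u - t\<bar> < d1 \<Longrightarrow> g u \<in> ball (g t) r1 \<and> V1 u = S1 (g u)"
            using lift_onE[OF V1(1), of t] 3 le t by (metis atLeastAtMost_iff order_refl)
          obtain S2 r2 d2 where 2: "0 < r2" "0 < d2" "ball (g t) r2 \<subseteq> \<Omega>" "lin_sol A S2 (ball (g t) r2)"
            "\<And>u. u \<in> {b..c} \<Longrightarrow> \<bar>u - t\<bar> < d2 \<Longrightarrow> g u \<in> ball (g t) r2 \<and> V2 u = S2 (g u)"
            using lift_onE[OF V2(1), of t] 3 le t by (metis atLeastAtMost_iff order_refl)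
          let ?r = "min r1 r2"
          have eq: "S1 l = S2 l" if "l \<in> ball (g t) ?r" for l
          proof (rule lin_sol_unique_ball[OF hol, of "g t" ?r "g t" S1 S2 l])
            show "S1 (g t) = S2 (g t)" using 1(5)[of t] 2(5)[of t] 3 le V2(2) 1(2) 2(2) by auto
            show "lin_sol A S1 (ball (g t) ?r)" by (rule lin_sol_subset[OF 1(4)]) auto
            show "lin_sol A S2 (ball (g t) ?r)" by (rule lin_sol_subset[OF 2(4)]) auto
          qed (use 1 2 that in auto)
          show ?thesis
          \<comment> \<open>At the junction the local solution on the larger of the two balls serves
            both sides, since the other one agrees with it on the smaller ball.\<close>
          proof (cases "r1 \<le> r2")
            case True
            have "g u \<in> ball (g t) r2 \<and> V u = S2 (g u)" if "u \<in> {a..c}" "\<bar>u - t\<bar> < min d1 d2" for u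
              using that 1(5)[of u] 2(5)[of u] eq[of "g u"] True 3 by (cases "u \<le> b") (auto simp: V_def)
            then show ?thesis using 1 2 by (intro exI[of _ S2] exI[of _ r2] exI[of _ "min d1 d2"]) auto
          next
            case False
            have "g u \<in> ball (g t) r1 \<and> V u = S1 (g u)" if "u \<in> {a..c}" "\<bar>u - t\<bar> < min d1 d2" for u
              using that 1(5)[of u] 2(5)[of u] eq[of "g u"] False 3 by (cases "u \<le> b") (auto simp: V_def)
            then show ?thesis using 1 2 by (intro exI[of _ S1] exI[of _ r1] exI[of _ "min d1 d2"]) auto
          qed
        qed
      qed
      moreover have "V a = V0" using V1(2) le by (auto simp: V_def)
      ultimately show "\<exists>V. lift_on A \<Omega> g a c V \<and> V a = V0" by blast
    qed
  next
    fix x :: real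
    show "\<exists>d>0. \<forall>a b. a \<le> x \<and> x \<le> b \<and> b - a < d \<longrightarrow> 0 \<le> a \<and> b \<le> 1 \<longrightarrow> (\<forall>V0. \<exists>V. lift_on A \<Omega> g a b V \<and> V a = V0)"
    proof (intro exI[of _ d] conjI allI impI d(1))
      fix a b :: real and V0 assume h: "a \<le> x \<and> x \<le> b \<and> b - a < d" "0 \<le> a \<and> b \<le> 1"
      then have "g a \<in> path_image g" by (auto simp: path_image_def)
      then obtain S where S: "lin_sol A S (ball (g a) \<rho>)" "S (g a) = V0" "ball (g a) \<rho> \<subseteq> \<Omega>"
        using \<rho> by meson
      have "lift_on A \<Omega> g a b (\<lambda>u. S (g u))"
        unfolding lift_on_def
      proof
        fix t assume t: "t \<in> {a..b}"
        have "dist (g t) (g a) < \<rho>/2" using t h by (intro d(2)) (auto simp: dist_real_def)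
        then have sub: "ball (g t) (\<rho>/2) \<subseteq> ball (g a) \<rho>"
          by (intro ball_subset_ball_iff[THEN iffD2]) auto
        show "\<exists>Sa r d. 0 < r \<and> 0 < d \<and> ball (g t) r \<subseteq> \<Omega> \<and> lin_sol A Sa (ball (g t) r) \<and>
            (\<forall>u\<in>{a..b}. \<bar>u - t\<bar> < d \<longrightarrow> g u \<in> ball (g t) r \<and> S (g u) = Sa (g u))"
          using \<rho>(1) d(1) sub S(3) lin_sol_subset[OF S(1) sub] d(2)[of t] t h
          by (intro exI[of _ S] exI[of _ "\<rho>/2"] exI[of _ d]) (auto simp: dist_real_def)
      qed
      then show "\<exists>V. lift_on A \<Omega> g a b V \<and> V a = V0" using S(2) by blast
    qed
  qed auto
  then show ?thesis by auto
qed

section \<open>The transport matrix and its homotopy invariance\<close>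

definition transp :: "(real \<Rightarrow> complex) \<Rightarrow> complex^2^2" where
  "transp g = (SOME P. \<exists>V. lift_on A \<Omega> g 0 1 V \<and> V 0 = mat 1 \<and> V 1 = P)"

text \<open>Lifts may be multiplied by constants on the right, so the lift that starts at the
  identity determines all others; its end value is unique, which makes the choice in
  \<open>transp\<close> harmless.\<close>

lemma transp_lift:
  assumes g: "path g" "path_image g \<subseteq> \<Omega>" and V: "lift_on A \<Omega> g 0 1 V"
  shows "V 1 = transp g ** V 0"
proof -
  have "\<exists>P V. lift_on A \<Omega> g 0 1 V \<and> V 0 = mat 1 \<and> V 1 = P"
    using lift_on_exists[OF g] by blast
  from someI_ex[OF this] obtain W where W: "lift_on A \<Omega> g 0 1 W" "W 0 = mat 1" "W 1 = transp g"
    unfolding transp_def by blast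
  have "V 1 = W 1 ** V 0"
    by (rule lift_on_unique[OF V lift_on_right_mult[OF W(1)]]) (auto simp: W)
  with W show ?thesis by simp
qed

lemma transp_join:
  assumes g: "path g1" "path_image g1 \<subseteq> \<Omega>" "path g2" "path_image g2 \<subseteq> \<Omega>" "pathfinish g1 = pathstart g2"
  shows "transp (g1 +++ g2) = transp g2 ** transp g1"
proof -
  have j: "path (g1 +++ g2)" "path_image (g1 +++ g2) \<subseteq> \<Omega>" using g by (auto simp: path_image_join)
  obtain W where W: "lift_on A \<Omega> (g1 +++ g2) 0 1 W" "W 0 = mat 1" using lift_on_exists[OF j] by blast
  have "lift_on A \<Omega> ((g1 +++ g2) \<circ> (\<lambda>t. t/2)) 0 1 (W \<circ> (\<lambda>t. t/2))"
    by (rule lift_on_compose[OF W(1)]) (auto intro!: continuous_intros)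
  then have "lift_on A \<Omega> g1 0 1 (W \<circ> (\<lambda>t. t/2))"
    by (rule lift_on_cong) (auto simp: joinpaths_def)
  from transp_lift[OF g(1,2) this] have 1: "W (1/2) = transp g1" by (simp add: W)
  have "lift_on A \<Omega> ((g1 +++ g2) \<circ> (\<lambda>t. (t+1)/2)) 0 1 (W \<circ> (\<lambda>t. (t+1)/2))"
    by (rule lift_on_compose[OF W(1)]) (auto intro!: continuous_intros)
  moreover have "((g1 +++ g2) \<circ> (\<lambda>t. (t+1)/2)) t = g2 t" if "t \<in> {0..1}" for t
  proof (cases "t = 0")
    case True then show ?thesis using g(5) by (simp add: joinpaths_def pathfinish_def pathstart_def)
  next
    case False then show ?thesis using that by (auto simp: joinpaths_def field_simps)
  qed
  ultimately have "lift_on A \<Omega> g2 0 1 (W \<circ> (\<lambda>t. (t+1)/2))"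
    by (rule lift_on_cong) auto
  from transp_lift[OF g(3,4) this] have 2: "W 1 = transp g2 ** W (1/2)" by simp
  from transp_lift[OF j W(1)] show ?thesis using 1 2 by (simp add: W)
qed

text \<open>The value of the second lift at \<open>t\<close> is read off from the local solution
  centred at \<open>g t\<close>, whose ball of radius \<open>\<rho>\<close> contains
  \<open>g' t\<close>. The local solutions for nearby parameters agree at \<open>g u\<close>, hence
  on the convex intersection of their balls, so these values do form a lift along
  \<open>g'\<close>.\<close>

lemma transp_close:
  assumes \<rho>: "\<rho> > 0" "\<And>p. p \<in> K \<Longrightarrow> ball p \<rho> \<subseteq> \<Omega>"
    "\<And>p V0. p \<in> K \<Longrightarrow> \<exists>S. lin_sol A S (ball p \<rho>) \<and> S p = V0"
    and g: "path g" "path_image g \<subseteq> K" and g': "path g'" "path_image g' \<subseteq> K"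
    and close: "\<And>t. t \<in> {0..1} \<Longrightarrow> dist (g t) (g' t) < \<rho>/2"
    and ends: "g 0 = g' 0" "g 1 = g' 1"
  shows "transp g = transp g'"
proof -
  have K: "K \<subseteq> \<Omega>" using \<rho> by (meson centre_in_ball subset_iff)
  have gO: "path_image g \<subseteq> \<Omega>" "path_image g' \<subseteq> \<Omega>" using g g' K by auto
  obtain V where V: "lift_on A \<Omega> g 0 1 V" "V 0 = mat 1" using lift_on_exists[OF g(1) gO(1)] by blast
  have gK: "g t \<in> K" if "t \<in> {0..1}" for t using g(2) that by (auto simp: path_image_def)
  have "\<exists>S. t \<in> {0..1} \<longrightarrow> lin_sol A S (ball (g t) \<rho>) \<and> S (g t) = V t" for t
    using \<rho>(3)[OF gK] by blast
  then obtain S where S: "\<And>t. t \<in> {0..1} \<Longrightarrow> lin_sol A (S t) (ball (g t) \<rho>)"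
     "\<And>t. t \<in> {0..1} \<Longrightarrow> S t (g t) = V t" by metis
  define V' where "V' = (\<lambda>t. S t (g' t))"
  have "lift_on A \<Omega> g' 0 1 V'"
    unfolding lift_on_def
  proof
    fix t :: real assume t: "t \<in> {0..1}"
    obtain T r d where T: "0 < r" "0 < d" "ball (g t) r \<subseteq> \<Omega>" "lin_sol A T (ball (g t) r)"
      "\<And>u. u \<in> {0..1} \<Longrightarrow> \<bar>u - t\<bar> < d \<Longrightarrow> g u \<in> ball (g t) r \<and> V u = T (g u)"
      by (rule lift_onE[OF V(1) t]) blast
    let ?m = "min r (\<rho>/2)"
    have TS: "T l = S t l" if "l \<in> ball (g t) ?m" for l
    proof (rule lin_sol_unique_ball[OF hol, of "g t" ?m "g t" T "S t" l])
      show "T (g t) = S t (g t)" using T(5)[of t] S(2)[OF t] T(2) t by auto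
      show "lin_sol A T (ball (g t) ?m)" by (rule lin_sol_subset[OF T(4)]) auto
      show "lin_sol A (S t) (ball (g t) ?m)" by (rule lin_sol_subset[OF S(1)[OF t]]) (use \<rho> in auto)
    qed (use T \<rho> that in auto)
    obtain d1 where d1: "d1 > 0" "\<And>u. u \<in> {0..1} \<Longrightarrow> dist u t < d1 \<Longrightarrow> dist (g u) (g t) < ?m"
      using g(1) t T(1) \<rho>(1) unfolding path_def continuous_on_iff by (metis half_gt_zero min_less_iff_conj)
    obtain d2 where d2: "d2 > 0" "\<And>u. u \<in> {0..1} \<Longrightarrow> dist u t < d2 \<Longrightarrow> dist (g' u) (g' t) < \<rho>/2"
      using g'(1) t \<rho>(1) unfolding path_def continuous_on_iff by (metis half_gt_zero)
    let ?d = "min d (min d1 d2)"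
    have sub: "ball (g' t) (\<rho>/2) \<subseteq> ball (g t) \<rho>"
      using close[OF t] by (intro ball_subset_ball_iff[THEN iffD2]) (auto simp: dist_commute)
    show "\<exists>S r d. 0 < r \<and> 0 < d \<and> ball (g' t) r \<subseteq> \<Omega> \<and> lin_sol A S (ball (g' t) r) \<and>
            (\<forall>u\<in>{0..1}. \<bar>u - t\<bar> < d \<longrightarrow> g' u \<in> ball (g' t) r \<and> V' u = S (g' u))"
    proof (rule exI[of _ "S t"], rule exI[of _ "\<rho>/2"], rule exI[of _ ?d], intro conjI ballI impI)
      show "lin_sol A (S t) (ball (g' t) (\<rho>/2))" by (rule lin_sol_subset[OF S(1)[OF t] sub])
      show "ball (g' t) (\<rho>/2) \<subseteq> \<Omega>" using sub \<rho>(2)[OF gK[OF t]] by auto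
      fix u :: real assume u: "u \<in> {0..1}" "\<bar>u - t\<bar> < ?d"
      then show "g' u \<in> ball (g' t) (\<rho>/2)" using d2(2)[of u] by (auto simp: dist_real_def dist_commute)
      have gu: "dist (g u) (g t) < ?m" using u d1(2)[of u] by (auto simp: dist_real_def)
      have "V u = T (g u)" using T(5)[of u] u by auto
      also have "\<dots> = S t (g u)" using gu by (intro TS) (auto simp: dist_commute)
      finally have eq: "S u (g u) = S t (g u)" using S(2)[OF u(1)] by simp
      let ?B = "ball (g u) \<rho> \<inter> ball (g t) \<rho>"
      show "V' u = S t (g' u)" unfolding V'_def
      proof (rule lin_sol_unique[of A ?B "g u" "S u" "S t" "g' u"])
        show "matrix_holomorphic_on A ?B" using hol \<rho>(2)[OF gK[OF t]]
          by (auto simp: matrix_holomorphic_on_def intro: holomorphic_on_subset)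
        show "connected ?B" by (intro convex_connected convex_Int convex_ball)
        show "g u \<in> ?B" using gu \<rho>(1) by (auto simp: dist_commute)
        show "lin_sol A (S u) ?B" by (rule lin_sol_subset[OF S(1)[OF u(1)]]) auto
        show "lin_sol A (S t) ?B" by (rule lin_sol_subset[OF S(1)[OF t]]) auto
        have "dist (g t) (g' u) \<le> dist (g u) (g t) + dist (g u) (g' u)"
          by (metis dist_commute dist_triangle add.commute)
        then show "g' u \<in> ?B" using gu close[OF u(1)] \<rho>(1) by auto
      qed (use eq in auto)
    qed (use \<rho> T d1 d2 in auto)
  qed
  from transp_lift[OF g'(1) gO(2) this] have "V' 1 = transp g' ** V' 0" .
  moreover have "V' 1 = V 1" "V' 0 = V 0" using S(2)[of 0] S(2)[of 1] ends by (auto simp: V'_def)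
  ultimately show ?thesis using transp_lift[OF g(1) gO(1) V(1)] by (simp add: V(2))
qed

text \<open>The image of the homotopy is compact and yields one radius for local solutions. Uniform
  continuity then makes nearby stages of the homotopy close in the sense of
  \<open>transp_close\<close>, and bisection in the homotopy parameter links the two ends.\<close>

lemma transp_homotopic:
  assumes "homotopic_paths \<Omega> p q"
  shows "transp p = transp q"
proof -
  obtain k where k: "continuous_on ({0..1} \<times> {0..1}) k" "k ` ({0..1} \<times> {0..1}) \<subseteq> \<Omega>"
    "\<forall>x\<in>{0..1::real}. k (0::real,x) = p x" "\<forall>x\<in>{0..1::real}. k (1::real,x) = q x"
    "\<forall>t\<in>{0..1::real}. pathstart (k \<circ> Pair t) = pathstart p \<and> pathfinish (k \<circ> Pair t) = pathfinish p"
    using assms unfolding homotopic_paths by (auto simp: image_subset_iff)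
  define K where "K = k ` ({0..1} \<times> {0..1})"
  have cK: "compact K" unfolding K_def
    by (intro compact_continuous_image k compact_Times compact_Icc)
  obtain \<rho> where \<rho>: "\<rho> > 0" "\<And>p. p \<in> K \<Longrightarrow> ball p \<rho> \<subseteq> \<Omega>"
    "\<And>p V0. p \<in> K \<Longrightarrow> \<exists>S. lin_sol A S (ball p \<rho>) \<and> S p = V0"
    using lin_sol_local_exists[OF hol op cK] k(2) K_def by meson
  have "uniformly_continuous_on ({0..1} \<times> {0..1}) k"
    using k(1) compact_uniformly_continuous compact_Times compact_Icc by blast
  then obtain d where d: "d > 0" "\<And>u v. u \<in> {0..1} \<times> {0..1} \<Longrightarrow> v \<in> {0..1} \<times> {0..1} \<Longrightarrow> dist u v < d \<Longrightarrow> dist (k u) (k v) < \<rho>/2"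
    using \<rho>(1) unfolding uniformly_continuous_on_def by (meson half_gt_zero)
  have pk: "path (k \<circ> Pair t)" "path_image (k \<circ> Pair t) \<subseteq> K" if "t \<in> {0..1}" for t
  proof -
    show "path (k \<circ> Pair t)" unfolding path_def
      using that by (intro continuous_on_compose continuous_intros continuous_on_subset[OF k(1)]) auto
    show "path_image (k \<circ> Pair t) \<subseteq> K" using that by (auto simp: path_image_def K_def)
  qed
  have "0 \<le> (0::real) \<and> (1::real) \<le> 1 \<longrightarrow> transp (k \<circ> Pair 0) = transp (k \<circ> Pair 1)"
  proof (rule Bolzano[where P = "\<lambda>a b. 0 \<le> a \<and> b \<le> 1 \<longrightarrow> transp (k \<circ> Pair a) = transp (k \<circ> Pair b)"])
    fix x :: real
    show "\<exists>d>0. \<forall>a b. a \<le> x \<and> x \<le> b \<and> b - a < d \<longrightarrow> 0 \<le> a \<and> b \<le> 1 \<longrightarrow> transp (k \<circ> Pair a) = transp (k \<circ> Pair b)"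
    proof (intro exI[of _ d] conjI allI impI d(1))
      fix a b assume ab: "a \<le> x \<and> x \<le> b \<and> b - a < d" "0 \<le> a \<and> b \<le> 1"
      then have a: "a \<in> {0..1}" and b: "b \<in> {0..1}" by auto
      show "transp (k \<circ> Pair a) = transp (k \<circ> Pair b)"
      proof (rule transp_close[OF \<rho> pk[OF a] pk[OF b]])
        show "dist ((k \<circ> Pair a) t) ((k \<circ> Pair b) t) < \<rho>/2" if "t \<in> {0..1}" for t
          using that a b ab d(2)[of "(a,t)" "(b,t)"] by (simp add: dist_Pair_Pair dist_real_def)
        show "(k \<circ> Pair a) 0 = (k \<circ> Pair b) 0" "(k \<circ> Pair a) 1 = (k \<circ> Pair b) 1"
          using k(5) a b by (metis pathstart_def, metis pathfinish_def)
      qed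
    qed
  qed auto
  then have "transp (k \<circ> Pair 0) = transp (k \<circ> Pair 1)" by simp
  \<comment> \<open>The homotopy agrees with \<open>p\<close> and \<open>q\<close> on the unit
    interval only, so \<open>transp\<close> has to be seen to depend on nothing else.\<close>
  have tc: "transp g = transp g'" if "\<And>t. t \<in> {0..1} \<Longrightarrow> g t = g' t" for g g'
  proof -
    have "lift_on A \<Omega> g 0 1 V \<longleftrightarrow> lift_on A \<Omega> g' 0 1 V" for V
      using lift_on_cong[of A \<Omega> g 0 1 V g' V, OF _ that refl]
        lift_on_cong[of A \<Omega> g' 0 1 V g V, OF _ that[symmetric] refl] by blast
    then show ?thesis by (simp add: transp_def)
  qed
  have "transp p = transp (k \<circ> Pair 0)" by (rule tc) (use k(3) in simp)
  also have "\<dots> = transp (k \<circ> Pair 1)" by fact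
  also have "\<dots> = transp q" by (rule tc[symmetric]) (use k(4) in simp)
  finally show ?thesis .
qed

lemma transp_linepath_refl: "p \<in> \<Omega> \<Longrightarrow> transp (linepath p p) = mat 1"
proof -
  assume p: "p \<in> \<Omega>"
  let ?g = "linepath p p"
  have g: "path ?g" "path_image ?g \<subseteq> \<Omega>" using p by auto
  obtain W where W: "lift_on A \<Omega> ?g 0 1 W" "W 0 = mat 1" using lift_on_exists[OF g] by blast
  have "lift_on A \<Omega> (?g \<circ> (\<lambda>t. 0)) 0 1 (W \<circ> (\<lambda>t. 0))"
    by (rule lift_on_compose[OF W(1)]) auto
  then have "lift_on A \<Omega> ?g 0 1 (W \<circ> (\<lambda>t. 0))" by (rule lift_on_cong) (auto simp: linepath_def)
  from transp_lift[OF g this] show ?thesis by (simp add: W)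
qed

lemma transp_reversepath:
  assumes g: "path g" "path_image g \<subseteq> \<Omega>"
  shows "transp (reversepath g) ** transp g = mat 1"
proof -
  have "transp (g +++ reversepath g) = transp (reversepath g) ** transp g"
    by (rule transp_join) (use g in auto)
  moreover have "transp (g +++ reversepath g) = transp (linepath (pathstart g) (pathstart g))"
    by (rule transp_homotopic) (use g in \<open>auto intro: homotopic_paths_rinv\<close>)
  moreover have "pathstart g \<in> \<Omega>" using g by (auto simp: path_image_def pathstart_def)
  ultimately show ?thesis using transp_linepath_refl by simp
qed

text \<open>Moving the base point along \<open>d\<close> conjugates the transport, which leaves the
  trace alone.\<close>

lemma trace_transp_conj:
  assumes h: "homotopic_paths \<Omega> h (d +++ e +++ reversepath d)" and d: "path d" "path_image d \<subseteq> \<Omega>"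
    and e: "path e" "path_image e \<subseteq> \<Omega>" "pathstart e = pathfinish d" "pathfinish e = pathfinish d"
  shows "trace (transp h) = trace (transp e)"
proof -
  have "transp h = transp (d +++ e +++ reversepath d)" by (rule transp_homotopic[OF h])
  also have "\<dots> = transp (e +++ reversepath d) ** transp d"
    by (rule transp_join) (use d e in \<open>auto simp: path_image_join\<close>)
  also have "transp (e +++ reversepath d) = transp (reversepath d) ** transp e"
    by (rule transp_join) (use d e in \<open>auto simp: path_image_join\<close>)
  finally have "trace (transp h) = trace (transp d ** transp (reversepath d) ** transp e)"
    by (metis trace_mul_sym matrix_mul_assoc)
  also have "transp d ** transp (reversepath d) = mat 1"
    using transp_reversepath[OF d] matrix_left_right_inverse by blast
  finally show ?thesis by simp
qed

text \<open>The germs in \<open>continues_along\<close> are only asked to be holomorphic. That all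
  of them solve the equation is the permanence of differential relations under continuation: the
  relation holds for the initial germ, spreads over each ball by the identity theorem
  (\<open>good_ball\<close>), and passes to the neighbouring germs
  (\<open>good_cong\<close>).\<close>

lemma monodromy_imp_transp:
  assumes g: "path g" "path_image g \<subseteq> \<Omega>" "pathfinish g = pathstart g"
    and \<Psi>: "lin_sol A \<Psi> U" "open U" "pathstart g \<in> U" and M: "has_monodromy \<Psi> g M"
  shows "\<Psi> (pathstart g) ** M = transp g ** \<Psi> (pathstart g)"
proof -
  obtain \<Phi> where \<Phi>: "\<And>t. t \<in> {0..1} \<Longrightarrow> \<exists>r>0. \<exists>d>0. matrix_holomorphic_on (\<Phi> t) (ball (g t) r) \<and>
           (\<forall>u\<in>{0..1}. \<bar>u - t\<bar> < d \<longrightarrow> g u \<in> ball (g t) r \<and> (\<forall>\<^sub>F l in nhds (g u). \<Phi> u l = \<Phi> t l))"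
    and \<Phi>0: "\<forall>\<^sub>F l in nhds (g 0). \<Phi> 0 l = \<Psi> l" and \<Phi>1: "\<forall>\<^sub>F l in nhds (g 1). \<Phi> 1 l = \<Psi> l ** M"
    using M unfolding has_monodromy_def continues_along_def by blast
  have loc: "\<exists>r>0. \<exists>d>0. ball (g t) r \<subseteq> \<Omega> \<and> matrix_holomorphic_on (\<Phi> t) (ball (g t) r) \<and>
           (\<forall>u\<in>{0..1}. \<bar>u - t\<bar> < d \<longrightarrow> g u \<in> ball (g t) r \<and> (\<forall>\<^sub>F l in nhds (g u). \<Phi> u l = \<Phi> t l))"
    if t: "t \<in> {0..1}" for t
  proof -
    obtain r d where rd: "r > 0" "d > 0" "matrix_holomorphic_on (\<Phi> t) (ball (g t) r)"
      "\<And>u. u \<in> {0..1} \<Longrightarrow> \<bar>u - t\<bar> < d \<Longrightarrow> g u \<in> ball (g t) r \<and> (\<forall>\<^sub>F l in nhds (g u). \<Phi> u l = \<Phi> t l)"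
      using \<Phi>[OF t] by blast
    have "g t \<in> \<Omega>" using g(2) t by (auto simp: path_image_def)
    then obtain e where e: "e > 0" "ball (g t) e \<subseteq> \<Omega>" using op openE by blast
    obtain d1 where d1: "d1 > 0" "\<And>u. u \<in> {0..1} \<Longrightarrow> dist u t < d1 \<Longrightarrow> dist (g u) (g t) < min r e"
      using g(1) t rd(1) e(1) unfolding path_def continuous_on_iff by (metis min_less_iff_conj)
    show ?thesis
    proof (rule ex_pos2I[of "min r e" "min d d1"], simp add: rd e, simp add: rd d1, intro conjI ballI impI)
      show "matrix_holomorphic_on (\<Phi> t) (ball (g t) (min r e))"
        using rd(3) unfolding matrix_holomorphic_on_def by (meson holomorphic_on_subset subset_ball min.cobounded1)
      fix u :: real assume u: "u \<in> {0..1}" "\<bar>u - t\<bar> < min d d1"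
      then show "g u \<in> ball (g t) (min r e)" using d1(2)[of u] by (auto simp: dist_real_def dist_commute)
      show "\<forall>\<^sub>F l in nhds (g u). \<Phi> u l = \<Phi> t l" using rd(4)[of u] u by auto
    qed (use rd e d1 in auto)
  qed
  define good where "good = (\<lambda>t. \<exists>W. open W \<and> g t \<in> W \<and> lin_sol A (\<Phi> t) W)"
  have good_ball: "lin_sol A (\<Phi> t) (ball (g t) r)"
    if tr: "r > 0" "ball (g t) r \<subseteq> \<Omega>" "matrix_holomorphic_on (\<Phi> t) (ball (g t) r)"
      and W: "open W" "w \<in> W" "w \<in> ball (g t) r" "lin_sol A (\<Phi> t) W" for t r w W
    unfolding lin_sol_def
  proof (intro ballI allI)
    fix l i j assume l: "l \<in> ball (g t) r"
    let ?B = "ball (g t) r"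
    have h: "(\<lambda>l. \<Phi> t l $ i $ j) holomorphic_on ?B" for i j using tr by (auto simp: matrix_holomorphic_on_def)
    have a: "(\<lambda>l. A l $ i $ j) holomorphic_on ?B" for i j
      using hol tr(2) unfolding matrix_holomorphic_on_def by (blast intro: holomorphic_on_subset)
    have "deriv (\<lambda>l. \<Phi> t l $ i $ j) l = (A l ** \<Phi> t l) $ i $ j"
    proof (rule analytic_continuation_open[where s = "W \<inter> ?B" and s' = ?B and z = l
          and f = "deriv (\<lambda>l. \<Phi> t l $ i $ j)" and g = "\<lambda>l. (A l ** \<Phi> t l) $ i $ j"])
      show "deriv (\<lambda>l. \<Phi> t l $ i $ j) holomorphic_on ?B" by (intro holomorphic_deriv h open_ball)
      show "(\<lambda>l. (A l ** \<Phi> t l) $ i $ j) holomorphic_on ?B"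
        unfolding mat2_mult_nth by (intro holomorphic_intros h a)
      show "deriv (\<lambda>l. \<Phi> t l $ i $ j) z = (A z ** \<Phi> t z) $ i $ j" if "z \<in> W \<inter> ?B" for z
        using W(4) that unfolding lin_sol_def by (auto intro!: DERIV_imp_deriv)
    qed (use W l in auto)
    then show "((\<lambda>l. \<Phi> t l $ i $ j) has_field_derivative (A l ** \<Phi> t l) $ i $ j) (at l)"
      using holomorphic_derivI[OF h open_ball l] by metis
  qed
  have good_cong: "\<exists>W. open W \<and> g u \<in> W \<and> lin_sol A Y W"
    if XY: "open W" "w = g u" "w \<in> W" "lin_sol A X W" "\<forall>\<^sub>F l in nhds w. X l = Y l" for W u w and X Y :: "complex \<Rightarrow> complex^2^2"
  proof -
    obtain W' where W': "open W'" "w \<in> W'" "\<And>l. l \<in> W' \<Longrightarrow> X l = Y l"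
      using XY(5) unfolding eventually_nhds by blast
    have "lin_sol A X (W \<inter> W')" by (rule lin_sol_subset[OF XY(4)]) auto
    then have "lin_sol A Y (W \<inter> W')" by (rule lin_sol_cong_ev) (use XY W' in auto)
    then show ?thesis using XY W' by (intro exI[of _ "W \<inter> W'"]) auto
  qed
  have good0: "good 0"
    unfolding good_def using \<Psi> \<Phi>0 
    by (intro good_cong[of U "g 0" 0 \<Psi>]) (auto simp: pathstart_def eq_commute)
  have good: "good t" if t: "t \<in> {0..1}" for t
  proof -
    have "0 \<le> (0::real) \<and> t \<le> 1 \<longrightarrow> good 0 \<longrightarrow> good t"
    proof (rule Bolzano[where P = "\<lambda>a b. 0 \<le> a \<and> b \<le> 1 \<longrightarrow> good a \<longrightarrow> good b"])
      fix x assume "0 \<le> x" "x \<le> t"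
      then have x: "x \<in> {0..1}" using t by auto
      obtain r d where rd: "r > 0" "d > 0" "ball (g x) r \<subseteq> \<Omega>" "matrix_holomorphic_on (\<Phi> x) (ball (g x) r)"
        "\<And>u. u \<in> {0..1} \<Longrightarrow> \<bar>u - x\<bar> < d \<Longrightarrow> g u \<in> ball (g x) r \<and> (\<forall>\<^sub>F l in nhds (g u). \<Phi> u l = \<Phi> x l)"
        using loc[OF x] by blast
      show "\<exists>d>0. \<forall>a b. a \<le> x \<and> x \<le> b \<and> b - a < d \<longrightarrow> 0 \<le> a \<and> b \<le> 1 \<longrightarrow> good a \<longrightarrow> good b"
      proof (intro exI[of _ d] conjI allI impI rd(2))
        fix a b assume ab: "a \<le> x \<and> x \<le> b \<and> b - a < d" "0 \<le> a \<and> b \<le> 1" "good a"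
        have a: "g a \<in> ball (g x) r" "\<forall>\<^sub>F l in nhds (g a). \<Phi> a l = \<Phi> x l" using rd(5)[of a] ab by auto
        have b: "g b \<in> ball (g x) r" "\<forall>\<^sub>F l in nhds (g b). \<Phi> b l = \<Phi> x l" using rd(5)[of b] ab by auto
        obtain Wa where Wa: "open Wa" "g a \<in> Wa" "lin_sol A (\<Phi> a) Wa" using ab(3) unfolding good_def by blast
        from good_cong[OF Wa(1) refl Wa(2,3) a(2)] obtain W where
          W: "open W" "g a \<in> W" "lin_sol A (\<Phi> x) W" by blast
        have "lin_sol A (\<Phi> x) (ball (g x) r)"
          by (rule good_ball[OF rd(1,3,4) W(1,2) a(1) W(3)])
        then show "good b" unfolding good_def
          using b by (intro good_cong[of "ball (g x) r" "g b" b "\<Phi> x"]) (auto simp: eq_commute)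
      qed
    qed (use t in auto)
    with t good0 show ?thesis by auto
  qed
  have "lift_on A \<Omega> g 0 1 (\<lambda>t. \<Phi> t (g t))"
    unfolding lift_on_def
  proof
    fix t :: real assume t: "t \<in> {0..1}"
    obtain r d where rd: "r > 0" "d > 0" "ball (g t) r \<subseteq> \<Omega>" "matrix_holomorphic_on (\<Phi> t) (ball (g t) r)"
      "\<And>u. u \<in> {0..1} \<Longrightarrow> \<bar>u - t\<bar> < d \<Longrightarrow> g u \<in> ball (g t) r \<and> (\<forall>\<^sub>F l in nhds (g u). \<Phi> u l = \<Phi> t l)"
      using loc[OF t] by blast
    obtain W where W: "open W" "g t \<in> W" "lin_sol A (\<Phi> t) W" using good[OF t] unfolding good_def by blast
    have "lin_sol A (\<Phi> t) (ball (g t) r)"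
      using good_ball[OF rd(1,3,4) W(1,2) _ W(3)] rd(1) by auto
    moreover have "\<Phi> u (g u) = \<Phi> t (g u)" if "u \<in> {0..1}" "\<bar>u - t\<bar> < d" for u
      using rd(5)[OF that] eventually_nhds_x_imp_x[of "\<lambda>l. \<Phi> u l = \<Phi> t l" "g u"] by blast
    ultimately show "\<exists>S r d. 0 < r \<and> 0 < d \<and> ball (g t) r \<subseteq> \<Omega> \<and> lin_sol A S (ball (g t) r) \<and>
            (\<forall>u\<in>{0..1}. \<bar>u - t\<bar> < d \<longrightarrow> g u \<in> ball (g t) r \<and> \<Phi> u (g u) = S (g u))"
      using rd by (rule_tac exI[of _ "\<Phi> t"], rule_tac exI[of _ r], rule_tac exI[of _ d]) (auto dest: eventually_nhds_x_imp_x)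
  qed
  from transp_lift[OF g(1,2) this] show ?thesis
    using eventually_nhds_x_imp_x[OF \<Phi>0] eventually_nhds_x_imp_x[OF \<Phi>1] g(3)
    by (simp add: pathstart_def pathfinish_def)
qed

text \<open>The local solutions behind a lift serve as the germs: neighbouring ones agree at a point
  of the path, hence near it.\<close>

lemma transp_imp_monodromy:
  assumes g: "path g" "path_image g \<subseteq> \<Omega>" "pathfinish g = pathstart g"
    and \<Psi>: "lin_sol A \<Psi> U" "open U" "pathstart g \<in> U"
    and M: "\<Psi> (pathstart g) ** M = transp g ** \<Psi> (pathstart g)"
  shows "has_monodromy \<Psi> g M"
proof -
  obtain V where V: "lift_on A \<Omega> g 0 1 V" "V 0 = \<Psi> (pathstart g)" using lift_on_exists[OF g(1,2)] by blast
  have V1: "V 1 = \<Psi> (pathstart g) ** M" using transp_lift[OF g(1,2) V(1)] V(2) M by simp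
  have "\<exists>S r d. t \<in> {0..1} \<longrightarrow> 0 < r \<and> 0 < d \<and> ball (g t) r \<subseteq> \<Omega> \<and> lin_sol A S (ball (g t) r) \<and>
     (\<forall>u\<in>{0..1}. \<bar>u - t\<bar> < d \<longrightarrow> g u \<in> ball (g t) r \<and> V u = S (g u))" for t
    using V(1) unfolding lift_on_def by blast
  then obtain S r d where S: "\<And>t. t \<in> {0..1} \<Longrightarrow> 0 < r t \<and> 0 < d t \<and> ball (g t) (r t) \<subseteq> \<Omega> \<and> lin_sol A (S t) (ball (g t) (r t)) \<and>
     (\<forall>u\<in>{0..1}. \<bar>u - t\<bar> < d t \<longrightarrow> g u \<in> ball (g t) (r t) \<and> V u = S t (g u))" by metis
  have eqn: "\<forall>\<^sub>F l in nhds p. X l = Y l"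
    if XY: "lin_sol A X W" "open W" "p \<in> W" "lin_sol A Y W'" "open W'" "p \<in> W'" "X p = Y p" "p \<in> \<Omega>" for X Y W W' p
  proof -
    have "open (W \<inter> W' \<inter> \<Omega>)" "p \<in> W \<inter> W' \<inter> \<Omega>" using XY op by auto
    then obtain e where e: "e > 0" "ball p e \<subseteq> W \<inter> W' \<inter> \<Omega>" using openE by blast
    have "lin_sol A X (ball p e)" "lin_sol A Y (ball p e)"
      using e(2) by (auto intro: lin_sol_subset[OF XY(1)] lin_sol_subset[OF XY(4)])
    then have "X l = Y l" if "l \<in> ball p e" for l
      using lin_sol_unique_ball[OF hol, of p e p X Y l] e that XY(7) by auto
    then show ?thesis using e unfolding eventually_nhds by (intro exI[of _ "ball p e"]) auto
  qed
  have gO: "g t \<in> \<Omega>" if "t \<in> {0..1}" for t using that g(2) by (auto simp: path_image_def)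
  have St: "S t (g t) = V t" if "t \<in> {0..1}" for t using S[OF that] that by auto
  show ?thesis
    unfolding has_monodromy_def continues_along_def
  proof (intro exI[of _ S] conjI ballI)
    fix t :: real assume t: "t \<in> {0..1}"
    show "\<exists>r>0. \<exists>d>0. matrix_holomorphic_on (S t) (ball (g t) r) \<and>
           (\<forall>u\<in>{0..1}. \<bar>u - t\<bar> < d \<longrightarrow> g u \<in> ball (g t) r \<and> (\<forall>\<^sub>F l in nhds (g u). S u l = S t l))"
    proof (rule ex_pos2I[of "r t" "d t"], use S[OF t] in simp, use S[OF t] in simp, intro conjI ballI impI)
      show "matrix_holomorphic_on (S t) (ball (g t) (r t))"
        unfolding matrix_holomorphic_on_def using S[OF t] lin_sol_holomorphic open_ball by blast
      fix u :: real assume u: "u \<in> {0..1}" "\<bar>u - t\<bar> < d t"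
      then show gu: "g u \<in> ball (g t) (r t)" using S[OF t] by auto
      have "S u (g u) = S t (g u)" using St[OF u(1)] S[OF t] u by auto
      then show "\<forall>\<^sub>F l in nhds (g u). S u l = S t l"
        using S[OF t] S[OF u(1)] gu gO[OF u(1)]
        by (intro eqn[of _ "ball (g u) (r u)" _ _ "ball (g t) (r t)"]) auto
    qed
  next
    show "\<forall>\<^sub>F l in nhds (g 0). S 0 l = \<Psi> l"
      using S[of 0] \<Psi> St[of 0] V(2) gO[of 0]
      by (intro eqn[of _ "ball (g 0) (r 0)" _ _ U]) (auto simp: pathstart_def)
    show "\<forall>\<^sub>F l in nhds (g 1). S 1 l = \<Psi> l ** M"
      using S[of 1] \<Psi> lin_sol_right_mult[OF \<Psi>(1), of M] St[of 1] V1 gO[of 1] g(3)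
      by (intro eqn[of _ "ball (g 1) (r 1)" _ _ U]) (auto simp: pathstart_def pathfinish_def)
  qed
qed

end

section \<open>Loops around a segment\<close>

text \<open>Elliptic coordinates with foci \<open>0\<close> and \<open>x\<close>: vertical lines go
  to confocal ellipses, and the half plane \<open>Re t > 0\<close> becomes the universal covering of
  the complement of the segment, with the period \<open>2 * pi * \<i>\<close> as deck
  translation.\<close>

definition ellipse_map :: "complex \<Rightarrow> complex \<Rightarrow> complex" where
  "ellipse_map x t = x / 2 * (1 + cosh t)"

definition focal_sum :: "complex \<Rightarrow> complex \<Rightarrow> real" where
  "focal_sum x l = norm l + norm (l - x)"

definition ellipse_loop :: "complex \<Rightarrow> real \<Rightarrow> real \<Rightarrow> complex" where
  "ellipse_loop x \<eta> = ellipse_map x \<circ> linepath (of_real \<eta>) (of_real \<eta> + 2 * of_real pi * \<i>)"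

lemma continuous_on_ellipse_map: "continuous_on S (ellipse_map x)"
  unfolding ellipse_map_def cosh_field_def by (intro continuous_intros) auto

lemma continuous_on_focal_sum: "continuous_on S (focal_sum x)"
  unfolding focal_sum_def by (intro continuous_intros)

lemma ellipse_map_periodic: "ellipse_map x (t + 2 * of_real pi * \<i>) = ellipse_map x t"
  "ellipse_map x (t + 2 * of_int n * of_real pi * \<i>) = ellipse_map x t"
proof -
  show *: "ellipse_map x (t + 2 * of_int n * of_real pi * \<i>) = ellipse_map x t" for n
  proof -
    have "exp (2 * of_int n * of_real pi * \<i>) = (1::complex)"
      using exp_integer_2pi[of "of_int n"] by simp
    then have "exp (t + 2 * of_int n * of_real pi * \<i>) = exp t" by (simp add: exp_add)
    then show ?thesis by (simp add: ellipse_map_def cosh_field_def exp_minus del: minus_add_distrib)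
  qed
  show "ellipse_map x (t + 2 * of_real pi * \<i>) = ellipse_map x t" using *[of 1] by simp
qed

lemma focal_sum_ge: "focal_sum x l \<ge> norm x"
  unfolding focal_sum_def by (metis norm_triangle_sub add.commute norm_minus_commute)

lemma focal_sum_segment: "focal_sum x l > norm x \<longleftrightarrow> l \<notin> closed_segment 0 x"
proof -
  have "l \<in> closed_segment 0 x \<longleftrightarrow> between (0, x) l" by (simp add: between_mem_segment)
  also have "\<dots> \<longleftrightarrow> norm x = focal_sum x l" by (simp add: between dist_norm focal_sum_def norm_minus_commute)
  finally show ?thesis using focal_sum_ge[of x l] by auto
qed

text \<open>With \<open>a = exp (t/2)\<close> and \<open>b = exp (-t/2)\<close> the distances to the
  two foci are \<open>norm x / 4\<close> times the squared moduli of \<open>a + b\<close> and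
  \<open>a - b\<close>; the parallelogram law adds them up.\<close>

lemma focal_sum_ellipse_map: "focal_sum x (ellipse_map x t) = norm x * cosh (Re t)"
proof -
  define a b where "a = exp (t/2)" and "b = exp (-t/2)"
  have ab: "a * b = 1" by (simp add: a_def b_def flip: exp_add)
  have e: "exp t = a^2" "exp (-t) = b^2" by (simp_all add: a_def b_def power2_eq_square flip: exp_add)
  have 1: "ellipse_map x t = x / 4 * (a + b)^2"
    unfolding ellipse_map_def cosh_field_def e using ab by (simp add: power2_sum field_simps)
  have 2: "ellipse_map x t - x = x / 4 * (a - b)^2"
    unfolding 1 using ab by (simp add: power2_sum power2_diff field_simps)
  have "focal_sum x (ellipse_map x t) = norm x / 4 * (norm (a + b)^2 + norm (a - b)^2)"
    unfolding focal_sum_def 2 unfolding 1 by (simp add: norm_mult norm_power norm_divide algebra_simps)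
  also have "norm (a + b)^2 + norm (a - b)^2 = 2 * (norm a)^2 + 2 * (norm b)^2"
    unfolding cmod_power2 by (simp add: power2_eq_square algebra_simps)
  also have "(norm a)^2 = exp (Re t)" by (simp add: a_def power2_eq_square flip: exp_add)
  also have "(norm b)^2 = exp (- Re t)" by (simp add: b_def power2_eq_square flip: exp_add)
  finally show ?thesis by (simp add: cosh_field_def field_simps)
qed

lemma focal_sum_ellipse_map_gt: "x \<noteq> 0 \<Longrightarrow> Re t > 0 \<Longrightarrow> focal_sum x (ellipse_map x t) > norm x"
  using cosh_real_strict_mono[of 0 "Re t"] by (simp add: focal_sum_ellipse_map)

text \<open>Equal hyperbolic cosines leave \<open>exp a\<close> equal to \<open>exp b\<close> or to
  its inverse, and the latter contradicts the positive real parts.\<close>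

lemma ellipse_map_inj:
  assumes x: "x \<noteq> 0" and ab: "Re a > 0" "Re b > 0" and eq: "ellipse_map x a = ellipse_map x b"
  shows "exp a = exp b"
proof -
  have "cosh a = cosh b" using eq x by (simp add: ellipse_map_def)
  then have "exp a + 1 / exp a = exp b + 1 / exp b"
    unfolding cosh_field_def exp_minus inverse_eq_divide by (metis divide_cancel_right zero_neq_numeral)
  then have "(exp a - exp b) * (exp a * exp b - 1) = 0"
    by (simp add: field_simps)
  moreover have "exp a * exp b \<noteq> 1"
  proof
    assume "exp a * exp b = 1"
    then have "norm (exp (a + b)) = 1" by (simp add: exp_add)
    then show False using ab by simp
  qed
  ultimately show ?thesis by auto
qed

text \<open>For \<open>l = ellipse_map x t\<close> the quotient \<open>l / (l - x)\<close> is the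
  square of \<open>(exp t + 1) / (exp t - 1)\<close>, so \<open>exp t\<close> is recovered from its
  principal root \<open>k\<close> as \<open>(k + 1) / (k - 1)\<close>. Off the segment the quotient
  avoids the cut of the root, and \<open>Re k > 0\<close> turns into modulus greater than 1.\<close>

lemma ellipse_section:
  assumes x: "x \<noteq> 0"
  obtains Z where "continuous_on {l. focal_sum x l > norm x} Z"
    "\<And>l. focal_sum x l > norm x \<Longrightarrow> norm (Z l) > 1"
    "\<And>l t. focal_sum x l > norm x \<Longrightarrow> exp t = Z l \<Longrightarrow> ellipse_map x t = l"
proof -
  define m where "m = (\<lambda>l. l / (l - x))"
  define k where "k = (\<lambda>l. csqrt (m l))"
  define Z where "Z = (\<lambda>l. (k l + 1) / (k l - 1))"
  let ?S = "{l. focal_sum x l > norm x}"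
  have nx: "l \<noteq> x" if "l \<in> ?S" for l using that by (auto simp: focal_sum_def)
  have m: "m l \<notin> \<real>\<^sub>\<le>\<^sub>0" if l: "l \<in> ?S" for l
  proof
    assume "m l \<in> \<real>\<^sub>\<le>\<^sub>0"
    then obtain c where c: "m l = of_real c" "c \<le> 0" by (auto elim: nonpos_Reals_cases)
    have "l = of_real c * (l - x)" using c(1) nx[OF l] by (simp add: m_def field_simps)
    then have "l * (1 - of_real c) = - (of_real c * x)" by (simp add: algebra_simps)
    moreover have "(1::complex) - of_real c \<noteq> 0" using c(2)
      by (metis of_real_1 of_real_eq_iff eq_iff_diff_eq_0 not_one_le_zero)
    ultimately have "l = - (of_real c * x) / (1 - of_real c)"
      by (metis nonzero_eq_divide_eq)
    then have "l = of_real (- c / (1 - c)) * x" by simp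
    moreover have "0 \<le> - c / (1 - c)" "- c / (1 - c) \<le> 1" using c(2) by (auto simp: divide_simps)
    ultimately have "l \<in> closed_segment 0 x"
      unfolding closed_segment_def by (auto simp: scaleR_conv_of_real intro!: exI[of _ "- c / (1 - c)"])
    then show False using l focal_sum_segment by auto
  qed
  have k: "Re (k l) > 0" "k l ^ 2 = m l" if l: "l \<in> ?S" for l
  proof -
    show "k l ^ 2 = m l" by (simp add: k_def)
    have "Re (csqrt (m l)) \<noteq> 0"
    proof
      assume "Re (csqrt (m l)) = 0"
      then have "(csqrt (m l))^2 = of_real (- ((Im (csqrt (m l)))^2))"
        by (simp add: complex_eq_iff power2_eq_square)
      then have "m l = of_real (- ((Im (csqrt (m l)))^2))" by simp
      then have "m l \<in> \<real>\<^sub>\<le>\<^sub>0" by (metis neg_le_0_iff_le nonpos_Reals_of_real_iff zero_le_power2)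
      with m[OF l] show False ..
    qed
    then have "0 < Re (csqrt (m l))" using csqrt_principal[of "m l"] by auto
    then show "Re (k l) > 0" by (simp add: k_def)
  qed
  have m1: "m l \<noteq> 1" if l: "l \<in> ?S" for l using nx[OF l] x by (auto simp: m_def)
  have k1: "k l \<noteq> 1" "k l \<noteq> -1" if l: "l \<in> ?S" for l
    using k(2)[OF l] m1[OF l] by auto
  show ?thesis
  proof
    show "continuous_on ?S Z"
    proof -
      have "continuous_on ?S m" unfolding m_def using nx by (intro continuous_intros) auto
      then have "continuous_on ?S k" unfolding k_def using m
        by (intro continuous_on_compose2[OF continuous_on_csqrt]) auto
      then show ?thesis unfolding Z_def using k1 by (intro continuous_intros) auto
    qed
    show "norm (Z l) > 1" if l: "focal_sum x l > norm x" for l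
    proof -
      have "norm (k l - 1)^2 < norm (k l + 1)^2"
        unfolding cmod_power2 using k(1)[of l] l by (simp add: power2_eq_square algebra_simps)
      then have "norm (k l - 1) < norm (k l + 1)" by (rule power2_less_imp_less) auto
      then show ?thesis using k1(1)[of l] l by (simp add: Z_def norm_divide divide_simps)
    qed
    show "ellipse_map x t = l" if l: "focal_sum x l > norm x" and t: "exp t = Z l" for l t
    proof -
      have ne: "k l - 1 \<noteq> 0" "k l + 1 \<noteq> 0" "m l - 1 \<noteq> 0" "l - x \<noteq> 0"
        using k1[of l] l m1[of l] nx[of l] by (auto simp: add_eq_0_iff2)
      have "cosh t = ((k l + 1) / (k l - 1) + (k l - 1) / (k l + 1)) / 2"
        using t by (simp add: cosh_field_def exp_minus Z_def)
      also have "\<dots> = (k l ^ 2 + 1) / (k l ^ 2 - 1)"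
      proof -
        have "k l ^ 2 - 1 = (k l - 1) * (k l + 1)" by (simp add: power2_eq_square algebra_simps)
        moreover have "b / a + a / b = (b * b + a * a) / (a * b)" if "a \<noteq> 0" "b \<noteq> 0" for a b :: complex
          using that by (simp add: field_simps)
        from this[OF ne(1,2)] have "(k l + 1) / (k l - 1) + (k l - 1) / (k l + 1) = 2 * (k l ^ 2 + 1) / ((k l - 1) * (k l + 1))"
          by (simp add: power2_eq_square algebra_simps)
        moreover have "2 * c / d / 2 = c / d" for c d :: complex by simp
        ultimately show ?thesis by metis
      qed
      also have "\<dots> = (m l + 1) / (m l - 1)" using k(2)[of l] l by simp
      also have "\<dots> = (2 * l - x) / x"
      proof -
        have "m l + 1 = (2 * l - x) / (l - x)" "m l - 1 = x / (l - x)" using ne(4) by (simp_all add: m_def field_simps)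
        then show ?thesis using ne(4) x by simp
      qed
      finally show ?thesis using x by (simp add: ellipse_map_def field_simps)
    qed
  qed
qed

lemma ellipse_map_surj:
  assumes "x \<noteq> 0" "focal_sum x l > norm x"
  shows "\<exists>t. Re t > 0 \<and> ellipse_map x t = l"
proof -
  obtain Z where Z: "\<And>l. focal_sum x l > norm x \<Longrightarrow> norm (Z l) > 1"
    "\<And>l t. focal_sum x l > norm x \<Longrightarrow> exp t = Z l \<Longrightarrow> ellipse_map x t = l"
    using ellipse_section[OF assms(1)] by metis
  have "Z l \<noteq> 0" using Z(1)[OF assms(2)] by auto
  then show ?thesis using Z(1)[OF assms(2)] Z(2)[OF assms(2), of "Ln (Z l)"]
    by (intro exI[of _ "Ln (Z l)"]) auto
qed

text \<open>A continuous logarithm of the section \<open>Z\<close> along \<open>q\<close> is a lift.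
  By \<open>ellipse_map_inj\<close> it misses the prescribed starting point only by a multiple of
  the period, which is then added.\<close>

lemma ellipse_map_lift:
  assumes x: "x \<noteq> 0" and q: "path q" "\<And>u. u \<in> {0..1} \<Longrightarrow> focal_sum x (q u) > norm x"
    and t0: "Re t0 > 0" "ellipse_map x t0 = q 0"
  obtains r where "path r" "r 0 = t0" "\<And>u. u \<in> {0..1} \<Longrightarrow> Re (r u) > 0 \<and> ellipse_map x (r u) = q u"
proof -
  obtain Z where Z: "continuous_on {l. focal_sum x l > norm x} Z"
    "\<And>l. focal_sum x l > norm x \<Longrightarrow> norm (Z l) > 1"
    "\<And>l t. focal_sum x l > norm x \<Longrightarrow> exp t = Z l \<Longrightarrow> ellipse_map x t = l"
    using ellipse_section[OF x] by metis
  have "continuous_on {0..1} (Z \<circ> q)"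
    using q by (intro continuous_on_compose continuous_on_subset[OF Z(1)]) (auto simp: path_def)
  moreover have "(Z \<circ> q) u \<noteq> 0" if "u \<in> {0..1}" for u using Z(2)[OF q(2)[OF that]] by auto
  moreover have "contractible {0..1::real}" by (intro convex_imp_contractible) auto
  ultimately obtain L where L: "continuous_on {0..1} L" "\<And>u. u \<in> {0..1} \<Longrightarrow> (Z \<circ> q) u = exp (L u)"
    using continuous_logarithm_on_contractible[of "{0..1::real}" "Z \<circ> q"] by metis
  have ReL: "Re (L u) > 0" if "u \<in> {0..1}" for u
    using Z(2)[OF q(2)[OF that]] L(2)[OF that] by (metis comp_apply norm_exp_eq_Re one_less_exp_iff)
  have JL: "ellipse_map x (L u) = q u" if "u \<in> {0..1}" for u
    using Z(3)[OF q(2)[OF that]] L(2)[OF that] by simp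
  have "exp t0 = exp (L 0)"
    by (rule ellipse_map_inj[OF x]) (use t0 ReL[of 0] JL[of 0] in auto)
  then obtain n where n: "t0 = L 0 + 2 * of_int n * of_real pi * \<i>"
    unfolding exp_eq by auto
  show ?thesis
  proof (rule that[of "\<lambda>u. L u + 2 * of_int n * of_real pi * \<i>"])
    show "path (\<lambda>u. L u + 2 * of_int n * of_real pi * \<i>)"
      unfolding path_def by (intro continuous_intros L)
  qed (use n ReL JL in \<open>auto simp: ellipse_map_periodic\<close>)
qed

text \<open>Since \<open>ellipse_map x t = x/4 * exp t * (1 + exp (-t))^2\<close> and
  \<open>1 + exp (-t)\<close> has positive real part, \<open>q\<close> plus a term that depends only
  on \<open>exp (q u)\<close> is a logarithm of \<open>h\<close>. Hence the increment of
  \<open>q\<close> is the increment of the logarithm.\<close>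

lemma ellipse_map_winding:
  assumes x: "x \<noteq> 0" and q: "path q" "\<And>u. u \<in> {0..1} \<Longrightarrow> Re (q u) > 0"
    and h: "path h" "pathfinish h = pathstart h" "\<And>u. u \<in> {0..1} \<Longrightarrow> h u = ellipse_map x (q u)"
  shows "q 1 - q 0 = 2 * of_real pi * \<i> * winding_number h 0"
proof -
  have h0: "0 \<notin> path_image h"
  proof
    assume "0 \<in> path_image h"
    then obtain u where "u \<in> {0..1}" "h u = 0" by (auto simp: path_image_def)
    then show False using focal_sum_ellipse_map_gt[OF x q(2)[of u]] h(3)[of u] by (auto simp: focal_sum_def)
  qed
  obtain p where p: "path p" "pathfinish p - pathstart p = 2 * of_real pi * \<i> * winding_number h 0"
     "\<And>t. t \<in> {0..1} \<Longrightarrow> h t = 0 + exp (p t)"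
    using winding_number_as_continuous_log[OF h(1) h0] by metis
  define p' where "p' = (\<lambda>u. Ln (x/4) + q u + 2 * Ln (1 + exp (- q u)))"
  have pos: "Re (1 + exp (- q u)) > 0" if "u \<in> {0..1}" for u
  proof -
    have "norm (exp (- q u)) < 1" using q(2)[OF that] by simp
    then have "- 1 < Re (exp (- q u))" using abs_Re_le_cmod[of "exp (- q u)"] by linarith
    then show ?thesis by simp
  qed
  have nz: "1 + exp (- q u) \<noteq> 0" if "u \<in> {0..1}" for u
    using pos[OF that] by (metis less_irrefl zero_complex.sel(1))
  have cp': "continuous_on {0..1} p'" unfolding p'_def
  proof (intro continuous_intros)
    show "continuous_on {0..1} q" using q(1) by (simp add: path_def)
    then show "continuous_on {0..1} q" .
    show "1 + exp (- q z) \<notin> \<real>\<^sub>\<le>\<^sub>0" if "z \<in> {0..1}" for z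
      using pos[OF that] by (auto simp: complex_nonpos_Reals_iff)
  qed
  have ep': "exp (p' u) = h u" if u: "u \<in> {0..1}" for u
  proof -
    have "exp (p' u) = x/4 * exp (q u) * (1 + exp (- q u))^2"
      unfolding p'_def using x nz[OF u] by (simp add: exp_add exp_double)
    also have "\<dots> = ellipse_map x (q u)"
      by (simp add: ellipse_map_def cosh_field_def exp_minus field_simps power2_eq_square)
    finally show ?thesis using h(3)[OF u] by simp
  qed
  \<comment> \<open>Two logarithms of \<open>h\<close> differ by a continuous function with values
    in the multiples of \<open>2 * pi * \<i>\<close>, whose spacing exceeds 1.\<close>
  have "(\<lambda>u. p u - p' u) constant_on {0..1}"
  proof (rule continuous_discrete_range_constant)
    show "continuous_on {0..1} (\<lambda>u. p u - p' u)" using p(1) cp' by (intro continuous_intros) (auto simp: path_def)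
    fix u :: real assume u: "u \<in> {0..1}"
    have e1: "exp (p v - p' v) = 1" if "v \<in> {0..1}" for v
      using ep'[OF that] p(3)[OF that] by (simp add: exp_diff)
    show "\<exists>e>0. \<forall>y. y \<in> {0..1} \<and> p y - p' y \<noteq> p u - p' u \<longrightarrow> e \<le> cmod (p y - p' y - (p u - p' u))"
    proof (intro exI[of _ 1] conjI allI impI)
      fix v assume v: "v \<in> {0..1} \<and> p v - p' v \<noteq> p u - p' u"
      have "exp (p v - p' v - (p u - p' u)) = 1" using e1[OF u] e1[of v] v by (simp add: exp_diff)
      then obtain n where n: "p v - p' v - (p u - p' u) = of_int (2 * n) * pi * \<i>"
        by (metis complex_eq exp_eq_1 complex_of_real_mult_Complex mult.commute complex_eq_iff Re_complex_of_real  complex.sel add_0 of_real_0 of_real_mult of_real_of_int_eq)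
      then have "n \<noteq> 0" using v by auto
      then have "\<bar>real_of_int n\<bar> \<ge> 1" by linarith
      then have "2 * \<bar>real_of_int n\<bar> * pi \<ge> 2 * 1 * 3" using pi_gt3 by (intro mult_mono) auto
      then have "1 \<le> 2 * \<bar>real_of_int n\<bar> * pi" by linarith
      then show "1 \<le> cmod (p v - p' v - (p u - p' u))"
        unfolding n by (simp add: norm_mult abs_mult)
    qed auto
  qed auto
  then have "p 1 - p' 1 = p 0 - p' 0" unfolding constant_on_def by auto
  then have "p' 1 - p' 0 = 2 * of_real pi * \<i> * winding_number h 0"
    using p(2) by (simp add: pathstart_def pathfinish_def algebra_simps)
  moreover have "exp (q 1) = exp (q 0)"
    by (rule ellipse_map_inj[OF x]) (use q h in \<open>auto simp: pathstart_def pathfinish_def\<close>)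
  then have "p' 1 - p' 0 = q 1 - q 0" by (simp add: p'_def exp_minus)
  ultimately show ?thesis by simp
qed

text \<open>A point outside the component lies outside \<open>T\<close> or in another component of
  \<open>T\<close>. That other component is either unbounded itself or has a frontier point outside
  \<open>T\<close>, through which it is joined to an unbounded set. So the complement has only
  unbounded components, which is the planar criterion for simple connectivity.\<close>

lemma simply_connected_component:
  fixes T :: "complex set"
  assumes T: "open T" and ub: "\<And>p. p \<notin> T \<Longrightarrow> \<exists>C. connected C \<and> p \<in> C \<and> C \<inter> T = {} \<and> \<not> bounded C"
  shows "simply_connected (connected_component_set T a)"
proof -
  let ?T0 = "connected_component_set T a"
  have ub0: "\<exists>C. connected C \<and> p \<in> C \<and> C \<subseteq> - ?T0 \<and> \<not> bounded C" if p: "p \<notin> ?T0" for p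
  proof (cases "p \<in> T")
    case False
    then show ?thesis using ub[OF False] connected_component_subset[of T a] by blast
  next
    case True
    let ?T1 = "connected_component_set T p"
    have pT1: "p \<in> ?T1" using True by simp
    have dis: "?T1 \<inter> ?T0 = {}"
      using p True by (metis connected_component_nonoverlap connected_component_eq connected_component_refl mem_Collect_eq disjoint_iff connected_component_sym connected_component_trans)
    have con: "connected ?T1" by simp
    show ?thesis
    proof (cases "bounded ?T1")
      case False
      then show ?thesis using con pT1 dis by blast
    next
      case b: True
      have "?T1 \<noteq> UNIV" using b not_bounded_UNIV by metis
      then have "frontier ?T1 \<noteq> {}" using pT1 frontier_eq_empty[of ?T1] by blast
      then obtain z where z: "z \<in> frontier ?T1" by auto
      have op1: "open ?T1" using T by (rule open_connected_component)
      have zc: "z \<in> closure ?T1" "z \<notin> ?T1" using z op1 by (auto simp: frontier_def interior_open)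
      have zT: "z \<notin> T"
      proof
        assume zT: "z \<in> T"
        have "open (connected_component_set T z)" using T by (rule open_connected_component)
        moreover have "z \<in> connected_component_set T z" using zT by simp
        ultimately obtain y where "y \<in> ?T1" "y \<in> connected_component_set T z"
          using zc(1) unfolding closure_iff_nhds_not_empty by blast
        then have "z \<in> ?T1" by (metis connected_component_sym connected_component_trans mem_Collect_eq)
        with zc show False by simp
      qed
      obtain C where C: "connected C" "z \<in> C" "C \<inter> T = {}" "\<not> bounded C" using ub[OF zT] by blast
      have "connected (insert z ?T1)"
        using zc(1) closure_subset[of ?T1] by (intro connected_intermediate_closure[OF con]) blast+
      then have "connected (insert z ?T1 \<union> C)" using C by (intro connected_Un) auto
      moreover have "insert z ?T1 \<union> C \<subseteq> - ?T0"
        using dis C(3) zT connected_component_subset[of T a] C(2) by blast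
      moreover have "\<not> bounded (insert z ?T1 \<union> C)" using C(4) by (meson bounded_Un)
      ultimately show ?thesis using pT1 by blast
    qed
  qed
  have "open ?T0" using T by (rule open_connected_component)
  moreover have "\<not> bounded C" if C: "C \<in> components (- ?T0)" for C
  proof -
    obtain p where p: "p \<in> C" using in_components_nonempty[OF C] by blast
    then have "p \<notin> ?T0" using C in_components_subset by blast
    then obtain D where D: "connected D" "p \<in> D" "D \<subseteq> - ?T0" "\<not> bounded D" using ub0 by blast
    then have "D \<subseteq> C" using components_maximal[OF C D(1,3)] p by blast
    with D(4) show ?thesis using bounded_subset by blast
  qed
  ultimately show ?thesis by (simp add: simply_connected_eq_unbounded_complement_components)
qed

text \<open>The loop is lifted to the half plane from which the preimages of a curve
  \<open>\<gamma>\<close>, leading from \<open>1\<close> to infinity outside \<open>h\<close>, are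
  deleted. In the simply connected component \<open>T0\<close> the lift, which ends one period above
  its start, is homotopic to a path \<open>d\<close> to the point \<open>\<eta>\<close>, followed by
  the vertical segment over one period and by the translate of \<open>d\<close> run backwards. The
  projection of this homotopy is the claim.\<close>

theorem loop_homotopic_ellipse:
  assumes x: "x \<noteq> 0" and h: "simple_path h" "pathfinish h = pathstart h"
    and ins: "closed_segment 0 x \<subseteq> inside (path_image h)" and out: "1 \<in> outside (path_image h)"
    and wn: "winding_number h 0 = 1"
  shows "\<exists>\<eta>0>0. \<forall>\<eta>. 0 < \<eta> \<and> \<eta> < \<eta>0 \<longrightarrow> path_image (ellipse_loop x \<eta>) \<subseteq> - {0, x, 1} \<and>
    (\<exists>d. path d \<and> path_image d \<subseteq> - {0, x, 1} \<and> pathfinish d = ellipse_map x (of_real \<eta>) \<and>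
       homotopic_paths (- {0, x, 1}) h (d +++ ellipse_loop x \<eta> +++ reversepath d))"
proof -
  let ?J = "ellipse_map x"
  let ?K = "closed_segment 0 x"
  define I Ou where "I = inside (path_image h)" and "Ou = outside (path_image h)"
  have jord: "open I" "connected I" "open Ou" "connected Ou" "I \<inter> Ou = {}" "I \<inter> path_image h = {}"
    "Ou \<inter> path_image h = {}" "frontier I = path_image h"
    using Jordan_inside_outside[OF h] inside_no_overlap outside_no_overlap by (auto simp: I_def Ou_def)
  have ph: "path h" using h(1) by (simp add: simple_path_imp_path)
  \<comment> \<open>a thin confocal ellipse lies inside \<open>h\<close>\<close>
  obtain e where e: "e > 0" "\<And>p. p \<in> ?K \<Longrightarrow> cball p e \<subseteq> I"
    using compact_subset_open_imp_cball_epsilon_subset[of ?K I] jord(1) ins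
    by (metis UN_subset_iff compact_segment I_def)
  \<comment> \<open>The distance of \<open>ellipse_map x t\<close> to the segment is at most
    \<open>norm x / 2 * (exp (Re t) - 1)\<close>, and this expression reaches \<open>e\<close> at
    \<open>Re t = \<eta>0\<close>.\<close>
  define \<eta>0 where "\<eta>0 = ln (1 + 2 * e / norm x)"
  have \<eta>0: "\<eta>0 > 0" "exp \<eta>0 = 1 + 2 * e / norm x"
    unfolding \<eta>0_def using e(1) x by (intro ln_gt_zero exp_ln; simp add: add_pos_pos)+
  have strip_in: "?J t \<in> I" if t: "0 < Re t" "Re t < \<eta>0" for t
  proof -
    let ?u = "exp (of_real (Re t)) - 1 :: complex" and ?y = "\<i> * of_real (Im t)"
    have et: "t = of_real (Re t) + ?y" by (simp add: complex_eq_iff)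
    have "?J t - ?J ?y = x / 4 * (exp ?y * (exp (of_real (Re t)) - 1) + exp (- ?y) * (exp (- of_real (Re t)) - 1))"
    proof -
      have "exp t = exp (of_real (Re t)) * exp ?y" "exp (- t) = exp (- of_real (Re t)) * exp (- ?y)"
        by (subst et, simp add: exp_add exp_diff exp_minus field_simps)+
      then show ?thesis by (simp add: ellipse_map_def cosh_field_def field_simps)
    qed
    also have "norm \<dots> \<le> norm x / 4 * (norm (exp (of_real (Re t)) - 1 :: complex) + norm (exp (- of_real (Re t)) - 1 :: complex))"
      unfolding norm_mult norm_divide
      by (intro mult_mono order_trans[OF norm_triangle_ineq] add_mono) (auto simp: norm_mult)
    also have "norm (exp (of_real (Re t)) - 1 :: complex) = exp (Re t) - 1"
      using t by (metis abs_of_nonneg diff_ge_0_iff_ge exp_of_real norm_of_real of_real_1 of_real_diff one_le_exp_iff order_less_imp_le)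
    also have "norm (exp (- of_real (Re t)) - 1 :: complex) = 1 - exp (- Re t)"
      using t by (metis abs_minus_commute abs_of_nonneg diff_ge_0_iff_ge exp_of_real norm_of_real of_real_1 of_real_diff of_real_minus exp_le_one_iff order_less_imp_le neg_le_0_iff_le)
    also have "1 - exp (- Re t) \<le> exp (Re t) - 1"
      using exp_ge_add_one_self[of "Re t"] exp_ge_add_one_self[of "- Re t"] by linarith
    also have "exp (Re t) \<le> 1 + 2 * e / norm x" using t \<eta>0(2) by (metis exp_le_cancel_iff order_less_imp_le)
    finally have "norm (?J t - ?J ?y) \<le> norm x / 4 * (2 * (2 * e / norm x))"
      by (simp add: mult_left_mono)
    also have "\<dots> = e" using x by simp
    finally have "dist (?J ?y) (?J t) \<le> e" by (simp add: dist_norm norm_minus_commute)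
    moreover have "?J ?y \<in> ?K"
    proof -
      have "cosh ?y = of_real (cos (Im t))"
        by (simp add: cosh_field_def cos_exp_eq cos_of_real[symmetric])
      then have "?J ?y = ((1 + cos (Im t)) / 2) *\<^sub>R x"
        by (simp add: ellipse_map_def scaleR_conv_of_real)
      moreover have "0 \<le> (1 + c) / 2 \<and> (1 + c) / 2 \<le> 1" if "-1 \<le> c" "c \<le> 1" for c :: real
        using that by simp
      from this[OF cos_ge_minus_one cos_le_one]
      have "0 \<le> (1 + cos (Im t)) / 2 \<and> (1 + cos (Im t)) / 2 \<le> 1" .
      ultimately show ?thesis unfolding closed_segment_def by (auto intro!: exI[of _ "(1 + cos (Im t)) / 2"])
    qed
    ultimately show ?thesis using e(2) by (auto simp: subset_iff)
  qed
  \<comment> \<open>a curve from 1 to infinity outside \<open>h\<close>\<close>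
  obtain R where R: "path_image h \<subseteq> ball 0 R" "R > 0"
    using bounded_subset_ballD[OF bounded_path_image[OF ph]] by blast
  have outR: "- ball 0 R \<subseteq> Ou" unfolding Ou_def using R by (intro outside_subset_convex) auto
  define ray where "ray = {z. Re z \<ge> R} \<inter> {z. Im z = 0}"
  have ray: "closed ray" "convex ray" "ray \<subseteq> Ou" "of_real R \<in> ray"
  proof -
    show "closed ray" unfolding ray_def by (intro closed_Int closed_halfspace_Re_ge closed_Collect_eq continuous_intros)
    show "convex ray" unfolding ray_def 
      by (intro convex_Int convex_halfspace_Re_ge) (auto simp: convex_def)
    show "ray \<subseteq> Ou"
    proof
      fix z assume "z \<in> ray"
      then have "z \<in> - ball 0 R" using abs_Re_le_cmod[of z] by (simp add: ray_def, linarith)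
      then show "z \<in> Ou" using outR by blast
    qed
  qed (auto simp: ray_def)
  have "path_connected Ou" using jord by (simp add: connected_open_path_connected)
  moreover have "of_real R \<in> Ou" "1 \<in> Ou" using ray out by (auto simp: Ou_def)
  ultimately obtain p where p: "path p" "path_image p \<subseteq> Ou" "pathstart p = 1" "pathfinish p = of_real R"
    unfolding path_connected_def by blast
  define \<gamma> where "\<gamma> = path_image p \<union> ray"
  have \<gamma>: "closed \<gamma>" "\<gamma> \<subseteq> Ou" "1 \<in> \<gamma>" "path_connected \<gamma>"
  proof -
    show "closed \<gamma>" using ray p by (auto simp: \<gamma>_def closed_path_image)
    show "\<gamma> \<subseteq> Ou" using ray p by (auto simp: \<gamma>_def)
    show "1 \<in> \<gamma>" using p(3) pathstart_in_path_image[of p] by (auto simp: \<gamma>_def)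
    have "of_real R \<in> path_image p \<inter> ray" using p(4) pathfinish_in_path_image[of p] ray(4) by auto
    then show "path_connected \<gamma>" unfolding \<gamma>_def using ray p
      by (intro path_connected_Un path_connected_path_image convex_imp_path_connected) auto
  qed
  have \<gamma>K: "focal_sum x l > norm x" if "l \<in> \<gamma>" for l
    using that \<gamma>(2) ins jord(5) unfolding focal_sum_segment I_def[symmetric] by blast
  have hK: "focal_sum x (h u) > norm x" if "u \<in> {0..1}" for u
    using that ins jord(6) unfolding focal_sum_segment I_def[symmetric] by (auto simp: path_image_def)
  \<comment> \<open>Points over \<open>0\<close> and \<open>x\<close> are absent because
    \<open>Re t > 0\<close>, points over \<open>1\<close> because \<open>1\<close> lies on
    \<open>\<gamma>\<close>.\<close>
  define T where "T = {t. Re t > 0} \<inter> ?J -` (- \<gamma>)"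
  have opT: "open T" unfolding T_def
    by (intro open_Int open_halfspace_Re_gt open_vimage continuous_on_ellipse_map) (use \<gamma>(1) in auto)
  have Tper: "t + 2 * of_real pi * \<i> \<in> T" if "t \<in> T" for t
    using that by (auto simp: T_def ellipse_map_periodic)
  define LS where "LS = {t. 0 < Re t} \<inter> {t. Re t < \<eta>0}"
  have LS: "LS \<subseteq> T" "convex LS"
    using strip_in \<gamma>(2) jord(5) by (auto simp: LS_def T_def intro!: convex_Int convex_halfspace_Re_gt convex_halfspace_Re_lt)
  define T0 where "T0 = connected_component_set T (of_real (\<eta>0 / 2))"
  have base: "of_real (\<eta>0/2) \<in> LS" using \<eta>0 by (auto simp: LS_def)
  have T0max: "C \<subseteq> T0" if C: "connected C" "C \<subseteq> T" "C \<inter> T0 \<noteq> {}" for C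
  proof -
    obtain c where c: "c \<in> C" "c \<in> T0" using C(3) by blast
    have "C \<subseteq> connected_component_set T c" by (rule connected_component_maximal) (use c C in auto)
    also have "connected_component_set T c = T0" using c(2) unfolding T0_def by (metis connected_component_eq)
    finally show ?thesis .
  qed
  have LST0: "LS \<subseteq> T0" unfolding T0_def using LS base by (intro connected_component_maximal) (auto intro: convex_connected)
  have T0T: "T0 \<subseteq> T" unfolding T0_def by (rule connected_component_subset)
  have opT0: "open T0" unfolding T0_def using opT by (rule open_connected_component)
  \<comment> \<open>The points outside \<open>T\<close> fall into the closed left half plane, which
    is unbounded, and the preimages of \<open>\<gamma>\<close>; a path in \<open>\<gamma>\<close>
    towards infinity lifts, so the component of every such preimage is unbounded too.\<close>
  have sc: "simply_connected T0" unfolding T0_def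
  proof (rule simply_connected_component[OF opT])
    fix q assume q: "q \<notin> T"
    show "\<exists>C. connected C \<and> q \<in> C \<and> C \<inter> T = {} \<and> \<not> bounded C"
    proof (cases "Re q > 0")
      case False
      have "\<not> bounded {t. Re t \<le> 0}"
      proof
        assume "bounded {t. Re t \<le> 0}"
        then obtain B where B: "\<And>t. Re t \<le> 0 \<Longrightarrow> norm t \<le> B" by (auto simp: bounded_iff)
        have "norm (- of_real (\<bar>B\<bar> + 1) :: complex) = \<bar>B\<bar> + 1"
          unfolding norm_minus_cancel norm_of_real by simp
        moreover have "norm (- of_real (\<bar>B\<bar> + 1) :: complex) \<le> B" by (rule B) simp
        ultimately show False by linarith
      qed
      then show ?thesis using False
        by (intro exI[of _ "{t. Re t \<le> 0}"]) (auto simp: T_def intro!: convex_connected convex_halfspace_Re_le)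
    next
      case True
      then have q\<gamma>: "?J q \<in> \<gamma>" using q by (auto simp: T_def)
      define C where "C = connected_component_set ({t. Re t > 0} \<inter> ?J -` \<gamma>) q"
      have Csub: "C \<subseteq> {t. Re t > 0} \<inter> ?J -` \<gamma>" unfolding C_def by (rule connected_component_subset)
      have qC: "q \<in> C" using True q\<gamma> by (auto simp: C_def)
      have "\<not> bounded C"
      proof
        assume "bounded C"
        then obtain B where B: "\<And>t. t \<in> C \<Longrightarrow> norm t \<le> B" by (auto simp: bounded_iff)
        \<comment> \<open>At this point of the ray the focal sum exceeds
          \<open>norm x * cosh B\<close>, so none of its preimages fits within the bound
          \<open>B\<close>.\<close>
        define r where "r = max R (norm x * cosh B + 1)"
        have rr: "of_real r \<in> \<gamma>" by (auto simp: \<gamma>_def ray_def r_def)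
        obtain w where w: "path w" "path_image w \<subseteq> \<gamma>" "pathstart w = ?J q" "pathfinish w = of_real r"
          using \<gamma>(4) q\<gamma> rr unfolding path_connected_def by blast
        have wK: "focal_sum x (w u) > norm x" if "u \<in> {0..1}" for u
          using w(2) that by (intro \<gamma>K) (auto simp: path_image_def image_subset_iff)
        obtain v where v: "path v" "v 0 = q" "\<And>u. u \<in> {0..1} \<Longrightarrow> Re (v u) > 0 \<and> ?J (v u) = w u"
          using ellipse_map_lift[OF x w(1) wK True] w(3) by (metis pathstart_def)
        have "path_image v \<subseteq> C" unfolding C_def
        proof (rule connected_component_maximal)
          show "q \<in> path_image v" using v(2) by (auto simp: path_image_def intro!: image_eqI[of _ _ 0])
          show "connected (path_image v)" using v(1) by (rule connected_path_image)
          show "path_image v \<subseteq> {t. Re t > 0} \<inter> ?J -` \<gamma>" using v(3) w(2) by (auto simp: path_image_def)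
        qed
        then have "norm (v 1) \<le> B" by (intro B) (auto simp: path_image_def image_subset_iff)
        then have ReB: "\<bar>Re (v 1)\<bar> \<le> B" using abs_Re_le_cmod order_trans by blast
        have "r \<le> norm (?J (v 1))" using v(3)[of 1] w(4) by (auto simp: pathfinish_def)
        also have "\<dots> \<le> focal_sum x (?J (v 1))" by (simp add: focal_sum_def)
        also have "\<dots> = norm x * cosh (Re (v 1))" by (rule focal_sum_ellipse_map)
        also have "\<dots> \<le> norm x * cosh B"
          using ReB cosh_real_nonneg_le_iff[of "\<bar>Re (v 1)\<bar>" B] by (intro mult_left_mono) (auto simp: cosh_real_abs)
        finally show False by (auto simp: r_def)
      qed
      then show ?thesis using qC Csub by (intro exI[of _ C]) (auto simp: T_def C_def)
    qed
  qed
  \<comment> \<open>the lift of \<open>h\<close>\<close>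
  obtain t0 where t0: "Re t0 > 0" "?J t0 = h 0" using ellipse_map_surj[OF x hK[of 0]] by auto
  obtain hh where hh: "path hh" "hh 0 = t0" "\<And>u. u \<in> {0..1} \<Longrightarrow> Re (hh u) > 0 \<and> ?J (hh u) = h u"
    using ellipse_map_lift[OF x ph hK t0] by metis
  have h\<gamma>: "h u \<notin> \<gamma>" if "u \<in> {0..1}" for u
  proof -
    have "h u \<in> path_image h" using that by (simp add: path_image_def)
    then show ?thesis using jord(7) \<gamma>(2) by blast
  qed
  have hhT: "path_image hh \<subseteq> T"
    using hh(3) h\<gamma> by (auto simp: T_def path_image_def)
  \<comment> \<open>The lift of \<open>h\<close> has to start in the component of the thin strip. A
    path from \<open>h 0\<close> to \<open>0\<close>, contained in the interior of \<open>h\<close>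
    and a small ball about \<open>h 0\<close>, is cut where its focal sum has dropped to
    \<open>c\<close>. Up to there it avoids the segment and therefore lifts, and the lift ends in
    the strip.\<close>
  have t0T0: "t0 \<in> T0"
  proof -
    have h0: "h 0 \<in> path_image h" by (auto simp: path_image_def)
    then have "h 0 \<in> - \<gamma>" using \<gamma>(2) jord(7) by auto
    then obtain r where r: "r > 0" "ball (h 0) r \<subseteq> - \<gamma>" using \<gamma>(1) by (metis open_Compl openE)
    have "h 0 \<in> closure I" using h0 jord(8) by (auto simp: frontier_def)
    then have "ball (h 0) r \<inter> I \<noteq> {}" using r(1) unfolding closure_iff_nhds_not_empty
      by (metis Int_commute centre_in_ball open_ball order_refl)
    then have "connected (I \<union> ball (h 0) r)" using jord(2) by (intro connected_Un) (auto simp: Int_commute)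
    then have "path_connected (I \<union> ball (h 0) r)" using jord(1) by (simp add: connected_open_path_connected open_Un)
    moreover have "0 \<in> I" using ins by (auto simp: I_def)
    ultimately obtain q where q: "path q" "path_image q \<subseteq> I \<union> ball (h 0) r" "pathstart q = h 0" "pathfinish q = 0"
      unfolding path_connected_def using r(1) by (metis UnI1 UnI2 centre_in_ball)
    have q\<gamma>: "path_image q \<inter> \<gamma> = {}" using q(2) r(2) \<gamma>(2) jord(5) by blast
    have ch: "norm x < norm x * cosh \<eta>0" using x \<eta>0(1) cosh_real_strict_mono[of 0 \<eta>0] by simp
    define c where "c = (norm x + min (focal_sum x (h 0)) (norm x * cosh \<eta>0)) / 2"
    have c: "norm x < c" "c < focal_sum x (h 0)" "c < norm x * cosh \<eta>0"
      using ch hK[of 0] by (auto simp: c_def)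
    define S where "S = {l. c < focal_sum x l}"
    have opS: "open S" unfolding S_def by (intro open_Collect_less continuous_intros continuous_on_focal_sum)
    have "pathstart q \<in> S" using q(3) c by (simp add: S_def)
    then have "pathstart q \<in> closure S" using closure_subset by blast
    moreover have "pathfinish q \<notin> S" using q(4) c by (auto simp: S_def focal_sum_def)
    ultimately obtain q2 where q2: "path q2" "pathstart q2 = pathstart q" "path_image q2 \<subseteq> path_image q"
       "path_image q2 - {pathfinish q2} \<subseteq> interior S" "pathfinish q2 \<in> frontier S"
      using exists_path_subpath_to_frontier[OF q(1)] by blast
    have "closure S \<subseteq> {l. c \<le> focal_sum x l}"
      by (intro closure_minimal closed_Collect_le continuous_intros continuous_on_focal_sum) (auto simp: S_def)
    then have q2f: "focal_sum x (pathfinish q2) = c"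
      using q2(5) opS by (auto simp: frontier_def interior_open S_def)
    have q2K: "focal_sum x (q2 u) > norm x" if "u \<in> {0..1}" for u
    proof (cases "q2 u = pathfinish q2")
      case True then show ?thesis using q2f c by simp
    next
      case False
      then have "q2 u \<in> S" using q2(4) that opS by (auto simp: path_image_def interior_open)
      then show ?thesis using c by (auto simp: S_def)
    qed
    have "?J t0 = q2 0" using q2(2) q(3) t0(2) by (simp add: pathstart_def)
    then obtain v where v: "path v" "v 0 = t0" "\<And>u. u \<in> {0..1} \<Longrightarrow> Re (v u) > 0 \<and> ?J (v u) = q2 u"
      using ellipse_map_lift[OF x q2(1) q2K t0(1)] by metis
    have "norm x * cosh (Re (v 1)) < norm x * cosh \<eta>0"
      using focal_sum_ellipse_map[of x "v 1"] v(3)[of 1] q2f c(3) by (simp add: pathfinish_def)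
    then have "cosh (Re (v 1)) < cosh \<eta>0" using x by simp
    then have "Re (v 1) < \<eta>0" using v(3)[of 1] \<eta>0(1) by (subst (asm) cosh_real_nonneg_less_iff) auto
    then have "v 1 \<in> T0" using LST0 v(3)[of 1] by (auto simp: LS_def)
    moreover have "v 1 \<in> path_image v" "v 0 \<in> path_image v" by (simp_all add: path_image_def)
    moreover have "path_image v \<subseteq> T"
    proof -
      have "q2 u \<notin> \<gamma>" if "u \<in> {0..1}" for u
      proof -
        have "q2 u \<in> path_image q" using that q2(3) by (auto simp: path_image_def)
        then show ?thesis using q\<gamma> by blast
      qed
      then show ?thesis using v(3) by (auto simp: path_image_def T_def)
    qed
    ultimately have "path_image v \<subseteq> T0" using v(1) by (intro T0max connected_path_image) blast+
    then show ?thesis using v(2) \<open>v 0 \<in> path_image v\<close> by blast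
  qed
  have hhT0: "path_image hh \<subseteq> T0"
  proof (rule T0max)
    have "hh 0 \<in> path_image hh" by (simp add: path_image_def)
    then show "path_image hh \<inter> T0 \<noteq> {}" using t0T0 hh(2) by blast
  qed (use hh(1) hhT connected_path_image in auto)
  \<comment> \<open>The winding number 1 about \<open>0\<close> makes the lift end exactly one
    period above its start.\<close>
  have hh1: "hh 1 = hh 0 + 2 * of_real pi * \<i>"
    using ellipse_map_winding[OF x hh(1) _ ph h(2)] hh(3) wn by (simp add: algebra_simps)
  have JT0: "?J ` T0 \<subseteq> - {0, x, 1}"
  proof -
    have "?J t \<notin> {0, x, 1}" if "t \<in> T0" for t
      using that T0T focal_sum_ellipse_map_gt[OF x, of t] \<gamma>(3) by (auto simp: T_def focal_sum_def)
    then show ?thesis by auto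
  qed
  show ?thesis
  proof (intro exI[of _ \<eta>0] conjI allI impI \<eta>0(1))
    fix \<eta> :: real assume \<eta>: "0 < \<eta> \<and> \<eta> < \<eta>0"
    define e' where "e' = linepath (of_real \<eta>) (of_real \<eta> + 2 * of_real pi * \<i>)"
    have e'T0: "path_image e' \<subseteq> T0"
    proof -
      have "closed_segment (of_real \<eta>) (of_real \<eta> + 2 * of_real pi * \<i>) \<subseteq> LS"
        using \<eta> LS(2) by (intro closed_segment_subset) (auto simp: LS_def)
      then show ?thesis using LST0 by (auto simp: e'_def)
    qed
    show "path_image (ellipse_loop x \<eta>) \<subseteq> - {0, x, 1}"
      using e'T0 JT0 by (auto simp: ellipse_loop_def path_image_compose e'_def)
    have "path_connected T0" using sc by (rule simply_connected_imp_path_connected)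
    moreover have \<eta>T0: "of_real \<eta> \<in> T0" using \<eta> LST0 by (auto simp: LS_def)
    ultimately obtain d where d: "path d" "path_image d \<subseteq> T0" "pathstart d = t0" "pathfinish d = of_real \<eta>"
      unfolding path_connected_def using t0T0 by blast
    define d' where "d' = (\<lambda>u. d u + 2 * of_real pi * \<i>)"
    have d': "path d'" "pathstart d' = hh 1" "pathfinish d' = of_real \<eta> + 2 * of_real pi * \<i>"
      using d hh1 hh(2) by (auto simp: d'_def path_def pathstart_def pathfinish_def intro!: continuous_intros)
    have "path_image d' \<subseteq> T"
    proof
      fix z assume "z \<in> path_image d'"
      then obtain u where "u \<in> {0..1}" "z = d u + 2 * of_real pi * \<i>" by (auto simp: path_image_def d'_def)
      moreover from this have "d u \<in> T" using d(2) T0T unfolding path_image_def by blast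
      ultimately show "z \<in> T" using Tper by simp
    qed
    moreover have "of_real \<eta> + 2 * of_real pi * \<i> \<in> path_image d' \<inter> T0"
      using d'(3) pathfinish_in_path_image[of d'] e'T0 by (auto simp: e'_def)
    ultimately have d'T0: "path_image d' \<subseteq> T0" using d'(1) by (intro T0max connected_path_image) auto
    have "homotopic_paths T0 hh (d +++ e' +++ reversepath d')"
    proof -
      have *: "homotopic_paths T0 p q" if "path p" "path_image p \<subseteq> T0" "path q" "path_image q \<subseteq> T0"
        "pathstart q = pathstart p" "pathfinish q = pathfinish p" for p q
        using sc that unfolding simply_connected_eq_homotopic_paths by blast
      have e': "path e'" "pathstart e' = pathfinish d" "pathfinish e' = pathfinish d'"
        using d(4) d'(3) by (simp_all add: e'_def)
      have hhe: "pathstart hh = t0" "pathfinish hh = hh 1" using hh(2) by (simp_all add: pathstart_def pathfinish_def)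
      show ?thesis
      proof (rule *)
        show "path hh" "path_image hh \<subseteq> T0" by fact+
        show "path (d +++ e' +++ reversepath d')" using d d' e' by simp
        show "path_image (d +++ e' +++ reversepath d') \<subseteq> T0"
          using d d' e' d'T0 e'T0 by (simp add: path_image_join)
      qed (use d d' e' hhe in simp_all)
    qed
    then have hom: "homotopic_paths (- {0, x, 1}) (?J \<circ> hh) (?J \<circ> (d +++ e' +++ reversepath d'))"
      by (rule homotopic_paths_continuous_image) (use JT0 continuous_on_ellipse_map in auto)
    \<comment> \<open>The translation by the period disappears under \<open>ellipse_map\<close>, so
      the way back is the reverse of the way out.\<close>
    have "?J \<circ> reversepath d' = reversepath (?J \<circ> d)"
      by (auto simp: d'_def reversepath_def fun_eq_iff ellipse_map_periodic)
    then have eq: "?J \<circ> (d +++ e' +++ reversepath d') = (?J \<circ> d) +++ ellipse_loop x \<eta> +++ reversepath (?J \<circ> d)"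
      by (simp add: path_compose_join ellipse_loop_def e'_def)
    have "homotopic_paths (- {0, x, 1}) h (?J \<circ> hh)"
    proof (rule homotopic_paths_eq)
      show "path_image h \<subseteq> - {0, x, 1}"
      proof -
        have "h u \<notin> {0,x,1}" if u: "u \<in> {0..1}" for u
        proof -
          have "hh u \<in> T0" using u hhT0 unfolding path_image_def by blast
          then have "?J (hh u) \<in> - {0, x, 1}" using JT0 by blast
          then show ?thesis using hh(3)[OF u] by simp
        qed
        then show ?thesis
        proof (intro subsetI)
          fix z assume "z \<in> path_image h"
          then obtain u where "u \<in> {0..1}" "z = h u" unfolding path_image_def by blast
          then show "z \<in> - {0, x, 1}" using \<open>\<And>u. u \<in> {0..1} \<Longrightarrow> h u \<notin> {0,x,1}\<close> by simp
        qed
      qed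
    qed (use ph hh in auto)
    with hom eq have "homotopic_paths (- {0, x, 1}) h ((?J \<circ> d) +++ ellipse_loop x \<eta> +++ reversepath (?J \<circ> d))"
      by (metis homotopic_paths_trans)
    moreover have "path (?J \<circ> d)" using d(1) by (intro path_continuous_image continuous_on_ellipse_map)
    moreover have "path_image (?J \<circ> d) \<subseteq> - {0, x, 1}" using d(2) JT0 by (auto simp: path_image_compose)
    moreover have "pathfinish (?J \<circ> d) = ?J (of_real \<eta>)" using d(4) by (simp add: pathfinish_compose)
    ultimately show "\<exists>d. path d \<and> path_image d \<subseteq> - {0, x, 1} \<and> pathfinish d = ?J (of_real \<eta>) \<and>
       homotopic_paths (- {0, x, 1}) h (d +++ ellipse_loop x \<eta> +++ reversepath d)" by blast
  qed
qed

section \<open>The trace of the transport around $0$ and $x$\<close>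

lemma trace_conj:
  fixes P M N :: "complex^2^2"
  assumes "det P \<noteq> 0" "P ** M = N ** P"
  shows "trace M = trace N"
proof -
  obtain P' where P': "P' ** P = mat 1" "P ** P' = mat 1"
    using assms(1) invertible_det_nz[of P] unfolding invertible_def by blast
  have "M = P' ** (N ** P)" using assms(2) P'(1) by (metis matrix_mul_assoc matrix_mul_lid)
  then have "trace M = trace ((N ** P) ** P')" by (metis trace_mul_sym)
  then show ?thesis using P'(2) by (simp flip: matrix_mul_assoc)
qed

lemma ccw_loop_around_path_image:
  assumes "ccw_loop_around g P Q"
  shows "path g" "path_image g \<subseteq> - (P \<union> Q)" "pathfinish g = pathstart g"
proof -
  have "P \<subseteq> inside (path_image g)" "Q \<subseteq> outside (path_image g)" using assms by (auto simp: ccw_loop_around_def)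
  then show "path_image g \<subseteq> - (P \<union> Q)"
    using inside_no_overlap[of "path_image g"] outside_no_overlap[of "path_image g"] by blast
qed (use assms in \<open>auto simp: ccw_loop_around_def simple_path_imp_path\<close>)

lemma matrix_holomorphic_fuchsian_coeff: "matrix_holomorphic_on (fuchsian_coeff A0 Ax A1 x) (- {0, x, 1})"
  unfolding matrix_holomorphic_on_def fuchsian_coeff_def
  by (auto intro!: holomorphic_intros)

lemma fundamental_solution_on_iff:
  "fundamental_solution_on A0 Ax A1 x \<Psi> U \<longleftrightarrow>
     open U \<and> U \<subseteq> - {0, x, 1} \<and> (\<forall>l\<in>U. det (\<Psi> l) \<noteq> 0) \<and> lin_sol (fuchsian_coeff A0 Ax A1 x) \<Psi> U"
  by (auto simp: fundamental_solution_on_def lin_sol_def)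

lemma open_punctures: "open (- {0, x, 1 :: complex})"
  by (intro open_Compl finite_imp_closed) auto

abbreviation fuchsian_transp ::
  "complex^2^2 \<Rightarrow> complex^2^2 \<Rightarrow> complex^2^2 \<Rightarrow> complex \<Rightarrow> (real \<Rightarrow> complex) \<Rightarrow> complex^2^2" where
  "fuchsian_transp A0 Ax A1 x \<equiv> transp (fuchsian_coeff A0 Ax A1 x) (- {0, x, 1})"

text \<open>Up to a change of base point both loops are homotopic to the same ellipse, once it is
  thin enough for both.\<close>

lemma trace_fuchsian_transp_eq:
  assumes x: "x \<noteq> 0" and h: "ccw_loop_around h (closed_segment 0 x) {1}"
    and h': "ccw_loop_around h' (closed_segment 0 x) {1}"
  shows "trace (fuchsian_transp A0 Ax A1 x h) = trace (fuchsian_transp A0 Ax A1 x h')"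
proof -
  have *: "\<exists>\<eta>0>0. \<forall>\<eta>. 0 < \<eta> \<and> \<eta> < \<eta>0 \<longrightarrow>
      trace (fuchsian_transp A0 Ax A1 x h) = trace (fuchsian_transp A0 Ax A1 x (ellipse_loop x \<eta>))"
    if h: "ccw_loop_around h (closed_segment 0 x) {1}" for h
  proof -
    obtain \<eta>0 where \<eta>0: "\<eta>0 > 0" "\<And>\<eta>. 0 < \<eta> \<Longrightarrow> \<eta> < \<eta>0 \<Longrightarrow> path_image (ellipse_loop x \<eta>) \<subseteq> - {0, x, 1} \<and>
    (\<exists>d. path d \<and> path_image d \<subseteq> - {0, x, 1} \<and> pathfinish d = ellipse_map x (of_real \<eta>) \<and>
       homotopic_paths (- {0, x, 1}) h (d +++ ellipse_loop x \<eta> +++ reversepath d))"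
      using loop_homotopic_ellipse[OF x, of h] h unfolding ccw_loop_around_def by auto
    show ?thesis
    proof (intro exI[of _ \<eta>0] conjI allI impI \<eta>0(1))
      fix \<eta> assume \<eta>: "0 < \<eta> \<and> \<eta> < \<eta>0"
      then obtain d where d: "path d" "path_image d \<subseteq> - {0, x, 1}" "pathfinish d = ellipse_map x (of_real \<eta>)"
        "homotopic_paths (- {0, x, 1}) h (d +++ ellipse_loop x \<eta> +++ reversepath d)" using \<eta>0(2) by meson
      show "trace (fuchsian_transp A0 Ax A1 x h) = trace (fuchsian_transp A0 Ax A1 x (ellipse_loop x \<eta>))"
      proof (rule trace_transp_conj[OF matrix_holomorphic_fuchsian_coeff open_punctures d(4,1,2)])
        show "path (ellipse_loop x \<eta>)" unfolding ellipse_loop_def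
          by (intro path_continuous_image continuous_on_ellipse_map) auto
        show "path_image (ellipse_loop x \<eta>) \<subseteq> - {0, x, 1}" using \<eta>0(2) \<eta> by meson
        show "pathstart (ellipse_loop x \<eta>) = pathfinish d" "pathfinish (ellipse_loop x \<eta>) = pathfinish d"
          using d(3) by (simp_all add: ellipse_loop_def pathstart_compose pathfinish_compose ellipse_map_periodic)
      qed
    qed
  qed
  obtain e1 where e1: "e1 > 0"
    "\<And>\<eta>. 0 < \<eta> \<and> \<eta> < e1 \<Longrightarrow> trace (fuchsian_transp A0 Ax A1 x h) = trace (fuchsian_transp A0 Ax A1 x (ellipse_loop x \<eta>))"
    using *[OF h] by blast
  obtain e2 where e2: "e2 > 0"
    "\<And>\<eta>. 0 < \<eta> \<and> \<eta> < e2 \<Longrightarrow> trace (fuchsian_transp A0 Ax A1 x h') = trace (fuchsian_transp A0 Ax A1 x (ellipse_loop x \<eta>))"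
    using *[OF h'] by blast
  have "0 < min e1 e2 / 2 \<and> min e1 e2 / 2 < e1" "0 < min e1 e2 / 2 \<and> min e1 e2 / 2 < e2" using e1(1) e2(1) by auto
  from e1(2)[OF this(1)] e2(2)[OF this(2)] show ?thesis by simp
qed

text \<open>The value of \<open>\<Psi>\<close> at the base point conjugates the monodromy matrices
  to transports, and \<open>transp_join\<close> composes these in the opposite order; the trace is
  insensitive to both.\<close>

lemma is_p0x_imp_trace:
  assumes x: "x \<noteq> 0" and h': "ccw_loop_around h' (closed_segment 0 x) {1}" and p: "is_p0x A0 Ax A1 x p"
  shows "p = trace (fuchsian_transp A0 Ax A1 x h')"
proof -
  let ?A = "fuchsian_coeff A0 Ax A1 x" and ?O = "- {0, x, 1} :: complex set"
  note H = matrix_holomorphic_fuchsian_coeff[of A0 Ax A1 x] open_punctures[of x]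
  obtain g0 gx h \<Psi> U M0 Mx where g: "ccw_loop_around g0 {0} {x, 1}" "ccw_loop_around gx {x} {0, 1}"
     "ccw_loop_around h (closed_segment 0 x) {1}" "pathstart gx = pathstart g0" "pathstart h = pathstart g0"
     "homotopic_paths (- {0, x, 1}) (g0 +++ gx) h" "pathstart g0 \<in> U" "fundamental_solution_on A0 Ax A1 x \<Psi> U"
     "has_monodromy \<Psi> g0 M0" "has_monodromy \<Psi> gx Mx" "p = trace (M0 ** Mx)"
    using p unfolding is_p0x_def by blast
  note i0 = ccw_loop_around_path_image[OF g(1)] and ix = ccw_loop_around_path_image[OF g(2)]
  have O: "path_image g0 \<subseteq> ?O" "path_image gx \<subseteq> ?O" using i0(2) ix(2) by auto
  have U: "open U" "lin_sol ?A \<Psi> U" "det (\<Psi> (pathstart g0)) \<noteq> 0" using g(7,8) by (auto simp: fundamental_solution_on_iff)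
  let ?P = "\<Psi> (pathstart g0)"
  have m0: "?P ** M0 = transp ?A ?O g0 ** ?P"
    by (rule monodromy_imp_transp[OF H i0(1) O(1) i0(3) U(2,1) g(7,9)])
  have mx: "?P ** Mx = transp ?A ?O gx ** ?P"
    using monodromy_imp_transp[OF H ix(1) O(2) ix(3) U(2,1) _ g(10)] g(4,7) by simp
  have "?P ** (M0 ** Mx) = (transp ?A ?O g0 ** transp ?A ?O gx) ** ?P"
  proof -
    have "?P ** (M0 ** Mx) = (?P ** M0) ** Mx" by (rule matrix_mul_assoc)
    also have "\<dots> = transp ?A ?O g0 ** (?P ** Mx)" unfolding m0 by (rule matrix_mul_assoc[symmetric])
    also have "\<dots> = (transp ?A ?O g0 ** transp ?A ?O gx) ** ?P" unfolding mx by (rule matrix_mul_assoc)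
    finally show ?thesis .
  qed
  then have "p = trace (transp ?A ?O g0 ** transp ?A ?O gx)" using trace_conj[OF U(3)] g(11) by simp
  also have "\<dots> = trace (transp ?A ?O (g0 +++ gx))"
  proof -
    have "transp ?A ?O (g0 +++ gx) = transp ?A ?O gx ** transp ?A ?O g0"
      by (rule transp_join[OF H i0(1) O(1) ix(1) O(2)]) (use i0(3) g(4) in simp)
    then show ?thesis by (simp only:) (rule trace_mul_sym)
  qed
  also have "\<dots> = trace (transp ?A ?O h)" using transp_homotopic[OF H g(6)] by simp
  also have "\<dots> = trace (transp ?A ?O h')" by (rule trace_fuchsian_transp_eq[OF x g(3) h'])
  finally show ?thesis .
qed

section \<open>Existence of admissible loops\<close>

lemma winding_number_full_circle:
  assumes "norm (z - c) < r"
  shows "winding_number (part_circlepath c r a (a + 2 * pi)) z = 1"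
    and "z \<in> inside (path_image (part_circlepath c r a (a + 2 * pi)))"
    and "simple_path (part_circlepath c r a (a + 2 * pi))"
    and "pathfinish (part_circlepath c r a (a + 2 * pi)) = pathstart (part_circlepath c r a (a + 2 * pi))"
proof -
  let ?h = "part_circlepath c r a (a + 2 * pi)"
  have r: "r > 0" using assms by (meson norm_ge_zero order_le_less_trans)
  show s: "simple_path ?h" using r by (simp add: simple_path_part_circlepath)
  show c: "pathfinish ?h = pathstart ?h"
  proof -
    have "exp (\<i> * (2 * complex_of_real pi)) = 1" using exp_two_pi_i by (simp add: mult.commute)
    then show ?thesis by (simp add: exp_add distrib_left)
  qed
  have "path_image ?h \<subseteq> sphere c r" using r by (intro path_image_part_circlepath_subset) auto
  then have z: "z \<notin> path_image ?h" using assms by (auto simp: dist_norm norm_minus_commute)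
  have "0 < Re (winding_number ?h z)"
    by (rule winding_number_part_circlepath_pos_less) (use assms in auto)
  then show w: "winding_number ?h z = 1"
    using simple_closed_path_winding_number_cases[OF s c z] by auto
  have "z \<notin> outside (path_image ?h)"
    using winding_number_zero_in_outside[OF _ c, of z] s w by (auto simp: simple_path_imp_path)
  then show "z \<in> inside (path_image ?h)" using z inside_Un_outside[of "path_image ?h"] by blast
qed

text \<open>The circle about \<open>x / 2\<close> of radius 1/2 encloses the segment and leaves out
  \<open>1\<close>, both because \<open>norm x < 1\<close>. Its diameter perpendicular to the
  segment cuts the disc into two halves, whose boundaries are \<open>g0\<close> and
  \<open>gx\<close>; they run through the diameter in opposite directions, so their join is
  homotopic to the circle.\<close>

lemma p0x_loops_exist:
  assumes x: "x \<noteq> 0" "norm x < 1"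
  shows "\<exists>g0 gx h. ccw_loop_around g0 {0} {x, 1} \<and> ccw_loop_around gx {x} {0, 1} \<and>
     ccw_loop_around h (closed_segment 0 x) {1} \<and> pathstart gx = pathstart g0 \<and> pathstart h = pathstart g0 \<and>
     homotopic_paths (- {0, x, 1}) (g0 +++ gx) h"
proof -
  define c r a where "c = x / 2" and "r = (1/2 :: real)" and "a = Arg x + pi / 2"
  define u where "u = cis (Arg x)"
  have xu: "x = of_real (norm x) * u" using rcis_cmod_Arg[of x] by (simp add: u_def rcis_def)
  have nu: "norm u = 1" by (simp add: u_def)
  have ca: "cis a = \<i> * u" by (simp add: a_def u_def flip: cis_mult) 
  define P Q where "P = c + of_real r * cis a" and "Q = c - of_real r * cis a"
  define arc1 where "arc1 = part_circlepath c r a (a + pi)"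
  define arc2 where "arc2 = part_circlepath c r (a + pi) (a + 2 * pi)"
  define l where "l = linepath Q P"
  define h where "h = part_circlepath c r a (a + 2 * pi)"
  have cisE: "exp (\<i> * of_real t) = cis t" for t by (simp add: cis_conv_exp)
  have ends: "pathstart arc1 = P" "pathfinish arc1 = Q" "pathstart arc2 = Q" "pathfinish arc2 = P"
  proof -
    have "cis (a + pi) = - cis a" "cis (a + 2 * pi) = cis a" by (simp_all flip: cis_mult)
    then show "pathstart arc1 = P" "pathfinish arc1 = Q" "pathstart arc2 = Q" "pathfinish arc2 = P"
      unfolding arc1_def arc2_def pathstart_part_circlepath pathfinish_part_circlepath cisE P_def Q_def by simp_all
  qed
  have h_eq: "h = arc1 +++ arc2"
  proof
    fix t
    have 1: "linepath a (a + 2 * pi) t = linepath a (a + pi) (2 * t)"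
      and 2: "linepath a (a + 2 * pi) t = linepath (a + pi) (a + 2 * pi) (2 * t - 1)"
      by (simp_all add: linepath_def algebra_simps)
    show "h t = (arc1 +++ arc2) t"
      unfolding h_def arc1_def arc2_def part_circlepath_def joinpaths_def using 1 2 by auto
  qed
  have PQ: "P \<noteq> Q" using nu by (auto simp: P_def Q_def r_def)
  define H1 where "H1 = cball c r \<inter> {z. inner u z \<le> inner u c}"
  define H2 where "H2 = cball c r \<inter> {z. inner u z \<ge> inner u c}"
  have convH: "convex H1" "convex H2" unfolding H1_def H2_def
    by (intro convex_Int convex_cball convex_halfspace_le convex_halfspace_ge)+
  have circ: "c + of_real r * cis t \<in> sphere c r" for t by (simp add: r_def dist_norm norm_mult)
  have inn: "inner u (c + of_real r * cis t) = inner u c + r * cos (t - Arg x)" for t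
    by (simp add: u_def inner_complex_def cos_diff algebra_simps)
  have im1: "path_image arc1 \<subseteq> H1 \<inter> sphere c r"
  proof
    fix z assume "z \<in> path_image arc1"
    then obtain t where t: "t \<in> {a..a+pi}" "z = c + of_real r * cis t"
      unfolding arc1_def path_image_part_circlepath[of a "a + pi" c r, simplified] by (auto simp: cisE)
    have "cos (t - Arg x) = - sin (t - a)" by (simp add: a_def cos_sin_eq[of "t - Arg x"] algebra_simps sin_minus[symmetric])
    also have "\<dots> \<le> 0" using t by (simp add: sin_ge_zero)
    finally have "inner u z \<le> inner u c" unfolding t inn by (simp add: r_def)
    then show "z \<in> H1 \<inter> sphere c r" using circ[of t] by (simp add: t H1_def)
  qed
  have im2: "path_image arc2 \<subseteq> H2 \<inter> sphere c r"
  proof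
    fix z assume "z \<in> path_image arc2"
    then obtain t where t: "t \<in> {a+pi..a+2*pi}" "z = c + of_real r * cis t"
      unfolding arc2_def path_image_part_circlepath[of "a + pi" "a + 2 * pi" c r, simplified] by (auto simp: cisE)
    have "sin (y + pi / 2 - 2 * pi) = cos y" for y
      unfolding sin_diff[of "y + pi / 2" "2 * pi"] sin_add[of y "pi / 2"] by simp
    moreover have "t - a - pi = (t - Arg x) + pi / 2 - 2 * pi" by (simp add: a_def)
    ultimately have "cos (t - Arg x) = sin (t - a - pi)" by metis
    also have "\<dots> \<ge> 0" using t by (intro sin_ge_zero) auto
    finally have "inner u z \<ge> inner u c" unfolding t inn by (simp add: r_def)
    then show "z \<in> H2 \<inter> sphere c r" using circ[of t] by (simp add: t H2_def)
  qed
  have chord: "z \<in> closed_segment Q P \<longleftrightarrow> (\<exists>v. 0 \<le> v \<and> v \<le> 1 \<and> z = c + of_real (2 * v - 1) * of_real r * cis a)" for z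
    unfolding closed_segment_def P_def Q_def by (auto simp: scaleR_conv_of_real algebra_simps)
  have iml: "path_image l \<subseteq> H1 \<inter> H2"
  proof
    fix z assume "z \<in> path_image l"
    then obtain v where v: "0 \<le> v" "v \<le> 1" "z = c + of_real (2 * v - 1) * of_real r * cis a" using chord by (auto simp: l_def)
    have "inner u (z - c) = 0" unfolding v ca by (simp add: inner_complex_def algebra_simps)
    then have "inner u z = inner u c" by (simp add: inner_diff_right)
    moreover have "\<bar>2 * v - 1\<bar> \<le> 1" using v by auto
    then have "norm (z - c) \<le> r" unfolding v using nu by (simp add: norm_mult ca r_def del: of_real_diff of_real_mult)
    ultimately show "z \<in> H1 \<inter> H2" by (auto simp: H1_def H2_def dist_norm norm_minus_commute)
  qed
  have sph: "path_image l \<inter> sphere c r \<subseteq> {P, Q}"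
  proof
    fix z assume "z \<in> path_image l \<inter> sphere c r"
    then have z: "z \<in> closed_segment Q P" "norm (z - c) = r" by (simp_all add: l_def dist_norm norm_minus_commute)
    then obtain v where v: "0 \<le> v" "v \<le> 1" "z = c + of_real (2 * v - 1) * of_real r * cis a" "norm (z - c) = r"
      using chord by blast
    have "\<bar>2 * v - 1\<bar> = 1" using v(4) unfolding v using nu by (simp add: norm_mult ca r_def del: of_real_diff of_real_mult)
    then have "v = 0 \<or> v = 1" by auto
    then show "z \<in> {P, Q}" unfolding v by (auto simp: P_def Q_def)
  qed
  have nx: "norm (0 - c) < r" "norm (x - c) < r" "norm (1 - c) > r"
  proof -
    show "norm (0 - c) < r" "norm (x - c) < r" using x by (simp_all add: c_def r_def norm_divide)
    have "norm (1::complex) \<le> norm (1 - c) + norm c" by (metis diff_add_cancel norm_triangle_ineq)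
    then show "norm (1 - c) > r" using x by (simp add: c_def r_def norm_divide)
  qed
  have iu: "inner u x = norm x" "inner u c = norm x / 2"
  proof -
    have "inner u x = norm x * inner u u" by (subst xu) (simp add: inner_complex_def algebra_simps)
    also have "inner u u = 1" using nu by (simp add: norm_eq_1)
    finally show "inner u x = norm x" by simp
    then show "inner u c = norm x / 2" by (simp add: c_def inner_complex_def)
  qed
  have npos: "0 < norm x" using x by simp
  have nH1: "x \<notin> H1"
  proof
    assume "x \<in> H1"
    then have "inner u x \<le> inner u c" by (simp add: H1_def)
    then show False unfolding iu using npos by linarith
  qed
  have nH2: "0 \<notin> H2"
  proof
    assume "0 \<in> H2"
    then have "inner u c \<le> inner u 0" by (simp add: H2_def)
    then show False unfolding iu inner_zero_right using npos by linarith
  qed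
  have n1: "1 \<notin> H1" "1 \<notin> H2" using nx(3) by (auto simp: H1_def H2_def dist_norm norm_minus_commute)
  have nl: "0 \<notin> path_image l" "x \<notin> path_image l" using iml nH1 nH2 by auto
  have paths: "path arc1" "path arc2" "path l" by (simp_all add: arc1_def arc2_def l_def)
  have nsph: "z \<notin> path_image arc1" "z \<notin> path_image arc2" if "z \<in> {0, x, 1}" for z
    using im1 im2 nx that by (auto simp: dist_norm norm_minus_commute subset_iff)
  have n1l: "1 \<notin> path_image l" using iml n1 by auto
  have sub: "path_image arc1 \<subseteq> - {0,x,1}" "path_image arc2 \<subseteq> - {0,x,1}" "path_image l \<subseteq> - {0,x,1}"
    using nsph nl n1l by auto
  let ?l' = "reversepath l"
  define g0 gx where "g0 = arc1 +++ l" and "gx = ?l' +++ arc2"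
  have le: "pathstart l = Q" "pathfinish l = P" by (simp_all add: l_def)
  have arcs: "arc arc1" "arc arc2" "arc l" "arc ?l'"
    using PQ by (auto simp: arc1_def arc2_def l_def r_def arc_part_circlepath arc_reversepath intro!: arc_linepath)
  have s0: "simple_path g0" unfolding g0_def
    using sph im1 ends le by (intro simple_path_join_loop arcs) auto
  have sx: "simple_path gx" unfolding gx_def
    using sph im2 ends le by (intro simple_path_join_loop arcs) auto
  have cl: "pathfinish g0 = pathstart g0" "pathfinish gx = pathstart gx" "pathstart g0 = P" "pathstart gx = P"
    using ends le by (simp_all add: g0_def gx_def)
  have i0: "path_image g0 \<subseteq> H1" "path_image gx \<subseteq> H2"
    using im1 im2 iml ends le by (auto simp: g0_def gx_def path_image_join)
  have out0: "- H1 \<subseteq> outside (path_image g0)" and outx: "- H2 \<subseteq> outside (path_image gx)"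
    by (intro outside_subset_convex convH i0)+
  \<comment> \<open>The contributions of the diameter cancel. As \<open>0\<close> is outside
    \<open>gx\<close> and \<open>x\<close> is outside \<open>g0\<close>, each half loop then
    inherits the winding number 1 of the circle about its own point.\<close>
  have wn_split: "winding_number g0 z + winding_number gx z = winding_number h z" if z: "z \<in> {0, x}" for z
  proof -
    have "winding_number g0 z = winding_number arc1 z + winding_number l z"
      unfolding g0_def using z nsph[of z] nl by (intro winding_number_join paths) (auto simp: ends le)
    moreover have "winding_number gx z = winding_number ?l' z + winding_number arc2 z"
      unfolding gx_def using z nsph[of z] nl paths by (intro winding_number_join) (auto simp: ends le)
    moreover have "winding_number ?l' z = - winding_number l z"
      using z nl paths by (intro winding_number_reversepath) auto
    moreover have "winding_number h z = winding_number arc1 z + winding_number arc2 z"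
      unfolding h_eq using z nsph[of z] by (intro winding_number_join paths) (auto simp: ends le)
    ultimately show ?thesis by simp
  qed
  have wh: "winding_number h z = 1" "z \<in> inside (path_image h)" if "norm (z - c) < r" for z
    using winding_number_full_circle[OF that] by (auto simp: h_def)
  have sh: "simple_path h" "pathfinish h = pathstart h" "pathstart h = P"
  proof -
    show "simple_path h" "pathfinish h = pathstart h"
      unfolding h_def by (rule winding_number_full_circle[OF nx(1)])+
    show "pathstart h = P" by (simp add: h_eq ends)
  qed
  have w0: "winding_number g0 0 = 1"
    using wn_split[of 0] wh(1)[OF nx(1)] winding_number_zero_in_outside[of gx 0] outx nH2 cl sx
    by (auto simp: simple_path_imp_path)
  have wx: "winding_number gx x = 1"
    using wn_split[of x] wh(1)[OF nx(2)] winding_number_zero_in_outside[of g0 x] out0 nH1 cl s0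
    by (auto simp: simple_path_imp_path)
  have ins: "z \<in> inside (path_image g)" if "path g" "pathfinish g = pathstart g" "winding_number g z = 1" "z \<notin> path_image g" for g z
    using that winding_number_zero_in_outside[OF that(1,2)] inside_Un_outside[of "path_image g"] by fastforce
  have 0: "0 \<in> inside (path_image g0)"
    using s0 cl w0 nsph[of 0] nl by (intro ins) (auto simp: simple_path_imp_path g0_def path_image_join ends le)
  have X: "x \<in> inside (path_image gx)"
    using sx cl wx nsph[of x] nl by (intro ins) (auto simp: simple_path_imp_path gx_def path_image_join ends le)
  have seg: "norm (z - c) < r" if "z \<in> closed_segment 0 x" for z
  proof -
    have "closed_segment 0 x \<subseteq> ball c r" using nx by (intro closed_segment_subset) (auto simp: dist_norm norm_minus_commute)
    then show ?thesis using that by (auto simp: dist_norm norm_minus_commute)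
  qed
  have "- cball c r \<subseteq> outside (path_image h)"
    using im1 im2 by (intro outside_subset_convex) (auto simp: h_eq path_image_join ends H1_def H2_def)
  then have out1: "1 \<in> outside (path_image h)" using nx(3) by (auto simp: dist_norm norm_minus_commute)
  have "homotopic_paths (- {0,x,1}) (g0 +++ gx) h"
  proof -
    let ?S = "- {0,x,1} :: complex set"
    have 1: "homotopic_paths ?S ((arc1 +++ l) +++ (?l' +++ arc2)) (arc1 +++ (l +++ (?l' +++ arc2)))"
      using homotopic_paths_assoc[of arc1 ?S l "?l' +++ arc2"] sub paths
      by (auto simp: ends le path_image_join intro: homotopic_paths_sym)
    have 2: "homotopic_paths ?S (l +++ (?l' +++ arc2)) ((l +++ ?l') +++ arc2)"
      using homotopic_paths_assoc[of l ?S ?l' arc2] sub paths by (auto simp: ends le)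
    have 3: "homotopic_paths ?S ((l +++ ?l') +++ arc2) (linepath Q Q +++ arc2)"
      using homotopic_paths_rinv[of l ?S] sub paths
      by (intro homotopic_paths_join) (auto simp: ends le)
    have 4: "homotopic_paths ?S (linepath Q Q +++ arc2) arc2"
      using homotopic_paths_lid[of arc2 ?S] sub paths by (simp add: ends)
    have "homotopic_paths ?S (l +++ (?l' +++ arc2)) arc2"
      using 2 3 4 by (blast intro: homotopic_paths_trans)
    then have "homotopic_paths ?S (arc1 +++ (l +++ (?l' +++ arc2))) (arc1 +++ arc2)"
      using sub paths by (intro homotopic_paths_join) (auto simp: ends le)
    with 1 show ?thesis unfolding g0_def gx_def h_eq by (blast intro: homotopic_paths_trans)
  qed
  moreover have "ccw_loop_around g0 {0} {x, 1}"
    unfolding ccw_loop_around_def using s0 cl 0 w0 out0 nH1 n1 by auto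
  moreover have "ccw_loop_around gx {x} {0, 1}"
    unfolding ccw_loop_around_def using sx cl X wx outx nH2 n1 by auto
  moreover have "ccw_loop_around h (closed_segment 0 x) {1}"
    unfolding ccw_loop_around_def using sh seg wh out1 by auto
  ultimately show ?thesis using cl sh by metis
qed

text \<open>Since every value equals the trace, it is enough to exhibit some value: for the loops
  just constructed and a local solution that is the identity at the base point.\<close>

theorem is_p0x_iff_trace:
  assumes x: "x \<noteq> 0" "norm x < 1" and h': "ccw_loop_around h' (closed_segment 0 x) {1}"
  shows "is_p0x A0 Ax A1 x p \<longleftrightarrow> p = trace (fuchsian_transp A0 Ax A1 x h')"
proof
  show "is_p0x A0 Ax A1 x p \<Longrightarrow> p = trace (fuchsian_transp A0 Ax A1 x h')"
    by (rule is_p0x_imp_trace[OF x(1) h'])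
next
  assume p: "p = trace (fuchsian_transp A0 Ax A1 x h')"
  let ?A = "fuchsian_coeff A0 Ax A1 x" and ?O = "- {0, x, 1} :: complex set"
  note H = matrix_holomorphic_fuchsian_coeff[of A0 Ax A1 x] open_punctures[of x]
  obtain g0 gx h where g: "ccw_loop_around g0 {0} {x, 1}" "ccw_loop_around gx {x} {0, 1}"
     "ccw_loop_around h (closed_segment 0 x) {1}" "pathstart gx = pathstart g0" "pathstart h = pathstart g0"
     "homotopic_paths (- {0, x, 1}) (g0 +++ gx) h"
    using p0x_loops_exist[OF x] by blast
  note i0 = ccw_loop_around_path_image[OF g(1)] and ix = ccw_loop_around_path_image[OF g(2)]
  have O: "path_image g0 \<subseteq> ?O" "path_image gx \<subseteq> ?O" using i0(2) ix(2) by auto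
  define b where "b = pathstart g0"
  have bO: "b \<in> ?O" using O(1) unfolding b_def by blast
  obtain \<rho> where \<rho>: "\<rho> > 0" "ball b \<rho> \<subseteq> ?O" "\<And>V0. \<exists>S. lin_sol ?A S (ball b \<rho>) \<and> S b = V0"
    using lin_sol_local_exists[OF H, of "{b}"] bO by auto
  obtain S where S: "lin_sol ?A S (ball b \<rho>)" "S b = mat 1" using \<rho>(3) by blast
  \<comment> \<open>Restricting to nonzero determinant makes the local solution a fundamental
    one.\<close>
  define U where "U = ball b \<rho> \<inter> (\<lambda>l. det (S l)) -` (- {0})"
  have opU: "open U" unfolding U_def
  proof (rule continuous_open_preimage)
    show "continuous_on (ball b \<rho>) (\<lambda>l. det (S l))"
      unfolding det_2 by (intro continuous_intros holomorphic_on_imp_continuous_on lin_sol_holomorphic[OF S(1)] open_ball)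
  qed auto
  have bU: "b \<in> U" using \<rho>(1) S(2) by (auto simp: U_def)
  have fs: "fundamental_solution_on A0 Ax A1 x S U"
    unfolding fundamental_solution_on_iff using opU \<rho>(2) lin_sol_subset[OF S(1), of U] by (auto simp: U_def)
  then have ls: "lin_sol ?A S U" by (simp add: fundamental_solution_on_iff)
  have "has_monodromy S g0 (transp ?A ?O g0)"
    by (rule transp_imp_monodromy[OF H i0(1) O(1) i0(3) ls opU]) (use bU S(2) in \<open>auto simp: b_def\<close>)
  moreover have "has_monodromy S gx (transp ?A ?O gx)"
    by (rule transp_imp_monodromy[OF H ix(1) O(2) ix(3) ls opU]) (use bU S(2) g(4) in \<open>auto simp: b_def\<close>)
  ultimately have *: "is_p0x A0 Ax A1 x (trace (transp ?A ?O g0 ** transp ?A ?O gx))"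
    unfolding is_p0x_def using g fs bU b_def by blast
  from is_p0x_imp_trace[OF x(1) h' this] p show "is_p0x A0 Ax A1 x p" using * by simp
qed

section \<open>Perturbation of the transport\<close>

lemma norm_mat2_le: "norm (X :: complex^2^2) \<le> norm (X$1$1) + norm (X$1$2) + norm (X$2$1) + norm (X$2$2)"
proof -
  have "norm X \<le> (\<Sum>i\<in>UNIV. norm (X $ i))" unfolding norm_vec_def by (rule L2_set_le_sum) auto
  moreover have "norm (X $ i) \<le> (\<Sum>j\<in>UNIV. norm (X $ i $ j))" for i
    unfolding norm_vec_def[of "X $ i"] by (rule L2_set_le_sum) auto
  from add_mono[OF this[of 1] this[of 2]] have "norm (X$1) + norm (X$2) \<le> norm (X$1$1) + norm (X$1$2) + norm (X$2$1) + norm (X$2$2)"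
    by (simp add: sum_2)
  ultimately show ?thesis by (simp add: sum_2)
qed

lemma bounded_linear_mat2_unit: "bounded_linear (\<lambda>c::complex. (\<chi> a b. if a = i \<and> b = j then c else 0) :: complex^2^2)"
  unfolding linear_conv_bounded_linear[symmetric] by (auto simp: linear_iff vec_eq_iff)

lemma has_vector_derivative_mat2I:
  fixes V :: "real \<Rightarrow> complex^2^2"
  assumes "\<And>i j. ((\<lambda>u. V u $ i $ j) has_vector_derivative M $ i $ j) F"
  shows "(V has_vector_derivative M) F"
proof -
  let ?E = "\<lambda>i j (c::complex). (\<chi> a b. if a = i \<and> b = j then c else 0) :: complex^2^2"
  have *: "X = (\<Sum>i\<in>UNIV. \<Sum>j\<in>UNIV. ?E i j (X $ i $ j))" for X
    unfolding vec_eq_iff forall_2 by (simp add: sum_2)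
  have "((\<lambda>u. \<Sum>i\<in>UNIV. \<Sum>j\<in>UNIV. ?E i j (V u $ i $ j)) has_vector_derivative
      (\<Sum>i\<in>UNIV. \<Sum>j\<in>UNIV. ?E i j (M $ i $ j))) F"
    by (intro has_vector_derivative_sum bounded_linear.has_vector_derivative[OF bounded_linear_mat2_unit] assms)
  then show ?thesis using * by simp
qed

lemma mat2_norm_mult_bound: "\<exists>K\<ge>1. \<forall>(X::complex^2^2) (Y::complex^2^2). norm (X ** Y) \<le> K * norm X * norm Y"
proof -
  obtain K where K: "\<And>(X::complex^2^2) (Y::complex^2^2). norm (X ** Y) \<le> norm X * norm Y * K"
    using bounded_bilinear.bounded[OF bounded_bilinear_mat2] by blast
  have "norm (X ** Y) \<le> max 1 K * norm X * norm Y" for X Y :: "complex^2^2"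
  proof -
    have "norm (X ** Y) \<le> (norm X * norm Y) * K" using K .
    also have "\<dots> \<le> (norm X * norm Y) * max 1 K" by (intro mult_left_mono) auto
    finally show ?thesis by (simp add: mult_ac)
  qed
  then show ?thesis by (intro exI[of _ "max 1 K"]) auto
qed

lemma mat2_norm_mult_mono:
  fixes X Y :: "complex^2^2"
  assumes "\<And>(X::complex^2^2) (Y::complex^2^2). norm (X ** Y) \<le> K * norm X * norm Y" "K \<ge> 1" "norm X \<le> a" "norm Y \<le> b"
  shows "norm (X ** Y) \<le> K * a * b"
proof -
  have "0 \<le> a" "0 \<le> b" using assms(3,4) norm_ge_zero order_trans by blast+
  then have "K * norm X * norm Y \<le> K * a * b" using assms(2-4) by (intro mult_mono) auto
  then show ?thesis using assms(1)[of X Y] by linarith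
qed

text \<open>The adjugate stands in for the inverse: it is linear in the matrix, hence easy to
  differentiate, and it inverts a solution of determinant 1.\<close>

definition adj2 :: "complex^2^2 \<Rightarrow> complex^2^2" where
  "adj2 X = (\<chi> i j. if i = 1 \<and> j = 1 then X$2$2 else if i = 2 \<and> j = 2 then X$1$1 else - X$i$j)"

lemma adj2_nth: "adj2 X $ 1 $ 1 = X$2$2" "adj2 X $ 2 $ 2 = X$1$1" "adj2 X $ 1 $ 2 = - X$1$2" "adj2 X $ 2 $ 1 = - X$2$1"
  by (simp_all add: adj2_def)

lemma adj2_mat_1: "adj2 (mat 1) = mat 1"
  by (simp add: vec_eq_iff forall_2 adj2_nth mat_def)

lemma adj2_mult: "adj2 X ** X = mat (det X)" "X ** adj2 X = mat (det X)" "adj2 (X ** Y) = adj2 Y ** adj2 X"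
  by (simp_all add: vec_eq_iff forall_2 mat2_mult_nth adj2_nth det_2 mat_def algebra_simps)

lemma trace_2: "trace (X :: complex^2^2) = X$1$1 + X$2$2"
  by (simp add: trace_def sum_2)

lemma adj2_traceless: "trace X = 0 \<Longrightarrow> adj2 X = - X"
  by (simp add: vec_eq_iff forall_2 adj2_nth trace_2 add_eq_0_iff)

lemma bounded_linear_adj2: "bounded_linear adj2"
  unfolding linear_conv_bounded_linear[symmetric] by (auto simp: linear_iff vec_eq_iff forall_2 adj2_nth)

lemma bounded_linear_trace2: "bounded_linear (trace :: complex^2^2 \<Rightarrow> complex)"
  unfolding linear_conv_bounded_linear[symmetric] by (auto simp: linear_iff trace_2 algebra_simps)

definition mat_ode :: "(real \<Rightarrow> complex^2^2) \<Rightarrow> (real \<Rightarrow> complex^2^2) \<Rightarrow> bool" where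
  "mat_ode D V \<longleftrightarrow> (\<forall>u\<in>{0..1}. (V has_vector_derivative D u ** V u) (at u within {0..1}))"

lemma mat_ode_continuous: "mat_ode D V \<Longrightarrow> continuous_on {0..1} V"
  unfolding mat_ode_def by (meson continuous_on_eq_continuous_within has_vector_derivative_continuous)

lemma mat_ode_bounded: 
  assumes "mat_ode D V"
  shows "\<exists>B\<ge>1. \<forall>u\<in>{0..1}. norm (V u) \<le> B \<and> norm (adj2 (V u)) \<le> B"
proof -
  have c: "continuous_on {0..1} V" using assms by (rule mat_ode_continuous)
  have "bounded (V ` {0..1})" "bounded ((\<lambda>u. adj2 (V u)) ` {0..1})"
    by (intro compact_imp_bounded compact_continuous_image c bounded_linear.continuous_on[OF bounded_linear_adj2] compact_Icc)+
  then obtain a b where "\<forall>u\<in>{0..1}. norm (V u) \<le> a" "\<forall>u\<in>{0..1}. norm (adj2 (V u)) \<le> b"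
    unfolding bounded_iff ball_simps by blast
  then show ?thesis by (intro exI[of _ "max 1 (max a b)"]) (auto simp: max.coboundedI1 max.coboundedI2 le_max_iff_disj)
qed

text \<open>Liouville's formula: the derivative of the determinant is \<open>trace (D u)\<close>
  times the determinant.\<close>

lemma mat_ode_det:
  assumes V: "mat_ode D V" and tr: "\<And>u. u \<in> {0..1} \<Longrightarrow> trace (D u) = 0" and u: "u \<in> {0..1}"
  shows "det (V u) = det (V 0)"
proof -
  have d: "((\<lambda>u. V u $ i $ j) has_vector_derivative (D u ** V u) $ i $ j) (at u within {0..1})" if "u \<in> {0..1}" for i j u
    using V that unfolding mat_ode_def
    by (intro bounded_linear.has_vector_derivative[OF bounded_linear_compose[OF bounded_linear_vec_nth bounded_linear_vec_nth], unfolded o_def]) auto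
  have "((\<lambda>u. det (V u)) has_vector_derivative 0) (at u within {0..1})" if u: "u \<in> {0..1}" for u
  proof -
    have "((\<lambda>u. V u $ 1 $ 1 * V u $ 2 $ 2 - V u $ 1 $ 2 * V u $ 2 $ 1) has_vector_derivative
      (V u $ 1 $ 1 * (D u ** V u) $ 2 $ 2 + (D u ** V u) $ 1 $ 1 * V u $ 2 $ 2
       - (V u $ 1 $ 2 * (D u ** V u) $ 2 $ 1 + (D u ** V u) $ 1 $ 2 * V u $ 2 $ 1))) (at u within {0..1})"
      by (intro has_vector_derivative_diff has_vector_derivative_mult d u)
    also have "(V u $ 1 $ 1 * (D u ** V u) $ 2 $ 2 + (D u ** V u) $ 1 $ 1 * V u $ 2 $ 2
       - (V u $ 1 $ 2 * (D u ** V u) $ 2 $ 1 + (D u ** V u) $ 1 $ 2 * V u $ 2 $ 1)) = trace (D u) * det (V u)"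
      by (simp add: mat2_mult_nth trace_2 det_2 algebra_simps)
    finally show ?thesis using tr[OF u] by (simp add: det_2)
  qed
  then obtain c where "\<And>u. u \<in> {0..1} \<Longrightarrow> det (V u) = c"
    using has_vector_derivative_zero_constant[of "{0..1::real}" "\<lambda>u. det (V u)"] by auto
  then show ?thesis using u by simp
qed

lemma vector_derivative_bound:
  fixes Q :: "real \<Rightarrow> complex^2^2"
  assumes "\<And>u. u \<in> {0..1} \<Longrightarrow> (Q has_vector_derivative Q' u) (at u within {0..1})"
    and "\<And>u. u \<in> {0..1} \<Longrightarrow> norm (Q' u) \<le> B" and u: "u \<in> {0..1}"
  shows "norm (Q u - Q 0) \<le> B"
proof -
  have B: "B \<ge> 0" using assms(2)[OF u] norm_ge_zero order_trans by blast
  have "norm (Q u - Q 0) \<le> B * norm (u - 0)"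
  proof (rule differentiable_bound[of "{0..1}" Q "\<lambda>u h. h *\<^sub>R Q' u"])
    show "(Q has_derivative (\<lambda>h. h *\<^sub>R Q' v)) (at v within {0..1})" if "v \<in> {0..1}" for v
      using assms(1)[OF that] by (simp add: has_vector_derivative_def)
    show "onorm (\<lambda>h. h *\<^sub>R Q' v) \<le> B" if "v \<in> {0..1}" for v
      using assms(2)[OF that] by (intro onorm_bound B) (metis abs_ge_zero mult.commute mult_right_mono norm_scaleR real_norm_def)
  qed (use u in auto)
  also have "\<dots> \<le> B * 1" using u B by (intro mult_left_mono) auto
  finally show ?thesis by simp
qed

text \<open>At the maximum of \<open>norm (Q u)\<close> the bound \<open>K * e \<le> 1/2\<close>
  gives at most \<open>2 * norm (Q 0)\<close>; inserting this into the estimate of the derivative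
  gives the claim.\<close>

lemma mat_ode_small:
  assumes Q: "mat_ode E Q" and K: "K \<ge> 1" "\<And>(X::complex^2^2) (Y::complex^2^2). norm (X ** Y) \<le> K * norm X * norm Y"
    and E: "\<And>u. u \<in> {0..1} \<Longrightarrow> norm (E u) \<le> e" and e: "K * e \<le> 1/2" and u: "u \<in> {0..1}"
  shows "norm (Q u - Q 0) \<le> 2 * K * e * norm (Q 0)"
proof -
  have e0: "e \<ge> 0" using E[OF u] norm_ge_zero order_trans by blast
  have "continuous_on {0..1} (\<lambda>u. norm (Q u))" using mat_ode_continuous[OF Q] by (intro continuous_intros)
  then obtain q where q: "q \<in> {0..1}" "\<And>u. u \<in> {0..1} \<Longrightarrow> norm (Q u) \<le> norm (Q q)"
    using continuous_attains_sup[of "{0..1::real}" "\<lambda>u. norm (Q u)"] by auto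
  have b: "norm (Q u - Q 0) \<le> K * e * norm (Q q)" if u: "u \<in> {0..1}" for u
  proof (rule vector_derivative_bound[OF _ _ u])
    show "(Q has_vector_derivative E u ** Q u) (at u within {0..1})" if "u \<in> {0..1}" for u
      using Q that by (simp add: mat_ode_def)
    show "norm (E u ** Q u) \<le> K * e * norm (Q q)" if "u \<in> {0..1}" for u
      using E[OF that] q(2)[OF that] by (intro mat2_norm_mult_mono[OF K(2,1)]) auto
  qed
  have "norm (Q q) \<le> norm (Q 0) + norm (Q q - Q 0)" by (metis add.commute diff_add_cancel norm_triangle_ineq)
  also have "\<dots> \<le> norm (Q 0) + (K * e) * norm (Q q)" using b[OF q(1)] by simp
  also have "(K * e) * norm (Q q) \<le> 1/2 * norm (Q q)" using e by (intro mult_right_mono) auto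
  finally have m: "norm (Q q) \<le> 2 * norm (Q 0)" by simp
  have "norm (Q u - Q 0) \<le> (K * e) * norm (Q q)" using b[OF u] .
  also have "\<dots> \<le> (K * e) * (2 * norm (Q 0))" using m K(1) e0 by (intro mult_left_mono) auto
  finally show ?thesis by simp
qed

text \<open>With \<open>adj2 V\<close> as the inverse of \<open>V\<close>, the function measures how
  far \<open>G\<close> is from carrying solutions for \<open>D'\<close> to solutions for
  \<open>D\<close>; its derivative vanishes when the compatibility equation
  \<open>G' + G ** D' = D ** G\<close> holds.\<close>

lemma gauge_derivative:
  assumes V: "mat_ode D V" and tr: "trace (D u) = 0" and W: "mat_ode D' W" and u: "u \<in> {0..1}"
    and G: "(G has_vector_derivative G') (at u within {0..1})"
  shows "((\<lambda>u. adj2 (V u) ** (G u ** W u)) has_vector_derivative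
     (adj2 (V u) ** ((G' + G u ** D' u - D u ** G u) ** W u))) (at u within {0..1})"
proof -
  note bb = bounded_bilinear.has_vector_derivative[OF bounded_bilinear_mat2]
  have 1: "((\<lambda>u. adj2 (V u)) has_vector_derivative adj2 (D u ** V u)) (at u within {0..1})"
    using V u by (intro bounded_linear.has_vector_derivative[OF bounded_linear_adj2]) (auto simp: mat_ode_def)
  have 2: "((\<lambda>u. G u ** W u) has_vector_derivative G u ** (D' u ** W u) + G' ** W u) (at u within {0..1})"
    using W u by (intro bb G) (auto simp: mat_ode_def)
  have "((\<lambda>u. adj2 (V u) ** (G u ** W u)) has_vector_derivative
     adj2 (V u) ** (G u ** (D' u ** W u) + G' ** W u) + adj2 (D u ** V u) ** (G u ** W u)) (at u within {0..1})"
    by (intro bb 1 2)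
  also have "adj2 (D u ** V u) = - (adj2 (V u) ** D u)"
    unfolding adj2_mult(3) adj2_traceless[OF tr]
    by (simp add: vec_eq_iff mat2_mult_nth)
  also have "adj2 (V u) ** (G u ** (D' u ** W u) + G' ** W u) + - (adj2 (V u) ** D u) ** (G u ** W u)
    = adj2 (V u) ** ((G' + G u ** D' u - D u ** G u) ** W u)"
    by (simp add: vec_eq_iff mat2_mult_nth algebra_simps)
  finally show ?thesis .
qed

text \<open>Variation of constants: \<open>Q = adj2 V ** W\<close> solves an equation whose
  coefficient is \<open>D' - D\<close> conjugated by \<open>V\<close>, hence small.\<close>

lemma mat_ode_perturb:
  assumes V: "mat_ode D V" "V 0 = mat 1" and tr: "\<And>u. u \<in> {0..1} \<Longrightarrow> trace (D u) = 0" and e: "e > 0"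
  shows "\<exists>\<delta>>0. \<forall>D' W. mat_ode D' W \<and> W 0 = mat 1 \<and> (\<forall>u\<in>{0..1}. norm (D' u - D u) \<le> \<delta>) \<longrightarrow>
     (\<forall>u\<in>{0..1}. norm (W u - V u) \<le> e)"
proof -
  obtain K where K: "K \<ge> 1" "\<And>(X::complex^2^2) (Y::complex^2^2). norm (X ** Y) \<le> K * norm X * norm Y" using mat2_norm_mult_bound by blast
  obtain B where B: "B \<ge> 1" "\<And>u. u \<in> {0..1} \<Longrightarrow> norm (V u) \<le> B \<and> norm (adj2 (V u)) \<le> B"
    using mat_ode_bounded[OF V(1)] by blast
  define N where "N = norm (mat 1 :: complex^2^2)"
  \<comment> \<open>A bound for the coefficient in the equation of \<open>Q\<close>: the first
    argument of the minimum meets the hypothesis of \<open>mat_ode_small\<close>, the second brings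
    \<open>V ** (Q - mat 1)\<close> below \<open>e\<close>.\<close>
  define \<kappa> where "\<kappa> = min (1 / (2 * K)) (e / (K * B * (2 * K * (N + 1))))"
  have N: "N \<ge> 0" by (simp add: N_def)
  have \<kappa>: "\<kappa> > 0" "K * \<kappa> \<le> 1/2" "K * B * (2 * K * \<kappa> * N) \<le> e"
  proof -
    show "\<kappa> > 0" using K(1) B(1) N e by (auto simp: \<kappa>_def intro!: divide_pos_pos mult_pos_pos)
    have "\<kappa> \<le> 1 / (2 * K)" by (simp add: \<kappa>_def)
    then show "K * \<kappa> \<le> 1/2" using K(1) by (simp add: field_simps)
    have "\<kappa> \<le> e / (K * B * (2 * K * (N + 1)))" by (simp add: \<kappa>_def)
    moreover have p: "K * B * (2 * K * (N + 1)) > 0" using K(1) B(1) N by (intro mult_pos_pos) auto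
    ultimately have "\<kappa> * (K * B * (2 * K * (N + 1))) \<le> e" by (simp add: pos_le_divide_eq)
    moreover have "K * B * (2 * K * \<kappa> * N) \<le> \<kappa> * (K * B * (2 * K * (N + 1)))"
      using K(1) B(1) N \<open>\<kappa> > 0\<close> by (simp add: algebra_simps)
    ultimately show "K * B * (2 * K * \<kappa> * N) \<le> e" by linarith
  qed
  \<comment> \<open>Multiplying by \<open>V\<close> and by its adjugate costs a factor
    \<open>K * B\<close> each.\<close>
  define \<delta> where "\<delta> = \<kappa> / (K * B * (K * B))"
  have \<delta>: "\<delta> > 0" using \<kappa> K(1) B(1) by (auto simp: \<delta>_def intro!: divide_pos_pos mult_pos_pos)
  show ?thesis
  proof (intro exI[of _ \<delta>] conjI allI impI ballI \<delta>)
    fix D' W and u :: real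
    assume h: "mat_ode D' W \<and> W 0 = mat 1 \<and> (\<forall>u\<in>{0..1}. norm (D' u - D u) \<le> \<delta>)" and u: "u \<in> {0..1}"
    have det: "det (V u) = 1" if "u \<in> {0..1}" for u
      using mat_ode_det[OF V(1) tr that] V(2) by simp
    define Q where "Q = (\<lambda>u. adj2 (V u) ** (mat 1 ** W u))"
    have W: "W u = V u ** Q u" if "u \<in> {0..1}" for u
      using adj2_mult(2)[of "V u"] det[OF that] by (simp add: Q_def matrix_mul_assoc)
    define E where "E = (\<lambda>u. adj2 (V u) ** ((D' u - D u) ** V u))"
    have Qode: "mat_ode E Q"
      unfolding mat_ode_def
    proof
      fix u :: real assume u: "u \<in> {0..1}"
      have "(Q has_vector_derivative (adj2 (V u) ** ((0 + mat 1 ** D' u - D u ** mat 1) ** W u))) (at u within {0..1})"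
        unfolding Q_def by (rule gauge_derivative[OF V(1) tr[OF u]]) (use h u in auto)
      then show "(Q has_vector_derivative E u ** Q u) (at u within {0..1})"
        using W[OF u] by (simp add: E_def matrix_mul_assoc)
    qed
    have Eb: "norm (E u) \<le> \<kappa>" if u: "u \<in> {0..1}" for u
    proof -
      have "norm ((D' u - D u) ** V u) \<le> K * \<delta> * B"
        using h u B(2)[OF u] by (intro mat2_norm_mult_mono[OF K(2,1)]) auto
      then have "norm (E u) \<le> K * B * (K * \<delta> * B)" unfolding E_def
        using mat2_norm_mult_mono[OF K(2,1)] B(2)[OF u] by blast
      also have "\<dots> = \<kappa>" using K(1) B(1) by (simp add: \<delta>_def)
      finally show ?thesis .
    qed
    have Q0: "Q 0 = mat 1" using h V(2) by (simp add: Q_def adj2_mat_1)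
    have "norm (Q u - mat 1) \<le> 2 * K * \<kappa> * N"
      using mat_ode_small[OF Qode K Eb \<kappa>(2) u] Q0 by (simp add: N_def)
    moreover have "W u - V u = V u ** (Q u - mat 1)" using W[OF u] by (simp add: vec_eq_iff mat2_mult_nth mat_def algebra_simps forall_2)
    ultimately have "norm (W u - V u) \<le> K * B * (2 * K * \<kappa> * N)"
      using B(2)[OF u] by (simp add: mat2_norm_mult_mono[OF K(2,1)])
    then show "norm (W u - V u) \<le> e" using \<kappa>(3) by linarith
  qed
qed

text \<open>Along a differentiable path continuation becomes a linear equation in the real
  parameter, to which the perturbation bounds apply.\<close>

lemma lift_mat_ode:
  assumes V: "lift_on A \<Omega> g 0 1 V"
    and g: "\<And>u. u \<in> {0..1} \<Longrightarrow> (g has_vector_derivative g' u) (at u within {0..1})"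
  shows "mat_ode (\<lambda>u. \<chi> i j. g' u * A (g u) $ i $ j) V"
  unfolding mat_ode_def
proof (intro ballI has_vector_derivative_mat2I)
  fix t :: real and i j assume t: "t \<in> {0..1}"
  obtain S r d where S: "0 < r" "0 < d" "ball (g t) r \<subseteq> \<Omega>" "lin_sol A S (ball (g t) r)"
    "\<And>u. u \<in> {0..1} \<Longrightarrow> \<bar>u - t\<bar> < d \<Longrightarrow> g u \<in> ball (g t) r \<and> V u = S (g u)"
    by (rule lift_onE[OF V t]) blast
  have Vt: "V t = S (g t)" using S(5)[OF t] S(2) by simp
  have "((\<lambda>l. S l $ i $ j) has_field_derivative (A (g t) ** S (g t)) $ i $ j) (at (g t) within g ` {0..1})"
    using S(1,4) by (auto simp: lin_sol_def intro: has_field_derivative_at_within)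
  from field_vector_diff_chain_within[OF g[OF t] this]
  have "((\<lambda>u. S (g u) $ i $ j) has_vector_derivative g' t * (A (g t) ** S (g t)) $ i $ j) (at t within {0..1})"
    by (simp add: o_def)
  then have "((\<lambda>u. V u $ i $ j) has_vector_derivative g' t * (A (g t) ** S (g t)) $ i $ j) (at t within {0..1})"
    by (rule has_vector_derivative_transform_within[OF _ S(2) t]) (use S(5) in \<open>auto simp: dist_real_def\<close>)
  moreover have "g' t * (A (g t) ** S (g t)) $ i $ j = ((\<chi> i j. g' t * A (g t) $ i $ j) ** V t) $ i $ j"
    by (simp add: mat2_mult_nth Vt algebra_simps)
  ultimately show "((\<lambda>u. V u $ i $ j) has_vector_derivative ((\<chi> i j. g' t * A (g t) $ i $ j) ** V t) $ i $ j) (at t within {0..1})"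
    by simp
qed

text \<open>With a gauge factor \<open>G\<close> that solves the compatibility equation up to \<open>\<rho>\<close>, the traces of the
  two transports along a closed path differ by \<open>O(\<rho>)\<close>.\<close>

lemma gauge_trace_bound:
  assumes V: "mat_ode D V" "V 0 = mat 1" and tr: "\<And>u. u \<in> {0..1} \<Longrightarrow> trace (D u) = 0"
  shows "\<exists>c>0. \<exists>\<delta>>0. \<forall>D' W G G' \<rho>. mat_ode D' W \<and> W 0 = mat 1 \<and> (\<forall>u\<in>{0..1}. norm (D' u - D u) \<le> \<delta>) \<and>
     (\<forall>u\<in>{0..1}. (G has_vector_derivative G' u) (at u within {0..1}) \<and>
        norm (G' u + G u ** D' u - D u ** G u) \<le> \<rho>) \<and>
     G 1 = G 0 \<and> norm (G 0 - mat 1) \<le> \<delta>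
     \<longrightarrow> norm (trace (W 1) - trace (V 1)) \<le> c * \<rho>"
proof -
  obtain K where K: "K \<ge> 1" "\<And>(X::complex^2^2) (Y::complex^2^2). norm (X ** Y) \<le> K * norm X * norm Y" using mat2_norm_mult_bound by blast
  obtain B where B: "B \<ge> 1" "\<And>u. u \<in> {0..1} \<Longrightarrow> norm (V u) \<le> B \<and> norm (adj2 (V u)) \<le> B"
    using mat_ode_bounded[OF V(1)] by blast
  have "\<exists>\<delta>>0. \<forall>D' W. mat_ode D' W \<and> W 0 = mat 1 \<and> (\<forall>u\<in>{0..1}. norm (D' u - D u) \<le> \<delta>) \<longrightarrow>
     (\<forall>u\<in>{0..1}. norm (W u - V u) \<le> 1)"
    by (rule mat_ode_perturb[OF V tr]) auto
  then obtain \<delta>1 where \<delta>1: "\<delta>1 > 0" "\<And>D' W. mat_ode D' W \<Longrightarrow> W 0 = mat 1 \<Longrightarrow> \<forall>u\<in>{0..1}. norm (D' u - D u) \<le> \<delta>1 \<Longrightarrow>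
     \<forall>u\<in>{0..1}. norm (W u - V u) \<le> 1"
    by blast
  have det: "det (V 1) = 1" using mat_ode_det[OF V(1) tr, of 1] V(2) by simp
  obtain C where C: "C > 0" "\<And>X. norm (trace X) \<le> norm (X :: complex^2^2) * C"
    using bounded_linear.pos_bounded[OF bounded_linear_trace2] by blast
  obtain a where a: "a > 0" "\<And>X. norm (adj2 X) \<le> norm X * a"
    using bounded_linear.pos_bounded[OF bounded_linear_adj2] by blast
  have "isCont (\<lambda>X :: complex^2^2. det X) (mat 1)"
    unfolding det_2 by (intro continuous_intros)
  then obtain \<delta>2 where \<delta>2: "\<delta>2 > 0" "\<And>X :: complex^2^2. norm (X - mat 1) < \<delta>2 \<Longrightarrow> norm (det X - 1) < 1/2"
    unfolding continuous_at_eps_delta dist_norm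
    by (metis det_I half_gt_zero_iff zero_less_one)
  define \<delta> where "\<delta> = min \<delta>1 (min (\<delta>2 / 2) 1)"
  define N where "N = norm (mat 1 :: complex^2^2)"
  \<comment> \<open>The product of the bounds met below, from the outside in: the trace, the
    adjugate of \<open>G 0\<close>, the matrix \<open>V 1\<close>, and the increment of
    \<open>adj2 V ** (G ** W)\<close>. The leading 2 comes from
    \<open>norm (det (G 0)) \<ge> 1/2\<close>.\<close>
  define c where "c = 2 * (C * (K * ((N + 1) * a) * (K * B * (K * B * (K * (B + 1))))))"
  have N: "N \<ge> 0" by (simp add: N_def)
  have c: "c > 0" using C(1) K(1) a(1) B(1) N by (auto simp: c_def intro!: mult_pos_pos)
  have d: "\<delta> > 0" using \<delta>1 \<delta>2 by (auto simp: \<delta>_def)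
  show ?thesis
  proof (rule exI[of _ c], rule conjI[OF c], rule exI[of _ \<delta>], rule conjI[OF d], intro allI impI, elim conjE)
    fix D' W G G' \<rho>
    assume W: "mat_ode D' W" "W 0 = mat 1" and DD: "\<forall>u\<in>{0..1}. norm (D' u - D u) \<le> \<delta>"
      and G: "\<forall>u\<in>{0..1}. (G has_vector_derivative G' u) (at u within {0..1}) \<and>
        norm (G' u + G u ** D' u - D u ** G u) \<le> \<rho>" and G1: "G 1 = G 0" and G0: "norm (G 0 - mat 1) \<le> \<delta>"
    have \<rho>0: "\<rho> \<ge> 0" using G by (meson atLeastAtMost_iff norm_ge_zero order_trans zero_le_one order_refl)
    have WB: "norm (W u) \<le> B + 1" if u: "u \<in> {0..1}" for u
    proof -
      have "norm (W u - V u) \<le> 1" using \<delta>1(2)[OF W] DD u by (auto simp: \<delta>_def)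
      then show ?thesis using B(2)[OF u] norm_triangle_sub[of "W u" "V u"] by linarith
    qed
    let ?Q = "\<lambda>u. adj2 (V u) ** (G u ** W u)"
    let ?X = "?Q 1 - ?Q 0"
    have "norm ?X \<le> K * B * (K * \<rho> * (B + 1))"
    proof (rule vector_derivative_bound)
      fix u :: real assume u: "u \<in> {0..1}"
      show "(?Q has_vector_derivative (adj2 (V u) ** ((G' u + G u ** D' u - D u ** G u) ** W u))) (at u within {0..1})"
        by (rule gauge_derivative[OF V(1) tr[OF u] W(1) u]) (use G u in auto)
      have "norm ((G' u + G u ** D' u - D u ** G u) ** W u) \<le> K * \<rho> * (B + 1)"
        using G u WB[OF u] by (intro mat2_norm_mult_mono[OF K(2,1)]) auto
      then show "norm (adj2 (V u) ** ((G' u + G u ** D' u - D u ** G u) ** W u)) \<le> K * B * (K * \<rho> * (B + 1))"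
        using mat2_norm_mult_mono[OF K(2,1)] B(2)[OF u] by blast
    qed auto
    moreover have "?X = adj2 (V 1) ** (G 0 ** W 1) - G 0"
      using V(2) W(2) G1 by (simp add: adj2_mat_1)
    ultimately have X: "norm (adj2 (V 1) ** (G 0 ** W 1) - G 0) \<le> K * B * (K * \<rho> * (B + 1))" by simp
    let ?G = "G 0" and ?P = "V 1" and ?P' = "W 1"
    \<comment> \<open>Multiplied by \<open>V 1\<close> and then by the adjugate of
      \<open>G 0\<close>, the increment becomes a matrix with trace
      \<open>det (G 0) * (trace (W 1) - trace (V 1))\<close>, which isolates the difference of the
      traces.\<close>
    let ?Z = "adj2 ?G ** (?P ** (adj2 ?P ** (?G ** ?P') - ?G))"
    have GN: "norm (adj2 ?G) \<le> (N + 1) * a"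
    proof -
      have "norm ?G \<le> N + 1" using G0 norm_triangle_sub[of ?G "mat 1"] by (auto simp: \<delta>_def N_def)
      then have "norm ?G * a \<le> (N + 1) * a" using a(1) by (intro mult_right_mono) auto
      then show ?thesis using a(2)[of ?G] by linarith
    qed
    have "norm (?P ** (adj2 ?P ** (?G ** ?P') - ?G)) \<le> K * B * (K * B * (K * \<rho> * (B + 1)))"
      using X B(2)[of 1] by (intro mat2_norm_mult_mono[OF K(2,1)]) auto
    then have "norm ?Z \<le> K * ((N + 1) * a) * (K * B * (K * B * (K * \<rho> * (B + 1))))"
      using mat2_norm_mult_mono[OF K(2,1) GN] by blast
    then have Z: "norm (trace ?Z) \<le> (K * ((N + 1) * a) * (K * B * (K * B * (K * \<rho> * (B + 1))))) * C"
      using C by (intro order_trans[OF C(2)] mult_right_mono) auto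
    have "?Z = mat (det ?G) ** ?P' - adj2 ?G ** (?P ** ?G)"
    proof -
      have "?P ** (adj2 ?P ** (?G ** ?P')) = ?G ** ?P'"
        using adj2_mult(2)[of ?P] det by (simp add: matrix_mul_assoc)
      moreover have "?Z = adj2 ?G ** (?P ** (adj2 ?P ** (?G ** ?P'))) - adj2 ?G ** (?P ** ?G)"
        by (simp add: vec_eq_iff mat2_mult_nth algebra_simps)
      ultimately show ?thesis using adj2_mult(1)[of ?G] by (simp add: matrix_mul_assoc)
    qed
    moreover have "trace (mat (det ?G) ** ?P') = det ?G * trace ?P'"
      by (simp add: trace_2 mat2_mult_nth mat_def algebra_simps)
    moreover have "trace (adj2 ?G ** (?P ** ?G)) = det ?G * trace ?P"
    proof -
      have "trace (adj2 ?G ** (?P ** ?G)) = trace ((?P ** ?G) ** adj2 ?G)" by (rule trace_mul_sym)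
      also have "\<dots> = trace (?P ** mat (det ?G))" using adj2_mult(2)[of ?G] by (simp flip: matrix_mul_assoc)
      finally show ?thesis by (simp add: trace_2 mat2_mult_nth mat_def algebra_simps)
    qed
    ultimately have tz: "trace ?Z = det ?G * (trace ?P' - trace ?P)"
      by (simp only: trace_sub right_diff_distrib)
    have "norm (det ?G - 1) < 1/2" using \<delta>2(2)[of ?G] G0 \<delta>2(1) by (auto simp: \<delta>_def)
    then have "norm (det ?G) \<ge> 1/2" using norm_triangle_ineq2[of 1 "1 - det ?G"] by (simp add: norm_minus_commute)
    then have "1/2 * norm (trace ?P' - trace ?P) \<le> norm (trace ?Z)"
      unfolding tz norm_mult by (intro mult_right_mono) auto
    also note Z
    finally show "norm (trace ?P' - trace ?P) \<le> c * \<rho>" by (simp add: c_def algebra_simps)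
  qed
qed

section \<open>Isomonodromy\<close>

text \<open>Products of uniform limits call for bounded limits; on a compact set continuity supplies
  the bound, so the two properties travel together.\<close>

definition unif_cont_limit :: "'b::metric_space set \<Rightarrow> 'a filter \<Rightarrow> ('a \<Rightarrow> 'b \<Rightarrow> complex) \<Rightarrow> ('b \<Rightarrow> complex) \<Rightarrow> bool" where
  "unif_cont_limit S F f l \<longleftrightarrow> uniform_limit S f l F \<and> continuous_on S l"

lemma unif_cont_limit_add: "unif_cont_limit S F f l \<Longrightarrow> unif_cont_limit S F g m \<Longrightarrow> unif_cont_limit S F (\<lambda>a b. f a b + g a b) (\<lambda>b. l b + m b)"
  unfolding unif_cont_limit_def by (auto intro!: uniform_limit_add continuous_intros)

lemma unif_cont_limit_diff: "unif_cont_limit S F f l \<Longrightarrow> unif_cont_limit S F g m \<Longrightarrow> unif_cont_limit S F (\<lambda>a b. f a b - g a b) (\<lambda>b. l b - m b)"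
  unfolding unif_cont_limit_def by (auto intro!: uniform_limit_minus continuous_intros)

lemma unif_cont_limit_mult:
  assumes "compact S" "unif_cont_limit S F f l" "unif_cont_limit S F g m"
  shows "unif_cont_limit S F (\<lambda>a b. f a b * g a b) (\<lambda>b. l b * m b)"
proof -
  have "bounded (l ` S)" "bounded (m ` S)"
    using assms unfolding unif_cont_limit_def by (auto intro: compact_imp_bounded compact_continuous_image)
  then show ?thesis using assms unfolding unif_cont_limit_def
    by (auto intro!: uniform_lim_mult continuous_intros)
qed

lemma unif_cont_limit_fun: "continuous_on S f \<Longrightarrow> unif_cont_limit S F (\<lambda>a b. f b) f"
  unfolding unif_cont_limit_def by (auto intro: uniform_limit_const)

lemma unif_cont_limit_tendsto: "(f \<longlongrightarrow> c) F \<Longrightarrow> unif_cont_limit S F (\<lambda>a b. f a) (\<lambda>b. c)"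
  unfolding unif_cont_limit_def uniform_limit_iff tendsto_iff by auto

lemma unif_cont_limit_eventually:
  assumes "unif_cont_limit S F f l" "e > 0"
  shows "\<forall>\<^sub>F a in F. \<forall>b\<in>S. norm (f a b - l b) \<le> e"
proof -
  have "\<forall>\<^sub>F a in F. \<forall>b\<in>S. dist (f a b) (l b) < e"
    using assms unfolding unif_cont_limit_def uniform_limit_iff by blast
  then show ?thesis by eventually_elim (auto simp: dist_norm intro: less_imp_le)
qed

lemma unif_cont_limit_pole:
  fixes X :: "'a \<Rightarrow> complex"
  assumes X: "(X \<longlongrightarrow> x) F" and x: "norm x < r"
  shows "unif_cont_limit (sphere 0 r) F (\<lambda>a l. 1 / (l - X a)) (\<lambda>l. 1 / (l - x))"
  unfolding unif_cont_limit_def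
proof
  have b: "r - norm x \<le> norm (l - x)" if "l \<in> sphere 0 r" for l
    using that norm_triangle_ineq2[of l x] by simp
  have "uniform_limit (sphere 0 r) (\<lambda>a l. l - X a) (\<lambda>l. l - x) F"
    using unif_cont_limit_tendsto[OF X, of "sphere 0 r"]
    by (intro uniform_limit_minus uniform_limit_const) (simp add: unif_cont_limit_def)
  then have "uniform_limit (sphere 0 r) (\<lambda>a l. inverse (l - X a)) (inverse \<circ> (\<lambda>l. l - x)) F"
    by (rule uniform_lim_inverse[where b = "r - norm x"]) (use b x in auto)
  then show "uniform_limit (sphere 0 r) (\<lambda>a l. 1 / (l - X a)) (\<lambda>l. 1 / (l - x)) F"
    by (simp add: o_def inverse_eq_divide)
  show "continuous_on (sphere 0 r) (\<lambda>l. 1 / (l - x))"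
    using x by (intro continuous_intros) auto
qed

section \<open>The Schlesinger equations and the transport on a fixed circle\<close>

lemma commutator_nth: "commutator X Y $ i $ j = (X $ i $ 1 * Y $ 1 $ j - Y $ i $ 1 * X $ 1 $ j) + (X $ i $ 2 * Y $ 2 $ j - Y $ i $ 2 * X $ 2 $ j)"
  unfolding commutator_def vector_minus_component mat2_mult_nth by (rule add_diff_add)

lemma schlesinger_derivs:
  assumes sys: "schlesinger_system \<theta>0 \<theta>x \<theta>1 \<theta>inf A0 Ax A1 W" and op: "open W" and s: "s \<in> W" and x: "exp s \<noteq> 1"
  shows "((\<lambda>s. A0 s $ i $ j) has_field_derivative commutator (Ax s) (A0 s) $ i $ j) (at s)"
    and "((\<lambda>s. A1 s $ i $ j) has_field_derivative exp s / (1 - exp s) * commutator (A1 s) (Ax s) $ i $ j) (at s)"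
    and "((\<lambda>s. Ax s $ i $ j) has_field_derivative commutator (A0 s) (Ax s) $ i $ j + exp s / (exp s - 1) * commutator (A1 s) (Ax s) $ i $ j) (at s)"
proof -
  have d: "(f has_field_derivative exp s * x_deriv f s) (at s)" if "f holomorphic_on W" for f
    using holomorphic_derivI[OF that op s] by (simp add: x_deriv_def)
  have h: "(\<lambda>s. A0 s $ i $ j) holomorphic_on W" "(\<lambda>s. A1 s $ i $ j) holomorphic_on W" "(\<lambda>s. Ax s $ i $ j) holomorphic_on W"
    using sys by (auto simp: schlesinger_system_def matrix_holomorphic_on_def)
  have x_deriv: "x_deriv (\<lambda>s. A0 s $ i $ j) s = commutator (Ax s) (A0 s) $ i $ j / exp s"
    "x_deriv (\<lambda>s. A1 s $ i $ j) s = commutator (A1 s) (Ax s) $ i $ j / (1 - exp s)"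
    "x_deriv (\<lambda>s. Ax s $ i $ j) s = commutator (A0 s) (Ax s) $ i $ j / exp s + commutator (A1 s) (Ax s) $ i $ j / (exp s - 1)"
    using sys s by (auto simp: schlesinger_system_def)
  show "((\<lambda>s. A0 s $ i $ j) has_field_derivative commutator (Ax s) (A0 s) $ i $ j) (at s)"
    using d[OF h(1)] unfolding x_deriv by simp
  show "((\<lambda>s. A1 s $ i $ j) has_field_derivative exp s / (1 - exp s) * commutator (A1 s) (Ax s) $ i $ j) (at s)"
    using d[OF h(2)] unfolding x_deriv by simp
  show "((\<lambda>s. Ax s $ i $ j) has_field_derivative commutator (A0 s) (Ax s) $ i $ j + exp s / (exp s - 1) * commutator (A1 s) (Ax s) $ i $ j) (at s)"
    using d[OF h(3)] unfolding x_deriv by (simp add: algebra_simps)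
qed

text \<open>A circle about \<open>0\<close> with radius below 1 is an admissible loop for every
  \<open>x\<close> inside it, so the loop can stay fixed while \<open>x\<close> moves. The end is
  written \<open>0 + 2 * pi\<close> to be an instance of
  \<open>winding_number_full_circle\<close>.\<close>

definition circ :: "real \<Rightarrow> real \<Rightarrow> complex" where
  "circ r = part_circlepath 0 r 0 (0 + 2 * pi)"

lemma circ_eq: "circ r u = of_real r * exp (2 * of_real pi * \<i> * of_real u)"
  by (simp add: circ_def part_circlepath_def linepath_def mult_ac)

lemma circ_sphere: "r \<ge> 0 \<Longrightarrow> circ r u \<in> sphere 0 r"
  by (simp add: circ_eq norm_mult)

lemma circ_deriv: "(circ r has_vector_derivative 2 * of_real pi * \<i> * circ r u) (at u within S)"
proof -
  have "((\<lambda>z. of_real r * exp (2 * of_real pi * \<i> * z)) has_field_derivative 2 * of_real pi * \<i> * circ r u) (at (of_real u))"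
    by (auto intro!: derivative_eq_intros simp: circ_eq)
  from has_vector_derivative_real_field[OF this]
  have "((\<lambda>u. of_real r * exp (2 * of_real pi * \<i> * of_real u)) has_vector_derivative 2 * of_real pi * \<i> * circ r u) (at u)"
    by (simp add: o_def)
  moreover have "(\<lambda>u. of_real r * exp (2 * of_real pi * \<i> * of_real u)) = circ r"
    by (rule ext) (simp only: circ_eq)
  ultimately show ?thesis by (simp only: has_vector_derivative_at_within)
qed

definition circ_coeff :: "complex^2^2 \<Rightarrow> complex^2^2 \<Rightarrow> complex^2^2 \<Rightarrow> complex \<Rightarrow> real \<Rightarrow> real \<Rightarrow> complex^2^2" where
  "circ_coeff A0 Ax A1 x r u =
     (\<chi> i j. (2 * of_real pi * \<i> * circ r u) * fuchsian_coeff A0 Ax A1 x (circ r u) $ i $ j)"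

lemma circ_transport:
  assumes "norm x < r" "r < 1"
  obtains V where "mat_ode (circ_coeff A0 Ax A1 x r) V" "V 0 = mat 1" "V 1 = fuchsian_transp A0 Ax A1 x (circ r)"
proof -
  have r: "r > 0" using assms(1) by (meson norm_ge_zero order_le_less_trans)
  have p: "path (circ r)" "path_image (circ r) \<subseteq> - {0, x, 1}"
  proof -
    show "path (circ r)" by (simp add: circ_def)
    have "circ r u \<notin> {0, x, 1}" for u using circ_sphere[of r u] r assms by auto
    then show "path_image (circ r) \<subseteq> - {0, x, 1}" unfolding path_image_def image_subset_iff by blast
  qed
  obtain V where V: "lift_on (fuchsian_coeff A0 Ax A1 x) (- {0, x, 1}) (circ r) 0 1 V" "V 0 = mat 1"
    using lift_on_exists[OF matrix_holomorphic_fuchsian_coeff open_punctures p] by blast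
  have "mat_ode (circ_coeff A0 Ax A1 x r) V"
    unfolding circ_coeff_def[abs_def] by (rule lift_mat_ode[OF V(1) circ_deriv])
  moreover have "V 1 = fuchsian_transp A0 Ax A1 x (circ r)"
    using transp_lift[OF matrix_holomorphic_fuchsian_coeff open_punctures p V(1)] V(2) by simp
  ultimately show ?thesis using that V(2) by blast
qed

lemma circ_admissible:
  assumes "norm x < r" "r < 1"
  shows "ccw_loop_around (circ r) (closed_segment 0 x) {1}"
proof -
  have r: "r > 0" using assms(1) by (meson norm_ge_zero order_le_less_trans)
  have seg: "norm (z - 0) < r" if "z \<in> closed_segment 0 x" for z
  proof -
    have "closed_segment 0 x \<subseteq> ball 0 r" using assms r by (intro closed_segment_subset) auto
    then show ?thesis using that by auto
  qed
  have "path_image (circ r) \<subseteq> cball 0 r"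
  proof
    fix z assume "z \<in> path_image (circ r)"
    then obtain u where "z = circ r u" unfolding path_image_def by blast
    then show "z \<in> cball 0 r" using circ_sphere[of r u] r by simp
  qed
  then have "- cball 0 r \<subseteq> outside (path_image (circ r))" by (intro outside_subset_convex) auto
  then have "1 \<in> outside (path_image (circ r))" using assms(2) by (simp add: subset_iff)
  then show ?thesis unfolding ccw_loop_around_def
    using winding_number_full_circle[OF seg, of _ 0] winding_number_full_circle(3,4)[of 0 0 r 0] r
    unfolding circ_def[symmetric] by auto
qed

lemma trace_circ_coeff:
  assumes "trace A0 = 0" "trace Ax = 0" "trace A1 = 0"
  shows "trace (circ_coeff A0 Ax A1 x r u) = 0"
proof -
  have "A0$2$2 = - A0$1$1" "Ax$2$2 = - Ax$1$1" "A1$2$2 = - A1$1$1"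
    using assms by (simp_all add: trace_2 add_eq_0_iff)
  then show ?thesis by (simp add: circ_coeff_def fuchsian_coeff_def trace_2 flip: distrib_left)
qed

text \<open>The zero-curvature expression of the Schlesinger system, with \<open>a\<close>,
  \<open>p\<close>, \<open>q\<close> for \<open>1/l\<close>, \<open>1/(l - x)\<close>,
  \<open>1/(l - 1)\<close> and \<open>k\<close> for \<open>x/(x - 1)\<close>. On the right it is
  grouped into multiples of two partial fraction relations, which vanish for these values.\<close>

lemma zero_curvature_identity:
  fixes e1 :: complex
  assumes "k * (x - 1) = x"
  shows "(e1 * f1' - f1 * e1' + (e2 * f2' - f2 * e2')) * a
    + (f1 * e1' - e1 * f1' + (f2 * e2' - e2 * f2') + k * (g1 * e1' - e1 * g1' + (g2 * e2' - e2 * g2'))) * p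
    + n * x * (p * p) + - k * (g1 * e1' - e1 * g1' + (g2 * e2' - e2 * g2')) * q - x * n * (p * p)
    + x * p * (e1 * (f1' * a + e1' * p + g1' * q) - (f1 * a + e1 * p + g1 * q) * e1'
       + (e2 * (f2' * a + e2' * p + g2' * q) - (f2 * a + e2 * p + g2 * q) * e2'))
   = (e1 * f1' - f1 * e1' + (e2 * f2' - f2 * e2')) * (a - p + x * p * a)
    + k * (g1 * e1' - e1 * g1' + (g2 * e2' - e2 * g2')) * (p - q - (x - 1) * p * q)"
proof -
  have *: "k * b * (p - q - (x - 1) * p * q) = b * (k * p - k * q - (k * (x - 1)) * p * q)" for b by algebra
  show ?thesis unfolding * unfolding assms by algebra
qed

text \<open>The systems at \<open>s\<close> and at a nearby \<open>s'\<close> are compared through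
  the gauge factor \<open>1 + h / (l - x) * Ax\<close>, the first-order flow of the isomonodromic
  deformation. By the Schlesinger equations it satisfies the compatibility equation up to o(s' - s),
  uniformly on the circle, and \<open>gauge_trace_bound\<close> turns this into a vanishing
  derivative of the trace.\<close>

theorem isomonodromy_circ:
  assumes sys: "schlesinger_system \<theta>0 \<theta>x \<theta>1 \<theta>inf A0 Ax A1 W" and op: "open W"
    and r: "\<And>s. s \<in> W \<Longrightarrow> norm (exp s) < r" "r < 1" and s: "s \<in> W"
  shows "((\<lambda>s. trace (fuchsian_transp (A0 s) (Ax s) (A1 s) (exp s) (circ r))) has_field_derivative 0) (at s)"
proof -
  let ?m = "\<lambda>s. trace (fuchsian_transp (A0 s) (Ax s) (A1 s) (exp s) (circ r))"
  let ?D = "\<lambda>s. circ_coeff (A0 s) (Ax s) (A1 s) (exp s) r"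
  let ?C = "\<lambda>s. fuchsian_coeff (A0 s) (Ax s) (A1 s) (exp s)"
  let ?S = "sphere 0 r :: complex set"
  define x where "x = exp s"
  have r0: "r > 0" using r(1)[OF s] by (meson norm_ge_zero order_le_less_trans)
  have xr: "norm x < r" "x \<noteq> 0" "x \<noteq> 1"
  proof -
    show xr: "norm x < r" using r(1)[OF s] by (simp add: x_def)
    show "x \<noteq> 0" by (simp add: x_def)
    show "x \<noteq> 1" using xr r(2) by auto
  qed
  have evW: "\<forall>\<^sub>F s' in at s. s' \<in> W" using op s by (meson eventually_at_topological)
  have evne: "\<forall>\<^sub>F s' in at s. s' \<noteq> s" by (simp add: eventually_at_filter)
  note dA = schlesinger_derivs[OF sys op s xr(3)[unfolded x_def], folded x_def]
  note UL = unif_cont_limit_add unif_cont_limit_diff unif_cont_limit_mult[OF compact_sphere]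
  have lim: "(f \<longlongrightarrow> f s) (at s)" "((\<lambda>s'. (f s' - f s) / (s' - s)) \<longlongrightarrow> d) (at s)"
    if "(f has_field_derivative d) (at s)" for f :: "complex \<Rightarrow> complex" and d
    using DERIV_isCont[OF that] that by (auto simp: isCont_def DERIV_def has_field_derivative_iff)
  have expd: "(exp has_field_derivative x) (at s)" by (simp add: x_def)
  have l_ne: "l \<noteq> 0" "l - 1 \<noteq> 0" "l - x \<noteq> 0" if "l \<in> ?S" for l using that r(2) r0 xr by auto
  have cl: "continuous_on ?S (\<lambda>l. 1 / l)" "continuous_on ?S (\<lambda>l. 1 / (l - 1))"
    using l_ne by (auto intro!: continuous_intros)
  have pole: "unif_cont_limit ?S (at s) (\<lambda>s' l. 1 / (l - exp s')) (\<lambda>l. 1 / (l - x))"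
    by (intro unif_cont_limit_pole xr) (use lim(1)[OF expd] in \<open>simp add: x_def\<close>)
  have pole0: "continuous_on ?S (\<lambda>l. 1 / (l - x))" using pole by (simp add: unif_cont_limit_def)
  have C: "unif_cont_limit ?S (at s) (\<lambda>s' l. A0 s' $ i $ j * (1 / l) + Ax s' $ i $ j * (1 / (l - exp s')) + A1 s' $ i $ j * (1 / (l - 1)))
     (\<lambda>l. A0 s $ i $ j * (1 / l) + Ax s $ i $ j * (1 / (l - x)) + A1 s $ i $ j * (1 / (l - 1)))" for i j
    by (intro UL pole unif_cont_limit_fun[OF cl(1)] unif_cont_limit_fun[OF cl(2)]
        unif_cont_limit_tendsto lim(1)[OF dA(1)] lim(1)[OF dA(2)] lim(1)[OF dA(3)])
  have C_eq: "?C s' l $ i $ j = A0 s' $ i $ j * (1 / l) + Ax s' $ i $ j * (1 / (l - exp s')) + A1 s' $ i $ j * (1 / (l - 1))" for s' l i j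
    by (simp add: fuchsian_coeff_def)
  define h where "h = (\<lambda>s'. exp s' - x)"
  \<comment> \<open>An entry of the compatibility error of the gauge factor \<open>G\<close>, with
    the velocity of the circle divided out; the fact \<open>R\<close> below confirms this.\<close>
  define E where "E = (\<lambda>i j s' l. ?C s' l $ i $ j - ?C s l $ i $ j - h s' * Ax s $ i $ j * ((1 / (l - x)) * (1 / (l - x)))
     + h s' * (1 / (l - x)) * ((Ax s $ i $ 1 * ?C s' l $ 1 $ j - ?C s l $ i $ 1 * Ax s $ 1 $ j)
                              + (Ax s $ i $ 2 * ?C s' l $ 2 $ j - ?C s l $ i $ 2 * Ax s $ 2 $ j)))"
  have evE: "\<forall>\<^sub>F s' in at s. \<forall>l\<in>?S. norm (E i j s' l) \<le> e * norm (s' - s)" if e: "e > 0" for e i j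
  proof -
    let ?H = "\<lambda>s'. h s' / (s' - s)"
    let ?\<Delta> = "\<lambda>f s'. (f s' - f s) / (s' - s)"
    have hH: "(?H \<longlongrightarrow> x) (at s)" using lim(2)[OF expd] unfolding h_def x_def .
    \<comment> \<open>The uniform limit of \<open>E / (s' - s)\<close>: difference quotients are
      replaced by the Schlesinger derivatives and \<open>h / (s' - s)\<close> by \<open>x\<close>.
      It is zero by \<open>zero_curvature_identity\<close>.\<close>
    define L where "L = (\<lambda>l. commutator (Ax s) (A0 s) $ i $ j * (1 / l)
        + (commutator (A0 s) (Ax s) $ i $ j + x / (x - 1) * commutator (A1 s) (Ax s) $ i $ j) * (1 / (l - x))
        + Ax s $ i $ j * x * ((1 / (l - x)) * (1 / (l - x)))
        + (x / (1 - x) * commutator (A1 s) (Ax s) $ i $ j) * (1 / (l - 1))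
        - x * Ax s $ i $ j * ((1 / (l - x)) * (1 / (l - x)))
        + x * (1 / (l - x)) * ((Ax s $ i $ 1 * (A0 s $ 1 $ j * (1 / l) + Ax s $ 1 $ j * (1 / (l - x)) + A1 s $ 1 $ j * (1 / (l - 1))) - ?C s l $ i $ 1 * Ax s $ 1 $ j)
             + (Ax s $ i $ 2 * (A0 s $ 2 $ j * (1 / l) + Ax s $ 2 $ j * (1 / (l - x)) + A1 s $ 2 $ j * (1 / (l - 1))) - ?C s l $ i $ 2 * Ax s $ 2 $ j)))"
    have cC: "continuous_on ?S (\<lambda>l. ?C s l $ i $ j)" for i j
      using C[of i j] unfolding C_eq unif_cont_limit_def x_def by simp
    have "unif_cont_limit ?S (at s) (\<lambda>s' l. ?\<Delta> (\<lambda>s. A0 s $ i $ j) s' * (1 / l)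
        + ?\<Delta> (\<lambda>s. Ax s $ i $ j) s' * (1 / (l - exp s'))
        + Ax s $ i $ j * ?H s' * ((1 / (l - exp s')) * (1 / (l - x)))
        + ?\<Delta> (\<lambda>s. A1 s $ i $ j) s' * (1 / (l - 1))
        - ?H s' * Ax s $ i $ j * ((1 / (l - x)) * (1 / (l - x)))
        + ?H s' * (1 / (l - x)) * ((Ax s $ i $ 1 * (A0 s' $ 1 $ j * (1 / l) + Ax s' $ 1 $ j * (1 / (l - exp s')) + A1 s' $ 1 $ j * (1 / (l - 1))) - ?C s l $ i $ 1 * Ax s $ 1 $ j)
             + (Ax s $ i $ 2 * (A0 s' $ 2 $ j * (1 / l) + Ax s' $ 2 $ j * (1 / (l - exp s')) + A1 s' $ 2 $ j * (1 / (l - 1))) - ?C s l $ i $ 2 * Ax s $ 2 $ j))) L"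
      unfolding L_def
      by (intro UL pole C unif_cont_limit_fun[OF cl(1)] unif_cont_limit_fun[OF cl(2)] unif_cont_limit_fun[OF pole0]
          unif_cont_limit_fun[OF cC] unif_cont_limit_tendsto lim(2)[OF dA(1)] lim(2)[OF dA(2)] lim(2)[OF dA(3)]
          lim(1)[OF dA(1)] lim(1)[OF dA(2)] lim(1)[OF dA(3)] hH tendsto_const)
    from unif_cont_limit_eventually[OF this e]
    show ?thesis using evW evne
    proof eventually_elim
      case (elim s')
      show ?case
      proof
        fix l assume l: "l \<in> ?S"
        note ne = l_ne[OF l]
        have "norm (exp s') < r" using r(1)[OF elim(2)] .
        then have ne': "l - exp s' \<noteq> 0" using l by auto
        have "L l = 0"
        proof -
          let ?\<alpha> = "commutator (Ax s) (A0 s) $ i $ j" and ?\<beta> = "commutator (A1 s) (Ax s) $ i $ j"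
          define a p q k where "a = 1 / l" and "p = 1 / (l - x)" and "q = 1 / (l - 1)" and "k = x / (x - 1)"
          have x1: "x - 1 \<noteq> 0" "1 - x = - (x - 1)" using xr by auto
          have k: "k * (x - 1) = x" "x / (1 - x) = - k" "x / (x - 1) = k"
          proof -
            show "k * (x - 1) = x" "x / (x - 1) = k" using x1(1) by (simp_all add: k_def)
            show "x / (1 - x) = - k" unfolding k_def x1(2) by (rule minus_divide_right[symmetric])
          qed
          have "L l = ?\<alpha> * (1 / l - 1 / (l - x) + x * (1 / (l - x)) * (1 / l))
             + x / (x - 1) * ?\<beta> * (1 / (l - x) - 1 / (l - 1) - (x - 1) * (1 / (l - x)) * (1 / (l - 1)))"
            unfolding L_def C_eq unfolding commutator_nth x_def[symmetric] k(2,3) a_def[symmetric] p_def[symmetric] q_def[symmetric]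
            by (rule zero_curvature_identity[OF k(1)])
          moreover have "1 / l - 1 / (l - x) + x * (1 / (l - x)) * (1 / l) = 0" using ne by (simp add: field_simps)
          moreover have "1 / (l - x) - 1 / (l - 1) - (x - 1) * (1 / (l - x)) * (1 / (l - 1)) = 0" using ne by (simp add: divide_simps)
          ultimately show ?thesis by simp
        qed
        moreover have "E i j s' l / (s' - s) = ?\<Delta> (\<lambda>s. A0 s $ i $ j) s' * (1 / l)
        + ?\<Delta> (\<lambda>s. Ax s $ i $ j) s' * (1 / (l - exp s'))
        + Ax s $ i $ j * ?H s' * ((1 / (l - exp s')) * (1 / (l - x)))
        + ?\<Delta> (\<lambda>s. A1 s $ i $ j) s' * (1 / (l - 1))
        - ?H s' * Ax s $ i $ j * ((1 / (l - x)) * (1 / (l - x)))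
        + ?H s' * (1 / (l - x)) * ((Ax s $ i $ 1 * (A0 s' $ 1 $ j * (1 / l) + Ax s' $ 1 $ j * (1 / (l - exp s')) + A1 s' $ 1 $ j * (1 / (l - 1))) - ?C s l $ i $ 1 * Ax s $ 1 $ j)
             + (Ax s $ i $ 2 * (A0 s' $ 2 $ j * (1 / l) + Ax s' $ 2 $ j * (1 / (l - exp s')) + A1 s' $ 2 $ j * (1 / (l - 1))) - ?C s l $ i $ 2 * Ax s $ 2 $ j))"
        proof -
          have "1 / (l - exp s') - 1 / (l - x) = h s' * ((1 / (l - exp s')) * (1 / (l - x)))"
            using ne ne' by (simp add: h_def field_simps)
          then have "?C s' l $ i $ j - ?C s l $ i $ j = (A0 s' $ i $ j - A0 s $ i $ j) * (1 / l)
            + (Ax s' $ i $ j - Ax s $ i $ j) * (1 / (l - exp s')) + Ax s $ i $ j * (h s' * ((1 / (l - exp s')) * (1 / (l - x))))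
            + (A1 s' $ i $ j - A1 s $ i $ j) * (1 / (l - 1))"
          proof -
            assume *: "1 / (l - exp s') - 1 / (l - x) = h s' * ((1 / (l - exp s')) * (1 / (l - x)))"
            have "a0' * a + ax' * p' + a1' * q - (a0 * a + ax * p + a1 * q) = (a0' - a0) * a + (ax' - ax) * p' + ax * (p' - p) + (a1' - a1) * q"
              for a0' a ax' p' a1' q a0 ax p a1 :: complex by algebra
            then show ?thesis unfolding C_eq unfolding x_def[symmetric] *[symmetric] .
          qed
          note CC = this
          have "(d0 * a + dx * p' + n * (k * w) + d1 * q - k * n * v + k * p * T) / D
              = d0 / D * a + dx / D * p' + n * (k / D) * w + d1 / D * q - k / D * n * v + k / D * p * T"
            for d0 a dx p' n k w d1 q v p T D :: complex
            by (simp add: add_divide_distrib diff_divide_distrib)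
          then show ?thesis unfolding E_def CC unfolding C_eq[of s'] .
        qed
        ultimately have "norm (E i j s' l / (s' - s)) \<le> e" using elim(1) l by (metis diff_zero)
        then show "norm (E i j s' l) \<le> e * norm (s' - s)" using elim(3) by (simp add: norm_divide pos_divide_le_eq)
      qed
    qed
  qed
  have tr: "trace (A0 s) = 0" "trace (Ax s) = 0" "trace (A1 s) = 0" if "s \<in> W" for s
    using sys that by (auto simp: schlesinger_system_def)
  obtain V where V: "mat_ode (?D s) V" "V 0 = mat 1" "V 1 = fuchsian_transp (A0 s) (Ax s) (A1 s) x (circ r)"
    using circ_transport[OF xr(1) r(2)] by (metis x_def)
  obtain c \<delta> where c: "c > 0" "\<delta> > 0" "\<And>D' W G G' \<rho>. mat_ode D' W \<and> W 0 = mat 1 \<and> (\<forall>u\<in>{0..1}. norm (D' u - ?D s u) \<le> \<delta>) \<and>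
     (\<forall>u\<in>{0..1}. (G has_vector_derivative G' u) (at u within {0..1}) \<and>
        norm (G' u + G u ** D' u - ?D s u ** G u) \<le> \<rho>) \<and>
     G 1 = G 0 \<and> norm (G 0 - mat 1) \<le> \<delta>
     \<Longrightarrow> norm (trace (W 1) - trace (V 1)) \<le> c * \<rho>"
    using gauge_trace_bound[OF V(1,2) trace_circ_coeff[OF tr[OF s]]] by blast
  define w where "w = (\<lambda>u. 2 * of_real pi * \<i> * circ r u)"
  have w: "norm (w u) = 2 * pi * r" for u using circ_sphere[of r u] r0 by (simp add: w_def norm_mult)
  have D_nth: "?D s' u $ i $ j = w u * ?C s' (circ r u) $ i $ j" for s' u i j
    by (simp add: circ_coeff_def w_def)
  have cS: "circ r u \<in> ?S" for u using circ_sphere[of r u] r0 by simp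
  have evC: "\<forall>\<^sub>F s' in at s. \<forall>l\<in>?S. norm (?C s' l $ i $ j - ?C s l $ i $ j) \<le> e" if "e > 0" for e i j
    using unif_cont_limit_eventually[OF C that, of i j] unfolding C_eq x_def .
  define G where "G = (\<lambda>s' u. mat 1 + (\<chi> i j. h s' * (1 / (circ r u - x)) * Ax s $ i $ j) :: complex^2^2)"
  define G' where "G' = (\<lambda>s' u. (\<chi> i j. - (h s' * w u * ((1 / (circ r u - x)) * (1 / (circ r u - x))) * Ax s $ i $ j)) :: complex^2^2)"
  have Gd: "(G s' has_vector_derivative G' s' u) (at u within {0..1})" for s' u
  proof (rule has_vector_derivative_mat2I)
    fix i j :: 2
    have f: "((\<lambda>l. h s' * (1 / (l - x)) * Ax s $ i $ j) has_field_derivative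
       - (h s' * ((1 / (circ r u - x)) * (1 / (circ r u - x))) * Ax s $ i $ j)) (at (circ r u) within circ r ` {0..1})"
      using l_ne(3)[OF cS] by (auto intro!: derivative_eq_intros simp: power2_eq_square divide_simps)
    have "((\<lambda>l. h s' * (1 / (l - x)) * Ax s $ i $ j) \<circ> circ r has_vector_derivative
      w u * (- (h s' * ((1 / (circ r u - x)) * (1 / (circ r u - x))) * Ax s $ i $ j))) (at u within {0..1})"
      unfolding w_def by (rule field_vector_diff_chain_within[OF circ_deriv f])
    then have "((\<lambda>u. mat 1 $ i $ j + h s' * (1 / (circ r u - x)) * Ax s $ i $ j) has_vector_derivative
      0 + w u * (- (h s' * ((1 / (circ r u - x)) * (1 / (circ r u - x))) * Ax s $ i $ j))) (at u within {0..1})"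
      unfolding o_def by (intro has_vector_derivative_add has_vector_derivative_const)
    then show "((\<lambda>u. G s' u $ i $ j) has_vector_derivative G' s' u $ i $ j) (at u within {0..1})"
      by (simp add: G_def G'_def mult_ac)
  qed
  have R: "(G' s' u + G s' u ** ?D s' u - ?D s u ** G s' u) $ i $ j = w u * E i j s' (circ r u)" for s' u and i j :: 2
    unfolding E_def using exhaust_2[of i] exhaust_2[of j]
    by (auto simp: G_def G'_def mat2_mult_nth D_nth mat_def algebra_simps)
  have main: "\<forall>\<^sub>F s' in at s. norm ((?m s' - ?m s) / (s' - s)) \<le> c * (4 * (2 * pi * r * e))" if e: "e > 0" for e
  proof -
    have dpos: "\<delta> / (4 * (2 * pi * r)) > 0" using c r0 by simp
    have evh: "\<forall>\<^sub>F s' in at s. norm (G s' 0 - mat 1) \<le> \<delta>"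
    proof -
      have "((\<lambda>s'. norm (h s') * (norm (1 / (of_real r - x)) * (norm (Ax s$1$1) + norm (Ax s$1$2) + norm (Ax s$2$1) + norm (Ax s$2$2)))) \<longlongrightarrow> norm (x - x) * (norm (1 / (of_real r - x)) * (norm (Ax s$1$1) + norm (Ax s$1$2) + norm (Ax s$2$1) + norm (Ax s$2$2)))) (at s)"
        unfolding h_def using lim(1)[OF expd] by (intro tendsto_intros) (simp add: x_def)
      then have "\<forall>\<^sub>F s' in at s. norm (h s') * (norm (1 / (of_real r - x)) * (norm (Ax s$1$1) + norm (Ax s$1$2) + norm (Ax s$2$1) + norm (Ax s$2$2))) < \<delta>"
        using c(2) by (auto dest!: order_tendstoD(2)[of _ _ _ \<delta>])
      then show ?thesis
      proof eventually_elim
        case (elim s')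
        have "norm (G s' 0 - mat 1) \<le> norm (h s') * (norm (1 / (of_real r - x)) * (norm (Ax s$1$1) + norm (Ax s$1$2) + norm (Ax s$2$1) + norm (Ax s$2$2)))"
          by (rule order_trans[OF norm_mat2_le]) (simp add: G_def circ_eq norm_mult norm_divide algebra_simps add_divide_distrib)
        with elim show ?case by linarith
      qed
    qed
    have ev: "\<forall>\<^sub>F s' in at s. \<forall>i j. \<forall>l\<in>?S. norm (E i j s' l) \<le> e * norm (s' - s)"
      unfolding forall_2 by (intro eventually_conj evE e)
    have ev2: "\<forall>\<^sub>F s' in at s. \<forall>i j. \<forall>l\<in>?S. norm (?C s' l $ i $ j - ?C s l $ i $ j) \<le> \<delta> / (4 * (2 * pi * r))"
      unfolding forall_2 by (intro eventually_conj evC dpos)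
    from evh ev ev2 evW evne show ?thesis
    proof eventually_elim
      case (elim s')
      obtain Z where Z: "mat_ode (?D s') Z" "Z 0 = mat 1" "Z 1 = fuchsian_transp (A0 s') (Ax s') (A1 s') (exp s') (circ r)"
        using circ_transport[OF r(1)[OF elim(4)] r(2)] by metis
      have n4: "norm X \<le> 4 * b" if "\<And>i j. norm (X $ i $ j) \<le> b" for X :: "complex^2^2" and b
        using norm_mat2_le[of X] that[of 1 1] that[of 1 2] that[of 2 1] that[of 2 2] by linarith
      have "norm (trace (Z 1) - trace (V 1)) \<le> c * (4 * (2 * pi * r * (e * norm (s' - s))))"
      proof (rule c(3)[of "?D s'" Z "G s'" "G' s'"], intro conjI ballI)
        fix u :: real assume "u \<in> {0..1}"
        show "norm (?D s' u - ?D s u) \<le> \<delta>"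
        proof -
          have "norm ((?D s' u - ?D s u) $ i $ j) \<le> \<delta> / 4" for i j
          proof -
            have "norm ((?D s' u - ?D s u) $ i $ j) = 2 * pi * r * norm (?C s' (circ r u) $ i $ j - ?C s (circ r u) $ i $ j)"
              by (simp add: D_nth w norm_mult flip: right_diff_distrib)
            also have "\<dots> \<le> 2 * pi * r * (\<delta> / (4 * (2 * pi * r)))" using elim(3) cS r0 by (intro mult_left_mono) auto
            also have "\<dots> = \<delta> / 4" using r0 by simp
            finally show ?thesis .
          qed
          from n4[OF this] show ?thesis by simp
        qed
        show "(G s' has_vector_derivative G' s' u) (at u within {0..1})" by (rule Gd)
        show "norm (G' s' u + G s' u ** ?D s' u - ?D s u ** G s' u) \<le> 4 * (2 * pi * r * (e * norm (s' - s)))"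
        proof (rule n4)
          fix i j
          show "norm ((G' s' u + G s' u ** ?D s' u - ?D s u ** G s' u) $ i $ j) \<le> 2 * pi * r * (e * norm (s' - s))"
            unfolding R norm_mult w using elim(2) cS r0 by (intro mult_left_mono) auto
        qed
      next
        show "G s' 1 = G s' 0" by (simp add: G_def circ_eq)
      qed (use Z elim(1) in auto)
      then have "norm (?m s' - ?m s) \<le> c * (4 * (2 * pi * r * e)) * norm (s' - s)"
        unfolding Z(3) V(3) x_def by (simp add: mult_ac)
      then show ?case using elim(5) by (simp add: norm_divide pos_divide_le_eq)
    qed
  qed
  show ?thesis
    unfolding has_field_derivative_iff tendsto_iff
  proof (intro allI impI)
    fix e :: real assume e: "e > 0"
    define e' where "e' = e / (2 * (c * (4 * (2 * pi * r))))"
    have p: "c * (4 * (2 * pi * r)) > 0" using c r0 by simp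
    have e': "e' > 0" "c * (4 * (2 * pi * r * e')) < e"
    proof -
      show "e' > 0" using e p unfolding e'_def by (intro divide_pos_pos) auto
      have "c * (4 * (2 * pi * r * e')) = (c * (4 * (2 * pi * r))) * e'" by (simp add: mult_ac)
      also have "\<dots> = e / 2"
      proof -
        have "X * (e / (2 * X)) = e / 2" if "X > 0" for X :: real using that by simp
        from this[OF p] show ?thesis unfolding e'_def .
      qed
      finally show "c * (4 * (2 * pi * r * e')) < e" using e by simp
    qed
    show "\<forall>\<^sub>F s' in at s. dist ((?m s' - ?m s) / (s' - s)) 0 < e"
      using main[OF e'(1)] by eventually_elim (use e'(2) in simp)
  qed
qed

section \<open>Scalar identities for PVI and its residues\<close>

text \<open>Dictionary: \<open>z0\<close>, \<open>zx\<close>, \<open>z1\<close> are the entries 11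
  of the residues, \<open>v\<close> and \<open>u\<close> the entries 21 of \<open>A0\<close> and
  \<open>Ax\<close> times \<open>d / (x * (x - 1))\<close> with \<open>d\<close> the denominator of
  \<open>y\<close>, and \<open>P\<close>, \<open>Q\<close> the first two derivatives of
  \<open>y\<close>. The premise on \<open>Q\<close> is the derivative of the one on
  \<open>P\<close>. After clearing denominators a polynomial identity remains.\<close>

lemma PVI_of_scalar_identities:
  fixes x y z0 zx z1 u v K P Q :: complex
  assumes ne: "x \<noteq> 0" "x \<noteq> 1" "y \<noteq> 0" "y \<noteq> 1" "y \<noteq> x"
    and K: "K = -2 * (z0 + zx + z1)"
    and P: "x * (x - 1) * P = y * (x - 1) * (1 + 2 * zx) + 2 * z0 * (x - y) - (1 - K) * y * (x - y)"
    and z0d: "x * z0d = (y - x) * v - y * (x - 1) * u"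
    and z1d: "(1 - x) * z1d = (1 - y) * x * u + (y - x) * (v + u)"
    and zxd: "zxd = - z0d - z1d"
    and Q: "(2 * x - 1) * P + x * (x - 1) * Q =
       (P * (x - 1) + y) * (1 + 2 * zx) + 2 * y * (x - 1) * zxd + 2 * z0d * (x - y) + 2 * z0 * (1 - P)
       - (1 - K) * (P * (x - y) + y * (1 - P))"
    and par: "\<alpha> = (K - 1)^2 / 2" "\<beta> = -2 * (y * (x - 1) * v + z0^2)"
      "\<gamma> = 2 * ((y - 1) * x * (u + v) + z1^2)" "\<delta> = (1 - 4 * ((y - x) * u + zx^2)) / 2"
  shows "Q = PVI_rhs \<alpha> \<beta> \<gamma> \<delta> x y P"
proof -
  define F where "F = y * (x - 1) * (1 + 2 * zx) + 2 * z0 * (x - y) - (1 - K) * y * (x - y)"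
  have ne': "x - 1 \<noteq> 0" "y - 1 \<noteq> 0" "y - x \<noteq> 0" using ne by auto
  have PF: "x * (x - 1) * P = F" using P by (simp add: F_def)
  define Z0 Z1 where "Z0 = (y - x) * v - y * (x - 1) * u" and "Z1 = (1 - y) * x * u + (y - x) * (v + u)"
  have z0': "x * z0d = Z0" and z1': "(x - 1) * z1d = - Z1" using z0d z1d by (auto simp: Z0_def Z1_def algebra_simps)
  define R where "R = (F * (x - 1) + y * (x * (x - 1))) * (1 + 2 * zx) + 2 * y * (x - 1) * (x * Z1 - (x - 1) * Z0)
     + 2 * (x - 1) * Z0 * (x - y) + 2 * z0 * (x * (x - 1) - F)
     - (1 - K) * (F * (x - y) + y * (x * (x - 1) - F)) - (2 * x - 1) * F"
  have QR: "(x * (x - 1)) * (x * (x - 1) * Q) = R"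
  proof -
    have "x * (x - 1) * zxd = x * Z1 - (x - 1) * Z0"
    proof -
      have "x * (x - 1) * zxd = - (x - 1) * (x * z0d) - x * ((x - 1) * z1d)" unfolding zxd by algebra
      then show ?thesis unfolding z0' z1' by algebra
    qed
    note zx' = this
    have "(x * (x - 1)) * (x * (x - 1) * Q) =
       ((x * (x - 1) * P) * (x - 1) + y * (x * (x - 1))) * (1 + 2 * zx) + 2 * y * (x - 1) * (x * (x - 1) * zxd)
       + 2 * (x - 1) * (x * z0d) * (x - y) + 2 * z0 * (x * (x - 1) - x * (x - 1) * P)
       - (1 - K) * ((x * (x - 1) * P) * (x - y) + y * (x * (x - 1) - x * (x - 1) * P)) - (2 * x - 1) * (x * (x - 1) * P)"
      using Q by algebra
    then show ?thesis unfolding PF zx' z0' R_def .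
  qed
  let ?D = "2 * y * (y - 1) * (y - x)"
  define S where "S = F^2 * ((y-1)*(y-x) + y*(y-x) + y*(y-1))
     - 2 * y * (y - 1) * F * ((x-1)*(y-x) + x*(y-x) + x*(x-1))
     + ((K - 1)^2 * (y^2*(y-1)^2*(y-x)^2) - 4 * (y * (x - 1) * v + z0^2) * x * ((y-1)^2*(y-x)^2)
        + 4 * ((y - 1) * x * (u + v) + z1^2) * (x-1) * (y^2*(y-x)^2)
        + (1 - 4 * ((y - x) * u + zx^2)) * x * (x-1) * (y^2*(y-1)^2))"
  \<comment> \<open>Both sides are polynomials in \<open>x\<close>, \<open>y\<close>,
    \<open>u\<close>, \<open>v\<close> and the diagonal entries, since \<open>K\<close> is a
    combination of the latter and \<open>F\<close> is \<open>x * (x - 1) * P\<close>.\<close>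
  have main: "?D * R = S"
    unfolding R_def S_def F_def Z0_def Z1_def K by algebra
  have PVI: "?D * ((x * (x - 1))^2 * PVI_rhs \<alpha> \<beta> \<gamma> \<delta> x y P) = S"
  proof -
    have t1: "?D * ((x * (x - 1))^2 * (1/2 * (1/y + 1/(y - 1) + 1/(y - x)) * P^2))
       = (x * (x - 1) * P)^2 * ((y-1)*(y-x) + y*(y-x) + y*(y-1))"
      using ne ne' by (simp add: divide_simps) algebra
    have t2: "?D * ((x * (x - 1))^2 * ((1/x + 1/(x - 1) + 1/(y - x)) * P))
       = 2 * y * (y - 1) * (x * (x - 1) * P) * ((x-1)*(y-x) + x*(y-x) + x*(x-1))"
      using ne ne' by (simp add: divide_simps) algebra
    have t3: "?D * ((x * (x - 1))^2 * (y * (y - 1) * (y - x) / (x^2 * (x - 1)^2)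
       * (\<alpha> + \<beta> * (x / y^2) + \<gamma> * ((x - 1) / (y - 1)^2) + \<delta> * (x * (x - 1) / (y - x)^2))))
      = 2 * (\<alpha> * (y^2*(y-1)^2*(y-x)^2) + \<beta> * x * ((y-1)^2*(y-x)^2) + \<gamma> * (x-1) * (y^2*(y-x)^2) + \<delta> * x * (x-1) * (y^2*(y-1)^2))"
    proof -
      have m1: "(x * (x - 1))^2 * (y * (y - 1) * (y - x) / (x^2 * (x - 1)^2) * X) = y * (y - 1) * (y - x) * X" for X
        using ne ne' by (simp add: power_mult_distrib)
      have m2: "?D * (y * (y - 1) * (y - x) * (\<alpha> + \<beta> * (x / y^2) + \<gamma> * ((x - 1) / (y - 1)^2) + \<delta> * (x * (x - 1) / (y - x)^2)))
        = 2 * (\<alpha> * (y^2*(y-1)^2*(y-x)^2) + \<beta> * x * ((y-1)^2*(y-x)^2) + \<gamma> * (x-1) * (y^2*(y-x)^2) + \<delta> * x * (x-1) * (y^2*(y-1)^2))"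
      proof -
        define c where "c = y * (y - 1) * (y - x)"
        have c2: "c^2 = y^2*(y-1)^2*(y-x)^2" "c^2 / y^2 = (y-1)^2*(y-x)^2" "c^2 / (y-1)^2 = y^2*(y-x)^2" "c^2 / (y-x)^2 = y^2*(y-1)^2"
          using ne ne' by (simp_all add: c_def power_mult_distrib)
        have "2 * c * (c * (\<alpha> + \<beta> * (x / y^2) + \<gamma> * ((x - 1) / (y - 1)^2) + \<delta> * (x * (x - 1) / (y - x)^2)))
          = 2 * (\<alpha> * c^2 + \<beta> * x * (c^2 / y^2) + \<gamma> * (x-1) * (c^2 / (y-1)^2) + \<delta> * x * (x-1) * (c^2 / (y-x)^2))"
          by (simp add: distrib_left power2_eq_square mult_ac)
        then show ?thesis unfolding c2(2-4) unfolding c2(1) unfolding c_def by (simp only: mult.assoc)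
      qed
      show ?thesis unfolding m1 by (rule m2)
    qed
    have "?D * ((x * (x - 1))^2 * PVI_rhs \<alpha> \<beta> \<gamma> \<delta> x y P) =
      ?D * ((x * (x - 1))^2 * (1/2 * (1/y + 1/(y - 1) + 1/(y - x)) * P^2))
      - ?D * ((x * (x - 1))^2 * ((1/x + 1/(x - 1) + 1/(y - x)) * P))
      + ?D * ((x * (x - 1))^2 * (y * (y - 1) * (y - x) / (x^2 * (x - 1)^2)
       * (\<alpha> + \<beta> * (x / y^2) + \<gamma> * ((x - 1) / (y - 1)^2) + \<delta> * (x * (x - 1) / (y - x)^2))))"
      unfolding PVI_rhs_def by (simp only: distrib_left right_diff_distrib)
    also have "\<dots> = S"
    proof -
      have par': "(K - 1)^2 = 2 * \<alpha>" "4 * (y * (x - 1) * v + z0^2) = - 2 * \<beta>"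
        "4 * ((y - 1) * x * (u + v) + z1^2) = 2 * \<gamma>" "1 - 4 * ((y - x) * u + zx^2) = 2 * \<delta>"
        unfolding par by simp_all
      show ?thesis unfolding t1 t2 t3 unfolding PF S_def par' by algebra
    qed
    finally show ?thesis .
  qed
  have "?D * ((x * (x - 1))^2 * Q) = ?D * ((x * (x - 1))^2 * PVI_rhs \<alpha> \<beta> \<gamma> \<delta> x y P)"
    unfolding PVI main[symmetric] QR[symmetric] by algebra
  then show ?thesis using ne ne' by simp
qed

text \<open>The linear equation for the free parameter of the residues has the coefficient \<open>K\<close>.\<close>

lemma residues_unique:
  fixes x y d e K P :: complex
  assumes ne: "x \<noteq> 0" "x \<noteq> 1" "y \<noteq> 0" "y \<noteq> 1" "y \<noteq> x" "d \<noteq> 0" "e \<noteq> 0" "K \<noteq> 0"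
    and z: "z0 + zx + z1 = - K / 2" and w: "w0 + wx + w1 = - K / 2"
    and Pz: "x * (x - 1) * P = y * (x - 1) * (1 + 2 * zx) + 2 * z0 * (x - y) - (1 - K) * y * (x - y)"
    and Pw: "x * (x - 1) * P = y * (x - 1) * (1 + 2 * wx) + 2 * w0 * (x - y) - (1 - K) * y * (x - y)"
    and bz: "b0 + bx + b1 = 0" and bw: "c0 + cx + c1 = 0"
    and z0: "z0^2 + d * y / x * b0 = T0" and zx: "zx^2 + d * (y - x) / (x * (x - 1)) * bx = Tx"
    and z1: "z1^2 + d * (1 - y) / (x - 1) * b1 = T1"
    and w0: "w0^2 + e * y / x * c0 = T0" and wx: "wx^2 + e * (y - x) / (x * (x - 1)) * cx = Tx"
    and w1: "w1^2 + e * (1 - y) / (x - 1) * c1 = T1"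
  shows "w0 = z0 \<and> wx = zx \<and> w1 = z1 \<and> e * c0 = d * b0 \<and> e * cx = d * bx \<and> e * c1 = d * b1"
proof -
  have ne': "x - 1 \<noteq> 0" "y - 1 \<noteq> 0" "1 - y \<noteq> 0" "y - x \<noteq> 0" using ne by auto
  have lin: "y * (x - 1) * (wx - zx) = (y - x) * (w0 - z0)"
  proof -
    have "2 * (y * (x - 1) * (wx - zx) - (y - x) * (w0 - z0)) = 0" using Pz Pw by algebra
    then show ?thesis by simp
  qed
  \<comment> \<open>For given \<open>y\<close> and \<open>P\<close> the diagonal entries with the
    prescribed sum form a one-parameter family, and \<open>t\<close> is its parameter.\<close>
  define t where "t = (w0 - z0) / (y * (x - 1))"
  have t0: "w0 = z0 + t * (y * (x - 1))" using ne ne' by (simp add: t_def)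
  have tx: "wx = zx + t * (y - x)" using lin ne ne' by (simp add: t_def field_simps)
  have t1: "w1 = z1 - t * (y * (x - 1) + (y - x))" using z w t0 tx by algebra
  have e0: "y * (d * b0) = x * (T0 - z0^2)" using z0 ne by (simp add: field_simps)
  have ex: "(y - x) * (d * bx) = x * (x - 1) * (Tx - zx^2)"
    using zx[symmetric] ne ne' by simp
  have e1: "(1 - y) * (d * b1) = (x - 1) * (T1 - z1^2)"
    using z1[symmetric] ne ne' by simp
  have f0: "y * (e * c0) = x * (T0 - w0^2)" using w0 ne by (simp add: field_simps)
  have fx: "(y - x) * (e * cx) = x * (x - 1) * (Tx - wx^2)"
    using wx[symmetric] ne ne' by simp
  have f1: "(1 - y) * (e * c1) = (x - 1) * (T1 - w1^2)"
    using w1[symmetric] ne ne' by simp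
  have g0: "y * (e * c0 - d * b0) = y * (- x * (x - 1) * (2 * z0 * t + t^2 * (y * (x - 1))))"
    using e0 f0 unfolding t0 by algebra
  have gx: "(y - x) * (e * cx - d * bx) = (y - x) * (- x * (x - 1) * (2 * zx * t + t^2 * (y - x)))"
    using ex fx unfolding tx by algebra
  have g1: "(1 - y) * (e * c1 - d * b1) = (1 - y) * (- x * (x - 1) * (2 * z1 * t - t^2 * (y * (x - 1) + (y - x))))"
    using e1 f1 unfolding t1 by algebra
  have h0: "e * c0 - d * b0 = - x * (x - 1) * (2 * z0 * t + t^2 * (y * (x - 1)))" using g0 ne(3) by (metis mult_left_cancel)
  have hx: "e * cx - d * bx = - x * (x - 1) * (2 * zx * t + t^2 * (y - x))" using gx ne' by (metis mult_left_cancel)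
  have h1: "e * c1 - d * b1 = - x * (x - 1) * (2 * z1 * t - t^2 * (y * (x - 1) + (y - x)))" using g1 ne' by (metis mult_left_cancel)
  have "(e * c0 - d * b0) + (e * cx - d * bx) + (e * c1 - d * b1) = e * (c0 + cx + c1) - d * (b0 + bx + b1)" by algebra
  then have "(e * c0 - d * b0) + (e * cx - d * bx) + (e * c1 - d * b1) = 0" using bz bw by simp
  \<comment> \<open>Both triples of lower entries sum to zero. In the sum of the three relations the
    terms in \<open>t^2\<close> cancel, and the coefficient of \<open>t\<close> is a multiple of
    \<open>K\<close>.\<close>
  then have "- x * (x - 1) * (2 * t * (z0 + zx + z1)) = 0" unfolding h0 hx h1 by algebra
  then have "x * (x - 1) * (t * K) = 0" unfolding z by simp
  then have t: "t = 0" using ne ne' by simp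
  show ?thesis using t0 tx t1 h0 hx h1 unfolding t by simp
qed

section \<open>The trace in the limit $x \rightarrow 0$\<close>

text \<open>\<open>\<Lambda>\<close> squares to \<open>\<sigma>^2 / 4\<close>, so the exponential of
  \<open>2 * pi * \<i> * u * \<Lambda>\<close> is \<open>cos (pi * \<sigma> * u)\<close> times the
  identity plus \<open>2 * \<i> / \<sigma> * sin (pi * \<sigma> * u)\<close> times
  \<open>\<Lambda>\<close>; the second term has no trace.\<close>

lemma trace_const_ode:
  fixes \<Lambda> :: "complex^2^2" and \<sigma> :: complex
  assumes tr: "trace \<Lambda> = 0" and det: "det \<Lambda> = - (\<sigma>^2 / 4)" and \<sigma>: "\<sigma> \<noteq> 0"
  shows "\<exists>V. mat_ode (\<lambda>u. \<chi> i j. 2 * of_real pi * \<i> * \<Lambda> $ i $ j) V \<and> V 0 = mat 1 \<and> trace (V 1) = 2 * cos (of_real pi * \<sigma>)"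
proof -
  define C S where "C = (\<lambda>z. cos (of_real pi * \<sigma> * z))" and "S = (\<lambda>z. 2 * \<i> / \<sigma> * sin (of_real pi * \<sigma> * z))"
  define V where "V = (\<lambda>u::real. (\<chi> i j. C (of_real u) * mat 1 $ i $ j + S (of_real u) * \<Lambda> $ i $ j) :: complex^2^2)"
  have l22: "\<Lambda>$2$2 = - \<Lambda>$1$1" using tr by (simp add: trace_2 add_eq_0_iff)
  have l2: "\<Lambda>$1$1 * \<Lambda>$1$1 + \<Lambda>$1$2 * \<Lambda>$2$1 = \<sigma>^2 / 4"
  proof -
    have "\<Lambda>$1$1 * \<Lambda>$2$2 - \<Lambda>$1$2 * \<Lambda>$2$1 = - (\<sigma>^2 / 4)" using det by (simp add: det_2)
    then show ?thesis unfolding l22 by (simp add: algebra_simps)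
  qed
  have dC: "(C has_field_derivative 2 * of_real pi * \<i> * (S z * (\<sigma>^2 / 4))) (at z)" for z
    unfolding C_def S_def using \<sigma> by (auto intro!: derivative_eq_intros simp: power2_eq_square field_simps)
  have dS: "(S has_field_derivative 2 * of_real pi * \<i> * C z) (at z)" for z
    unfolding C_def S_def using \<sigma> by (auto intro!: derivative_eq_intros simp: field_simps)
  have sq: "\<Lambda>$i$1 * \<Lambda>$1$j + \<Lambda>$i$2 * \<Lambda>$2$j = \<sigma>^2 / 4 * mat 1 $ i $ j" for i j
    using exhaust_2[of i] exhaust_2[of j] l2 by (auto simp: mat_def l22 algebra_simps)
  have "mat_ode (\<lambda>u. \<chi> i j. 2 * of_real pi * \<i> * \<Lambda> $ i $ j) V"
    unfolding mat_ode_def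
  proof (intro ballI has_vector_derivative_mat2I)
    fix u :: real and i j :: 2
    have "((\<lambda>z. C z * mat 1 $ i $ j + S z * \<Lambda> $ i $ j) has_field_derivative
       2 * of_real pi * \<i> * (S (of_real u) * (\<sigma>^2 / 4)) * mat 1 $ i $ j + 2 * of_real pi * \<i> * C (of_real u) * \<Lambda> $ i $ j) (at (of_real u))"
      by (intro DERIV_add DERIV_cmult_right dC dS)
    from has_vector_derivative_real_field[OF this]
    have "((\<lambda>u. V u $ i $ j) has_vector_derivative 2 * of_real pi * \<i> * (S (of_real u) * (\<sigma>^2 / 4)) * mat 1 $ i $ j + 2 * of_real pi * \<i> * C (of_real u) * \<Lambda> $ i $ j) (at u within {0..1})"
      by (simp add: V_def o_def has_vector_derivative_at_within)
    also have "2 * of_real pi * \<i> * (S (of_real u) * (\<sigma>^2 / 4)) * mat 1 $ i $ j + 2 * of_real pi * \<i> * C (of_real u) * \<Lambda> $ i $ j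
      = ((\<chi> i j. 2 * of_real pi * \<i> * \<Lambda> $ i $ j) ** V u) $ i $ j"
    proof -
      have "((\<chi> i j. 2 * of_real pi * \<i> * \<Lambda> $ i $ j) ** V u) $ i $ j =
        2 * of_real pi * \<i> * (C (of_real u) * (\<Lambda>$i$1 * mat 1 $1$j + \<Lambda>$i$2 * mat 1 $2$j) + S (of_real u) * (\<Lambda>$i$1 * \<Lambda>$1$j + \<Lambda>$i$2 * \<Lambda>$2$j))"
        by (simp add: mat2_mult_nth V_def algebra_simps)
      also have "\<Lambda>$i$1 * mat 1 $1$j + \<Lambda>$i$2 * mat 1 $2$j = \<Lambda>$i$j"
        using exhaust_2[of j] by (auto simp: mat_def)
      finally show ?thesis unfolding sq by (simp add: algebra_simps)
    qed
    finally show "((\<lambda>u. V u $ i $ j) has_vector_derivative ((\<chi> i j. 2 * of_real pi * \<i> * \<Lambda> $ i $ j) ** V u) $ i $ j) (at u within {0..1})" .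
  qed
  moreover have "V 0 = mat 1" by (simp add: V_def C_def S_def vec_eq_iff)
  moreover have "trace (V 1) = 2 * cos (of_real pi * \<sigma>)"
    by (simp add: trace_2 V_def C_def l22 mat_def)
  ultimately show ?thesis by blast
qed

text \<open>On the circle \<open>norm l = r\<close> with \<open>norm x \<lless> r \<lless> 1\<close> the system is close to the Euler system
  \<open>l * \<Psi>' = \<Lambda> ** \<Psi>\<close>.\<close>

theorem trace_transp_limit:
  fixes \<Lambda> :: "complex^2^2" and \<sigma> :: complex
  assumes tr: "trace \<Lambda> = 0" and det: "det \<Lambda> = - (\<sigma>^2 / 4)" and \<sigma>: "\<sigma> \<noteq> 0" and e: "e > 0"
  shows "\<exists>\<delta>>0. \<forall>A0 Ax A1 x M. 0 < norm x \<and> norm x < 1 \<and>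
     (\<forall>i j. norm (Ax $ i $ j) \<le> M \<and> norm (A1 $ i $ j) \<le> M \<and> norm (A0 $ i $ j + Ax $ i $ j - \<Lambda> $ i $ j) \<le> \<delta>) \<and>
     M * (2 * sqrt (norm x)) \<le> \<delta> * (1 - sqrt (norm x)) \<longrightarrow>
     norm (trace (fuchsian_transp A0 Ax A1 x (circ (sqrt (norm x)))) - 2 * cos (of_real pi * \<sigma>)) \<le> e"
proof -
  obtain V where V: "mat_ode (\<lambda>u. \<chi> i j. 2 * of_real pi * \<i> * \<Lambda> $ i $ j) V" "V 0 = mat 1" "trace (V 1) = 2 * cos (of_real pi * \<sigma>)"
    using trace_const_ode[OF tr det \<sigma>] by blast
  have tr': "trace ((\<chi> i j. 2 * of_real pi * \<i> * \<Lambda> $ i $ j) :: complex^2^2) = 0"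
    using tr by (simp add: trace_2 flip: distrib_left)
  obtain C where C: "C > 0" "\<And>X. norm (trace X) \<le> norm (X :: complex^2^2) * C"
    using bounded_linear.pos_bounded[OF bounded_linear_trace2] by blast
  have "e / C > 0" using e C by simp
  from mat_ode_perturb[OF V(1,2) tr' this] obtain \<delta>1 where \<delta>1: "\<delta>1 > 0"
    "\<And>D' W. mat_ode D' W \<and> W 0 = mat 1 \<and> (\<forall>u\<in>{0..1}. norm (D' u - (\<chi> i j. 2 * of_real pi * \<i> * \<Lambda> $ i $ j)) \<le> \<delta>1) \<Longrightarrow>
     \<forall>u\<in>{0..1}. norm (W u - V u) \<le> e / C" by blast
  \<comment> \<open>Each of the four entries will deviate by at most
    \<open>2 * pi * (\<delta> + \<delta>)\<close>, which is a quarter of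
    \<open>\<delta>1\<close>.\<close>
  define \<delta> where "\<delta> = \<delta>1 / (16 * pi)"
  have \<delta>: "\<delta> > 0" using \<delta>1 by (simp add: \<delta>_def)
  show ?thesis
  proof (intro exI[of _ \<delta>] conjI allI impI \<delta>, elim conjE)
    fix A0 Ax A1 :: "complex^2^2" and x :: complex and M :: real
    assume x: "0 < norm x" "norm x < 1" 
      and A: "\<forall>i j. norm (Ax $ i $ j) \<le> M \<and> norm (A1 $ i $ j) \<le> M \<and> norm (A0 $ i $ j + Ax $ i $ j - \<Lambda> $ i $ j) \<le> \<delta>"
      and M: "M * (2 * sqrt (norm x)) \<le> \<delta> * (1 - sqrt (norm x))"
    \<comment> \<open>This radius balances the two perturbations: \<open>x / (l - x)\<close> and
      \<open>l / (l - 1)\<close> are both at most \<open>r / (1 - r)\<close> in modulus.\<close>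
    define r where "r = sqrt (norm x)"
    have r: "0 < r" "r < 1" "norm x = r * r" using x by (auto simp: r_def real_sqrt_lt_1_iff)
    have xr: "norm x < r" using r by simp
    have M0: "M \<ge> 0" using A norm_ge_zero order_trans by blast
    obtain W where W: "mat_ode (circ_coeff A0 Ax A1 x r) W" "W 0 = mat 1" "W 1 = fuchsian_transp A0 Ax A1 x (circ r)"
      using circ_transport[OF xr r(2)] by metis
    have "norm (circ_coeff A0 Ax A1 x r u - (\<chi> i j. 2 * of_real pi * \<i> * \<Lambda> $ i $ j)) \<le> \<delta>1" for u
    proof -
      have "norm ((circ_coeff A0 Ax A1 x r u - (\<chi> i j. 2 * of_real pi * \<i> * \<Lambda> $ i $ j)) $ i $ j) \<le> \<delta>1 / 4" for i j
      proof -
        define l where "l = circ r u"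
        have l: "norm l = r" using circ_sphere[of r u] r by (simp add: l_def)
        have ne: "l \<noteq> 0" "l - x \<noteq> 0" "l - 1 \<noteq> 0" using l r xr by auto
        have lx: "norm (l - x) \<ge> r * (1 - r)" using norm_triangle_ineq2[of l x] l r(3) by (simp add: algebra_simps)
        have l1: "norm (l - 1) \<ge> 1 - r" using norm_triangle_ineq2[of 1 l] l by (simp add: norm_minus_commute)
        have rr: "0 < r * (1 - r)" using r by simp
        have "(circ_coeff A0 Ax A1 x r u - (\<chi> i j. 2 * of_real pi * \<i> * \<Lambda> $ i $ j)) $ i $ j
          = 2 * of_real pi * \<i> * ((A0 $ i $ j + Ax $ i $ j - \<Lambda> $ i $ j) + Ax $ i $ j * (x / (l - x)) + A1 $ i $ j * (l / (l - 1)))"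
        proof -
          have "l * (Ax $ i $ j / (l - x)) = Ax $ i $ j + Ax $ i $ j * (x / (l - x))" using ne by (simp add: field_simps)
          moreover have "l * (A0 $ i $ j / l) = A0 $ i $ j" using ne by simp
          ultimately have "l * fuchsian_coeff A0 Ax A1 x l $ i $ j = A0 $ i $ j + Ax $ i $ j + Ax $ i $ j * (x / (l - x)) + A1 $ i $ j * (l / (l - 1))"
            by (simp add: fuchsian_coeff_def distrib_left)
          then show ?thesis by (simp add: circ_coeff_def l_def[symmetric] mult.assoc flip: right_diff_distrib) 
        qed
        also have "norm \<dots> \<le> 2 * pi * (\<delta> + M * (r / (1 - r)) + M * (r / (1 - r)))"
          unfolding norm_mult
        proof (rule mult_mono)
          have "norm (x / (l - x)) \<le> (r * r) / (r * (1 - r))"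
            unfolding norm_divide r(3) using lx rr by (intro divide_left_mono) (auto intro: mult_pos_pos less_le_trans)
          also have "\<dots> = r / (1 - r)" using r by simp
          finally have 1: "norm (Ax $ i $ j * (x / (l - x))) \<le> M * (r / (1 - r))"
            unfolding norm_mult using A M0 by (intro mult_mono) auto
          have "norm (l / (l - 1)) \<le> r / (1 - r)"
            unfolding norm_divide l using l1 r ne(3) by (intro divide_left_mono) (auto intro!: mult_pos_pos)
          then have 2: "norm (A1 $ i $ j * (l / (l - 1))) \<le> M * (r / (1 - r))"
            unfolding norm_mult using A M0 by (intro mult_mono) auto
          show "norm (A0 $ i $ j + Ax $ i $ j - \<Lambda> $ i $ j + Ax $ i $ j * (x / (l - x)) + A1 $ i $ j * (l / (l - 1))) \<le> \<delta> + M * (r / (1 - r)) + M * (r / (1 - r))"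
            using A 1 2 by (intro order_trans[OF norm_triangle_ineq] add_mono) auto
        qed (simp_all add: norm_mult)
        also have "\<dots> = 2 * pi * (\<delta> + M * (2 * r) / (1 - r))" by (simp add: algebra_simps)
        also have "M * (2 * r) / (1 - r) \<le> \<delta>" using M r unfolding r_def[symmetric] by (simp add: pos_divide_le_eq)
        finally have "norm ((circ_coeff A0 Ax A1 x r u - (\<chi> i j. 2 * of_real pi * \<i> * \<Lambda> $ i $ j)) $ i $ j) \<le> 2 * pi * (\<delta> + \<delta>)"
          by (simp add: mult_left_mono)
        also have "\<dots> = \<delta>1 / 4" by (simp add: \<delta>_def)
        finally show ?thesis .
      qed
      note b = this
      show ?thesis
        by (rule order_trans[OF norm_mat2_le]) (use b[of 1 1] b[of 1 2] b[of 2 1] b[of 2 2] in linarith)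
    qed
    then have "\<forall>u\<in>{0..1}. norm (W u - V u) \<le> e / C" using \<delta>1(2)[of "circ_coeff A0 Ax A1 x r" W] W by blast
    then have "norm (W 1 - V 1) \<le> e / C" by (rule bspec) simp
    then have "norm (W 1 - V 1) * C \<le> e" using C(1) by (simp add: pos_le_divide_eq)
    then have "norm (trace (W 1 - V 1)) \<le> e" using C(2)[of "W 1 - V 1"] by linarith
    then show "norm (trace (fuchsian_transp A0 Ax A1 x (circ (sqrt (norm x)))) - 2 * cos (of_real pi * \<sigma>)) \<le> e"
      using W(3) V(3) by (simp add: trace_sub r_def)
  qed
qed

section \<open>Power series with polynomial coefficients\<close>

text \<open>The value at \<open>W\<close> of the majorant polynomial: it is submultiplicative and
  bounds the polynomial on the disc of radius \<open>W\<close>.\<close>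

definition pnorm :: "real \<Rightarrow> complex poly \<Rightarrow> real" where
  "pnorm W p = poly (map_poly norm p) W"

lemma pnorm_0 [simp]: "pnorm W 0 = 0"
  by (simp add: pnorm_def)

lemma pnorm_pCons [simp]: "pnorm W (pCons a p) = norm a + W * pnorm W p"
  by (simp add: pnorm_def map_poly_pCons)

lemma pnorm_sum: "degree p \<le> N \<Longrightarrow> pnorm W p = (\<Sum>k\<le>N. norm (coeff p k) * W ^ k)"
proof (induction p arbitrary: N)
  case 0 then show ?case by simp
next
  case (pCons a p)
  show ?case
  proof (cases N)
    case 0
    then have "p = 0" using pCons.prems by (auto split: if_splits)
    then show ?thesis using 0 by simp
  next
    case (Suc M)
    then have d: "degree p \<le> M" using pCons.prems by (auto split: if_splits)
    have "(\<Sum>k\<le>Suc M. norm (coeff (pCons a p) k) * W ^ k) = norm a + W * (\<Sum>k\<le>M. norm (coeff p k) * W ^ k)"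
      by (subst sum.atMost_Suc_shift) (simp add: sum_distrib_left mult_ac)
    then show ?thesis using pCons.IH[OF d] Suc by simp
  qed
qed

lemma pnorm_nonneg: "W \<ge> 0 \<Longrightarrow> pnorm W p \<ge> 0"
  by (induction p) auto

lemma pnorm_mono:
  assumes "W \<ge> 0" "\<And>k. norm (coeff p k) \<le> norm (coeff q k)"
  shows "pnorm W p \<le> pnorm W q"
proof -
  have "pnorm W p = (\<Sum>k\<le>max (degree p) (degree q). norm (coeff p k) * W ^ k)" by (rule pnorm_sum) simp
  also have "\<dots> \<le> (\<Sum>k\<le>max (degree p) (degree q). norm (coeff q k) * W ^ k)"
    using assms by (intro sum_mono mult_right_mono) auto
  also have "\<dots> = pnorm W q" by (rule pnorm_sum[symmetric]) simp
  finally show ?thesis .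
qed

lemma pnorm_add: 
  assumes "W \<ge> 0" shows "pnorm W (p + q) \<le> pnorm W p + pnorm W q"
proof -
  let ?N = "max (degree p) (degree q)"
  have "pnorm W (p + q) = (\<Sum>k\<le>?N. norm (coeff (p + q) k) * W ^ k)" by (rule pnorm_sum) (simp add: degree_add_le)
  also have "\<dots> \<le> (\<Sum>k\<le>?N. norm (coeff p k) * W ^ k + norm (coeff q k) * W ^ k)"
    using assms by (intro sum_mono) (auto simp: distrib_right[symmetric] intro!: mult_right_mono norm_triangle_ineq)
  also have "\<dots> = pnorm W p + pnorm W q"
    by (simp add: sum.distrib pnorm_sum[of p ?N] pnorm_sum[of q ?N])
  finally show ?thesis .
qed

lemma pnorm_uminus [simp]: "pnorm W (- p) = pnorm W p"
  by (induction p) auto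

lemma pnorm_smult: "pnorm W (smult c p) = norm c * pnorm W p"
  by (induction p) (auto simp: norm_mult algebra_simps)

lemma pnorm_mult:
  assumes "W \<ge> 0" shows "pnorm W (p * q) \<le> pnorm W p * pnorm W q"
proof (induction p)
  case 0 then show ?case by simp
next
  case (pCons a p)
  have "pnorm W (pCons a p * q) \<le> pnorm W (smult a q) + pnorm W (pCons 0 (p * q))"
    unfolding mult_pCons_left by (rule pnorm_add[OF assms])
  also have "\<dots> \<le> norm a * pnorm W q + W * (pnorm W p * pnorm W q)"
    using pCons.IH assms by (auto simp: pnorm_smult intro!: mult_left_mono)
  finally show ?case by (simp add: algebra_simps)
qed

lemma pnorm_sum_le:
  assumes "W \<ge> 0" "finite A" shows "pnorm W (\<Sum>i\<in>A. f i) \<le> (\<Sum>i\<in>A. pnorm W (f i))"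
  using assms(2)
proof (induction A)
  case (insert x A)
  then show ?case using pnorm_add[OF assms(1), of "f x" "sum f A"] by simp
qed simp

lemma norm_poly_le_pnorm: "norm z \<le> W \<Longrightarrow> norm (poly p z) \<le> pnorm W p"
proof (induction p)
  case 0 then show ?case by simp
next
  case (pCons a p)
  have "norm (a + z * poly p z) \<le> norm a + norm z * norm (poly p z)"
    by (metis norm_mult norm_triangle_ineq)
  also have "norm z * norm (poly p z) \<le> W * pnorm W p"
    using pCons by (intro mult_mono) (auto intro: order_trans[OF norm_ge_zero])
  finally show ?case by simp
qed

text \<open>A series in \<open>v\<close> with coefficients that are polynomials in \<open>w\<close>; \<open>weighted_bound W \<rho> F B\<close> is
  the bound for the sum of the absolute values of all its terms at \<open>w = W\<close>, \<open>v = \<rho>\<close>.\<close>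

definition weighted_bound :: "real \<Rightarrow> real \<Rightarrow> complex poly fps \<Rightarrow> real \<Rightarrow> bool" where
  "weighted_bound W \<rho> F B \<longleftrightarrow> (\<forall>N. (\<Sum>n\<le>N. pnorm W (fps_nth F n) * \<rho> ^ n) \<le> B)"

text \<open>The slope 2 encodes the shape of the expansion: for \<open>j = 2\<close>, dividing
  \<open>v^n * w^k\<close> by \<open>w\<close> gives \<open>x^n * w^(k-n-1)\<close>, and
  \<open>k - n - 1\<close> lies between \<open>-n-1\<close> and \<open>n+1\<close>.\<close>

definition degree_bound :: "nat \<Rightarrow> complex poly fps \<Rightarrow> bool" where
  "degree_bound j F \<longleftrightarrow> (\<forall>n. degree (fps_nth F n) \<le> 2 * n + j)"

definition eq_below :: "nat \<Rightarrow> complex poly fps \<Rightarrow> complex poly fps \<Rightarrow> bool" where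
  "eq_below n F G \<longleftrightarrow> (\<forall>m<n. fps_nth F m = fps_nth G m)"

lemma weighted_bound_nonneg: "W \<ge> 0 \<Longrightarrow> \<rho> \<ge> 0 \<Longrightarrow> weighted_bound W \<rho> F B \<Longrightarrow> B \<ge> 0"
  unfolding weighted_bound_def by (drule spec[of _ 0]) (auto intro: order_trans[OF pnorm_nonneg])

lemma weighted_bound_mono: "weighted_bound W \<rho> F B \<Longrightarrow> B \<le> B' \<Longrightarrow> weighted_bound W \<rho> F B'"
  unfolding weighted_bound_def using order_trans by blast

lemma weighted_bound_add:
  assumes "W \<ge> 0" "\<rho> \<ge> 0" "weighted_bound W \<rho> F a" "weighted_bound W \<rho> G b"
  shows "weighted_bound W \<rho> (F + G) (a + b)"
  unfolding weighted_bound_def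
proof
  fix N
  have "(\<Sum>n\<le>N. pnorm W (fps_nth (F + G) n) * \<rho> ^ n) \<le> (\<Sum>n\<le>N. pnorm W (fps_nth F n) * \<rho> ^ n + pnorm W (fps_nth G n) * \<rho> ^ n)"
    using assms(1,2) by (intro sum_mono) (auto simp: distrib_right[symmetric] intro!: mult_right_mono pnorm_add)
  also have "\<dots> \<le> a + b" using assms(3,4) unfolding weighted_bound_def by (simp add: sum.distrib add_mono)
  finally show "(\<Sum>n\<le>N. pnorm W (fps_nth (F + G) n) * \<rho> ^ n) \<le> a + b" .
qed

lemma weighted_bound_uminus: "weighted_bound W \<rho> F a \<Longrightarrow> weighted_bound W \<rho> (- F) a"
  by (simp add: weighted_bound_def)

lemma weighted_bound_diff:
  assumes "W \<ge> 0" "\<rho> \<ge> 0" "weighted_bound W \<rho> F a" "weighted_bound W \<rho> G b"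
  shows "weighted_bound W \<rho> (F - G) (a + b)"
  using weighted_bound_add[OF assms(1,2,3) weighted_bound_uminus[OF assms(4)]] by simp

text \<open>All terms being nonnegative, the triangle of the truncated Cauchy product is dominated
  by the square of the product of the truncated sums.\<close>

lemma weighted_bound_mult:
  assumes W: "W \<ge> 0" "\<rho> \<ge> 0" and F: "weighted_bound W \<rho> F a" and G: "weighted_bound W \<rho> G b"
  shows "weighted_bound W \<rho> (F * G) (a * b)"
  unfolding weighted_bound_def
proof
  fix N
  let ?f = "\<lambda>i. pnorm W (fps_nth F i) * \<rho> ^ i" and ?g = "\<lambda>i. pnorm W (fps_nth G i) * \<rho> ^ i"
  have nn: "?f i \<ge> 0" "?g i \<ge> 0" for i using pnorm_nonneg W by auto
  have "(\<Sum>n\<le>N. pnorm W (fps_nth (F * G) n) * \<rho> ^ n) \<le> (\<Sum>n\<le>N. \<Sum>i\<le>n. ?f i * ?g (n - i))"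
  proof (rule sum_mono)
    fix n
    have "pnorm W (fps_nth (F * G) n) \<le> (\<Sum>i=0..n. pnorm W (fps_nth F i) * pnorm W (fps_nth G (n - i)))"
      unfolding fps_mult_nth by (intro order_trans[OF pnorm_sum_le] sum_mono pnorm_mult W) auto
    then have "pnorm W (fps_nth (F * G) n) * \<rho> ^ n \<le> (\<Sum>i=0..n. pnorm W (fps_nth F i) * pnorm W (fps_nth G (n - i))) * \<rho> ^ n"
      using W by (intro mult_right_mono) auto
    also have "\<dots> = (\<Sum>i\<le>n. ?f i * ?g (n - i))"
      unfolding sum_distrib_right atLeast0AtMost
    proof (rule sum.cong[OF refl])
      fix i assume "i \<in> {..n}"
      then have "\<rho> ^ n = \<rho> ^ i * \<rho> ^ (n - i)" by (simp flip: power_add)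
      then show "pnorm W (fps_nth F i) * pnorm W (fps_nth G (n - i)) * \<rho> ^ n = ?f i * ?g (n - i)" by simp
    qed
    finally show "pnorm W (fps_nth (F * G) n) * \<rho> ^ n \<le> (\<Sum>i\<le>n. ?f i * ?g (n - i))" .
  qed
  also have "\<dots> = (\<Sum>(i, j)\<in>{(i, j). i + j \<le> N}. ?f i * ?g j)"
    by (rule sum.triangle_reindex_eq[symmetric])
  also have "\<dots> \<le> (\<Sum>(i, j)\<in>{..N} \<times> {..N}. ?f i * ?g j)"
  proof (rule sum_mono2)
    show "0 \<le> (case b of (i, j) \<Rightarrow> ?f i * ?g j)" for b
      by (cases b) (simp only: prod.case mult_nonneg_nonneg[OF nn])
  qed auto
  also have "\<dots> = (\<Sum>i\<le>N. ?f i) * (\<Sum>j\<le>N. ?g j)" by (simp add: sum_product sum.cartesian_product)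
  also have "\<dots> \<le> a * b"
    using F G nn W unfolding weighted_bound_def
    by (intro mult_mono) (auto intro!: sum_nonneg weighted_bound_nonneg[of W \<rho> F a, unfolded weighted_bound_def])
  finally show "(\<Sum>n\<le>N. pnorm W (fps_nth (F * G) n) * \<rho> ^ n) \<le> a * b" .
qed

lemma weighted_bound_const:
  assumes "pnorm W p \<le> a" shows "weighted_bound W \<rho> (fps_const p) a"
  unfolding weighted_bound_def
proof
  fix N
  have "(\<Sum>n\<le>N. pnorm W (fps_nth (fps_const p) n) * \<rho> ^ n) = (\<Sum>n\<le>N. if n = 0 then pnorm W p else 0)"
    by (intro sum.cong) auto
  then show "(\<Sum>n\<le>N. pnorm W (fps_nth (fps_const p) n) * \<rho> ^ n) \<le> a" using assms by (simp add: sum.delta)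
qed

text \<open>Each partial sum sees finitely many coefficients, so a bound on the approximations
  passes to their formal limit.\<close>

lemma weighted_bound_eq_below:
  assumes "\<And>n. \<exists>G. eq_below n F G \<and> weighted_bound W \<rho> G a"
  shows "weighted_bound W \<rho> F a"
  unfolding weighted_bound_def
proof
  fix N
  obtain G where G: "eq_below (Suc N) F G" "weighted_bound W \<rho> G a" using assms by blast
  have "(\<Sum>n\<le>N. pnorm W (fps_nth F n) * \<rho> ^ n) = (\<Sum>n\<le>N. pnorm W (fps_nth G n) * \<rho> ^ n)"
    using G(1) by (intro sum.cong) (auto simp: eq_below_def)
  then show "(\<Sum>n\<le>N. pnorm W (fps_nth F n) * \<rho> ^ n) \<le> a" using G(2) by (simp add: weighted_bound_def)
qed

lemma degree_bound_mono: "degree_bound i F \<Longrightarrow> i \<le> j \<Longrightarrow> degree_bound j F"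
  unfolding degree_bound_def by (meson add_left_mono order_trans)

lemma degree_bound_add: "degree_bound j F \<Longrightarrow> degree_bound j G \<Longrightarrow> degree_bound j (F + G)"
  by (auto simp: degree_bound_def intro!: degree_add_le)

lemma degree_bound_uminus: "degree_bound j F \<Longrightarrow> degree_bound j (- F)"
  by (auto simp: degree_bound_def)

lemma degree_bound_diff: "degree_bound j F \<Longrightarrow> degree_bound j G \<Longrightarrow> degree_bound j (F - G)"
  by (auto simp: degree_bound_def intro!: degree_diff_le)

lemma degree_bound_mult:
  assumes "degree_bound i F" "degree_bound j G"
  shows "degree_bound (i + j) (F * G)"
  unfolding degree_bound_def fps_mult_nth
proof (intro allI degree_sum_le)
  fix n k :: nat assume k: "k \<in> {0..n}"
  have "degree (fps_nth F k * fps_nth G (n - k)) \<le> (2 * k + i) + (2 * (n - k) + j)"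
    using assms by (intro order_trans[OF degree_mult_le] add_mono) (auto simp: degree_bound_def)
  then show "degree (fps_nth F k * fps_nth G (n - k)) \<le> 2 * n + (i + j)" using k by simp
qed auto

lemma degree_bound_const: "degree p \<le> j \<Longrightarrow> degree_bound j (fps_const p)"
  by (auto simp: degree_bound_def)

lemma degree_bound_eq_below:
  assumes "\<And>n. \<exists>G. eq_below n F G \<and> degree_bound j G"
  shows "degree_bound j F"
  unfolding degree_bound_def
proof
  fix n
  obtain G where "eq_below (Suc n) F G" "degree_bound j G" using assms by blast
  then show "degree (fps_nth F n) \<le> 2 * n + j" by (auto simp: degree_bound_def eq_below_def)
qed

section \<open>Agreement up to a given order, and formal fixed points\<close>

lemma eq_below_refl: "eq_below n F F"
  by (simp add: eq_below_def)

lemma eq_below_add: "eq_below n F F' \<Longrightarrow> eq_below n G G' \<Longrightarrow> eq_below n (F + G) (F' + G')"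
  by (auto simp: eq_below_def)

lemma eq_below_diff: "eq_below n F F' \<Longrightarrow> eq_below n G G' \<Longrightarrow> eq_below n (F - G) (F' - G')"
  by (auto simp: eq_below_def)

lemma eq_below_uminus: "eq_below n F F' \<Longrightarrow> eq_below n (- F) (- F')"
  by (auto simp: eq_below_def)

lemma eq_below_mult: "eq_below n F F' \<Longrightarrow> eq_below n G G' \<Longrightarrow> eq_below n (F * G) (F' * G')"
  by (auto simp: eq_below_def fps_mult_nth intro!: sum.cong)

text \<open>A vanishing constant term shifts the other factor by one power of \<open>v\<close>;
  every formal contraction below comes from this.\<close>

lemma eq_below_mult_zero:
  assumes F: "eq_below (Suc n) F F'" "fps_nth F 0 = 0" and G: "eq_below n G G'"
  shows "eq_below (Suc n) (F * G) (F' * G')"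
  unfolding eq_below_def fps_mult_nth
proof (intro allI impI sum.cong refl)
  fix m i assume m: "m < Suc n" and i: "i \<in> {0..m}"
  have F0: "fps_nth F' 0 = 0" using F by (auto simp: eq_below_def)
  show "fps_nth F i * fps_nth G (m - i) = fps_nth F' i * fps_nth G' (m - i)"
  proof (cases i)
    case 0 then show ?thesis using F(2) F0 by simp
  next
    case (Suc k)
    then show ?thesis using F(1) G m i by (auto simp: eq_below_def)
  qed
qed

text \<open>The iterates stabilize coefficient by coefficient, as in Banach's theorem for the adic
  metric. The second conclusion serves to hand bounds on the iterates over to the fixed
  point.\<close>

lemma fps_fixed_point:
  fixes \<Phi> :: "('i \<Rightarrow> complex poly fps) \<Rightarrow> ('i \<Rightarrow> complex poly fps)"
  assumes contr: "\<And>n F G. (\<And>i. eq_below n (F i) (G i)) \<Longrightarrow> (\<And>i. eq_below (Suc n) (\<Phi> F i) (\<Phi> G i))"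
  shows "\<exists>F. \<Phi> F = F \<and> (\<forall>n. \<exists>k. \<forall>i. eq_below n (F i) ((\<Phi> ^^ k) F0 i))"
proof -
  define S where "S = (\<lambda>k. (\<Phi> ^^ k) F0)"
  have S_Suc: "S (Suc k) = \<Phi> (S k)" for k by (simp add: S_def)
  have step: "eq_below k (S k i) (S (Suc k) i)" for k i
  proof (induction k arbitrary: i)
    case 0 show ?case by (simp add: eq_below_def)
  next
    case (Suc k) then show ?case unfolding S_Suc[of k] S_Suc[of "Suc k"] by (intro contr) (simp add: S_Suc)
  qed
  have chain: "eq_below k (S k i) (S (k + j) i)" for k j i
  proof (induction j)
    case 0 show ?case by (simp add: eq_below_refl)
  next
    case (Suc j)
    then show ?case using step[of "k + j" i] by (auto simp: eq_below_def)
  qed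
  define F where "F = (\<lambda>i. Abs_fps (\<lambda>n. fps_nth (S (Suc n) i) n))"
  have FS: "eq_below n (F i) (S n i)" for n i
    unfolding eq_below_def
  proof (intro allI impI)
    fix m assume "m < n"
    then obtain j where "n = Suc m + j" using less_iff_Suc_add by auto
    then show "fps_nth (F i) m = fps_nth (S n i) m" using chain[of "Suc m" i j] by (simp add: F_def eq_below_def)
  qed
  have "\<Phi> F i = F i" for i
  proof (rule fps_ext)
    fix n
    have "eq_below (Suc n) (\<Phi> F i) (S (Suc n) i)" unfolding S_Suc by (intro contr FS)
    then show "fps_nth (\<Phi> F i) n = fps_nth (F i) n" by (simp add: F_def eq_below_def)
  qed
  then show ?thesis using FS unfolding S_def by (intro exI[of _ F]) auto
qed

section \<open>The derivation on series and its inverse\<close>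

lemma coeff_sum_monom: "coeff (\<Sum>k\<le>d. monom (c k) k) m = (if m \<le> d then c m else 0)"
  by (simp add: coeff_sum)

text \<open>\<open>log_deriv \<sigma>\<close> is $d/ds$ for $v = e^{(1-\<sigma>) s}$, $w = e^{\<sigma> s}$; \<open>log_integral \<sigma> j H\<close> solves
  \<open>log_deriv \<sigma> F = j \<sigma> F + H\<close>.\<close>

definition log_deriv :: "complex \<Rightarrow> complex poly fps \<Rightarrow> complex poly fps" where
  "log_deriv \<sigma> F = Abs_fps (\<lambda>n. \<Sum>k\<le>degree (fps_nth F n).
     monom ((of_nat n * (1 - \<sigma>) + of_nat k * \<sigma>) * coeff (fps_nth F n) k) k)"

definition log_integral :: "complex \<Rightarrow> nat \<Rightarrow> complex poly fps \<Rightarrow> complex poly fps" where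
  "log_integral \<sigma> j H = Abs_fps (\<lambda>n. if n = 0 then 0 else \<Sum>k\<le>degree (fps_nth H n).
     monom (coeff (fps_nth H n) k / (of_nat n * (1 - \<sigma>) + of_nat k * \<sigma> - of_nat j * \<sigma>)) k)"

lemma coeff_log_deriv: "coeff (fps_nth (log_deriv \<sigma> F) n) k = (of_nat n * (1 - \<sigma>) + of_nat k * \<sigma>) * coeff (fps_nth F n) k"
  by (simp add: log_deriv_def coeff_sum_monom coeff_eq_0)

lemma coeff_log_integral: "coeff (fps_nth (log_integral \<sigma> j H) n) k =
    (if n = 0 then 0 else coeff (fps_nth H n) k / (of_nat n * (1 - \<sigma>) + of_nat k * \<sigma> - of_nat j * \<sigma>))"
  by (simp add: log_integral_def coeff_sum_monom coeff_eq_0)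

lemma log_integral_0: "fps_nth (log_integral \<sigma> j H) 0 = 0"
  by (simp add: log_integral_def)

lemma eq_below_log_integral: "eq_below n H H' \<Longrightarrow> eq_below n (log_integral \<sigma> j H) (log_integral \<sigma> j H')"
  by (auto simp: eq_below_def log_integral_def)

lemma degree_bound_log_integral:
  assumes "degree_bound i H" shows "degree_bound i (log_integral \<sigma> j H)"
  unfolding degree_bound_def
proof (intro allI degree_le impI)
  fix n k assume "2 * n + i < k"
  then have "coeff (fps_nth H n) k = 0" using assms by (intro coeff_eq_0) (auto simp: degree_bound_def intro: order.strict_trans1)
  then show "coeff (fps_nth (log_integral \<sigma> j H) n) k = 0" by (simp add: coeff_log_integral)
qed

lemma log_denominator:
  assumes "Re \<sigma> = 0" "n \<ge> 1"
  shows "norm (of_nat n * (1 - \<sigma>) + of_nat k * \<sigma> - of_nat j * \<sigma>) \<ge> 1"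
proof -
  have "Re (of_nat n * (1 - \<sigma>) + of_nat k * \<sigma> - of_nat j * \<sigma>) = real n" using assms(1) by simp
  then have "norm (of_nat n * (1 - \<sigma>) + of_nat k * \<sigma> - of_nat j * \<sigma>) \<ge> \<bar>real n\<bar>" by (metis abs_Re_le_cmod)
  then show ?thesis using assms(2) by linarith
qed

lemma weighted_bound_log_integral:
  assumes W: "W \<ge> 0" "\<rho> \<ge> 0" and \<sigma>: "Re \<sigma> = 0" and H: "weighted_bound W \<rho> H a"
  shows "weighted_bound W \<rho> (log_integral \<sigma> j H) a"
  unfolding weighted_bound_def
proof
  fix N
  have "pnorm W (fps_nth (log_integral \<sigma> j H) n) \<le> pnorm W (fps_nth H n)" for n
  proof (rule pnorm_mono[OF W(1)])
    fix k
    show "norm (coeff (fps_nth (log_integral \<sigma> j H) n) k) \<le> norm (coeff (fps_nth H n) k)"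
    proof (cases "n = 0")
      case False
      then have d: "norm (of_nat n * (1 - \<sigma>) + of_nat k * \<sigma> - of_nat j * \<sigma>) \<ge> 1" using log_denominator[OF \<sigma>] by simp
      have "norm (coeff (fps_nth H n) k) / norm (of_nat n * (1 - \<sigma>) + of_nat k * \<sigma> - of_nat j * \<sigma>) \<le> norm (coeff (fps_nth H n) k) / 1"
        using d by (intro divide_left_mono) auto
      then show ?thesis using False by (simp add: coeff_log_integral norm_divide)
    qed (simp add: coeff_log_integral)
  qed
  then have "(\<Sum>n\<le>N. pnorm W (fps_nth (log_integral \<sigma> j H) n) * \<rho> ^ n) \<le> (\<Sum>n\<le>N. pnorm W (fps_nth H n) * \<rho> ^ n)"
    using W by (intro sum_mono mult_right_mono) auto
  also have "\<dots> \<le> a" using H by (simp add: weighted_bound_def)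
  finally show "(\<Sum>n\<le>N. pnorm W (fps_nth (log_integral \<sigma> j H) n) * \<rho> ^ n) \<le> a" .
qed

text \<open>At order zero in \<open>v\<close> the monomial \<open>c * w^j\<close> solves the
  homogeneous equation; there the divisor for \<open>k = j\<close> is zero, and \<open>H\<close>
  contributes only from order one on, where no divisor vanishes.\<close>

lemma log_deriv_log_integral:
  assumes \<sigma>: "Re \<sigma> = 0" and H: "fps_nth H 0 = 0"
  shows "log_deriv \<sigma> (fps_const (monom c j) + log_integral \<sigma> j H)
     = fps_const [:of_nat j * \<sigma>:] * (fps_const (monom c j) + log_integral \<sigma> j H) + H"
proof (rule fps_ext, rule poly_eqI)
  fix n k
  let ?F = "fps_const (monom c j) + log_integral \<sigma> j H"
  have r: "coeff (fps_nth (fps_const [:of_nat j * \<sigma>:] * ?F + H) n) k = of_nat j * \<sigma> * coeff (fps_nth ?F n) k + coeff (fps_nth H n) k"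
    by simp
  show "coeff (fps_nth (log_deriv \<sigma> ?F) n) k = coeff (fps_nth (fps_const [:of_nat j * \<sigma>:] * ?F + H) n) k"
  proof (cases "n = 0")
    case True
    then show ?thesis unfolding r coeff_log_deriv using H by (simp add: coeff_log_integral)
  next
    case False
    then have "norm (of_nat n * (1 - \<sigma>) + of_nat k * \<sigma> - of_nat j * \<sigma>) \<ge> 1" using log_denominator[OF \<sigma>] by simp
    then have ne: "of_nat n * (1 - \<sigma>) + of_nat k * \<sigma> - of_nat j * \<sigma> \<noteq> 0" by auto
    let ?d = "of_nat n * (1 - \<sigma>) + of_nat k * \<sigma> - of_nat j * \<sigma>"
    have "coeff (fps_nth ?F n) k = coeff (fps_nth H n) k / ?d" using False by (simp add: coeff_log_integral)
    moreover have "of_nat n * (1 - \<sigma>) + of_nat k * \<sigma> = ?d + of_nat j * \<sigma>" by simp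
    ultimately show ?thesis unfolding r coeff_log_deriv using ne
      by (metis (no_types, lifting) add.commute distrib_right nonzero_mult_div_cancel_left times_divide_eq_right)
  qed
qed

text \<open>The expansion of \<open>v / (1 - v * w)\<close>. Times \<open>w\<close> it is
  \<open>x / (1 - x)\<close>; that factor is left out because the entries of \<open>w * Ax\<close>,
  which the series multiplies, already carry it.\<close>

definition geom_series :: "complex poly fps" where
  "geom_series = Abs_fps (\<lambda>n. if n = 0 then 0 else monom 1 (n - 1))"

lemma geom_series_0: "fps_nth geom_series 0 = 0"
  by (simp add: geom_series_def)

lemma geom_series_eq: "geom_series = fps_X + fps_X * fps_const [:0, 1:] * geom_series"
proof (rule fps_ext)
  fix n
  show "fps_nth geom_series n = fps_nth (fps_X + fps_X * fps_const [:0, 1:] * geom_series) n"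
  proof (cases n)
    case (Suc m)
    have "fps_nth (fps_X + fps_X * fps_const [:0, 1:] * geom_series) n = (if m = 0 then 1 else 0) + [:0,1:] * fps_nth geom_series m"
      unfolding Suc mult.assoc by simp
    also have "\<dots> = fps_nth geom_series n"
      unfolding Suc by (cases m) (auto simp: geom_series_def monom_0 one_pCons monom_Suc)
    finally show ?thesis ..
  qed (simp add: geom_series_def)
qed

lemma weighted_bound_geom_series:
  assumes W: "W \<ge> 0" "\<rho> \<ge> 0" "\<rho> * W \<le> 1/2"
  shows "weighted_bound W \<rho> geom_series (2 * \<rho>)"
  unfolding weighted_bound_def
proof
  fix N
  have pm: "pnorm W (monom 1 k) = W ^ k" for k
    by (induction k) (auto simp: monom_0 monom_Suc)
  have "(\<Sum>n\<le>N. pnorm W (fps_nth geom_series n) * \<rho> ^ n) \<le> (\<Sum>n\<le>Suc N. pnorm W (fps_nth geom_series n) * \<rho> ^ n)"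
    using W by (simp add: geom_series_def pm)
  also have "\<dots> = (\<Sum>n\<le>N. \<rho> * (\<rho> * W) ^ n)"
    by (subst sum.atMost_Suc_shift) (simp add: geom_series_def pm power_mult_distrib mult_ac)
  also have "\<dots> \<le> (\<Sum>n\<le>N. \<rho> * (1/2) ^ n)" using W by (intro sum_mono mult_left_mono power_mono) auto
  also have "\<dots> = \<rho> * (\<Sum>n\<le>N. (1/2) ^ n)" by (simp add: sum_distrib_left)
  also have "(\<Sum>n\<le>N. (1/2::real) ^ n) \<le> 2"
    using sum_le_suminf[of "\<lambda>n. (1/2::real)^n" "{..N}"] suminf_geometric[of "1/2::real"] by (simp add: summable_geometric)
  finally have "(\<Sum>n\<le>N. pnorm W (fps_nth geom_series n) * \<rho> ^ n) \<le> \<rho> * 2" using W(2) by (simp add: mult_left_mono)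
  then show "(\<Sum>n\<le>N. pnorm W (fps_nth geom_series n) * \<rho> ^ n) \<le> 2 * \<rho>" by simp
qed

text \<open>The coefficient of \<open>v^k\<close> in \<open>geom_series\<close> has degree
  \<open>k - 1\<close> where \<open>2 * k\<close> is allowed, and for \<open>k \<ge> 1\<close> this
  absorbs the surplus 2 of the other factor.\<close>

lemma degree_bound_geom_series_mult:
  assumes "degree_bound 2 F" shows "degree_bound 0 (geom_series * F)"
  unfolding degree_bound_def fps_mult_nth
proof (intro allI degree_sum_le)
  fix n k :: nat assume k: "k \<in> {0..n}"
  show "degree (fps_nth geom_series k * fps_nth F (n - k)) \<le> 2 * n + 0"
  proof (cases "k = 0")
    case False
    have "degree (fps_nth geom_series k * fps_nth F (n - k)) \<le> (k - 1) + (2 * (n - k) + 2)"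
      using assms False by (intro order_trans[OF degree_mult_le] add_mono) (auto simp: degree_bound_def geom_series_def degree_monom_le)
    then show ?thesis using k False by simp
  qed (simp add: geom_series_0)
qed auto

section \<open>The formal solution of the Schlesinger equations\<close>

abbreviation w_var :: "complex poly fps" where "w_var \<equiv> fps_const [:0, 1:]"
abbreviation cst :: "complex \<Rightarrow> complex poly fps" where "cst c \<equiv> fps_const [:c:]"

text \<open>Unknowns, in a basis where the limit of \<open>A0 + Ax\<close> is \<open>diag (\<sigma>/2) (-\<sigma>/2)\<close>: \<open>F 0, F 1, F 2\<close> are
  the entries 11, 12, 21 of \<open>A0 + Ax - diag (\<sigma>/2) (-\<sigma>/2)\<close> and \<open>F 3, F 4, F 5\<close> those of \<open>w * A0\<close>.
  The limit of \<open>A1\<close> has the entries \<open>c1, c2, c3\<close>.\<close>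

definition formal_L ::
  "complex \<Rightarrow> complex \<Rightarrow> complex \<Rightarrow> complex \<Rightarrow> (nat \<Rightarrow> complex poly fps) \<Rightarrow> nat \<Rightarrow> complex poly fps" where
  "formal_L \<sigma> c1 c2 c3 F i =
    (let X1 = w_var * (cst (\<sigma>/2) + F 0) - F 3; X2 = w_var * F 1 - F 4; X3 = w_var * F 2 - F 5 in
     if i = 0 then - (geom_series * ((cst c2 - F 1) * X3 - X2 * (cst c3 - F 2)))
     else if i = 1 then - (geom_series * (cst 2 * ((cst c1 - F 0) * X2 - X1 * (cst c2 - F 1))))
     else - (geom_series * (cst 2 * ((cst c3 - F 2) * X1 - X3 * (cst c1 - F 0)))))"

text \<open>The entries of the commutator of \<open>L\<close> with \<open>w * A0\<close>, where
  \<open>L\<close> is \<open>A0 + Ax\<close> without its limit. Replacing \<open>Ax\<close> by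
  \<open>A0 + Ax\<close> does not change the commutator with \<open>A0\<close>, and it makes the
  equation for \<open>A0\<close> linear once \<open>L\<close> is given.\<close>

definition formal_R :: "(nat \<Rightarrow> complex poly fps) \<Rightarrow> (nat \<Rightarrow> complex poly fps) \<Rightarrow> nat \<Rightarrow> complex poly fps" where
  "formal_R L F i =
    (if i = 3 then L 1 * F 5 - L 2 * F 4
     else if i = 4 then cst 2 * (L 0 * F 4 - L 1 * F 3)
     else cst 2 * (L 2 * F 3 - L 0 * F 5))"

definition lead :: "complex \<Rightarrow> complex \<Rightarrow> complex \<Rightarrow> nat \<Rightarrow> complex poly" where
  "lead p q r i = (if i = 3 then monom p 1 else if i = 4 then monom q 2 else monom r 0)"

text \<open>Two sources of the exponents: differentiating the factor \<open>w\<close> in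
  \<open>w * A0\<close> contributes 1 to each entry, and the commutator with
  \<open>diag (\<sigma>/2) (-\<sigma>/2)\<close> contributes 0, 1, -1 to the entries 11, 12,
  21.\<close>

definition twist :: "nat \<Rightarrow> nat" where
  "twist i = (if i = 3 then 1 else if i = 4 then 2 else 0)"

text \<open>The second group of unknowns is fed with the updated first group instead of
  \<open>F\<close>. The updated series have no constant term, so their products gain an order in
  \<open>v\<close>; this makes the step a contraction on arbitrary \<open>F\<close>.\<close>

definition formal_step ::
  "complex \<Rightarrow> complex \<Rightarrow> complex \<Rightarrow> complex \<Rightarrow> complex \<Rightarrow> complex \<Rightarrow> complex \<Rightarrow>
   (nat \<Rightarrow> complex poly fps) \<Rightarrow> nat \<Rightarrow> complex poly fps" where
  "formal_step \<sigma> c1 c2 c3 p q r F i =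
    (if i < 3 then log_integral \<sigma> 0 (formal_L \<sigma> c1 c2 c3 F i)
     else fps_const (lead p q r i) +
       log_integral \<sigma> (twist i) (formal_R (\<lambda>i. log_integral \<sigma> 0 (formal_L \<sigma> c1 c2 c3 F i)) F i))"

lemma eq_below_if: "eq_below n A A' \<Longrightarrow> eq_below n B B' \<Longrightarrow> eq_below n (if c then A else B) (if c then A' else B')"
  by simp

lemma degree_bound_if: "degree_bound j A \<Longrightarrow> degree_bound j B \<Longrightarrow> degree_bound j (if c then A else B)"
  by simp

lemma weighted_bound_if: "weighted_bound W \<rho> A a \<Longrightarrow> weighted_bound W \<rho> B a \<Longrightarrow> weighted_bound W \<rho> (if c then A else B) a"
  by simp

lemma formal_L_0: "fps_nth (formal_L \<sigma> c1 c2 c3 F i) 0 = 0"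
  by (simp add: formal_L_def Let_def geom_series_0)

lemma formal_step_contraction:
  assumes FG: "\<And>i. eq_below n (F i) (G i)"
  shows "eq_below (Suc n) (formal_step \<sigma> c1 c2 c3 p q r F i) (formal_step \<sigma> c1 c2 c3 p q r G i)"
proof -
  note E = eq_below_add eq_below_diff eq_below_mult eq_below_refl
  have gm: "eq_below (Suc n) (geom_series * X) (geom_series * Y)" if "eq_below n X Y" for X Y
    by (rule eq_below_mult_zero[OF eq_below_refl geom_series_0 that])
  have "eq_below (Suc n) (formal_L \<sigma> c1 c2 c3 F i) (formal_L \<sigma> c1 c2 c3 G i)" for i
    unfolding formal_L_def Let_def by (intro eq_below_if eq_below_uminus gm E FG)
  then have L: "eq_below (Suc n) (log_integral \<sigma> 0 (formal_L \<sigma> c1 c2 c3 F i)) (log_integral \<sigma> 0 (formal_L \<sigma> c1 c2 c3 G i))" for i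
    by (rule eq_below_log_integral)
  have LM: "eq_below (Suc n) (log_integral \<sigma> 0 (formal_L \<sigma> c1 c2 c3 F i) * F j) (log_integral \<sigma> 0 (formal_L \<sigma> c1 c2 c3 G i) * G j)" for i j
    by (rule eq_below_mult_zero[OF L log_integral_0 FG])
  have "eq_below (Suc n) (formal_R (\<lambda>i. log_integral \<sigma> 0 (formal_L \<sigma> c1 c2 c3 F i)) F i)
      (formal_R (\<lambda>i. log_integral \<sigma> 0 (formal_L \<sigma> c1 c2 c3 G i)) G i)" for i
    unfolding formal_R_def by (intro eq_below_if eq_below_mult[OF eq_below_refl] eq_below_diff LM)
  then show ?thesis unfolding formal_step_def
    by (intro eq_below_if[OF L eq_below_add[OF eq_below_refl eq_below_log_integral]])
qed

lemma degree_bound_formal_step: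
  assumes "\<And>i. i < 3 \<Longrightarrow> degree_bound 0 (F i)" "\<And>i. i \<ge> 3 \<Longrightarrow> degree_bound 2 (F i)"
  shows "degree_bound (if i < 3 then 0 else 2) (formal_step \<sigma> c1 c2 c3 p q r F i)"
proof -
  have l: "degree_bound 0 (F 0)" "degree_bound 0 (F 1)" "degree_bound 0 (F 2)" by (rule assms(1), simp)+
  have l': "degree_bound 0 (cst c)" for c by (rule degree_bound_const) simp
  have P: "degree_bound 2 (F 3)" "degree_bound 2 (F 4)" "degree_bound 2 (F 5)" by (rule assms(2), simp)+
  have wl: "degree_bound 2 (w_var * X)" if "degree_bound 0 X" for X
    by (rule degree_bound_mono[OF degree_bound_mult[OF degree_bound_const[of "[:0,1:]" 1] that]]) auto
  have m02: "degree_bound 2 (X * Y)" if "degree_bound 0 X" "degree_bound 2 Y" for X Y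
    using degree_bound_mult[OF that] by (simp only: add_0)
  have m20: "degree_bound 2 (Y * X)" if "degree_bound 0 X" "degree_bound 2 Y" for X Y
    using degree_bound_mult[OF that(2,1)] by (simp only: add_0_right)
  have X: "degree_bound 2 (w_var * (cst (\<sigma>/2) + F 0) - F 3)" "degree_bound 2 (w_var * F 1 - F 4)" "degree_bound 2 (w_var * F 2 - F 5)"
    by (rule degree_bound_diff[OF wl[OF degree_bound_add[OF l' l(1)]] P(1)] degree_bound_diff[OF wl[OF l(2)] P(2)] degree_bound_diff[OF wl[OF l(3)] P(3)])+
  have br: "degree_bound 2 ((cst z - A) * X - Y * (cst z' - B))"
    if "degree_bound 0 A" "degree_bound 0 B" "degree_bound 2 X" "degree_bound 2 Y" for z z' A B X Y
    by (rule degree_bound_diff[OF m02[OF degree_bound_diff[OF l' that(1)] that(3)] m20[OF degree_bound_diff[OF l' that(2)] that(4)]])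
  have L: "degree_bound 0 (log_integral \<sigma> 0 (formal_L \<sigma> c1 c2 c3 F i))" for i
    unfolding formal_L_def Let_def
    by (intro degree_bound_log_integral degree_bound_if degree_bound_uminus degree_bound_geom_series_mult
        m02[OF l'] br X l)
  have "degree_bound 2 (formal_R (\<lambda>i. log_integral \<sigma> 0 (formal_L \<sigma> c1 c2 c3 F i)) F i)" for i
    unfolding formal_R_def by (intro degree_bound_if m02[OF l'] degree_bound_diff m02[OF L] P)
  moreover have "degree_bound 2 (fps_const (lead p q r i))" for i
    by (rule degree_bound_const) (auto simp: lead_def intro: order_trans[OF degree_monom_le])
  ultimately have "degree_bound 2 (fps_const (lead p q r i) + log_integral \<sigma> (twist i) (formal_R (\<lambda>i. log_integral \<sigma> 0 (formal_L \<sigma> c1 c2 c3 F i)) F i))"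
    by (intro degree_bound_add degree_bound_log_integral)
  with L show ?thesis unfolding formal_step_def by simp
qed

text \<open>The box with sides \<open>\<eta>\<close> and \<open>K0 + 1\<close> is invariant. The
  first group contains \<open>geom_series\<close>, hence a factor \<open>2 * \<rho>\<close>; the 8
  collects it with the factor 2 of the off-diagonal entries and the two products in a commutator.
  The second group moves by at most \<open>4 * \<eta> * (K0 + 1)\<close> from its leading term,
  which is bounded by \<open>K0\<close>.\<close>

lemma weighted_bound_formal_step:
  assumes W: "W \<ge> 1" and \<rho>: "\<rho> \<ge> 0" "\<rho> * W \<le> 1/2" and \<sigma>: "Re \<sigma> = 0" and \<eta>: "\<eta> \<ge> 0" "\<eta> \<le> 1" 
    and c: "norm c1 \<le> c" "norm c2 \<le> c" "norm c3 \<le> c"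
    and K0: "norm p * W \<le> K0" "norm q * W^2 \<le> K0" "norm r \<le> K0"
    and small: "8 * \<rho> * ((c + 1) * (W * (norm \<sigma> / 2 + 1) + (K0 + 1))) \<le> \<eta>" "4 * \<eta> * (K0 + 1) \<le> 1"
    and F: "\<And>i. i < 3 \<Longrightarrow> weighted_bound W \<rho> (F i) \<eta>" "\<And>i. i \<ge> 3 \<Longrightarrow> weighted_bound W \<rho> (F i) (K0 + 1)"
  shows "weighted_bound W \<rho> (formal_step \<sigma> c1 c2 c3 p q r F i) (if i < 3 then \<eta> else K0 + 1)"
proof -
  define K where "K = K0 + 1"
  define XB where "XB = W * (norm \<sigma> / 2 + 1) + K"
  have W0: "W \<ge> 0" using W by simp
  have K: "K \<ge> 1" using K0(3) norm_ge_zero[of r] unfolding K_def by linarith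
  have c0: "c \<ge> 0" using c(1) norm_ge_zero order_trans by blast
  have l: "weighted_bound W \<rho> (F 0) \<eta>" "weighted_bound W \<rho> (F 1) \<eta>" "weighted_bound W \<rho> (F 2) \<eta>" by (rule F(1), simp)+
  have P: "weighted_bound W \<rho> (F 3) K" "weighted_bound W \<rho> (F 4) K" "weighted_bound W \<rho> (F 5) K"
    unfolding K_def by (rule F(2), simp)+
  note mono = weighted_bound_mono and add = weighted_bound_add[OF W0 \<rho>(1)] and diff = weighted_bound_diff[OF W0 \<rho>(1)]
    and mult = weighted_bound_mult[OF W0 \<rho>(1)]
  have wv: "weighted_bound W \<rho> w_var W" by (rule weighted_bound_const) (use W0 in simp)
  have cl: "weighted_bound W \<rho> (cst z - X) (c + 1)" if "norm z \<le> c" "weighted_bound W \<rho> X \<eta>" for z X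
    using that \<eta> by (intro mono[OF diff[OF weighted_bound_const[of W "[:z:]" c] that(2)]]) auto
  have XX: "weighted_bound W \<rho> (w_var * Y - Z) XB" if "weighted_bound W \<rho> Y (norm \<sigma> / 2 + 1)" "weighted_bound W \<rho> Z K" for Y Z
    unfolding XB_def by (intro diff mult wv that)
  have Y0: "weighted_bound W \<rho> (cst (\<sigma>/2) + F 0) (norm \<sigma> / 2 + 1)"
    using \<eta> by (intro mono[OF add[OF weighted_bound_const[of W "[:\<sigma>/2:]" "norm \<sigma> / 2"] l(1)]]) (auto simp: norm_divide)
  have Yl: "weighted_bound W \<rho> X (norm \<sigma> / 2 + 1)" if "weighted_bound W \<rho> X \<eta>" for X
    by (rule mono[OF that]) (use \<eta> in \<open>auto intro: order_trans\<close>)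
  have X: "weighted_bound W \<rho> (w_var * (cst (\<sigma>/2) + F 0) - F 3) XB" "weighted_bound W \<rho> (w_var * F 1 - F 4) XB" "weighted_bound W \<rho> (w_var * F 2 - F 5) XB"
    by (intro XX Y0 Yl l P)+
  have XB0: "XB \<ge> 0" using W K unfolding XB_def by (intro add_nonneg_nonneg mult_nonneg_nonneg) auto
  have br: "weighted_bound W \<rho> ((cst z - A) * X - Y * (cst z' - B)) (2 * ((c + 1) * XB))"
    if "norm z \<le> c" "norm z' \<le> c" "weighted_bound W \<rho> A \<eta>" "weighted_bound W \<rho> B \<eta>" "weighted_bound W \<rho> X XB" "weighted_bound W \<rho> Y XB" for z z' A B X Y
    by (rule mono[OF diff[OF mult[OF cl[OF that(1,3)] that(5)] mult[OF that(6) cl[OF that(2,4)]]]]) simp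
  have g1: "weighted_bound W \<rho> (- (geom_series * X)) \<eta>" if "weighted_bound W \<rho> X (2 * ((c + 1) * XB))" for X
  proof (rule mono[OF weighted_bound_uminus[OF mult[OF weighted_bound_geom_series[OF W0 \<rho>] that]]])
    have "2 * \<rho> * (2 * ((c + 1) * XB)) \<le> 8 * \<rho> * ((c + 1) * XB)" using \<rho>(1) c0 XB0 by simp
    also have "\<dots> \<le> \<eta>" using small(1) by (simp add: XB_def K_def)
    finally show "2 * \<rho> * (2 * ((c + 1) * XB)) \<le> \<eta>" .
  qed
  have w2: "weighted_bound W \<rho> (cst 2) 2" by (rule weighted_bound_const) simp
  have g2: "weighted_bound W \<rho> (- (geom_series * (cst 2 * X))) \<eta>" if "weighted_bound W \<rho> X (2 * ((c + 1) * XB))" for X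
  proof (rule mono[OF weighted_bound_uminus[OF mult[OF weighted_bound_geom_series[OF W0 \<rho>] mult[OF w2 that]]]])
    have "2 * \<rho> * (2 * (2 * ((c + 1) * XB))) = 8 * \<rho> * ((c + 1) * XB)" by simp
    then show "2 * \<rho> * (2 * (2 * ((c + 1) * XB))) \<le> \<eta>"
      using small(1) by (simp only: XB_def K_def)
  qed
  have L: "weighted_bound W \<rho> (log_integral \<sigma> 0 (formal_L \<sigma> c1 c2 c3 F i)) \<eta>" for i
    unfolding formal_L_def Let_def
    by (intro weighted_bound_log_integral[OF W0 \<rho>(1) \<sigma>] weighted_bound_if g1 g2 br c l X)
  have LM: "weighted_bound W \<rho> (log_integral \<sigma> 0 (formal_L \<sigma> c1 c2 c3 F i) * Y) (\<eta> * K)" if "weighted_bound W \<rho> Y K" for i Y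
    by (rule mult[OF L that])
  have eK: "0 \<le> \<eta> * K" using \<eta> K by simp
  have R: "weighted_bound W \<rho> (formal_R (\<lambda>i. log_integral \<sigma> 0 (formal_L \<sigma> c1 c2 c3 F i)) F i) (4 * (\<eta> * K))" for i
  proof -
    have d: "weighted_bound W \<rho> (A - B) (2 * (\<eta> * K))" if "weighted_bound W \<rho> A (\<eta> * K)" "weighted_bound W \<rho> B (\<eta> * K)" for A B
      using diff[OF that] by (simp only: mult_2)
    have a: "weighted_bound W \<rho> (cst 2 * A) (4 * (\<eta> * K))" if "weighted_bound W \<rho> A (2 * (\<eta> * K))" for A
      using mult[OF w2 that] by simp
    have m: "weighted_bound W \<rho> A (4 * (\<eta> * K))" if "weighted_bound W \<rho> A (2 * (\<eta> * K))" for A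
      by (rule mono[OF that]) (use eK in linarith)
    show ?thesis unfolding formal_R_def
      by (rule weighted_bound_if, intro m d LM P, rule weighted_bound_if; intro a d LM P)
  qed
  have "weighted_bound W \<rho> (fps_const (lead p q r i)) K0"
  proof (rule weighted_bound_const)
    have "pnorm W (monom z n) = norm z * W ^ n" for z n
      by (induction n) (auto simp: monom_0 monom_Suc)
    then show "pnorm W (lead p q r i) \<le> K0" using K0 by (simp add: lead_def)
  qed
  from add[OF this weighted_bound_log_integral[OF W0 \<rho>(1) \<sigma> R]]
  have "weighted_bound W \<rho> (fps_const (lead p q r i) + log_integral \<sigma> (twist i) (formal_R (\<lambda>i. log_integral \<sigma> 0 (formal_L \<sigma> c1 c2 c3 F i)) F i)) (K0 + 1)"
    by (rule mono) (use small(2) in \<open>simp add: K_def mult.assoc\<close>)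
  with L show ?thesis unfolding formal_step_def by simp
qed

text \<open>One formal solution serves every \<open>W\<close>, and only the radius depends on it.
  The order of the quantifiers matters: \<open>K\<close> comes from the leading terms before
  \<open>\<eta>\<close> is made small.\<close>

theorem formal_solution_exists:
  assumes \<sigma>: "Re \<sigma> = 0"
  shows "\<exists>F :: nat \<Rightarrow> complex poly fps.
    (\<forall>i<3. log_deriv \<sigma> (F i) = formal_L \<sigma> c1 c2 c3 F i \<and> fps_nth (F i) 0 = 0 \<and> degree_bound 0 (F i)) \<and>
    (\<forall>i\<in>{3,4,5}. log_deriv \<sigma> (F i) = cst (of_nat (twist i) * \<sigma>) * F i + formal_R F F i \<and>
       fps_nth (F i) 0 = lead p q r i \<and> degree_bound 2 (F i)) \<and>
    (\<forall>W\<ge>1. \<exists>K\<ge>1. \<forall>\<eta>>0. \<exists>\<rho>>0. \<rho> \<le> \<eta> \<and> \<rho> * W \<le> 1/2 \<and>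
       (\<forall>i<3. weighted_bound W \<rho> (F i) \<eta>) \<and> (\<forall>i\<in>{3,4,5}. weighted_bound W \<rho> (F i) K))"
proof -
  let ?\<Phi> = "formal_step \<sigma> c1 c2 c3 p q r"
  define F0 where "F0 = (\<lambda>i. if i < 3 then 0 else fps_const (lead p q r i))"
  obtain F where fx: "?\<Phi> F = F" and app: "\<And>n. \<exists>k. \<forall>i. eq_below n (F i) ((?\<Phi> ^^ k) F0 i)"
    using fps_fixed_point[of ?\<Phi> F0, OF formal_step_contraction] by blast
  have L: "F i = log_integral \<sigma> 0 (formal_L \<sigma> c1 c2 c3 F i)" if "i < 3" for i
    using fun_cong[OF fx, of i] that by (simp add: formal_step_def)
  have fR: "formal_R (\<lambda>i. log_integral \<sigma> 0 (formal_L \<sigma> c1 c2 c3 F i)) F i = formal_R F F i" for i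
    by (simp add: formal_R_def flip: L)
  have R: "F i = fps_const (lead p q r i) + log_integral \<sigma> (twist i) (formal_R F F i)" if "\<not> i < 3" for i
    using fun_cong[OF fx, of i] that by (simp add: formal_step_def fR)
  have F00: "fps_nth (F i) 0 = 0" if "i < 3" for i by (subst L[OF that]) (rule log_integral_0)
  have R0: "fps_nth (formal_R F F i) 0 = 0" for i by (simp add: formal_R_def F00)
  \<comment> \<open>A property that is closed under formal limits, preserved by the step and true of
    the starting point passes to the fixed point.\<close>
  have inv: "I F" if c: "\<And>G. (\<And>n. \<exists>H. (\<forall>i. eq_below n (G i) (H i)) \<and> I H) \<Longrightarrow> I G" and s: "\<And>G. I G \<Longrightarrow> I (?\<Phi> G)" and z: "I F0"
    for I :: "(nat \<Rightarrow> complex poly fps) \<Rightarrow> bool"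
  proof (rule c)
    fix n
    obtain k where k: "\<forall>i. eq_below n (F i) ((?\<Phi> ^^ k) F0 i)" using app by blast
    moreover have "I ((?\<Phi> ^^ k) F0)" by (induction k) (auto simp: z s)
    ultimately show "\<exists>H. (\<forall>i. eq_below n (F i) (H i)) \<and> I H" by blast
  qed
  have deg: "\<forall>i. degree_bound (if i < 3 then 0 else 2) (F i)"
  proof (rule inv)
    fix G assume "\<And>n. \<exists>H. (\<forall>i. eq_below n (G i) (H i)) \<and> (\<forall>i. degree_bound (if i < 3 then 0 else 2) (H i))"
    then show "\<forall>i. degree_bound (if i < 3 then 0 else 2) (G i)" by (meson degree_bound_eq_below)
  next
    fix G :: "nat \<Rightarrow> complex poly fps" assume "\<forall>i. degree_bound (if i < 3 then 0 else 2) (G i)"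
    then show "\<forall>i. degree_bound (if i < 3 then 0 else 2) (?\<Phi> G i)"
      by (intro allI degree_bound_formal_step) (metis, metis not_le)
  next
    have "degree (lead p q r i) \<le> 2" for i by (auto simp: lead_def intro: order_trans[OF degree_monom_le])
    then have "degree_bound 2 (fps_const (lead p q r i))" for i by (rule degree_bound_const)
    moreover have "degree_bound 0 0" by (simp add: degree_bound_def)
    ultimately show "\<forall>i. degree_bound (if i < 3 then 0 else 2) (F0 i)"
      by (simp add: F0_def)
  qed
  have bound: "\<exists>K\<ge>1. \<forall>\<eta>>0. \<exists>\<rho>>0. \<rho> \<le> \<eta> \<and> \<rho> * W \<le> 1/2 \<and>
       (\<forall>i<3. weighted_bound W \<rho> (F i) \<eta>) \<and> (\<forall>i\<in>{3,4,5}. weighted_bound W \<rho> (F i) K)" if W: "W \<ge> 1" for W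
  proof -
    define K0 where "K0 = max (norm p * W) (max (norm q * W^2) (norm r))"
    have K0: "norm p * W \<le> K0" "norm q * W^2 \<le> K0" "norm r \<le> K0" by (auto simp: K0_def)
    have K00: "K0 \<ge> 0" using K0(3) norm_ge_zero order_trans by blast
    define c where "c = max (norm c1) (max (norm c2) (norm c3))"
    have c: "norm c1 \<le> c" "norm c2 \<le> c" "norm c3 \<le> c" by (auto simp: c_def)
    have c0: "c \<ge> 0" using c(1) norm_ge_zero order_trans by blast
    define M where "M = (c + 1) * (W * (norm \<sigma> / 2 + 1) + (K0 + 1))"
    have M: "M > 0" unfolding M_def using c0 W K00 by (intro mult_pos_pos add_nonneg_pos) auto
    show ?thesis
    proof (rule exI[of _ "K0 + 1"], rule conjI, use K00 in simp, intro allI impI)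
      fix \<eta>0 :: real assume \<eta>0: "\<eta>0 > 0"
      define \<eta> where "\<eta> = min \<eta>0 (min 1 (1 / (4 * (K0 + 1))))"
      have \<eta>: "\<eta> > 0" "\<eta> \<le> 1" "\<eta> \<le> \<eta>0" "4 * \<eta> * (K0 + 1) \<le> 1"
      proof -
        show "\<eta> \<le> 1" "\<eta> \<le> \<eta>0" unfolding \<eta>_def by linarith+
        show "\<eta> > 0" using \<eta>0 K00 by (simp add: \<eta>_def)
        have "\<eta> \<le> 1 / (4 * (K0 + 1))" by (simp add: \<eta>_def)
        then show "4 * \<eta> * (K0 + 1) \<le> 1" using K00 by (simp add: field_simps)
      qed
      define \<rho> where "\<rho> = min \<eta> (min (1 / (2 * W)) (\<eta> / (8 * M)))"
      have \<rho>: "\<rho> > 0" "\<rho> \<le> \<eta>" "\<rho> * W \<le> 1/2" "8 * \<rho> * M \<le> \<eta>"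
      proof -
        show "\<rho> > 0" "\<rho> \<le> \<eta>" using \<eta>(1) M W by (auto simp: \<rho>_def)
        have "\<rho> \<le> 1 / (2 * W)" by (simp add: \<rho>_def)
        then show "\<rho> * W \<le> 1/2" using W by (simp add: field_simps)
        have "\<rho> \<le> \<eta> / (8 * M)" by (simp add: \<rho>_def)
        then show "8 * \<rho> * M \<le> \<eta>" using M by (simp add: pos_le_divide_eq mult_ac)
      qed
      have "\<forall>i. weighted_bound W \<rho> (F i) (if i < 3 then \<eta> else K0 + 1)"
      proof (rule inv)
        fix G assume "\<And>n. \<exists>H. (\<forall>i. eq_below n (G i) (H i)) \<and> (\<forall>i. weighted_bound W \<rho> (H i) (if i < 3 then \<eta> else K0 + 1))"
        then show "\<forall>i. weighted_bound W \<rho> (G i) (if i < 3 then \<eta> else K0 + 1)" by (meson weighted_bound_eq_below)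
      next
        fix G :: "nat \<Rightarrow> complex poly fps" assume G: "\<forall>i. weighted_bound W \<rho> (G i) (if i < 3 then \<eta> else K0 + 1)"
        have G1: "weighted_bound W \<rho> (G i) \<eta>" if "i < 3" for i using spec[OF G, of i] that by simp
        have G2: "weighted_bound W \<rho> (G i) (K0 + 1)" if "i \<ge> 3" for i using spec[OF G, of i] that by simp
        show "\<forall>i. weighted_bound W \<rho> (?\<Phi> G i) (if i < 3 then \<eta> else K0 + 1)"
          by (intro allI weighted_bound_formal_step[OF W less_imp_le[OF \<rho>(1)] \<rho>(3) \<sigma> less_imp_le[OF \<eta>(1)] \<eta>(2) c K0
            \<rho>(4)[unfolded M_def] \<eta>(4) G1 G2])
      next
        have "pnorm W (monom z n) = norm z * W ^ n" for z n
          by (induction n) (auto simp: monom_0 monom_Suc)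
        then have "pnorm W (lead p q r i) \<le> K0 + 1" for i using K0 by (simp add: lead_def)
        moreover have "weighted_bound W \<rho> 0 \<eta>" using \<eta>(1) by (simp add: weighted_bound_def)
        ultimately show "\<forall>i. weighted_bound W \<rho> (F0 i) (if i < 3 then \<eta> else K0 + 1)"
          by (auto simp: F0_def intro: weighted_bound_const)
      qed
      then have wb: "weighted_bound W \<rho> (F i) (if i < 3 then \<eta> else K0 + 1)" for i by blast
      show "\<exists>\<rho>>0. \<rho> \<le> \<eta>0 \<and> \<rho> * W \<le> 1/2 \<and> (\<forall>i<3. weighted_bound W \<rho> (F i) \<eta>0) \<and> (\<forall>i\<in>{3,4,5}. weighted_bound W \<rho> (F i) (K0 + 1))"
      proof (rule exI[of _ \<rho>], intro conjI allI impI ballI)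
        show "weighted_bound W \<rho> (F i) \<eta>0" if "i < 3" for i
          using wb[of i] that by (intro weighted_bound_mono[OF _ \<eta>(3)]) simp
        show "weighted_bound W \<rho> (F i) (K0 + 1)" if "i \<in> {3,4,5}" for i
        proof -
          have "\<not> i < 3" using that by auto
          then show ?thesis using wb[of i] by simp
        qed
        show "\<rho> \<le> \<eta>0" using \<rho>(2) \<eta>(3) by linarith
      qed (use \<rho> in auto)
    qed
  qed
  have D1: "log_deriv \<sigma> (F i) = formal_L \<sigma> c1 c2 c3 F i" if "i < 3" for i
    using log_deriv_log_integral[where c = 0 and j = 0 and H = "formal_L \<sigma> c1 c2 c3 F i", OF \<sigma> formal_L_0] L[OF that, symmetric] by simp
  have D2: "log_deriv \<sigma> (F i) = cst (of_nat (twist i) * \<sigma>) * F i + formal_R F F i" if i: "i \<in> {3,4,5}" for i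
  proof -
    obtain z where "lead p q r i = monom z (twist i)" using i by (auto simp: lead_def twist_def)
    then show ?thesis using log_deriv_log_integral[where c = z and j = "twist i" and H = "formal_R F F i", OF \<sigma> R0] R[of i] i by auto
  qed
  have lead0: "fps_nth (F i) 0 = lead p q r i" if "i \<in> {3,4,5}" for i
    by (subst R) (use that in \<open>auto simp: log_integral_0\<close>)
  have deg1: "degree_bound 0 (F i)" if "i < 3" for i using spec[OF deg, of i] that by simp
  have deg2: "degree_bound 2 (F i)" if "i \<in> {3,4,5}" for i
  proof -
    have "\<not> i < 3" using that by auto
    then show ?thesis using spec[OF deg, of i] by simp
  qed
  show ?thesis
    by (rule exI[of _ F], intro conjI) (blast intro: D1 F00 deg1, blast intro: D2 lead0 deg2, blast intro: bound)
qed

section \<open>Convergence\<close>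

definition ev :: "complex \<Rightarrow> complex poly fps \<Rightarrow> complex \<Rightarrow> complex" where
  "ev \<sigma> F s = (\<Sum>n. poly (fps_nth F n) (exp (\<sigma> * s)) * exp ((1 - \<sigma>) * s) ^ n)"

definition within_radii :: "complex \<Rightarrow> real \<Rightarrow> real \<Rightarrow> complex \<Rightarrow> bool" where
  "within_radii \<sigma> W \<rho> s \<longleftrightarrow> norm (exp (\<sigma> * s)) \<le> W \<and> norm (exp ((1 - \<sigma>) * s)) \<le> \<rho>"

definition converges :: "real \<Rightarrow> real \<Rightarrow> complex poly fps \<Rightarrow> bool" where
  "converges W \<rho> F \<longleftrightarrow> (\<exists>B. weighted_bound W \<rho> F B)"

lemma within_radii_nonneg:
  assumes "within_radii \<sigma> W \<rho> s" shows "W \<ge> 0" "\<rho> \<ge> 0"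
  using assms norm_ge_zero order_trans unfolding within_radii_def by blast+

lemma convergesI: "weighted_bound W \<rho> F B \<Longrightarrow> converges W \<rho> F"
  by (auto simp: converges_def)

lemma weighted_bound_fps_X: "weighted_bound W \<rho> fps_X \<bar>\<rho>\<bar>"
  unfolding weighted_bound_def
proof
  fix N
  have "pnorm W (fps_nth fps_X n) * \<rho> ^ n = (if n = 1 then \<rho> else 0)" for n
    by (auto simp: fps_X_def one_pCons)
  then have "(\<Sum>n\<le>N. pnorm W (fps_nth fps_X n) * \<rho> ^ n) = (\<Sum>n\<le>N. if n = 1 then \<rho> else 0)" by (simp only:)
  then show "(\<Sum>n\<le>N. pnorm W (fps_nth fps_X n) * \<rho> ^ n) \<le> \<bar>\<rho>\<bar>" using abs_ge_self[of \<rho>] by (simp add: sum.delta del: fps_X_nth)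
qed

lemma converges_rules:
  assumes "W \<ge> 0" "\<rho> \<ge> 0"
  shows "converges W \<rho> F \<Longrightarrow> converges W \<rho> G \<Longrightarrow> converges W \<rho> (F + G)"
    and "converges W \<rho> F \<Longrightarrow> converges W \<rho> G \<Longrightarrow> converges W \<rho> (F - G)"
    and "converges W \<rho> F \<Longrightarrow> converges W \<rho> G \<Longrightarrow> converges W \<rho> (F * G)"
    and "converges W \<rho> F \<Longrightarrow> converges W \<rho> (- F)"
    and "converges W \<rho> (fps_const p)" and "converges W \<rho> fps_X"
proof -
  show "converges W \<rho> F \<Longrightarrow> converges W \<rho> G \<Longrightarrow> converges W \<rho> (F + G)"
    unfolding converges_def by (blast intro: weighted_bound_add[OF assms])
  show "converges W \<rho> F \<Longrightarrow> converges W \<rho> G \<Longrightarrow> converges W \<rho> (F - G)"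
    unfolding converges_def by (blast intro: weighted_bound_diff[OF assms])
  show "converges W \<rho> F \<Longrightarrow> converges W \<rho> G \<Longrightarrow> converges W \<rho> (F * G)"
    unfolding converges_def by (blast intro: weighted_bound_mult[OF assms])
  show "converges W \<rho> F \<Longrightarrow> converges W \<rho> (- F)"
    unfolding converges_def by (blast intro: weighted_bound_uminus)
  show "converges W \<rho> (fps_const p)" by (rule convergesI[OF weighted_bound_const[OF order_refl]])
  show "converges W \<rho> fps_X" by (rule convergesI[OF weighted_bound_fps_X])
qed

lemma norm_ev_term:
  assumes "within_radii \<sigma> W \<rho> s"
  shows "norm (poly (fps_nth F n) (exp (\<sigma> * s)) * exp ((1 - \<sigma>) * s) ^ n) \<le> pnorm W (fps_nth F n) * \<rho> ^ n"
  using assms within_radii_nonneg[OF assms] unfolding norm_mult norm_power within_radii_def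
  by (intro mult_mono power_mono norm_poly_le_pnorm pnorm_nonneg) (simp_all only: norm_ge_zero zero_le_power)

lemma weighted_bound_summable:
  assumes "W \<ge> 0" "\<rho> \<ge> 0" "weighted_bound W \<rho> F B"
  shows "summable (\<lambda>n. pnorm W (fps_nth F n) * \<rho> ^ n)" "(\<Sum>n. pnorm W (fps_nth F n) * \<rho> ^ n) \<le> B"
proof -
  have nn: "pnorm W (fps_nth F n) * \<rho> ^ n \<ge> 0" for n using assms pnorm_nonneg by simp
  have b: "(\<Sum>i<n. pnorm W (fps_nth F i) * \<rho> ^ i) \<le> B" for n
  proof -
    have "(\<Sum>i<n. pnorm W (fps_nth F i) * \<rho> ^ i) \<le> (\<Sum>i\<le>n. pnorm W (fps_nth F i) * \<rho> ^ i)"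
      using nn by (intro sum_mono2) auto
    then show ?thesis using assms(3) order_trans unfolding weighted_bound_def by blast
  qed
  show "summable (\<lambda>n. pnorm W (fps_nth F n) * \<rho> ^ n)" by (rule summableI_nonneg_bounded[OF nn b])
  then show "(\<Sum>n. pnorm W (fps_nth F n) * \<rho> ^ n) \<le> B" using b by (rule suminf_le_const)
qed

lemma ev_summable:
  assumes "within_radii \<sigma> W \<rho> s" "converges W \<rho> F"
  shows "summable (\<lambda>n. norm (poly (fps_nth F n) (exp (\<sigma> * s)) * exp ((1 - \<sigma>) * s) ^ n))"
proof -
  obtain B where B: "weighted_bound W \<rho> F B" using assms(2) by (auto simp: converges_def)
  show ?thesis
    using norm_ev_term[OF assms(1)] by (intro summable_comparison_test'[OF weighted_bound_summable(1)[OF within_radii_nonneg[OF assms(1)] B]]) auto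
qed

lemma norm_ev_le:
  assumes r: "within_radii \<sigma> W \<rho> s" and B: "weighted_bound W \<rho> F B"
  shows "norm (ev \<sigma> F s) \<le> B"
proof -
  note wn = within_radii_nonneg[OF r]
  have "norm (ev \<sigma> F s) \<le> (\<Sum>n. norm (poly (fps_nth F n) (exp (\<sigma> * s)) * exp ((1 - \<sigma>) * s) ^ n))"
    unfolding ev_def by (rule summable_norm[OF ev_summable[OF r convergesI[OF B]]])
  also have "\<dots> \<le> (\<Sum>n. pnorm W (fps_nth F n) * \<rho> ^ n)"
    by (intro suminf_le norm_ev_term[OF r] ev_summable[OF r convergesI[OF B]] weighted_bound_summable(1)[OF wn B])
  finally show ?thesis using weighted_bound_summable(2)[OF wn B] by linarith
qed

lemma ev_sums:
  assumes "within_radii \<sigma> W \<rho> s" "converges W \<rho> F"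
  shows "(\<lambda>n. poly (fps_nth F n) (exp (\<sigma> * s)) * exp ((1 - \<sigma>) * s) ^ n) sums ev \<sigma> F s"
  unfolding ev_def using summable_norm_cancel[OF ev_summable[OF assms]] by (rule summable_sums)

lemma ev_add:
  assumes "within_radii \<sigma> W \<rho> s" "converges W \<rho> F" "converges W \<rho> G"
  shows "ev \<sigma> (F + G) s = ev \<sigma> F s + ev \<sigma> G s"
proof -
  have "(\<lambda>n. poly (fps_nth (F + G) n) (exp (\<sigma> * s)) * exp ((1 - \<sigma>) * s) ^ n) sums (ev \<sigma> F s + ev \<sigma> G s)"
    using sums_add[OF ev_sums[OF assms(1,2)] ev_sums[OF assms(1,3)]] by (simp add: distrib_right)
  then show ?thesis by (simp add: ev_def sums_iff)
qed

lemma ev_uminus: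
  assumes "within_radii \<sigma> W \<rho> s" "converges W \<rho> F"
  shows "ev \<sigma> (- F) s = - ev \<sigma> F s"
  using sums_minus[OF ev_sums[OF assms]] by (simp add: ev_def sums_iff)

lemma ev_diff:
  assumes "within_radii \<sigma> W \<rho> s" "converges W \<rho> F" "converges W \<rho> G"
  shows "ev \<sigma> (F - G) s = ev \<sigma> F s - ev \<sigma> G s"
  using ev_add[OF assms(1,2) converges_rules(4)[OF within_radii_nonneg[OF assms(1)] assms(3)]] ev_uminus[OF assms(1,3)] by simp

lemma ev_mult:
  assumes r: "within_radii \<sigma> W \<rho> s" and "converges W \<rho> F" "converges W \<rho> G"
  shows "ev \<sigma> (F * G) s = ev \<sigma> F s * ev \<sigma> G s"
proof -
  let ?w = "exp (\<sigma> * s)" and ?v = "exp ((1 - \<sigma>) * s)"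
  have t: "(\<Sum>i\<le>n. (poly (fps_nth F i) ?w * ?v ^ i) * (poly (fps_nth G (n - i)) ?w * ?v ^ (n - i)))
      = poly (fps_nth (F * G) n) ?w * ?v ^ n" for n
  proof -
    have "(\<Sum>i\<le>n. (poly (fps_nth F i) ?w * ?v ^ i) * (poly (fps_nth G (n - i)) ?w * ?v ^ (n - i)))
       = (\<Sum>i\<le>n. poly (fps_nth F i) ?w * poly (fps_nth G (n - i)) ?w * ?v ^ n)"
    proof (rule sum.cong[OF refl])
      fix i assume "i \<in> {..n}"
      then have "?v ^ n = ?v ^ i * ?v ^ (n - i)" by (simp flip: power_add)
      then show "(poly (fps_nth F i) ?w * ?v ^ i) * (poly (fps_nth G (n - i)) ?w * ?v ^ (n - i))
        = poly (fps_nth F i) ?w * poly (fps_nth G (n - i)) ?w * ?v ^ n" by (simp only: mult_ac)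
    qed
    then show ?thesis by (simp add: fps_mult_nth poly_sum sum_distrib_right atLeast0AtMost)
  qed
  show ?thesis
    using Cauchy_product_sums[OF ev_summable[OF r assms(2)] ev_summable[OF r assms(3)]]
    by (simp add: ev_def t sums_iff)
qed

lemma ev_const: "ev \<sigma> (fps_const p) s = poly p (exp (\<sigma> * s))"
proof -
  have "(\<lambda>n. poly (fps_nth (fps_const p) n) (exp (\<sigma> * s)) * exp ((1 - \<sigma>) * s) ^ n) = (\<lambda>n. if n = 0 then poly p (exp (\<sigma> * s)) else 0)"
    by auto
  then show ?thesis using sums_single[of 0 "\<lambda>n. poly p (exp (\<sigma> * s))"] unfolding ev_def by (simp add: sums_iff)
qed

lemma ev_X: "ev \<sigma> fps_X s = exp ((1 - \<sigma>) * s)"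
proof -
  have "(\<lambda>n. poly (fps_nth fps_X n) (exp (\<sigma> * s)) * exp ((1 - \<sigma>) * s) ^ n) = (\<lambda>n. if n = 1 then exp ((1 - \<sigma>) * s) else 0)"
    by (auto simp: fps_X_def)
  then show ?thesis using sums_single[of 1 "\<lambda>n. exp ((1 - \<sigma>) * s)"] unfolding ev_def by (simp add: sums_iff)
qed

text \<open>Without a constant term every summand contains a factor \<open>v\<close>; passing from
  \<open>\<rho>\<close> to the actual modulus of \<open>v\<close> gains their quotient. All
  estimates of order \<open>x\<close> stem from this.\<close>

lemma norm_ev_vanishing:
  assumes r: "within_radii \<sigma> W \<rho> s" and B: "weighted_bound W \<rho> F B" and F0: "fps_nth F 0 = 0" and \<rho>: "\<rho> > 0"
  shows "norm (ev \<sigma> F s) \<le> B * (norm (exp ((1 - \<sigma>) * s)) / \<rho>)"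
proof -
  note wn = within_radii_nonneg[OF r]
  let ?v = "norm (exp ((1 - \<sigma>) * s))"
  note S = weighted_bound_summable[OF wn B]
  have v: "?v / \<rho> \<le> 1" "?v / \<rho> \<ge> 0" using r \<rho> by (auto simp: within_radii_def)
  have "norm (poly (fps_nth F n) (exp (\<sigma> * s)) * exp ((1 - \<sigma>) * s) ^ n) \<le> (pnorm W (fps_nth F n) * \<rho> ^ n) * (?v / \<rho>)" for n
  proof (cases n)
    case 0 then show ?thesis using F0 by simp
  next
    case (Suc m)
    have "norm (poly (fps_nth F n) (exp (\<sigma> * s)) * exp ((1 - \<sigma>) * s) ^ n) \<le> pnorm W (fps_nth F n) * ?v ^ n"
      using r unfolding norm_mult norm_power within_radii_def
      by (intro mult_right_mono norm_poly_le_pnorm) auto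
    also have "?v ^ n = \<rho> ^ n * (?v / \<rho>) ^ n" using \<rho> by (simp add: power_divide)
    also have "(?v / \<rho>) ^ n \<le> ?v / \<rho>" using power_decreasing[OF _ v(2,1), of 1 n] Suc by simp
    finally show ?thesis using wn pnorm_nonneg[OF wn(1)] by (simp add: mult.assoc mult_left_mono)
  qed
  then have "(\<Sum>n. norm (poly (fps_nth F n) (exp (\<sigma> * s)) * exp ((1 - \<sigma>) * s) ^ n)) \<le> (\<Sum>n. (pnorm W (fps_nth F n) * \<rho> ^ n) * (?v / \<rho>))"
    by (intro suminf_le ev_summable[OF r convergesI[OF B]] summable_mult2 S(1))
  also have "\<dots> = (\<Sum>n. pnorm W (fps_nth F n) * \<rho> ^ n) * (?v / \<rho>)" by (rule suminf_mult2[OF S(1), symmetric])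
  also have "\<dots> \<le> B * (?v / \<rho>)" by (intro mult_right_mono S(2) v(2))
  finally show ?thesis using summable_norm[OF ev_summable[OF r convergesI[OF B]]] unfolding ev_def by linarith
qed

text \<open>The monomial \<open>v^n * w^k\<close> is an exponential in \<open>s\<close> with the
  exponent \<open>n * (1 - \<sigma>) + k * \<sigma>\<close>, which is how \<open>log_deriv\<close>
  acts. Convergence is assumed for \<open>F\<close> alone: for a dominated series of holomorphic
  functions that of the derived series follows.\<close>

lemma ev_has_derivative:
  assumes op: "open S" and r: "\<And>s. s \<in> S \<Longrightarrow> within_radii \<sigma> W \<rho> s" and F: "converges W \<rho> F" and s: "s \<in> S"
  shows "(ev \<sigma> F has_field_derivative ev \<sigma> (log_deriv \<sigma> F) s) (at s)"
proof -
  obtain B where B: "weighted_bound W \<rho> F B" using F by (auto simp: converges_def)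
  let ?f = "\<lambda>F n s. poly (fps_nth F n) (exp (\<sigma> * s)) * exp ((1 - \<sigma>) * s) ^ n"
  have d: "(?f F n has_field_derivative ?f (log_deriv \<sigma> F) n s) (at s)" for n s
  proof -
    define N where "N = degree (fps_nth F n)"
    let ?c = "\<lambda>k. of_nat n * (1 - \<sigma>) + of_nat k * \<sigma>"
    have mono: "exp (\<sigma> * s) ^ k * exp ((1 - \<sigma>) * s) ^ n = exp (?c k * s)" for k s
      by (simp add: exp_of_nat_mult[symmetric] exp_add[symmetric] algebra_simps)
    have e: "?f G n s = (\<Sum>k\<le>N. coeff (fps_nth G n) k * exp (?c k * s))" if "degree (fps_nth G n) \<le> N" for G s
    proof -
      have "poly (fps_nth G n) z = (\<Sum>k\<le>N. coeff (fps_nth G n) k * z ^ k)" for z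
        unfolding poly_altdef using that by (intro sum.mono_neutral_left) (auto simp: coeff_eq_0)
      then show ?thesis by (simp add: sum_distrib_right mult.assoc mono)
    qed
    have dg: "degree (fps_nth (log_deriv \<sigma> F) n) \<le> N"
      by (rule degree_le) (auto simp: coeff_log_deriv N_def coeff_eq_0)
    have "((\<lambda>s. \<Sum>k\<le>N. coeff (fps_nth F n) k * exp (?c k * s)) has_field_derivative
        (\<Sum>k\<le>N. coeff (fps_nth F n) k * (exp (?c k * s) * ?c k))) (at s)"
      by (intro DERIV_sum DERIV_cmult) (auto intro!: derivative_eq_intros)
    also have "(\<Sum>k\<le>N. coeff (fps_nth F n) k * (exp (?c k * s) * ?c k)) = ?f (log_deriv \<sigma> F) n s"
      by (subst e[OF dg]) (simp add: coeff_log_deriv mult_ac)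
    finally show ?thesis using e[of F] by (simp add: N_def)
  qed
  have "\<exists>g g'. \<forall>x\<in>S. (\<lambda>n. ?f F n x) sums g x \<and> (\<lambda>n. ?f (log_deriv \<sigma> F) n x) sums g' x \<and> (g has_field_derivative g' x) (at x)"
  proof (rule series_and_derivative_comparison_complex[OF op, of "?f F" "?f (log_deriv \<sigma> F)"])
    fix x assume x: "x \<in> S"
    note wn = within_radii_nonneg[OF r[OF x]]
    have "\<forall>\<^sub>F n in sequentially. \<forall>y\<in>ball x 1 \<inter> S. norm (?f F n y) \<le> norm (complex_of_real (pnorm W (fps_nth F n) * \<rho> ^ n))"
      unfolding norm_of_real
      by (intro always_eventually allI ballI order_trans[OF norm_ev_term[OF r] abs_ge_self]) blast
    moreover have "summable (\<lambda>n. complex_of_real (pnorm W (fps_nth F n) * \<rho> ^ n))"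
      by (rule summable_of_real[OF weighted_bound_summable(1)[OF wn B]])
    moreover have "range (\<lambda>n. complex_of_real (pnorm W (fps_nth F n) * \<rho> ^ n)) \<subseteq> \<real>\<^sub>\<ge>\<^sub>0"
      using wn pnorm_nonneg[OF wn(1)] by auto
    ultimately show "\<exists>d (h :: nat \<Rightarrow> complex). 0 < d \<and> summable h \<and> range h \<subseteq> \<real>\<^sub>\<ge>\<^sub>0 \<and> (\<forall>\<^sub>F n in sequentially. \<forall>y\<in>ball x d \<inter> S. norm (?f F n y) \<le> norm (h n))"
      by - (rule exI[of _ "1::real"], rule exI[of _ "\<lambda>n. complex_of_real (pnorm W (fps_nth F n) * \<rho> ^ n)"], intro conjI zero_less_one)
  qed (use d in simp)
  then obtain g g' where g: "\<forall>x\<in>S. (\<lambda>n. ?f F n x) sums g x \<and> (\<lambda>n. ?f (log_deriv \<sigma> F) n x) sums g' x \<and> (g has_field_derivative g' x) (at x)"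
    by blast
  have eq: "ev \<sigma> F x = g x" "ev \<sigma> (log_deriv \<sigma> F) x = g' x" if "x \<in> S" for x
    using g that by (auto simp: ev_def sums_iff)
  have "(g has_field_derivative ev \<sigma> (log_deriv \<sigma> F) s) (at s)" using g s eq by simp
  then show ?thesis
    by (rule has_field_derivative_transform_within_open[OF _ op s]) (use eq in simp)
qed

section \<open>The series of the PVI solution\<close>

text \<open>Each power of \<open>v\<close> raises the allowed degree by 2.\<close>

lemma degree_bound_fps_X_mult:
  assumes "degree_bound 2 F" shows "degree_bound 0 (fps_X * F)"
  unfolding degree_bound_def
proof
  fix n
  show "degree (fps_nth (fps_X * F) n) \<le> 2 * n + 0"
  proof (cases n)
    case (Suc m)
    then show ?thesis using assms[unfolded degree_bound_def, rule_format, of m] by simp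
  qed simp
qed

text \<open>\<open>series_a0\<close> and \<open>series_a1\<close> are the entries 12 of \<open>w * A0\<close> and of \<open>A1\<close> in the original basis, and
  \<open>1 - series_g\<close> is the denominator $x(A_0 + A_1)_{12} - (A_1)_{12}$ of $y$.\<close>

definition series_a0 :: "complex \<Rightarrow> (nat \<Rightarrow> complex poly fps) \<Rightarrow> complex poly fps" where
  "series_a0 \<sigma> F = cst (1 / \<sigma>) * (cst 2 * F 3 + F 5 - F 4)"

definition series_a1 :: "complex \<Rightarrow> (nat \<Rightarrow> complex poly fps) \<Rightarrow> complex poly fps" where
  "series_a1 \<sigma> F = cst (1 / \<sigma>) * (F 1 - cst 2 * F 0 - F 2) - cst 1"

definition series_g :: "complex \<Rightarrow> (nat \<Rightarrow> complex poly fps) \<Rightarrow> complex poly fps" where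
  "series_g \<sigma> F = (series_a1 \<sigma> F + cst 1) - fps_X * (w_var * series_a1 \<sigma> F) - fps_X * series_a0 \<sigma> F"

text \<open>The equation \<open>y * (1 - series_g) = series_a0\<close> is solved by iteration;
  \<open>y\<close> stands for \<open>w / x\<close> times the PVI solution. \<open>series_g\<close>
  has no constant term, which makes the iteration a formal contraction, and its bound 1/2 makes the
  result converge.\<close>

theorem formal_y_exists:
  fixes F :: "nat \<Rightarrow> complex poly fps"
  assumes F0: "\<forall>i<3. fps_nth (F i) 0 = 0 \<and> degree_bound 0 (F i)" and F3: "\<forall>i\<in>{3,4,5}. degree_bound 2 (F i)"
    and bd: "\<forall>W\<ge>1. \<exists>K\<ge>1. \<forall>\<eta>>0. \<exists>\<rho>>0. \<rho> \<le> \<eta> \<and> \<rho> * W \<le> 1/2 \<and>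
       (\<forall>i<3. weighted_bound W \<rho> (F i) \<eta>) \<and> (\<forall>i\<in>{3,4,5}. weighted_bound W \<rho> (F i) K)"
    and \<sigma>: "\<sigma> \<noteq> 0"
  shows "\<exists>y. y = series_a0 \<sigma> F + series_g \<sigma> F * y \<and> fps_nth y 0 = fps_nth (series_a0 \<sigma> F) 0 \<and> degree_bound 2 y \<and>
    (\<forall>W\<ge>1. \<exists>K\<ge>1. \<forall>\<eta>>0. \<exists>\<rho>>0. \<rho> * W \<le> 1/2 \<and>
       (\<forall>i<3. weighted_bound W \<rho> (F i) \<eta>) \<and> (\<forall>i\<in>{3,4,5}. weighted_bound W \<rho> (F i) K) \<and>
       weighted_bound W \<rho> y K \<and> weighted_bound W \<rho> (series_g \<sigma> F) (1/2))"
proof -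
  let ?a = "series_a0 \<sigma> F" and ?g = "series_g \<sigma> F"
  have f: "fps_nth (F 0) 0 = 0" "fps_nth (F 1) 0 = 0" "fps_nth (F 2) 0 = 0"
    "degree_bound 0 (F 0)" "degree_bound 0 (F 1)" "degree_bound 0 (F 2)" using F0 by auto
  have f': "degree_bound 2 (F 3)" "degree_bound 2 (F 4)" "degree_bound 2 (F 5)" using F3 by auto
  have cd: "degree_bound 0 (cst c)" for c by (rule degree_bound_const) simp
  have m2: "degree_bound 2 (A * B)" if "degree_bound 0 A" "degree_bound 2 B" for A B
    using degree_bound_mult[OF that] by (simp only: add_0)
  have m0: "degree_bound 0 (A * B)" if "degree_bound 0 A" "degree_bound 0 B" for A B
    using degree_bound_mult[OF that] by (simp only: add_0)
  have da0: "degree_bound 2 ?a" unfolding series_a0_def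
    by (intro m2 cd degree_bound_diff degree_bound_add f')
  have da1: "degree_bound 0 (series_a1 \<sigma> F)" unfolding series_a1_def
    by (intro m0 cd degree_bound_diff degree_bound_add f)
  have "degree_bound 2 (w_var * series_a1 \<sigma> F)"
    by (rule degree_bound_mono[OF degree_bound_mult[OF degree_bound_const[of "[:0,1:]" 1] da1]]) auto
  then have dg: "degree_bound 0 ?g" unfolding series_g_def
    by (intro degree_bound_diff degree_bound_add da1 cd degree_bound_fps_X_mult da0)
  \<comment> \<open>The added 1 cancels the limit -1 of the entry 12 of \<open>A1\<close>.\<close>
  have a10: "fps_nth (series_a1 \<sigma> F + cst 1) 0 = 0"
    using f by (simp add: series_a1_def)
  then have g0: "fps_nth ?g 0 = 0" unfolding series_g_def by (simp only: fps_sub_nth fps_X_mult_nth) simp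
  define \<Phi> where "\<Phi> = (\<lambda>(G :: unit \<Rightarrow> complex poly fps) (_::unit). ?a + ?g * G ())"
  have "eq_below (Suc n) (\<Phi> G i) (\<Phi> H i)" if "\<And>i. eq_below n (G i) (H i)" for n G H i
    unfolding \<Phi>_def by (intro eq_below_add eq_below_refl eq_below_mult_zero[OF eq_below_refl g0 that])
  then obtain Z where Z: "\<Phi> Z = Z" and app: "\<And>n. \<exists>k. \<forall>i. eq_below n (Z i) ((\<Phi> ^^ k) (\<lambda>_. 0) i)"
    using fps_fixed_point[of \<Phi> "\<lambda>_. 0"] by metis
  define y where "y = Z ()"
  have y: "y = ?a + ?g * y" using fun_cong[OF Z, of "()"] by (simp add: \<Phi>_def y_def)
  have inv: "I y" if c: "\<And>G. (\<And>n. \<exists>H. eq_below n G H \<and> I H) \<Longrightarrow> I G" and s: "\<And>G. I G \<Longrightarrow> I (?a + ?g * G)" and z: "I 0"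
    for I :: "complex poly fps \<Rightarrow> bool"
  proof (rule c)
    fix n
    obtain k where k: "eq_below n y ((\<Phi> ^^ k) (\<lambda>_. 0) ())" using app unfolding y_def by blast
    moreover have "I ((\<Phi> ^^ k) (\<lambda>_. 0) ())" by (induction k) (auto simp: z \<Phi>_def intro: s)
    ultimately show "\<exists>H. eq_below n y H \<and> I H" by blast
  qed
  have "degree_bound 2 y"
  proof (rule inv)
    show "degree_bound 2 G" if "\<And>n. \<exists>H. eq_below n G H \<and> degree_bound 2 H" for G
      by (rule degree_bound_eq_below[OF that])
  qed (auto intro: degree_bound_add da0 m2[OF dg] simp: degree_bound_def[of 2 0])
  moreover have "fps_nth y 0 = fps_nth ?a 0" by (subst y) (simp add: g0)
  moreover have "\<exists>K\<ge>1. \<forall>\<eta>>0. \<exists>\<rho>>0. \<rho> * W \<le> 1/2 \<and>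
       (\<forall>i<3. weighted_bound W \<rho> (F i) \<eta>) \<and> (\<forall>i\<in>{3,4,5}. weighted_bound W \<rho> (F i) K) \<and>
       weighted_bound W \<rho> y K \<and> weighted_bound W \<rho> ?g (1/2)" if W: "W \<ge> 1" for W
  proof -
    obtain K where K: "K \<ge> 1" and bK: "\<And>\<eta>. \<eta> > 0 \<Longrightarrow> \<exists>\<rho>>0. \<rho> \<le> \<eta> \<and> \<rho> * W \<le> 1/2 \<and>
       (\<forall>i<3. weighted_bound W \<rho> (F i) \<eta>) \<and> (\<forall>i\<in>{3,4,5}. weighted_bound W \<rho> (F i) K)"
      using bd W by blast
    define S where "S = norm \<sigma>"
    have S: "S > 0" using \<sigma> by (simp add: S_def)
    have nS: "norm (1 / \<sigma>) = 1 / S" by (simp add: S_def norm_divide)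
    \<comment> \<open>\<open>4 * K / S\<close> bounds \<open>series_a0\<close>, and the factor 2 is
      the geometric sum with ratio 1/2; adding \<open>K\<close> lets the same constant bound the
      \<open>F i\<close>.\<close>
    define K' where "K' = K + 2 * (1 / S * (4 * K))"
    show ?thesis
    proof (rule exI[of _ K'], rule conjI, use K S in \<open>simp add: K'_def add_increasing2\<close>, intro allI impI)
      fix \<eta>0 :: real assume \<eta>0: "\<eta>0 > 0"
      \<comment> \<open>Chosen to make each of the three parts of \<open>series_g\<close> at most
        1/8.\<close>
      define \<eta> where "\<eta> = min \<eta>0 (min (S / 32) (min (1 / (16 * W)) (S / (32 * K))))"
      have \<eta>: "\<eta> > 0" "\<eta> \<le> \<eta>0" "1 / S * (4 * \<eta>) \<le> 1/8" "\<eta> * W \<le> 1/16" "\<eta> * (1 / S * (4 * K)) \<le> 1/8"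
      proof -
        show "\<eta> > 0" "\<eta> \<le> \<eta>0" using \<eta>0 S W K by (auto simp: \<eta>_def)
        have "\<eta> \<le> S / 32" "\<eta> \<le> 1 / (16 * W)" "\<eta> \<le> S / (32 * K)" by (auto simp: \<eta>_def)
        then show "1 / S * (4 * \<eta>) \<le> 1/8" "\<eta> * W \<le> 1/16" "\<eta> * (1 / S * (4 * K)) \<le> 1/8" using S W K by (auto simp: field_simps)
      qed
      obtain \<rho> where \<rho>: "\<rho> > 0" "\<rho> \<le> \<eta>" "\<rho> * W \<le> 1/2" and l: "\<And>i. i < 3 \<Longrightarrow> weighted_bound W \<rho> (F i) \<eta>"
        and P: "\<And>i. i \<in> {3,4,5} \<Longrightarrow> weighted_bound W \<rho> (F i) K" using bK[OF \<eta>(1)] by blast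
      have W0: "W \<ge> 0" and \<rho>0: "\<rho> \<ge> 0" using W \<rho> by auto
      note add = weighted_bound_add[OF W0 \<rho>0] and diff = weighted_bound_diff[OF W0 \<rho>0] and mult = weighted_bound_mult[OF W0 \<rho>0]
      have l': "weighted_bound W \<rho> (F 0) \<eta>" "weighted_bound W \<rho> (F 1) \<eta>" "weighted_bound W \<rho> (F 2) \<eta>" by (rule l, simp)+
      have P': "weighted_bound W \<rho> (F 3) K" "weighted_bound W \<rho> (F 4) K" "weighted_bound W \<rho> (F 5) K" by (rule P, simp)+
      have c: "weighted_bound W \<rho> (cst z) (norm z)" for z by (rule weighted_bound_const) simp
      have n2: "norm (2::complex) = 2" by simp
      have ba0: "weighted_bound W \<rho> ?a (1 / S * (4 * K))"
        unfolding series_a0_def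
        by (rule weighted_bound_mono[OF mult[OF c diff[OF add[OF mult[OF c P'(1)] P'(3)] P'(2)]]]) (simp add: nS)
      have ba1: "weighted_bound W \<rho> (series_a1 \<sigma> F + cst 1) (1/8)"
      proof -
        have "weighted_bound W \<rho> (cst (1 / \<sigma>) * (F 1 - cst 2 * F 0 - F 2)) (1 / S * (4 * \<eta>))"
          by (rule weighted_bound_mono[OF mult[OF c diff[OF diff[OF l'(2) mult[OF c l'(1)]] l'(3)]]]) (simp add: nS)
        then show ?thesis unfolding series_a1_def using weighted_bound_mono[OF _ \<eta>(3)] by simp
      qed
      have ba: "weighted_bound W \<rho> (series_a1 \<sigma> F) 2"
        using weighted_bound_mono[OF diff[OF ba1 c[of 1]], of 2] by simp
      have wv: "weighted_bound W \<rho> w_var W" by (rule weighted_bound_const) simp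
      have X: "weighted_bound W \<rho> fps_X \<rho>" using weighted_bound_fps_X[of W \<rho>] \<rho>0 by simp
      have bg: "weighted_bound W \<rho> ?g (1/2)" unfolding series_g_def
      proof (rule weighted_bound_mono[OF diff[OF diff[OF ba1 mult[OF X mult[OF wv ba]]] mult[OF X ba0]]])
        have "\<rho> * (W * 2) \<le> 1/8" using mult_right_mono[OF \<rho>(2) W0] \<eta>(4) by linarith
        moreover have "\<rho> * (1 / S * (4 * K)) \<le> 1/8"
        proof -
          have "1 / S * (4 * K) \<ge> 0" using S K by simp
          from mult_right_mono[OF \<rho>(2) this] \<eta>(5) show ?thesis by linarith
        qed
        ultimately show "1/8 + \<rho> * (W * 2) + \<rho> * (1 / S * (4 * K)) \<le> 1/2" by linarith
      qed
      have "weighted_bound W \<rho> y (2 * (1 / S * (4 * K)))"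
      proof (rule inv)
        show "weighted_bound W \<rho> G (2 * (1 / S * (4 * K)))" if "\<And>n. \<exists>H. eq_below n G H \<and> weighted_bound W \<rho> H (2 * (1 / S * (4 * K)))" for G
          by (rule weighted_bound_eq_below[OF that])
        show "weighted_bound W \<rho> (?a + ?g * G) (2 * (1 / S * (4 * K)))" if "weighted_bound W \<rho> G (2 * (1 / S * (4 * K)))" for G
          using add[OF ba0 mult[OF bg that]] by simp
        show "weighted_bound W \<rho> 0 (2 * (1 / S * (4 * K)))" using K S by (simp add: weighted_bound_def)
      qed
      then have "weighted_bound W \<rho> y K'" by (rule weighted_bound_mono) (use K in \<open>simp add: K'_def\<close>)
      moreover have "K \<le> K'" using K S by (simp add: K'_def)
      ultimately show "\<exists>\<rho>>0. \<rho> * W \<le> 1/2 \<and> (\<forall>i<3. weighted_bound W \<rho> (F i) \<eta>0) \<and> (\<forall>i\<in>{3,4,5}. weighted_bound W \<rho> (F i) K') \<and>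
         weighted_bound W \<rho> y K' \<and> weighted_bound W \<rho> ?g (1/2)"
        using \<rho> bg weighted_bound_mono[OF l \<eta>(2)] weighted_bound_mono[OF P, of _ K'] by blast
    qed
  qed
  ultimately show ?thesis using y by blast
qed

section \<open>Schlesinger systems in a fixed basis\<close>

lemma eigenvalues_traceless:
  assumes "trace X = 0" shows "eigenvalues X = {c. c^2 = - det X}"
proof -
  have "(\<exists>v. v \<noteq> 0 \<and> X *v v = c *s v) \<longleftrightarrow> c^2 = - det X" for c
  proof -
    define M where "M = X - mat c"
    have "(X *v v = c *s v) \<longleftrightarrow> M *v v = 0" for v
    proof -
      have "mat c *v v = c *s v"
        by (simp add: vec_eq_iff forall_2 matrix_vector_mult_def mat_def sum_2)
      then show ?thesis by (simp add: M_def matrix_vector_mult_diff_rdistrib)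
    qed
    then have "(\<exists>v. v \<noteq> 0 \<and> X *v v = c *s v) \<longleftrightarrow> \<not> invertible M"
      by (auto simp: invertible_left_inverse matrix_left_invertible_ker)
    also have "\<dots> \<longleftrightarrow> det M = 0" by (simp add: invertible_det_nz)
    also have "det M = c^2 + det X"
    proof -
      have "X $ 2 $ 2 = - X $ 1 $ 1" using assms by (simp add: trace_2 add_eq_0_iff)
      then show ?thesis by (simp add: M_def det_2 mat_def power2_eq_square algebra_simps)
    qed
    finally show ?thesis by (simp add: eq_neg_iff_add_eq_0)
  qed
  then show ?thesis by (simp add: eigenvalues_def)
qed

text \<open>The spectrum of a traceless matrix is the set of square roots of \<open>- det X\<close>,
  so the eigenvalue condition amounts to one equation, also for \<open>\<theta> = 0\<close>.\<close>

lemma eigenvalues_half_iff: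
  assumes "trace X = 0" shows "eigenvalues X = {\<theta>/2, - \<theta>/2} \<longleftrightarrow> - det X = (\<theta>/2)^2"
proof
  assume "eigenvalues X = {\<theta>/2, - \<theta>/2}"
  then have "\<theta>/2 \<in> {c. c^2 = - det X}" using eigenvalues_traceless[OF assms] by blast
  then show "- det X = (\<theta>/2)^2" by simp
next
  assume "- det X = (\<theta>/2)^2"
  then show "eigenvalues X = {\<theta>/2, - \<theta>/2}"
    unfolding eigenvalues_traceless[OF assms] by (auto simp: power2_eq_iff)
qed

section \<open>Sectors and first integrals\<close>

lemma log_sector_props:
  shows "open (log_sector \<epsilon> \<Theta>)" "convex (log_sector \<epsilon> \<Theta>)" "connected (log_sector \<epsilon> \<Theta>)"
proof -
  have e: "log_sector \<epsilon> \<Theta> = {s. Re s < ln \<epsilon>} \<inter> {s. Im s < \<Theta>} \<inter> {s. Im s > - \<Theta>}"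
    by (auto simp: log_sector_def)
  show "open (log_sector \<epsilon> \<Theta>)" unfolding e
    by (intro open_Int open_halfspace_Re_lt open_halfspace_Im_lt open_halfspace_Im_gt)
  show c: "convex (log_sector \<epsilon> \<Theta>)" unfolding e
    by (intro convex_Int convex_halfspace_Re_lt convex_halfspace_Im_lt convex_halfspace_Im_gt)
  show "connected (log_sector \<epsilon> \<Theta>)" by (rule convex_connected[OF c])
qed

lemma log_sector_norm_exp:
  assumes "\<epsilon> > 0" "s \<in> log_sector \<epsilon> \<Theta>" shows "norm (exp s) < \<epsilon>"
proof -
  have "Re s < ln \<epsilon>" using assms by (simp add: log_sector_def)
  then have "exp (Re s) < exp (ln \<epsilon>)" by (simp only: exp_less_cancel_iff)
  then show ?thesis using assms by (simp add: norm_exp_eq_Re)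
qed

lemma log_sector_real:
  assumes "\<Theta> > 0" "t < ln \<epsilon>" shows "of_real t \<in> log_sector \<epsilon> \<Theta>"
  using assms by (simp add: log_sector_def)

text \<open>The sector contains points with arbitrarily small \<open>exp s\<close>, so a constant of
  that order is zero.\<close>

lemma zero_of_exp_bound:
  assumes "\<Theta> > 0" "\<And>s. s \<in> log_sector \<epsilon> \<Theta> \<Longrightarrow> norm c \<le> C * norm (exp s)"
  shows "c = 0"
proof (rule ccontr)
  assume c: "c \<noteq> 0"
  define t where "t = min (ln \<epsilon> - 1) (ln (norm c / (2 * (\<bar>C\<bar> + 1))))"
  have "norm c \<le> C * norm (exp (complex_of_real t))"
    by (rule assms(2)) (intro log_sector_real assms(1), simp add: t_def)
  also have "\<dots> \<le> \<bar>C\<bar> * exp t" by (simp add: norm_exp_eq_Re mult_right_mono)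
  also have "exp t \<le> exp (ln (norm c / (2 * (\<bar>C\<bar> + 1))))" by (simp add: t_def)
  also have "\<dots> = norm c / (2 * (\<bar>C\<bar> + 1))" using c by (subst exp_ln) (auto intro!: divide_pos_pos)
  also have "\<bar>C\<bar> * (norm c / (2 * (\<bar>C\<bar> + 1))) \<le> norm c / 2" by (simp add: field_simps)
  finally show False using c by (simp add: mult_left_mono)
qed

text \<open>The function is constant on the convex sector, and its limit at \<open>x = 0\<close>
  identifies the constant.\<close>

lemma first_integral_value:
  fixes N :: "complex \<Rightarrow> complex"
  assumes \<Theta>: "\<Theta> > 0" and d: "\<And>s. s \<in> log_sector \<epsilon> \<Theta> \<Longrightarrow> (N has_field_derivative 0) (at s)"
    and b: "\<And>s. s \<in> log_sector \<epsilon> \<Theta> \<Longrightarrow> norm (N s - l) \<le> C * norm (exp s)" and s: "s \<in> log_sector \<epsilon> \<Theta>"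
  shows "N s = l"
proof -
  obtain c where c: "\<And>s. s \<in> log_sector \<epsilon> \<Theta> \<Longrightarrow> N s = c"
    using has_field_derivative_zero_constant[OF log_sector_props(2), of \<epsilon> \<Theta> N] d has_field_derivative_at_within by blast
  have "c - l = 0" by (rule zero_of_exp_bound[OF \<Theta>]) (use b c in auto)
  then show ?thesis using c[OF s] by simp
qed

text \<open>The matrix \<open>[[p, q], [r, -p]]\<close> conjugated by \<open>[[1, 1], [g1, g2]]\<close>.\<close>

definition conj_mat :: "complex \<Rightarrow> complex \<Rightarrow> complex \<Rightarrow> complex \<Rightarrow> complex \<Rightarrow> complex^2^2" where
  "conj_mat g1 g2 p q r = (\<chi> i j.
     if i = 1 \<and> j = 1 then ((p + r) * g2 - (q - p) * g1) / (g2 - g1)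
     else if i = 1 then (q - 2 * p - r) / (g2 - g1)
     else if j = 1 then ((g1 * p + g2 * r) * g2 - (g1 * q - g2 * p) * g1) / (g2 - g1)
     else - (((p + r) * g2 - (q - p) * g1) / (g2 - g1)))"

lemma conj_mat_nth:
  "conj_mat g1 g2 p q r $ 1 $ 1 = ((p + r) * g2 - (q - p) * g1) / (g2 - g1)"
  "conj_mat g1 g2 p q r $ 1 $ 2 = (q - 2 * p - r) / (g2 - g1)"
  "conj_mat g1 g2 p q r $ 2 $ 1 = ((g1 * p + g2 * r) * g2 - (g1 * q - g2 * p) * g1) / (g2 - g1)"
  "conj_mat g1 g2 p q r $ 2 $ 2 = - (((p + r) * g2 - (q - p) * g1) / (g2 - g1))"
  by (simp_all add: conj_mat_def)

text \<open>Conjugation respects commutators; therefore the matrix equations can be treated as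
  equations for triples in the eigenbasis.\<close>

lemma commutator_conj_mat:
  assumes "g1 \<noteq> g2"
  shows "commutator (conj_mat g1 g2 p q r) (conj_mat g1 g2 p' q' r') =
    conj_mat g1 g2 (q * r' - q' * r) (2 * (p * q' - q * p')) (2 * (r * p' - p * r'))"
proof -
  have ne: "g2 - g1 \<noteq> 0" using assms by simp
  have quot: "a / (g2 - g1) * (b / (g2 - g1)) - a' / (g2 - g1) * (b' / (g2 - g1)) + (c / (g2 - g1) * (d / (g2 - g1)) - c' / (g2 - g1) * (d' / (g2 - g1))) = e / (g2 - g1)"
    if "a * b - a' * b' + (c * d - c' * d') = e * (g2 - g1)" for a b a' b' c d c' d' e
  proof -
    have "a / (g2 - g1) * (b / (g2 - g1)) - a' / (g2 - g1) * (b' / (g2 - g1)) + (c / (g2 - g1) * (d / (g2 - g1)) - c' / (g2 - g1) * (d' / (g2 - g1)))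
      = (a * b - a' * b' + (c * d - c' * d')) / ((g2 - g1) * (g2 - g1))"
      by (simp add: add_divide_distrib diff_divide_distrib)
    also have "\<dots> = e / (g2 - g1)" unfolding that using ne by simp
    finally show ?thesis .
  qed
  note neg = minus_divide_left
  show ?thesis
    unfolding vec_eq_iff forall_2 commutator_nth conj_mat_nth neg
    by (intro conjI quot; algebra)
qed

lemma det_conj_mat:
  assumes "g1 \<noteq> g2" shows "det (conj_mat g1 g2 p q r) = - (p^2 + q * r)"
proof -
  have ne: "g2 - g1 \<noteq> 0" using assms by simp
  have "det (conj_mat g1 g2 p q r) = (((p + r) * g2 - (q - p) * g1) * - ((p + r) * g2 - (q - p) * g1) -
      (q - 2 * p - r) * ((g1 * p + g2 * r) * g2 - (g1 * q - g2 * p) * g1)) / ((g2 - g1) * (g2 - g1))"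
    by (simp only: det_2 conj_mat_nth minus_divide_left times_divide_times_eq diff_divide_distrib[symmetric])
  also have "((p + r) * g2 - (q - p) * g1) * - ((p + r) * g2 - (q - p) * g1) -
      (q - 2 * p - r) * ((g1 * p + g2 * r) * g2 - (g1 * q - g2 * p) * g1) = - (p^2 + q * r) * ((g2 - g1) * (g2 - g1))"
    by algebra
  finally show ?thesis using ne by simp
qed

lemma trace_conj_mat: "trace (conj_mat g1 g2 p q r) = 0"
  by (simp add: trace_2 conj_mat_nth)

lemma conj_mat_add: "conj_mat g1 g2 p q r + conj_mat g1 g2 p' q' r' = conj_mat g1 g2 (p + p') (q + q') (r + r')"
  unfolding vec_eq_iff forall_2 vector_add_component conj_mat_nth
    minus_divide_left add_divide_distrib[symmetric]
  by (intro conjI arg_cong[where f = "\<lambda>u. u / (g2 - g1)"]) (simp_all add: algebra_simps)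

lemma conj_mat_scale: "c * conj_mat g1 g2 p q r $ i $ j = conj_mat g1 g2 (c * p) (c * q) (c * r) $ i $ j"
  using exhaust_2[of i] exhaust_2[of j] by (auto simp: conj_mat_nth algebra_simps)

lemma conj_mat_bound: "\<exists>\<kappa>\<ge>0. \<forall>p q r i j. norm (conj_mat g1 g2 p q r $ i $ j) \<le> \<kappa> * (norm p + norm q + norm r)"
proof -
  define c where "c = (\<lambda>i j. norm (conj_mat g1 g2 1 0 0 $ i $ j) + norm (conj_mat g1 g2 0 1 0 $ i $ j) + norm (conj_mat g1 g2 0 0 1 $ i $ j))"
  define \<kappa> where "\<kappa> = (\<Sum>i\<in>UNIV. \<Sum>j\<in>UNIV. c i j)"
  have c0: "c i j \<ge> 0" for i j by (simp add: c_def)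
  have c\<kappa>: "c i j \<le> \<kappa>" for i j
  proof -
    have "c i j \<le> (\<Sum>j\<in>UNIV. c i j)" by (rule member_le_sum) (auto simp: c0)
    also have "\<dots> \<le> \<kappa>" unfolding \<kappa>_def by (rule member_le_sum[of i UNIV "\<lambda>i. \<Sum>j\<in>UNIV. c i j"]) (auto simp: c0 sum_nonneg)
    finally show ?thesis .
  qed
  have "norm (conj_mat g1 g2 p q r $ i $ j) \<le> \<kappa> * (norm p + norm q + norm r)" for p q r i j
  proof -
    have "conj_mat g1 g2 p q r $ i $ j = p * conj_mat g1 g2 1 0 0 $ i $ j + q * conj_mat g1 g2 0 1 0 $ i $ j + r * conj_mat g1 g2 0 0 1 $ i $ j"
      unfolding conj_mat_scale by (simp flip: vector_add_component add: conj_mat_add)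
    also have "norm \<dots> \<le> norm p * norm (conj_mat g1 g2 1 0 0 $ i $ j) + norm q * norm (conj_mat g1 g2 0 1 0 $ i $ j) + norm r * norm (conj_mat g1 g2 0 0 1 $ i $ j)"
      by (intro order_trans[OF norm_triangle_ineq] add_mono) (auto simp: norm_mult)
    also have "\<dots> \<le> norm p * c i j + norm q * c i j + norm r * c i j"
      by (intro add_mono mult_left_mono) (auto simp: c_def)
    also have "\<dots> \<le> norm p * \<kappa> + norm q * \<kappa> + norm r * \<kappa>" by (intro add_mono mult_left_mono c\<kappa>) auto
    finally show ?thesis by (simp add: algebra_simps)
  qed
  moreover have "\<kappa> \<ge> 0" unfolding \<kappa>_def by (intro sum_nonneg c0)
  ultimately show ?thesis by blast
qed

lemma conj_mat_derivative:
  assumes "(p has_field_derivative p') (at t)" "(q has_field_derivative q') (at t)" "(r has_field_derivative r') (at t)"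
  shows "((\<lambda>s. conj_mat g1 g2 (p s) (q s) (r s) $ i $ j) has_field_derivative conj_mat g1 g2 p' q' r' $ i $ j) (at t)"
proof -
  have e: "((\<lambda>s. (a * p s + b * q s + c * r s) / e) has_field_derivative (a * p' + b * q' + c * r') / e) (at t)" for a b c e
    by (intro DERIV_cdivide DERIV_add DERIV_cmult assms)
  have "conj_mat g1 g2 p q r $ 1 $ 1 = ((g2 + g1) * p + - g1 * q + g2 * r) / (g2 - g1)"
    "conj_mat g1 g2 p q r $ 1 $ 2 = (-2 * p + 1 * q + -1 * r) / (g2 - g1)"
    "conj_mat g1 g2 p q r $ 2 $ 1 = ((2 * (g1 * g2)) * p + - (g1 * g1) * q + (g2 * g2) * r) / (g2 - g1)"
    "conj_mat g1 g2 p q r $ 2 $ 2 = (- (g2 + g1) * p + g1 * q + - g2 * r) / (g2 - g1)" for p q r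
    unfolding conj_mat_nth minus_divide_left by (simp_all add: algebra_simps)
  then show ?thesis using exhaust_2[of i] exhaust_2[of j] e by (auto simp only:)
qed

text \<open>The triples are coordinates in the eigenbasis: \<open>a\<close> of \<open>A0\<close>,
  \<open>l\<close> of \<open>A0 + Ax\<close>, and \<open>C\<close> of the constant total, so that
  \<open>Ax\<close> and \<open>A1\<close> are differences. The three determinants are first
  integrals, and the hypotheses \<open>lim\<close> read off their values at \<open>x = 0\<close>,
  which yields the eigenvalues.\<close>

lemma schlesinger_of_triples:
  fixes a1 a2 a3 l1 l2 l3 :: "complex \<Rightarrow> complex"
  assumes ne: "g1 \<noteq> g2" and \<Theta>: "\<Theta> > 0" and \<epsilon>: "0 < \<epsilon>" "\<epsilon> \<le> 1"
    and a: "\<And>s. s \<in> log_sector \<epsilon> \<Theta> \<Longrightarrow> (a1 has_field_derivative l2 s * a3 s - a2 s * l3 s) (at s)"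
      "\<And>s. s \<in> log_sector \<epsilon> \<Theta> \<Longrightarrow> (a2 has_field_derivative 2 * (l1 s * a2 s - l2 s * a1 s)) (at s)"
      "\<And>s. s \<in> log_sector \<epsilon> \<Theta> \<Longrightarrow> (a3 has_field_derivative 2 * (l3 s * a1 s - l1 s * a3 s)) (at s)"
    and l: "\<And>s. s \<in> log_sector \<epsilon> \<Theta> \<Longrightarrow> (l1 has_field_derivative
          - (exp s / (1 - exp s) * ((C2 - l2 s) * (l3 s - a3 s) - (l2 s - a2 s) * (C3 - l3 s)))) (at s)"
      "\<And>s. s \<in> log_sector \<epsilon> \<Theta> \<Longrightarrow> (l2 has_field_derivative
          - (exp s / (1 - exp s) * (2 * ((C1 - l1 s) * (l2 s - a2 s) - (C2 - l2 s) * (l1 s - a1 s))))) (at s)"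
      "\<And>s. s \<in> log_sector \<epsilon> \<Theta> \<Longrightarrow> (l3 has_field_derivative
          - (exp s / (1 - exp s) * (2 * ((C3 - l3 s) * (l1 s - a1 s) - (C1 - l1 s) * (l3 s - a3 s))))) (at s)"
    and C: "conj_mat g1 g2 C1 C2 C3 = vector [vector [- \<theta>inf/2, 0], vector [0, \<theta>inf/2]]"
    and lim: "\<And>s. s \<in> log_sector \<epsilon> \<Theta> \<Longrightarrow> norm ((a1 s)^2 + a2 s * a3 s - (\<theta>0/2)^2) \<le> k * norm (exp s)"
      "\<And>s. s \<in> log_sector \<epsilon> \<Theta> \<Longrightarrow> norm ((l1 s - a1 s)^2 + (l2 s - a2 s) * (l3 s - a3 s) - (\<theta>x/2)^2) \<le> k * norm (exp s)"
      "\<And>s. s \<in> log_sector \<epsilon> \<Theta> \<Longrightarrow> norm ((C1 - l1 s)^2 + (C2 - l2 s) * (C3 - l3 s) - (\<theta>1/2)^2) \<le> k * norm (exp s)"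
  shows "schlesinger_system \<theta>0 \<theta>x \<theta>1 \<theta>inf (\<lambda>s. conj_mat g1 g2 (a1 s) (a2 s) (a3 s))
     (\<lambda>s. conj_mat g1 g2 (l1 s - a1 s) (l2 s - a2 s) (l3 s - a3 s))
     (\<lambda>s. conj_mat g1 g2 (C1 - l1 s) (C2 - l2 s) (C3 - l3 s)) (log_sector \<epsilon> \<Theta>)"
proof -
  let ?S = "log_sector \<epsilon> \<Theta>"
  let ?A0 = "\<lambda>s. conj_mat g1 g2 (a1 s) (a2 s) (a3 s)"
  let ?Ax = "\<lambda>s. conj_mat g1 g2 (l1 s - a1 s) (l2 s - a2 s) (l3 s - a3 s)"
  let ?A1 = "\<lambda>s. conj_mat g1 g2 (C1 - l1 s) (C2 - l2 s) (C3 - l3 s)"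
  have x1: "exp s \<noteq> 1" "1 - exp s \<noteq> 0" if "s \<in> ?S" for s
  proof -
    have "norm (exp s) < 1" using log_sector_norm_exp[OF \<epsilon>(1) that] \<epsilon>(2) by linarith
    then show "exp s \<noteq> 1" by (metis less_irrefl norm_one)
    then show "1 - exp s \<noteq> 0" by simp
  qed
  have d0: "((\<lambda>s. ?A0 s $ i $ j) has_field_derivative commutator (?Ax s) (?A0 s) $ i $ j) (at s)" if s: "s \<in> ?S" for s i j
    unfolding commutator_conj_mat[OF ne]
    by (rule conj_mat_derivative; rule DERIV_cong, rule a[OF s]; simp add: algebra_simps)
  have d1: "((\<lambda>s. ?A1 s $ i $ j) has_field_derivative exp s / (1 - exp s) * commutator (?A1 s) (?Ax s) $ i $ j) (at s)" if s: "s \<in> ?S" for s i j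
    unfolding commutator_conj_mat[OF ne] conj_mat_scale
    by (rule conj_mat_derivative; rule DERIV_cong, rule DERIV_diff[OF DERIV_const], rule l[OF s]; simp only: diff_0 minus_minus mult_ac)
  have Ax: "?Ax s $ i $ j = conj_mat g1 g2 C1 C2 C3 $ i $ j - ?A1 s $ i $ j - ?A0 s $ i $ j" for s i j
  proof -
    have "?Ax s + (?A1 s + ?A0 s) = conj_mat g1 g2 C1 C2 C3" by (simp add: conj_mat_add)
    then have "?Ax s $ i $ j + (?A1 s $ i $ j + ?A0 s $ i $ j) = conj_mat g1 g2 C1 C2 C3 $ i $ j"
      by (metis vector_add_component)
    then show ?thesis by (simp add: algebra_simps)
  qed
  have dx: "((\<lambda>s. ?Ax s $ i $ j) has_field_derivative
      commutator (?A0 s) (?Ax s) $ i $ j + exp s / (exp s - 1) * commutator (?A1 s) (?Ax s) $ i $ j) (at s)" if s: "s \<in> ?S" for s i j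
  proof -
    have "commutator (?A0 s) (?Ax s) $ i $ j = - commutator (?Ax s) (?A0 s) $ i $ j" by (simp add: commutator_def)
    moreover have "exp s / (exp s - 1) = - (exp s / (1 - exp s))" using x1[OF s] by (simp add: divide_simps) (simp add: algebra_simps)
    ultimately have e: "commutator (?A0 s) (?Ax s) $ i $ j + exp s / (exp s - 1) * commutator (?A1 s) (?Ax s) $ i $ j
       = 0 - exp s / (1 - exp s) * commutator (?A1 s) (?Ax s) $ i $ j - commutator (?Ax s) (?A0 s) $ i $ j" by simp
    show ?thesis unfolding e by (subst Ax) (intro DERIV_diff DERIV_const d0[OF s] d1[OF s])
  qed
  have hol: "matrix_holomorphic_on ?A0 ?S" "matrix_holomorphic_on ?Ax ?S" "matrix_holomorphic_on ?A1 ?S"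
    unfolding matrix_holomorphic_on_def holomorphic_on_open[OF log_sector_props(1)] using d0 d1 dx by blast+
  have i0: "(a1 s)^2 + a2 s * a3 s = (\<theta>0/2)^2" if "s \<in> ?S" for s
  proof (rule first_integral_value[OF \<Theta> _ lim(1) that])
    fix s assume s: "s \<in> ?S"
    show "((\<lambda>s. (a1 s)^2 + a2 s * a3 s) has_field_derivative 0) (at s)"
      by (rule DERIV_cong, (rule derivative_eq_intros refl a[OF s])+) (simp add: algebra_simps)
  qed
  have ix: "(l1 s - a1 s)^2 + (l2 s - a2 s) * (l3 s - a3 s) = (\<theta>x/2)^2" if "s \<in> ?S" for s
  proof (rule first_integral_value[OF \<Theta> _ lim(2) that])
    fix s assume s: "s \<in> ?S"
    define e where "e = exp s / (1 - exp s)"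
    show "((\<lambda>s. (l1 s - a1 s)^2 + (l2 s - a2 s) * (l3 s - a3 s)) has_field_derivative 0) (at s)"
      by (rule DERIV_cong, (rule derivative_eq_intros refl a[OF s] l[OF s, folded e_def])+) (simp add: algebra_simps)
  qed
  have i1: "(C1 - l1 s)^2 + (C2 - l2 s) * (C3 - l3 s) = (\<theta>1/2)^2" if "s \<in> ?S" for s
  proof (rule first_integral_value[OF \<Theta> _ lim(3) that])
    fix s assume s: "s \<in> ?S"
    define e where "e = exp s / (1 - exp s)"
    show "((\<lambda>s. (C1 - l1 s)^2 + (C2 - l2 s) * (C3 - l3 s)) has_field_derivative 0) (at s)"
      by (rule DERIV_cong, (rule derivative_eq_intros refl l[OF s, folded e_def])+) (simp add: algebra_simps)
  qed
  have sum: "?A0 s + ?Ax s + ?A1 s = vector [vector [- \<theta>inf/2, 0], vector [0, \<theta>inf/2]]" for s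
    by (simp add: conj_mat_add C)
  show ?thesis
    unfolding schlesinger_system_def
  proof (intro conjI ballI allI hol sum)
    fix s i j assume s: "s \<in> ?S"
    show "x_deriv (\<lambda>s. ?A0 s $ i $ j) s = commutator (?Ax s) (?A0 s) $ i $ j / exp s"
      unfolding x_deriv_def by (simp only: DERIV_imp_deriv[OF d0[OF s]])
    show "x_deriv (\<lambda>s. ?A1 s $ i $ j) s = commutator (?A1 s) (?Ax s) $ i $ j / (1 - exp s)"
      unfolding x_deriv_def by (simp add: DERIV_imp_deriv[OF d1[OF s]])
    show "x_deriv (\<lambda>s. ?Ax s $ i $ j) s = commutator (?A0 s) (?Ax s) $ i $ j / exp s + commutator (?A1 s) (?Ax s) $ i $ j / (exp s - 1)"
      unfolding x_deriv_def by (simp add: DERIV_imp_deriv[OF dx[OF s]] add_divide_distrib)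
  qed (simp_all only: eigenvalues_half_iff[OF trace_conj_mat] trace_conj_mat det_conj_mat[OF ne] minus_minus i0 ix i1)
qed

section \<open>The analytic solution\<close>

text \<open>\<open>y\<close> and \<open>\<Lambda>\<close> are chosen before \<open>\<Theta>\<close>,
  so that all sectors carry restrictions of the same function; \<open>ev \<sigma> y\<close> is the
  bracket of the asserted expansion times \<open>x^\<sigma>\<close>, which clears the negative power
  of \<open>w\<close> in its leading term.\<close>

theorem analytic_solution:
  fixes \<theta>0 \<theta>x \<theta>1 \<theta>inf \<sigma> A B \<phi> :: complex
  assumes ti: "\<theta>inf \<noteq> 0" and \<sigma>: "Re \<sigma> = 0" "\<sigma> \<noteq> 0"
    and B: "B = (\<theta>0^2 - \<theta>x^2 + \<sigma>^2) / (2 * \<sigma>^2)" and A: "A^2 = \<theta>0^2 / \<sigma>^2 - B^2"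
  shows "\<exists>y \<Lambda>. degree_bound 2 y \<and>
    (\<forall>s. poly (fps_nth y 0) (exp (\<sigma> * s)) = exp (\<sigma> * s) * (\<i> * A * sin (\<i> * \<sigma> * s + \<phi>) + B)) \<and>
    trace \<Lambda> = 0 \<and> det \<Lambda> = - (\<sigma>^2 / 4) \<and>
    (\<forall>\<Theta>>0. \<exists>\<epsilon> C. 0 < \<epsilon> \<and> \<epsilon> < 1 \<and>
      (\<forall>s\<in>log_sector \<epsilon> \<Theta>.
        (\<lambda>n. poly (fps_nth y n) (exp (\<sigma> * s)) * exp ((1 - \<sigma>) * s) ^ n) sums ev \<sigma> y s \<and>
        norm (ev \<sigma> y s - poly (fps_nth y 0) (exp (\<sigma> * s))) \<le> C * norm (exp s)) \<and>
      (\<exists>A0 Ax A1. schlesinger_system \<theta>0 \<theta>x \<theta>1 \<theta>inf A0 Ax A1 (log_sector \<epsilon> \<Theta>) \<and>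
        PVI_associated A0 A1 (\<lambda>s. exp s * (ev \<sigma> y s / exp (\<sigma> * s))) (log_sector \<epsilon> \<Theta>) \<and>
        (\<forall>s\<in>log_sector \<epsilon> \<Theta>. \<forall>i j. norm (Ax s $ i $ j) \<le> C \<and> norm (A1 s $ i $ j) \<le> C \<and>
           norm (A0 s $ i $ j + Ax s $ i $ j - \<Lambda> $ i $ j) \<le> C * norm (exp s))))"
proof -
  \<comment> \<open>\<open>(1, g1)\<close> and \<open>(1, g2)\<close> are the eigenvectors of \<open>\<Lambda> = [[a, 1], [\<sigma>^2/4 - a^2, -a]]\<close>; \<open>a\<close> is
    determined by the eigenvalues of the limit of \<open>A1\<close>, whose entry 12 is normalized to \<open>-1\<close>\<close>
  define a where "a = (\<theta>1^2 - \<theta>inf^2 - \<sigma>^2) / (4 * \<theta>inf)"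
  define g1 g2 where "g1 = \<sigma> / 2 - a" and "g2 = - \<sigma> / 2 - a"
  have g: "g2 - g1 = - \<sigma>" "g1 \<noteq> g2" using \<sigma>(2) by (auto simp: g1_def g2_def)
  define C1 C2 C3 where "C1 = - (\<theta>inf * a / \<sigma>)" and "C2 = \<theta>inf * g2 / \<sigma>" and "C3 = - (\<theta>inf * g1 / \<sigma>)"
  define c1 where "c1 = C1 - \<sigma> / 2"
  define p q r where "p = \<sigma> * B / 2" and "q = \<sigma> * A * exp (- (\<i> * \<phi>)) / 2" and "r = \<sigma> * A * exp (\<i> * \<phi>) / 2"
  have qr: "q * r = \<sigma>^2 * A^2 / 4"
  proof -
    have "exp (- (\<i> * \<phi>)) * exp (\<i> * \<phi>) = 1" by (simp flip: exp_add)
    then have "\<sigma> * A * \<sigma> * A * (exp (- (\<i> * \<phi>)) * exp (\<i> * \<phi>)) / 4 = \<sigma>^2 * A^2 / 4"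
      by (simp add: power2_eq_square mult_ac)
    then show ?thesis unfolding q_def r_def by (simp only: mult_ac times_divide_eq_left times_divide_eq_right divide_divide_eq_left) simp
  qed
  have det0: "p^2 + q * r = (\<theta>0/2)^2" unfolding qr A p_def using \<sigma>(2) by (simp add: field_simps)
  have detx: "(\<sigma>/2 - p)^2 + q * r = (\<theta>x/2)^2"
  proof -
    have "(\<sigma>/2 - p)^2 + q * r = (p^2 + q * r) + \<sigma>^2/4 - \<sigma> * p" by (simp add: power2_eq_square field_simps)
    also have "\<dots> = (\<theta>x/2)^2" unfolding det0 unfolding p_def B using \<sigma>(2) by (simp add: field_simps power2_eq_square)
    finally show ?thesis .
  qed
  have det1: "c1^2 + C2 * C3 = (\<theta>1/2)^2"
  proof -
    have "c1^2 + C2 * C3 = (\<theta>inf * a + \<sigma>^2/4 + \<theta>inf^2/4)"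
      unfolding c1_def C1_def C2_def C3_def g1_def g2_def using \<sigma>(2) by (simp add: field_simps power2_eq_square)
    also have "\<theta>inf * a = (\<theta>1^2 - \<theta>inf^2 - \<sigma>^2) / 4" using ti by (simp add: a_def)
    finally show ?thesis by (simp add: field_simps power2_eq_square)
  qed
  have Cmat: "conj_mat g1 g2 C1 C2 C3 = vector [vector [- \<theta>inf/2, 0], vector [0, \<theta>inf/2]]"
    unfolding vec_eq_iff forall_2 conj_mat_nth g(1) using \<sigma>(2)
    by (simp add: C1_def C2_def C3_def g1_def g2_def vector_2) (simp add: field_simps power2_eq_square)
  have C12: "(C2 - 2 * c1 - C3) / (- \<sigma>) = -1"
    using \<sigma>(2) by (simp add: c1_def C1_def C2_def C3_def g1_def g2_def field_simps)
  define \<Lambda> where "\<Lambda> = conj_mat g1 g2 (\<sigma>/2) 0 0"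
  obtain F where FL: "\<And>i. i < 3 \<Longrightarrow> log_deriv \<sigma> (F i) = formal_L \<sigma> c1 C2 C3 F i \<and> fps_nth (F i) 0 = 0 \<and> degree_bound 0 (F i)"
    and FR: "\<And>i. i \<in> {3,4,5} \<Longrightarrow> log_deriv \<sigma> (F i) = cst (of_nat (twist i) * \<sigma>) * F i + formal_R F F i \<and>
       fps_nth (F i) 0 = lead p q r i \<and> degree_bound 2 (F i)"
    and Fb: "\<forall>W\<ge>1. \<exists>K\<ge>1. \<forall>\<eta>>0. \<exists>\<rho>>0. \<rho> \<le> \<eta> \<and> \<rho> * W \<le> 1/2 \<and>
       (\<forall>i<3. weighted_bound W \<rho> (F i) \<eta>) \<and> (\<forall>i\<in>{3,4,5}. weighted_bound W \<rho> (F i) K)"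
    using formal_solution_exists[OF \<sigma>(1), of c1 C2 C3 p q r] by metis
  obtain y where y: "y = series_a0 \<sigma> F + series_g \<sigma> F * y" "fps_nth y 0 = fps_nth (series_a0 \<sigma> F) 0" "degree_bound 2 y"
    and yb: "\<And>W. W \<ge> 1 \<Longrightarrow> \<exists>K\<ge>1. \<forall>\<eta>>0. \<exists>\<rho>>0. \<rho> * W \<le> 1/2 \<and>
       (\<forall>i<3. weighted_bound W \<rho> (F i) \<eta>) \<and> (\<forall>i\<in>{3,4,5}. weighted_bound W \<rho> (F i) K) \<and>
       weighted_bound W \<rho> y K \<and> weighted_bound W \<rho> (series_g \<sigma> F) (1/2)"
    using formal_y_exists[OF _ _ Fb \<sigma>(2)] FL FR by (metis (no_types, lifting))
  have lead: "poly (fps_nth y 0) (exp (\<sigma> * s)) = exp (\<sigma> * s) * (\<i> * A * sin (\<i> * \<sigma> * s + \<phi>) + B)" for s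
  proof -
    define w where "w = exp (\<sigma> * s)"
    have w: "w \<noteq> 0" by (simp add: w_def)
    have "fps_nth (F 3) 0 = monom p 1" "fps_nth (F 4) 0 = monom q 2" "fps_nth (F 5) 0 = monom r 0"
      using FR[of 3] FR[of 4] FR[of 5] by (auto simp: lead_def)
    then have "poly (fps_nth y 0) w = (2 * (p * w) + r - q * w^2) / \<sigma>"
      unfolding y(2) series_a0_def by (simp add: poly_monom add_divide_distrib diff_divide_distrib)
    also have "\<dots> = B * w + A / 2 * (exp (\<i> * \<phi>) - exp (- (\<i> * \<phi>)) * w^2)"
      using \<sigma>(2) by (simp add: p_def q_def r_def field_simps)
    also have "\<dots> = w * (\<i> * A * sin (\<i> * \<sigma> * s + \<phi>) + B)"
    proof -
    have "sin (\<i> * \<sigma> * s + \<phi>) = (exp (\<i> * \<phi>) / w - exp (- (\<i> * \<phi>)) * w) / (2 * \<i>)"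
    proof -
      have "exp (\<i> * (\<i> * \<sigma> * s + \<phi>)) = exp (\<i> * \<phi>) / w" 
      proof -
        have "\<i> * (\<i> * \<sigma> * s + \<phi>) = \<i> * \<phi> - \<sigma> * s" by (simp add: distrib_left flip: mult.assoc)
        then show ?thesis by (simp add: exp_diff w_def)
      qed
      moreover have "exp (- (\<i> * (\<i> * \<sigma> * s + \<phi>))) = exp (- (\<i> * \<phi>)) * w"
      proof -
        have "- (\<i> * (\<i> * \<sigma> * s + \<phi>)) = - (\<i> * \<phi>) + \<sigma> * s" by (simp add: distrib_left flip: mult.assoc)
        then show ?thesis by (simp add: w_def flip: exp_add)
      qed
      ultimately show ?thesis by (simp add: sin_exp_eq)
    qed
    moreover have "w * (\<i> * A * ((e1 / w - e2 * w) / (2 * \<i>)) + B) = B * w + A / 2 * (e1 - e2 * w^2)" for e1 e2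
        using w by (simp add: field_simps power2_eq_square)
    ultimately show ?thesis by simp
    qed
    finally show ?thesis by (simp add: w_def)
  qed
  have main: "\<exists>\<epsilon> C. 0 < \<epsilon> \<and> \<epsilon> < 1 \<and>
      (\<forall>s\<in>log_sector \<epsilon> \<Theta>.
        (\<lambda>n. poly (fps_nth y n) (exp (\<sigma> * s)) * exp ((1 - \<sigma>) * s) ^ n) sums ev \<sigma> y s \<and>
        norm (ev \<sigma> y s - poly (fps_nth y 0) (exp (\<sigma> * s))) \<le> C * norm (exp s)) \<and>
      (\<exists>A0 Ax A1. schlesinger_system \<theta>0 \<theta>x \<theta>1 \<theta>inf A0 Ax A1 (log_sector \<epsilon> \<Theta>) \<and>
        PVI_associated A0 A1 (\<lambda>s. exp s * (ev \<sigma> y s / exp (\<sigma> * s))) (log_sector \<epsilon> \<Theta>) \<and>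
        (\<forall>s\<in>log_sector \<epsilon> \<Theta>. \<forall>i j. norm (Ax s $ i $ j) \<le> C \<and> norm (A1 s $ i $ j) \<le> C \<and>
           norm (A0 s $ i $ j + Ax s $ i $ j - \<Lambda> $ i $ j) \<le> C * norm (exp s)))" if \<Theta>: "\<Theta> > 0" for \<Theta>
  proof -
    \<comment> \<open>As \<open>\<sigma>\<close> is imaginary, the modulus of
      \<open>x^\<sigma>\<close> depends on the argument of \<open>x\<close> alone; \<open>W\<close>
      bounds it and its inverse on the sector.\<close>
    define W where "W = exp (norm \<sigma> * \<Theta>)"
    have W: "W \<ge> 1" using \<Theta> by (simp add: W_def)
    obtain K where K: "K \<ge> 1" and "\<forall>\<eta>>0. \<exists>\<rho>>0. \<rho> * W \<le> 1/2 \<and>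
       (\<forall>i<3. weighted_bound W \<rho> (F i) \<eta>) \<and> (\<forall>i\<in>{3,4,5}. weighted_bound W \<rho> (F i) K) \<and>
       weighted_bound W \<rho> y K \<and> weighted_bound W \<rho> (series_g \<sigma> F) (1/2)" using yb[OF W] by blast
    then obtain \<rho> where \<rho>: "\<rho> > 0" "\<rho> * W \<le> 1/2" and bl: "\<And>i. i < 3 \<Longrightarrow> weighted_bound W \<rho> (F i) 1"
      and bP: "\<And>i. i \<in> {3,4,5} \<Longrightarrow> weighted_bound W \<rho> (F i) K" and by': "weighted_bound W \<rho> y K"
      and bg: "weighted_bound W \<rho> (series_g \<sigma> F) (1/2)" by (metis zero_less_one)
    \<comment> \<open>From \<open>v = x / w\<close> the modulus of \<open>v\<close> is at most
      \<open>W * norm x\<close>, and this has to stay within \<open>\<rho>\<close>.\<close>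
    define \<epsilon> where "\<epsilon> = min (1/2) (\<rho> / W)"
    have \<epsilon>: "0 < \<epsilon>" "\<epsilon> < 1" "\<epsilon> * W \<le> \<rho>"
    proof -
      show "0 < \<epsilon>" "\<epsilon> < 1" using \<rho> W by (auto simp: \<epsilon>_def)
      have "\<epsilon> \<le> \<rho> / W" by (simp add: \<epsilon>_def)
      then show "\<epsilon> * W \<le> \<rho>" using W by (simp add: field_simps)
    qed
    let ?S = "log_sector \<epsilon> \<Theta>"
    define w v x where "w = (\<lambda>s. exp (\<sigma> * s))" and "v = (\<lambda>s. exp ((1 - \<sigma>) * s))" and "x = (\<lambda>s::complex. exp s)"
    have w0: "w s \<noteq> 0" for s by (simp add: w_def)
    have vw: "v s * w s = x s" for s by (simp add: v_def w_def x_def algebra_simps flip: exp_add)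
    have wW: "norm (w s) \<le> W" "norm (1 / w s) \<le> W" if s: "s \<in> ?S" for s
    proof -
      have "\<bar>Re (\<sigma> * s)\<bar> = \<bar>Im \<sigma>\<bar> * \<bar>Im s\<bar>" using \<sigma>(1) by (simp add: abs_mult)
      also have "\<dots> \<le> norm \<sigma> * \<Theta>" using s abs_Im_le_cmod[of \<sigma>] \<Theta> by (intro mult_mono) (auto simp: log_sector_def)
      finally have "Re (\<sigma> * s) \<le> norm \<sigma> * \<Theta>" "- Re (\<sigma> * s) \<le> norm \<sigma> * \<Theta>" by linarith+
      then have "exp (Re (\<sigma> * s)) \<le> W" "exp (- Re (\<sigma> * s)) \<le> W" unfolding W_def by (simp_all only: exp_le_cancel_iff)
      then show "norm (w s) \<le> W" "norm (1 / w s) \<le> W" by (simp_all only: w_def norm_divide norm_exp_eq_Re exp_minus norm_one inverse_eq_divide)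
    qed
    have vx: "norm (v s) \<le> W * norm (x s)" if s: "s \<in> ?S" for s
    proof -
      have "v s = 1 / w s * x s" using vw[of s] w0[of s] by (simp add: field_simps)
      then have "norm (v s) = norm (1 / w s) * norm (x s)" by (simp only: norm_mult)
      then show ?thesis using mult_right_mono[OF wW(2)[OF s] norm_ge_zero[of "x s"]] by (simp only:)
    qed
    have x\<epsilon>: "norm (x s) < \<epsilon>" if "s \<in> ?S" for s using log_sector_norm_exp[OF \<epsilon>(1) that] by (simp add: x_def)
    have x1: "norm (x s) < 1" "x s \<noteq> 1" if "s \<in> ?S" for s
    proof -
      show "norm (x s) < 1" using x\<epsilon>[OF that] \<epsilon>(2) by linarith
      then show "x s \<noteq> 1" by (metis less_irrefl norm_one)
    qed
    have rad: "within_radii \<sigma> W \<rho> s" if s: "s \<in> ?S" for s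
    proof -
      have "W * norm (x s) \<le> W * \<epsilon>" using x\<epsilon>[OF s] W by (intro mult_left_mono) auto
      then have "norm (v s) \<le> \<rho>" using vx[OF s] \<epsilon>(3) by (simp add: mult.commute)
      then show ?thesis using wW(1)[OF s] by (simp add: within_radii_def w_def v_def)
    qed
    have W0: "W \<ge> 0" "\<rho> \<ge> 0" using W \<rho> by auto
    note cr = converges_rules[OF W0]
    have cF: "converges W \<rho> (F 0)" "converges W \<rho> (F 1)" "converges W \<rho> (F 2)"
      "converges W \<rho> (F 3)" "converges W \<rho> (F 4)" "converges W \<rho> (F 5)"
      by (rule convergesI[OF bl] convergesI[OF bP]; simp)+
    have cg: "converges W \<rho> geom_series" by (rule convergesI[OF weighted_bound_geom_series[OF W0 \<rho>(2)]])
    have cy: "converges W \<rho> y" by (rule convergesI[OF by'])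
    have csg: "converges W \<rho> (series_g \<sigma> F)" by (rule convergesI[OF bg])
    define f where "f = (\<lambda>i. ev \<sigma> (F i))"
    define \<gamma> where "\<gamma> = ev \<sigma> geom_series"
    have evs: "ev \<sigma> (G + H) s = ev \<sigma> G s + ev \<sigma> H s" "ev \<sigma> (G - H) s = ev \<sigma> G s - ev \<sigma> H s"
       "ev \<sigma> (G * H) s = ev \<sigma> G s * ev \<sigma> H s"
      if "s \<in> ?S" "converges W \<rho> G" "converges W \<rho> H" for G H s
      using ev_add[OF rad] ev_diff[OF rad] ev_mult[OF rad] that by blast+
    have evm: "ev \<sigma> (- G) s = - ev \<sigma> G s" if "s \<in> ?S" "converges W \<rho> G" for G s
      using ev_uminus[OF rad] that by blast
    have evc: "ev \<sigma> (cst c) s = c" "ev \<sigma> w_var s = w s" "ev \<sigma> fps_X s = v s" for c s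
      by (simp_all add: ev_const ev_X w_def v_def)
    note E = evs evm evc cr cF cg cy csg
    have \<gamma>: "\<gamma> s * w s = x s / (1 - x s)" if s: "s \<in> ?S" for s
    proof -
      have "\<gamma> s = v s + v s * w s * \<gamma> s"
        unfolding \<gamma>_def by (subst geom_series_eq) (simp only: E s)
      then have "(\<gamma> s * w s) * (1 - x s) = x s" using vw[of s] by algebra
      moreover have "1 - x s \<noteq> 0" using x1(2)[OF s] by simp
      ultimately show ?thesis using nonzero_eq_divide_eq by blast
    qed
    have fd: "(f i has_field_derivative ev \<sigma> (log_deriv \<sigma> (F i)) s) (at s)" if "i \<in> {0,1,2,3,4,5}" "s \<in> ?S" for i s
      unfolding f_def by (rule ev_has_derivative[OF log_sector_props(1) rad _ that(2)]) (use that(1) cF in auto)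
    define a1 a2 a3 where "a1 = (\<lambda>s. f 3 s / w s)" and "a2 = (\<lambda>s. f 4 s / w s)" and "a3 = (\<lambda>s. f 5 s / w s)"
    define l1 l2 l3 where "l1 = (\<lambda>s. \<sigma>/2 + f 0 s)" and "l2 = f 1" and "l3 = f 2"
    have X: "w s * (\<sigma>/2 + f 0 s) - f 3 s = w s * (l1 s - a1 s)" "w s * f 1 s - f 4 s = w s * (l2 s - a2 s)"
      "w s * f 2 s - f 5 s = w s * (l3 s - a3 s)" for s
      using w0[of s] by (simp_all add: a1_def a2_def a3_def l1_def l2_def l3_def algebra_simps)
    have m: "c1 - f 0 s = C1 - l1 s" for s by (simp add: c1_def l1_def)
    have dl: "(l1 has_field_derivative - (exp s / (1 - exp s) * ((C2 - l2 s) * (l3 s - a3 s) - (l2 s - a2 s) * (C3 - l3 s)))) (at s)"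
        "(l2 has_field_derivative - (exp s / (1 - exp s) * (2 * ((C1 - l1 s) * (l2 s - a2 s) - (C2 - l2 s) * (l1 s - a1 s))))) (at s)"
        "(l3 has_field_derivative - (exp s / (1 - exp s) * (2 * ((C3 - l3 s) * (l1 s - a1 s) - (C1 - l1 s) * (l3 s - a3 s))))) (at s)"
      if s: "s \<in> ?S" for s
    proof -
      note \<gamma>s = \<gamma>[OF s, unfolded x_def]
      have pull: "- (\<gamma> s * (u * (w s * p) - (w s * q) * t)) = - ((\<gamma> s * w s) * (u * p - q * t))"
        "- (\<gamma> s * (2 * (u * (w s * p) - (w s * q) * t))) = - ((\<gamma> s * w s) * (2 * (u * p - q * t)))" for u p q t
        by algebra+
      have n: "(2::nat) = 0 \<longleftrightarrow> False" "(2::nat) = 1 \<longleftrightarrow> False" by simp_all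
      have fi: "(f i has_field_derivative ev \<sigma> (formal_L \<sigma> c1 C2 C3 F i) s) (at s)" if "i \<in> {0,1,2}" for i
        using fd[of i s] FL[of i] s that by auto
      have "ev \<sigma> (formal_L \<sigma> c1 C2 C3 F 0) s = - (\<gamma> s * ((C2 - f 1 s) * (w s * f 2 s - f 5 s) - (w s * f 1 s - f 4 s) * (C3 - f 2 s)))"
        unfolding formal_L_def Let_def f_def \<gamma>_def by (simp only: simp_thms if_True E s)
      also have "\<dots> = - (exp s / (1 - exp s) * ((C2 - l2 s) * (l3 s - a3 s) - (l2 s - a2 s) * (C3 - l3 s)))"
        unfolding X pull \<gamma>s l2_def l3_def ..
      finally show "(l1 has_field_derivative - (exp s / (1 - exp s) * ((C2 - l2 s) * (l3 s - a3 s) - (l2 s - a2 s) * (C3 - l3 s)))) (at s)"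
        unfolding l1_def using DERIV_add[OF DERIV_const fi[of 0]] by (simp only: add_0 insertI1)
      have "ev \<sigma> (formal_L \<sigma> c1 C2 C3 F 1) s = - (\<gamma> s * (2 * ((c1 - f 0 s) * (w s * f 1 s - f 4 s) - (w s * (\<sigma>/2 + f 0 s) - f 3 s) * (C2 - f 1 s))))"
        unfolding formal_L_def Let_def f_def \<gamma>_def by (simp only: simp_thms one_neq_zero if_True if_False E s)
      also have "\<dots> = - (exp s / (1 - exp s) * (2 * ((C1 - l1 s) * (l2 s - a2 s) - (l1 s - a1 s) * (C2 - l2 s))))"
        unfolding X pull \<gamma>s m l2_def ..
      also have "\<dots> = - (exp s / (1 - exp s) * (2 * ((C1 - l1 s) * (l2 s - a2 s) - (C2 - l2 s) * (l1 s - a1 s))))" by (simp only: mult.commute)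
      finally show "(l2 has_field_derivative - (exp s / (1 - exp s) * (2 * ((C1 - l1 s) * (l2 s - a2 s) - (C2 - l2 s) * (l1 s - a1 s))))) (at s)"
        unfolding l2_def using fi[of 1] by (simp only: insertI1 insertI2)
      have "ev \<sigma> (formal_L \<sigma> c1 C2 C3 F 2) s = - (\<gamma> s * (2 * ((C3 - f 2 s) * (w s * (\<sigma>/2 + f 0 s) - f 3 s) - (w s * f 2 s - f 5 s) * (c1 - f 0 s))))"
        unfolding formal_L_def Let_def f_def \<gamma>_def by (simp only: n if_False E s)
      also have "\<dots> = - (exp s / (1 - exp s) * (2 * ((C3 - l3 s) * (l1 s - a1 s) - (l3 s - a3 s) * (C1 - l1 s))))"
        unfolding X pull \<gamma>s m l3_def ..
      also have "\<dots> = - (exp s / (1 - exp s) * (2 * ((C3 - l3 s) * (l1 s - a1 s) - (C1 - l1 s) * (l3 s - a3 s))))" by (simp only: mult.commute)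
      finally show "(l3 has_field_derivative - (exp s / (1 - exp s) * (2 * ((C3 - l3 s) * (l1 s - a1 s) - (C1 - l1 s) * (l3 s - a3 s))))) (at s)"
        unfolding l3_def using fi[of 2] by (simp only: insertI1 insertI2)
    qed
    have dw: "((\<lambda>s. h s / w s) has_field_derivative h' / w s - \<sigma> * (h s / w s)) (at s)" if "(h has_field_derivative h') (at s)" for h h' s
    proof -
      have e: "((\<lambda>s. exp (\<sigma> * s)) has_field_derivative \<sigma> * exp (\<sigma> * s)) (at s)" by (auto intro!: derivative_eq_intros)
      show ?thesis unfolding w_def by (rule DERIV_cong[OF DERIV_divide[OF that e]]) (simp_all add: field_simps)
    qed
    have da: "(a1 has_field_derivative l2 s * a3 s - a2 s * l3 s) (at s)"
        "(a2 has_field_derivative 2 * (l1 s * a2 s - l2 s * a1 s)) (at s)"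
        "(a3 has_field_derivative 2 * (l3 s * a1 s - l1 s * a3 s)) (at s)" if s: "s \<in> ?S" for s
    proof -
      have e3: "ev \<sigma> (log_deriv \<sigma> (F 3)) s = \<sigma> * f 3 s + (f 1 s * f 5 s - f 2 s * f 4 s)"
      proof -
        have "log_deriv \<sigma> (F 3) = cst \<sigma> * F 3 + (F 1 * F 5 - F 2 * F 4)" using FR[of 3] by (simp add: twist_def formal_R_def)
        then show ?thesis unfolding f_def by (simp only: E s)
      qed
      have e4: "ev \<sigma> (log_deriv \<sigma> (F 4)) s = 2 * \<sigma> * f 4 s + 2 * (f 0 s * f 4 s - f 1 s * f 3 s)"
      proof -
        have "log_deriv \<sigma> (F 4) = cst (2 * \<sigma>) * F 4 + cst 2 * (F 0 * F 4 - F 1 * F 3)" using FR[of 4] by (simp add: twist_def formal_R_def)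
        then show ?thesis unfolding f_def by (simp only: E s)
      qed
      have e5: "ev \<sigma> (log_deriv \<sigma> (F 5)) s = 2 * (f 2 s * f 3 s - f 0 s * f 5 s)"
      proof -
        have "log_deriv \<sigma> (F 5) = cst 2 * (F 2 * F 3 - F 0 * F 5)" using FR[of 5] by (simp add: twist_def formal_R_def)
        then show ?thesis unfolding f_def by (simp only: E s)
      qed
      show "(a1 has_field_derivative l2 s * a3 s - a2 s * l3 s) (at s)"
        unfolding a1_def by (rule DERIV_cong[OF dw[OF fd[of 3 s]]]) (use s w0[of s] in \<open>simp_all add: e3 a2_def a3_def l2_def l3_def field_simps\<close>)
      show "(a2 has_field_derivative 2 * (l1 s * a2 s - l2 s * a1 s)) (at s)"
        unfolding a2_def by (rule DERIV_cong[OF dw[OF fd[of 4 s]]]) (use s w0[of s] in \<open>simp_all add: e4 a1_def l1_def l2_def field_simps\<close>)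
      show "(a3 has_field_derivative 2 * (l3 s * a1 s - l1 s * a3 s)) (at s)"
        unfolding a3_def by (rule DERIV_cong[OF dw[OF fd[of 5 s]]]) (use s w0[of s] in \<open>simp_all add: e5 a1_def l1_def l3_def field_simps\<close>)
    qed
    have fb: "norm (f i s) \<le> W / \<rho> * norm (x s)" if "i < 3" "s \<in> ?S" for i s
    proof -
      have "norm (f i s) \<le> 1 * (norm (v s) / \<rho>)"
        unfolding f_def v_def by (rule norm_ev_vanishing[OF rad[OF that(2)] bl[OF that(1)] _ \<rho>(1)]) (use FL[OF that(1)] in blast)
      also have "\<dots> \<le> W * norm (x s) / \<rho>" using vx[OF that(2)] \<rho>(1) by (simp add: divide_right_mono)
      finally show ?thesis by simp
    qed
    \<comment> \<open>Removing the constant term leaves a series that starts at order one in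
      \<open>v\<close>, at the price of doubling the bound.\<close>
    have rest: "norm (ev \<sigma> G s - poly (fps_nth G 0) (w s)) \<le> 2 * K * W / \<rho> * norm (x s)"
      if G: "weighted_bound W \<rho> G K" and s: "s \<in> ?S" for G s
    proof -
      let ?c = "fps_const (fps_nth G 0)"
      have "pnorm W (fps_nth G 0) \<le> K" using G[unfolded weighted_bound_def, rule_format, of 0] by simp
      then have c: "weighted_bound W \<rho> ?c K" by (rule weighted_bound_const)
      have b: "weighted_bound W \<rho> (G - ?c) (2 * K)" using weighted_bound_diff[OF W0 G c] by simp
      have "norm (ev \<sigma> (G - ?c) s) \<le> 2 * K * (norm (v s) / \<rho>)"
        unfolding v_def by (rule norm_ev_vanishing[OF rad[OF s] b _ \<rho>(1)]) simp
      also have "\<dots> \<le> 2 * K * (W * norm (x s) / \<rho>)" using vx[OF s] \<rho>(1) K by (intro mult_left_mono divide_right_mono) auto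
      finally show ?thesis by (simp add: evs(2)[OF s convergesI[OF G] cr(5)] ev_const w_def)
    qed
    \<comment> \<open>\<open>D\<close> controls the remainders of the entries of
      \<open>w * A0\<close>; dividing by \<open>w\<close> costs another factor \<open>W\<close>,
      which gives \<open>\<delta>\<close>.\<close>
    define D where "D = 2 * K * W / \<rho>"
    define \<delta> where "\<delta> = W * D"
    have D: "D \<ge> 0" "W / \<rho> \<le> D" "D \<le> \<delta>"
    proof -
      show D0: "D \<ge> 0" using K W \<rho>(1) by (simp add: D_def)
      have "1 * W \<le> 2 * K * W" using K W by (intro mult_right_mono) auto
      then show "W / \<rho> \<le> D" unfolding D_def using \<rho>(1) by (simp add: divide_right_mono)
      show "D \<le> \<delta>" using mult_right_mono[OF W D0] by (simp add: \<delta>_def)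
    qed
    have \<delta>: "\<delta> \<ge> 0" using D by linarith
    have xn: "norm (x s) \<ge> 0" "norm (x s) \<le> 1" if "s \<in> ?S" for s using x1(1)[OF that] by auto
    have fb': "norm (f i s) \<le> \<delta> * norm (x s)" if "i < 3" "s \<in> ?S" for i s
      by (rule order_trans[OF fb[OF that]], rule mult_right_mono) (use D in auto)
    have F0s: "fps_nth (F 3) 0 = monom p 1" "fps_nth (F 4) 0 = monom q 2" "fps_nth (F 5) 0 = monom r 0"
      using FR[of 3] FR[of 4] FR[of 5] by (auto simp: lead_def)
    have ab: "norm (a1 s - p) \<le> \<delta> * norm (x s)" "norm (a2 s - q * w s) \<le> \<delta> * norm (x s)" "norm (a3 s - r / w s) \<le> \<delta> * norm (x s)"
      if s: "s \<in> ?S" for s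
    proof -
      have dv: "norm (1 / w s * z) \<le> \<delta> * norm (x s)" if "norm z \<le> D * norm (x s)" for z
        unfolding norm_mult \<delta>_def mult.assoc using wW(2)[OF s] that W0 by (intro mult_mono) auto
      have "norm (f 3 s - p * w s) \<le> D * norm (x s)" "norm (f 4 s - q * (w s)^2) \<le> D * norm (x s)" "norm (f 5 s - r) \<le> D * norm (x s)"
        using rest[OF bP[of 3] s] rest[OF bP[of 4] s] rest[OF bP[of 5] s]
        by (simp_all add: F0s poly_monom D_def f_def)
      from this[THEN dv] show "norm (a1 s - p) \<le> \<delta> * norm (x s)" "norm (a2 s - q * w s) \<le> \<delta> * norm (x s)" "norm (a3 s - r / w s) \<le> \<delta> * norm (x s)"
        using w0[of s] by (simp_all add: a1_def a2_def a3_def diff_divide_distrib power2_eq_square right_diff_distrib)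
    qed
    \<comment> \<open>A common bound for the coordinates of the three residues and of their leading
      parts.\<close>
    define M where "M = norm p + norm q * W + norm r * W + norm (\<sigma>/2) + norm c1 + norm C2 + norm C3 + 2 * \<delta>"
    have W00: "norm q * W \<ge> 0" "norm r * W \<ge> 0" using W0 by auto
    have qw: "norm (q * w s) \<le> norm q * W" "norm (r / w s) \<le> norm r * W" if "s \<in> ?S" for s
      using wW[OF that] mult_left_mono[OF wW(1)[OF that] norm_ge_zero[of q]] mult_left_mono[OF wW(2)[OF that] norm_ge_zero[of r]]
      by (simp_all add: norm_mult norm_divide)
    \<comment> \<open>Minus the determinant of a traceless matrix is \<open>u^2 + u' * u''\<close>;
      this is its Lipschitz estimate on a bounded set.\<close>
    have quad: "norm (u^2 + u' * u'' - (z^2 + z' * z'')) \<le> 8 * M * \<delta> * norm (x s)"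
      if "norm (u - z) \<le> 2 * \<delta> * norm (x s)" "norm (u' - z') \<le> 2 * \<delta> * norm (x s)" "norm (u'' - z'') \<le> 2 * \<delta> * norm (x s)"
        "norm u \<le> M" "norm u'' \<le> M" "norm z \<le> M" "norm z' \<le> M" for u u' u'' z z' z'' :: complex and s
    proof -
      have pr: "norm (u1 * u2 - z1 * z2) \<le> 4 * M * \<delta> * norm (x s)"
        if "norm (u1 - z1) \<le> 2 * \<delta> * norm (x s)" "norm (u2 - z2) \<le> 2 * \<delta> * norm (x s)" "norm u2 \<le> M" "norm z1 \<le> M" for u1 u2 z1 z2 :: complex
      proof -
        have "u1 * u2 - z1 * z2 = (u1 - z1) * u2 + z1 * (u2 - z2)" by algebra
        also have "norm \<dots> \<le> norm (u1 - z1) * norm u2 + norm z1 * norm (u2 - z2)"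
          using norm_triangle_ineq norm_mult by metis
        also have "\<dots> \<le> (2 * \<delta> * norm (x s)) * M + M * (2 * \<delta> * norm (x s))"
          using that \<delta> by (intro add_mono mult_mono) (auto intro: order_trans[OF norm_ge_zero])
        finally show ?thesis by (simp add: mult_ac)
      qed
      have "u^2 + u' * u'' - (z^2 + z' * z'') = (u * u - z * z) + (u' * u'' - z' * z'')" by (simp add: power2_eq_square)
      also have "norm \<dots> \<le> norm (u * u - z * z) + norm (u' * u'' - z' * z'')" by (rule norm_triangle_ineq)
      also have "\<dots> \<le> 4 * M * \<delta> * norm (x s) + 4 * M * \<delta> * norm (x s)" by (intro add_mono pr that)
      finally show ?thesis by simp
    qed
    have x\<delta>: "\<delta> * norm (x s) \<le> \<delta>" "\<delta> * norm (x s) \<ge> 0" if "s \<in> ?S" for s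
      using mult_left_mono[OF xn(2)[OF that] \<delta>] \<delta> by simp_all
    have aM: "norm (a1 s) \<le> norm p + \<delta>" "norm (a2 s) \<le> norm q * W + \<delta>" "norm (a3 s) \<le> norm r * W + \<delta>" if s: "s \<in> ?S" for s
      using ab[OF s] x\<delta>[OF s] qw[OF s] norm_triangle_ineq2[of "a1 s" p] norm_triangle_ineq2[of "a2 s" "q * w s"] norm_triangle_ineq2[of "a3 s" "r / w s"]
      by linarith+
    have fM: "norm (f 0 s) \<le> \<delta>" "norm (f 1 s) \<le> \<delta>" "norm (f 2 s) \<le> \<delta>" if s: "s \<in> ?S" for s
      using fb'[of 0 s] fb'[of 1 s] fb'[of 2 s] x\<delta>[OF s] s by linarith+
    have n0: "0 \<le> norm p" "0 \<le> norm (\<sigma>/2)" "0 \<le> norm c1" "0 \<le> norm C2" "0 \<le> norm C3" by simp_all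
    have aM': "norm (a1 s) \<le> M" "norm (a2 s) \<le> M" "norm (a3 s) \<le> M" if s: "s \<in> ?S" for s
      using aM[OF s] n0 W00 \<delta> unfolding M_def by linarith+
    have xM: "norm (l1 s - a1 s) \<le> M" "norm (l2 s - a2 s) \<le> M" "norm (l3 s - a3 s) \<le> M" if s: "s \<in> ?S" for s
      using aM[OF s] fM[OF s] n0 W00 \<delta> norm_triangle_ineq[of "\<sigma>/2" "f 0 s"] norm_triangle_ineq4[of "l1 s" "a1 s"]
         norm_triangle_ineq4[of "l2 s" "a2 s"] norm_triangle_ineq4[of "l3 s" "a3 s"]
      unfolding M_def l1_def l2_def l3_def by linarith+
    have mM: "norm (C1 - l1 s) \<le> M" "norm (C2 - l2 s) \<le> M" "norm (C3 - l3 s) \<le> M" if s: "s \<in> ?S" for s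
      using fM[OF s] n0 W00 \<delta> norm_triangle_ineq4[of c1 "f 0 s"] norm_triangle_ineq4[of C2 "f 1 s"] norm_triangle_ineq4[of C3 "f 2 s"]
      unfolding M_def m[symmetric] l2_def l3_def by linarith+
    have lim0: "norm ((a1 s)^2 + a2 s * a3 s - (\<theta>0/2)^2) \<le> 8 * M * \<delta> * norm (x s)" if s: "s \<in> ?S" for s
    proof -
      \<comment> \<open>The oscillating factors \<open>w\<close> and \<open>1/w\<close> cancel in
        the determinant of the leading part, so it has the limit value at every
        \<open>s\<close>.\<close>
      have "p^2 + (q * w s) * (r / w s) = (\<theta>0/2)^2" using det0 w0[of s] by simp
      moreover have "norm ((a1 s)^2 + a2 s * a3 s - (p^2 + (q * w s) * (r / w s))) \<le> 8 * M * \<delta> * norm (x s)"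
        by (rule quad) (use ab[OF s] aM'[OF s] x\<delta>[OF s] qw[OF s] n0 W00 \<delta> in \<open>(unfold M_def)?, linarith+\<close>)
      ultimately show ?thesis by simp
    qed
    have limx: "norm ((l1 s - a1 s)^2 + (l2 s - a2 s) * (l3 s - a3 s) - (\<theta>x/2)^2) \<le> 8 * M * \<delta> * norm (x s)" if s: "s \<in> ?S" for s
    proof -
      have e: "(\<sigma>/2 - p)^2 + (- (q * w s)) * (- (r / w s)) = (\<theta>x/2)^2" using detx w0[of s] by simp
      have "norm (l1 s - a1 s - (\<sigma>/2 - p)) \<le> 2 * \<delta> * norm (x s)"
        using ab(1)[OF s] fb'[of 0 s] s norm_triangle_ineq4[of "f 0 s" "a1 s - p"] by (simp add: l1_def algebra_simps)
      moreover have "norm (l2 s - a2 s - (- (q * w s))) \<le> 2 * \<delta> * norm (x s)"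
        using ab(2)[OF s] fb'[of 1 s] s norm_triangle_ineq4[of "f 1 s" "a2 s - q * w s"] by (simp add: l2_def algebra_simps)
      moreover have "norm (l3 s - a3 s - (- (r / w s))) \<le> 2 * \<delta> * norm (x s)"
        using ab(3)[OF s] fb'[of 2 s] s norm_triangle_ineq4[of "f 2 s" "a3 s - r / w s"] by (simp add: l3_def algebra_simps)
      moreover have "norm (\<sigma>/2 - p) \<le> M" using norm_triangle_ineq4[of "\<sigma>/2" p] n0 W00 \<delta> unfolding M_def by linarith
      moreover have "norm (- (q * w s)) \<le> M" using qw(1)[OF s] n0 W00 \<delta> unfolding M_def norm_minus_cancel by linarith
      ultimately show ?thesis unfolding e[symmetric] by (intro quad xM[OF s])
    qed
    have lim1: "norm ((C1 - l1 s)^2 + (C2 - l2 s) * (C3 - l3 s) - (\<theta>1/2)^2) \<le> 8 * M * \<delta> * norm (x s)" if s: "s \<in> ?S" for s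
    proof -
      have "norm (C1 - l1 s - c1) \<le> 2 * \<delta> * norm (x s)" "norm (C2 - l2 s - C2) \<le> 2 * \<delta> * norm (x s)" "norm (C3 - l3 s - C3) \<le> 2 * \<delta> * norm (x s)"
        using fb'[of 0 s] fb'[of 1 s] fb'[of 2 s] s x\<delta>[OF s] by (simp_all add: c1_def l1_def l2_def l3_def)
      moreover have "norm c1 \<le> M" "norm C2 \<le> M" using n0 W00 \<delta> unfolding M_def by linarith+
      ultimately show ?thesis unfolding det1[symmetric] by (intro quad mM[OF s])
    qed
    let ?A0 = "\<lambda>s. conj_mat g1 g2 (a1 s) (a2 s) (a3 s)"
    let ?Ax = "\<lambda>s. conj_mat g1 g2 (l1 s - a1 s) (l2 s - a2 s) (l3 s - a3 s)"
    let ?A1 = "\<lambda>s. conj_mat g1 g2 (C1 - l1 s) (C2 - l2 s) (C3 - l3 s)"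
    have sys: "schlesinger_system \<theta>0 \<theta>x \<theta>1 \<theta>inf ?A0 ?Ax ?A1 ?S"
      by (rule schlesinger_of_triples[OF g(2) \<Theta> \<epsilon>(1) less_imp_le[OF \<epsilon>(2)] da dl Cmat lim0[unfolded x_def] limx[unfolded x_def] lim1[unfolded x_def]])
    have assoc: "PVI_associated ?A0 ?A1 (\<lambda>s. exp s * (ev \<sigma> y s / exp (\<sigma> * s))) ?S"
      unfolding PVI_associated_def Let_def
    proof
      fix s assume s: "s \<in> ?S"
      define b0 b1 d where "b0 = ?A0 s $ 1 $ 2" and "b1 = ?A1 s $ 1 $ 2" and "d = x s * (b0 + b1) - b1"
      have e0: "ev \<sigma> (series_a0 \<sigma> F) s = w s * b0"
      proof -
        have "ev \<sigma> (series_a0 \<sigma> F) s = 1 / \<sigma> * (2 * f 3 s + f 5 s - f 4 s)"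
          unfolding series_a0_def f_def by (simp only: E s)
        also have "\<dots> = w s * b0" unfolding b0_def conj_mat_nth g(1) using w0[of s] \<sigma>(2)
          by (simp add: a1_def a2_def a3_def divide_simps)
        finally show ?thesis .
      qed
      have e1: "ev \<sigma> (series_a1 \<sigma> F) s = b1"
      proof -
        have "ev \<sigma> (series_a1 \<sigma> F) s = 1 / \<sigma> * (f 1 s - 2 * f 0 s - f 2 s) - 1"
          unfolding series_a1_def f_def by (simp only: E s)
        also have "\<dots> = 1 / \<sigma> * (f 1 s - 2 * f 0 s - f 2 s) + (C2 - 2 * c1 - C3) / (- \<sigma>)" unfolding C12 by simp
        also have "\<dots> = b1" unfolding b1_def conj_mat_nth g(1) m[symmetric] using \<sigma>(2)
          by (simp add: l2_def l3_def divide_simps)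
        finally show ?thesis .
      qed
      have cs: "converges W \<rho> (series_a0 \<sigma> F)" "converges W \<rho> (series_a1 \<sigma> F)"
        unfolding series_a0_def series_a1_def by (intro cr cF)+
      have eg: "ev \<sigma> (series_g \<sigma> F) s = 1 - d"
      proof -
        have "ev \<sigma> (series_g \<sigma> F) s = (b1 + 1) - v s * (w s * b1) - v s * (w s * b0)"
          unfolding series_g_def by (simp only: E cs e0 e1 s)
        then show ?thesis using vw[of s] unfolding d_def by algebra
      qed
      \<comment> \<open>The bound 1/2 on \<open>series_g\<close> also keeps the denominator of the
        solution away from zero.\<close>
      have "norm (1 - d) \<le> 1/2" using norm_ev_le[OF rad[OF s] bg] by (simp add: eg)
      then have d0: "d \<noteq> 0" by auto
      have "ev \<sigma> y s = w s * b0 + (1 - d) * ev \<sigma> y s"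
        by (subst y(1)) (simp only: E cs e0 eg s)
      then have "ev \<sigma> y s * d = w s * b0" by algebra
      then have "exp s * (ev \<sigma> y s / exp (\<sigma> * s)) = exp s * b0 / d"
        using d0 w0[of s] by (simp add: w_def field_simps)
      then show "exp s * (?A0 s $ 1 $ 2 + ?A1 s $ 1 $ 2) - ?A1 s $ 1 $ 2 \<noteq> 0 \<and>
         exp s * (ev \<sigma> y s / exp (\<sigma> * s)) = exp s * ?A0 s $ 1 $ 2 / (exp s * (?A0 s $ 1 $ 2 + ?A1 s $ 1 $ 2) - ?A1 s $ 1 $ 2)"
        using d0 unfolding d_def b0_def b1_def x_def by blast
    qed
    obtain \<kappa> where \<kappa>: "\<kappa> \<ge> 0" "\<And>p q r i j. norm (conj_mat g1 g2 p q r $ i $ j) \<le> \<kappa> * (norm p + norm q + norm r)"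
      using conj_mat_bound by metis
    define C where "C = D + \<kappa> * (3 * M) + \<kappa> * (3 * \<delta>)"
    have M0: "M \<ge> 0" using n0 W00 \<delta> unfolding M_def by linarith
    have C: "D \<le> C" "\<kappa> * (3 * M) \<le> C" "\<kappa> * (3 * \<delta>) \<le> C" using D \<kappa>(1) \<delta> M0 by (simp_all add: C_def)
    have bound: "norm (?Ax s $ i $ j) \<le> C \<and> norm (?A1 s $ i $ j) \<le> C \<and> norm (?A0 s $ i $ j + ?Ax s $ i $ j - \<Lambda> $ i $ j) \<le> C * norm (exp s)"
      if s: "s \<in> ?S" for s i j
    proof (intro conjI)
      have "norm (?Ax s $ i $ j) \<le> \<kappa> * (3 * M)"
        by (rule order_trans[OF \<kappa>(2)], rule mult_left_mono) (use xM[OF s] \<kappa>(1) in auto)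
      then show "norm (?Ax s $ i $ j) \<le> C" using C(2) by linarith
      have "norm (?A1 s $ i $ j) \<le> \<kappa> * (3 * M)"
        by (rule order_trans[OF \<kappa>(2)], rule mult_left_mono) (use mM[OF s] \<kappa>(1) in auto)
      then show "norm (?A1 s $ i $ j) \<le> C" using C(2) by linarith
      have "?A0 s + ?Ax s = \<Lambda> + conj_mat g1 g2 (f 0 s) (f 1 s) (f 2 s)"
        unfolding \<Lambda>_def by (simp add: conj_mat_add l1_def l2_def l3_def)
      then have "?A0 s $ i $ j + ?Ax s $ i $ j - \<Lambda> $ i $ j = conj_mat g1 g2 (f 0 s) (f 1 s) (f 2 s) $ i $ j"
        by (metis vector_add_component add_diff_cancel_left')
      also have "norm \<dots> \<le> \<kappa> * (3 * (\<delta> * norm (x s)))"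
        by (rule order_trans[OF \<kappa>(2)], rule mult_left_mono) (use fb'[of 0 s] fb'[of 1 s] fb'[of 2 s] s \<kappa>(1) in auto)
      also have "\<dots> \<le> C * norm (x s)" using mult_right_mono[OF C(3) norm_ge_zero[of "x s"]] by (simp add: mult_ac)
      finally show "norm (?A0 s $ i $ j + ?Ax s $ i $ j - \<Lambda> $ i $ j) \<le> C * norm (exp s)" by (simp add: x_def)
    qed
    have ser: "(\<lambda>n. poly (fps_nth y n) (exp (\<sigma> * s)) * exp ((1 - \<sigma>) * s) ^ n) sums ev \<sigma> y s \<and>
        norm (ev \<sigma> y s - poly (fps_nth y 0) (exp (\<sigma> * s))) \<le> C * norm (exp s)" if s: "s \<in> ?S" for s
    proof
      show "(\<lambda>n. poly (fps_nth y n) (exp (\<sigma> * s)) * exp ((1 - \<sigma>) * s) ^ n) sums ev \<sigma> y s"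
        by (rule ev_sums[OF rad[OF s] cy])
      have "norm (ev \<sigma> y s - poly (fps_nth y 0) (w s)) \<le> C * norm (x s)"
        by (rule order_trans[OF rest[OF by' s]], fold D_def, rule mult_right_mono[OF C(1)]) simp
      then show "norm (ev \<sigma> y s - poly (fps_nth y 0) (exp (\<sigma> * s))) \<le> C * norm (exp s)" by (simp add: w_def x_def)
    qed
    show ?thesis
      by (rule exI[of _ \<epsilon>], rule exI[of _ C]) (use \<epsilon>(1,2) ser sys assoc bound in blast)
  qed
  have "trace \<Lambda> = 0" "det \<Lambda> = - (\<sigma>^2 / 4)"
    by (simp_all add: \<Lambda>_def trace_conj_mat det_conj_mat[OF g(2)] power2_eq_square)
  then show ?thesis using y(3) lead main by blast
qed

section \<open>Systems associated with a solution\<close>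

text \<open>The perturbation bound with \<open>D' = D\<close> holds for every
  \<open>e > 0\<close>.\<close>

lemma mat_ode_unique:
  assumes V: "mat_ode D V" "V 0 = mat 1" and W: "mat_ode D W" "W 0 = mat 1"
    and tr: "\<And>u. u \<in> {0..1} \<Longrightarrow> trace (D u) = 0" and u: "u \<in> {0..1}"
  shows "W u = V u"
proof -
  have "norm (W u - V u) \<le> 0 + e" if e: "e > 0" for e
  proof -
    obtain \<delta> where \<delta>: "\<delta> > 0" "\<forall>D' W. mat_ode D' W \<and> W 0 = mat 1 \<and> (\<forall>u\<in>{0..1}. norm (D' u - D u) \<le> \<delta>) \<longrightarrow>
       (\<forall>u\<in>{0..1}. norm (W u - V u) \<le> e)"
      using mat_ode_perturb[OF V tr e] by blast
    then have "\<forall>u\<in>{0..1}. norm (W u - V u) \<le> e" using \<delta>(2)[THEN spec, of D, THEN spec, of W] W by simp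
    then show ?thesis using u by simp
  qed
  then have "norm (W u - V u) \<le> 0" by (rule field_le_epsilon)
  then show ?thesis by simp
qed

text \<open>The hypotheses say that the second system is the first one conjugated by
  \<open>diag 1 (1/c)\<close>. Conjugating the fundamental solution in the same way produces that of
  the second system, with the same trace.\<close>

lemma trace_transp_diagonal_conj:
  fixes A0 Ax A1 B0 Bx B1 :: "complex^2^2"
  assumes c: "c \<noteq> 0" and x: "norm x < r" "r < 1"
    and tr: "trace A0 = 0" "trace Ax = 0" "trace A1 = 0" "trace B0 = 0" "trace Bx = 0" "trace B1 = 0"
    and diag: "B0 $ 1 $ 1 = A0 $ 1 $ 1" "Bx $ 1 $ 1 = Ax $ 1 $ 1" "B1 $ 1 $ 1 = A1 $ 1 $ 1"
    and upper: "B0 $ 1 $ 2 = c * A0 $ 1 $ 2" "Bx $ 1 $ 2 = c * Ax $ 1 $ 2" "B1 $ 1 $ 2 = c * A1 $ 1 $ 2"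
    and lower: "c * B0 $ 2 $ 1 = A0 $ 2 $ 1" "c * Bx $ 2 $ 1 = Ax $ 2 $ 1" "c * B1 $ 2 $ 1 = A1 $ 2 $ 1"
  shows "trace (fuchsian_transp B0 Bx B1 x (circ r)) = trace (fuchsian_transp A0 Ax A1 x (circ r))"
proof -
  let ?D = "circ_coeff A0 Ax A1 x r" and ?E = "circ_coeff B0 Bx B1 x r"
  obtain V where V: "mat_ode ?D V" "V 0 = mat 1" "V 1 = fuchsian_transp A0 Ax A1 x (circ r)"
    using circ_transport[OF x] by blast
  obtain V' where V': "mat_ode ?E V'" "V' 0 = mat 1" "V' 1 = fuchsian_transp B0 Bx B1 x (circ r)"
    using circ_transport[OF x] by blast
  have d22: "B0 $ 2 $ 2 = A0 $ 2 $ 2" "Bx $ 2 $ 2 = Ax $ 2 $ 2" "B1 $ 2 $ 2 = A1 $ 2 $ 2"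
    using tr diag by (simp_all add: trace_2 add_eq_0_iff)
  have l': "B0 $ 2 $ 1 = A0 $ 2 $ 1 / c" "Bx $ 2 $ 1 = Ax $ 2 $ 1 / c" "B1 $ 2 $ 1 = A1 $ 2 $ 1 / c"
    using lower c by (auto simp: field_simps)
  have pull: "t * (c * a / k + c * b / l + c * e / m) = c * (t * (a / k + b / l + e / m))"
    "t * (a / c / k + b / c / l + e / c / m) = t * (a / k + b / l + e / m) / c" for t a b e k l m
    by (simp add: distrib_left mult.left_commute) (simp add: distrib_left add_divide_distrib mult.commute)
  have E: "?E u $ 1 $ 1 = ?D u $ 1 $ 1" "?E u $ 2 $ 2 = ?D u $ 2 $ 2" "?E u $ 1 $ 2 = c * ?D u $ 1 $ 2" "?E u $ 2 $ 1 = ?D u $ 2 $ 1 / c" for u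
    by (simp_all only: circ_coeff_def fuchsian_coeff_def vec_lambda_beta diag d22 upper l' pull)
  define k :: "2 \<Rightarrow> complex" where "k = (\<lambda>i. if i = 1 then 1 else 1 / c)"
  have k: "k 1 = 1" "k 2 = 1 / c" by (simp_all add: k_def)
  define Z where "Z = (\<lambda>u. (\<chi> i j. k i * V u $ i $ j / k j) :: complex^2^2)"
  have "mat_ode ?E Z" unfolding mat_ode_def
  proof (intro ballI has_vector_derivative_mat2I)
    fix u :: real and i j :: 2 assume u: "u \<in> {0..1}"
    have "((\<lambda>u. V u $ i $ j) has_vector_derivative (?D u ** V u) $ i $ j) (at u within {0..1})"
      using V(1) u unfolding mat_ode_def
      by (intro bounded_linear.has_vector_derivative[OF bounded_linear_vec_nth] bounded_linear.has_vector_derivative[OF bounded_linear_vec_nth, of V]) auto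
    then have "((\<lambda>u. k i * V u $ i $ j / k j) has_vector_derivative k i * (?D u ** V u) $ i $ j / k j) (at u within {0..1})"
      by (intro has_vector_derivative_divide has_vector_derivative_mult_right)
    moreover have "k i * (?D u ** V u) $ i $ j / k j = (?E u ** Z u) $ i $ j"
      using exhaust_2[of i] exhaust_2[of j] c by (auto simp: mat2_mult_nth E Z_def k field_simps)
    ultimately show "((\<lambda>u. Z u $ i $ j) has_vector_derivative (?E u ** Z u) $ i $ j) (at u within {0..1})"
      by (simp add: Z_def)
  qed
  moreover have "Z 0 = mat 1" using c by (simp add: Z_def V(2) vec_eq_iff forall_2 mat_def k)
  moreover have "trace (?E u) = 0" for u by (rule trace_circ_coeff[OF tr(4-6)])
  ultimately have "Z 1 = V' 1" using mat_ode_unique[OF V'(1,2), of Z] by simp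
  moreover have "trace (Z 1) = trace (V 1)" using c by (simp add: trace_2 Z_def k)
  ultimately show ?thesis using V(3) V'(3) by simp
qed

definition assoc_denom :: "(complex \<Rightarrow> complex^2^2) \<Rightarrow> (complex \<Rightarrow> complex^2^2) \<Rightarrow> complex \<Rightarrow> complex" where
  "assoc_denom A0 A1 s = exp s * (A0 s $ 1 $ 2 + A1 s $ 1 $ 2) - A1 s $ 1 $ 2"

context
  fixes A0 Ax A1 :: "complex \<Rightarrow> complex^2^2" and Y :: "complex \<Rightarrow> complex" and W :: "complex set" and \<theta>0 \<theta>x \<theta>1 K :: complex
  assumes sys: "schlesinger_system \<theta>0 \<theta>x \<theta>1 K A0 Ax A1 W" and assoc: "PVI_associated A0 A1 Y W"
    and op: "open W" and x1: "\<forall>s\<in>W. exp s \<noteq> 1"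
begin

text \<open>The definitions of \<open>y\<close> and of its denominator, together with the vanishing
  sum, are three linear equations for the entries 12, which express them by \<open>x\<close>,
  \<open>y\<close> and the denominator.\<close>

lemma residue_scalars:
  assumes s: "s \<in> W"
  shows "assoc_denom A0 A1 s \<noteq> 0"
    "A0 s $ 1 $ 2 = assoc_denom A0 A1 s * Y s / exp s"
    "Ax s $ 1 $ 2 = assoc_denom A0 A1 s * (Y s - exp s) / (exp s * (exp s - 1))"
    "A1 s $ 1 $ 2 = assoc_denom A0 A1 s * (1 - Y s) / (exp s - 1)"
    "A0 s $ 1 $ 1 + Ax s $ 1 $ 1 + A1 s $ 1 $ 1 = - K / 2"
    "A0 s $ 2 $ 1 + Ax s $ 2 $ 1 + A1 s $ 2 $ 1 = 0"
    "A0 s $ 1 $ 2 + Ax s $ 1 $ 2 + A1 s $ 1 $ 2 = 0"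
    "trace (A0 s) = 0" "trace (Ax s) = 0" "trace (A1 s) = 0"
    "(A0 s $ 1 $ 1)^2 + A0 s $ 1 $ 2 * A0 s $ 2 $ 1 = (\<theta>0/2)^2"
    "(Ax s $ 1 $ 1)^2 + Ax s $ 1 $ 2 * Ax s $ 2 $ 1 = (\<theta>x/2)^2"
    "(A1 s $ 1 $ 1)^2 + A1 s $ 1 $ 2 * A1 s $ 2 $ 1 = (\<theta>1/2)^2"
proof -
  define x d where "x = exp s" and "d = assoc_denom A0 A1 s"
  have x: "x \<noteq> 0" "x - 1 \<noteq> 0" using x1[rule_format, OF s] by (auto simp: x_def)
  have d: "d \<noteq> 0" "Y s = x * A0 s $ 1 $ 2 / d"
    using assoc s by (auto simp: PVI_associated_def Let_def d_def x_def assoc_denom_def)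
  have sum: "A0 s + Ax s + A1 s = vector [vector [- K/2, 0], vector [0, K/2]]"
    and tr: "trace (A0 s) = 0" "trace (Ax s) = 0" "trace (A1 s) = 0"
    and ev: "eigenvalues (A0 s) = {\<theta>0/2, - \<theta>0/2}" "eigenvalues (Ax s) = {\<theta>x/2, - \<theta>x/2}" "eigenvalues (A1 s) = {\<theta>1/2, - \<theta>1/2}"
    using sys s by (auto simp: schlesinger_system_def)
  have e: "(A0 s + Ax s + A1 s) $ i $ j = (vector [vector [- K/2, 0], vector [0, K/2]] :: complex^2^2) $ i $ j" for i j
    by (simp only: sum)
  show s12: "A0 s $ 1 $ 2 + Ax s $ 1 $ 2 + A1 s $ 1 $ 2 = 0" using e[of 1 2] by (simp add: vector_2)
  show "A0 s $ 1 $ 1 + Ax s $ 1 $ 1 + A1 s $ 1 $ 1 = - K / 2" using e[of 1 1] by (simp add: vector_2)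
  show "A0 s $ 2 $ 1 + Ax s $ 2 $ 1 + A1 s $ 2 $ 1 = 0" using e[of 2 1] by (simp add: vector_2)
  show "trace (A0 s) = 0" "trace (Ax s) = 0" "trace (A1 s) = 0" by (fact tr)+
  have q: "(X $ 1 $ 1)^2 + X $ 1 $ 2 * X $ 2 $ 1 = (\<theta>/2)^2" if "trace X = 0" "eigenvalues X = {\<theta>/2, - \<theta>/2}" for X :: "complex^2^2" and \<theta>
  proof -
    have "X $ 2 $ 2 = - X $ 1 $ 1" using that(1) by (simp add: trace_2 add_eq_0_iff)
    moreover have "- det X = (\<theta>/2)^2" using that eigenvalues_half_iff by blast
    ultimately show ?thesis by (simp add: det_2 power2_eq_square add.commute)
  qed
  show "(A0 s $ 1 $ 1)^2 + A0 s $ 1 $ 2 * A0 s $ 2 $ 1 = (\<theta>0/2)^2"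
    "(Ax s $ 1 $ 1)^2 + Ax s $ 1 $ 2 * Ax s $ 2 $ 1 = (\<theta>x/2)^2"
    "(A1 s $ 1 $ 1)^2 + A1 s $ 1 $ 2 * A1 s $ 2 $ 1 = (\<theta>1/2)^2" by (rule q tr ev)+
  show "assoc_denom A0 A1 s \<noteq> 0" using d by (simp add: d_def)
  have a0: "A0 s $ 1 $ 2 = d * Y s / x" using d x by simp
  have a1: "A1 s $ 1 $ 2 = d * (1 - Y s) / (x - 1)"
  proof -
    have "d = x * (A0 s $ 1 $ 2 + A1 s $ 1 $ 2) - A1 s $ 1 $ 2" by (simp add: d_def assoc_denom_def x_def)
    moreover have "d * Y s = x * A0 s $ 1 $ 2" using d by simp
    ultimately have "A1 s $ 1 $ 2 * (x - 1) = d * (1 - Y s)" by algebra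
    then show ?thesis using x by (simp add: nonzero_eq_divide_eq)
  qed
  have "Ax s $ 1 $ 2 = - A0 s $ 1 $ 2 - A1 s $ 1 $ 2" using s12 by algebra
  also have "\<dots> = d * (Y s - x) / (x * (x - 1))" unfolding a0 a1 using x by (simp add: divide_simps) (simp add: algebra_simps)
  finally show "Ax s $ 1 $ 2 = assoc_denom A0 A1 s * (Y s - exp s) / (exp s * (exp s - 1))" by (simp add: d_def x_def)
  show "A0 s $ 1 $ 2 = assoc_denom A0 A1 s * Y s / exp s" "A1 s $ 1 $ 2 = assoc_denom A0 A1 s * (1 - Y s) / (exp s - 1)"
    using a0 a1 by (simp_all add: d_def x_def)
qed

text \<open>When the quotient defining \<open>y\<close> is differentiated by the Schlesinger
  equations, the scale of the denominator drops out and the result is linear in the diagonal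
  entries. In the derivative of the denominator the diagonal entries enter only through their sum,
  that is, through \<open>K\<close>.\<close>

lemma associated_first_derivative:
  assumes s: "s \<in> W"
  shows "(Y has_field_derivative exp s * x_deriv Y s) (at s)"
    and "exp s * (exp s - 1) * x_deriv Y s = Y s * (exp s - 1) * (1 + 2 * Ax s $ 1 $ 1)
       + 2 * A0 s $ 1 $ 1 * (exp s - Y s) - (1 - K) * Y s * (exp s - Y s)"
proof -
  define x y d where "x = exp s" and "y = Y s" and "d = assoc_denom A0 A1 s"
  define a0 ax a1 z0 zx z1 where "a0 = A0 s $ 1 $ 2" and "ax = Ax s $ 1 $ 2" and "a1 = A1 s $ 1 $ 2"
    and "z0 = A0 s $ 1 $ 1" and "zx = Ax s $ 1 $ 1" and "z1 = A1 s $ 1 $ 1"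
  note R = residue_scalars[OF s, folded x_def y_def d_def a0_def ax_def a1_def z0_def zx_def z1_def]
  have x: "x \<noteq> 0" "x - 1 \<noteq> 0" "1 - x \<noteq> 0" using x1[rule_format, OF s] by (auto simp: x_def)
  have t22: "A0 s $ 2 $ 2 = - z0" "Ax s $ 2 $ 2 = - zx" "A1 s $ 2 $ 2 = - z1"
    using R(8-10) by (simp_all add: trace_2 add_eq_0_iff z0_def zx_def z1_def)
  have D0: "((\<lambda>s. A0 s $ 1 $ 2) has_field_derivative 2 * (zx * a0 - z0 * ax)) (at s)"
    by (rule DERIV_cong[OF schlesinger_derivs(1)[OF sys op s x1[rule_format, OF s]]])
       (simp add: commutator_nth t22 a0_def ax_def z0_def zx_def)
  define a1' where "a1' = x / (1 - x) * (2 * (z1 * ax - zx * a1))"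
  have D1: "((\<lambda>s. A1 s $ 1 $ 2) has_field_derivative a1') (at s)"
    by (rule DERIV_cong[OF schlesinger_derivs(2)[OF sys op s x1[rule_format, OF s]]])
       (simp add: commutator_nth t22 a1_def ax_def z1_def zx_def x_def a1'_def)
  have Dd: "(assoc_denom A0 A1 has_field_derivative x * (a0 + a1) * (1 - K)) (at s)"
  proof -
    have "(assoc_denom A0 A1 has_field_derivative x * (a0 + a1) + x * (2 * (zx * a0 - z0 * ax) + a1') - a1') (at s)"
      unfolding assoc_denom_def x_def a0_def a1_def
      by (rule DERIV_cong, (rule derivative_eq_intros refl D0[unfolded a0_def] D1)+) (simp add: algebra_simps a0_def)
    moreover have "x * (a0 + a1) + x * (2 * (zx * a0 - z0 * ax) + a1') - a1' = x * (a0 + a1) * (1 - K)"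
    proof -
      have "(x - 1) * a1' = - x * (2 * (z1 * ax - zx * a1))" using x(3) unfolding a1'_def by (simp add: field_simps)
      moreover have "ax = - (a0 + a1)" "z0 + zx + z1 = - K / 2" using R(5,7) by algebra+
      ultimately show ?thesis by algebra
    qed
    ultimately show ?thesis by simp
  qed
  have Yeq: "Y t = exp t * A0 t $ 1 $ 2 / assoc_denom A0 A1 t" if "t \<in> W" for t
    using assoc that by (auto simp: PVI_associated_def Let_def assoc_denom_def)
  define Y' where "Y' = ((x * a0 + x * (2 * (zx * a0 - z0 * ax))) * d - x * a0 * (x * (a0 + a1) * (1 - K))) / (d * d)"
  have "((\<lambda>t. exp t * A0 t $ 1 $ 2 / assoc_denom A0 A1 t) has_field_derivative Y') (at s)"
    unfolding Y'_def
    by (rule DERIV_cong, (rule derivative_eq_intros refl D0 Dd)+)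
       (use R(1) in \<open>simp_all add: d_def x_def a0_def mult_ac\<close>)
  then have DY: "(Y has_field_derivative Y') (at s)"
    by (rule has_field_derivative_transform_within_open[OF _ op s]) (simp add: Yeq)
  have P: "x_deriv Y s = Y' / x" using DERIV_imp_deriv[OF DY] by (simp add: x_deriv_def x_def)
  then show "(Y has_field_derivative exp s * x_deriv Y s) (at s)" using DY x(1) by (simp add: x_def)
  have "(x - 1) * Y' = y * (x - 1) * (1 + 2 * zx) + 2 * z0 * (x - y) - (1 - K) * y * (x - y)"
  proof -
    have e: "x * a0 = d * y" "x * (x - 1) * ax = d * (y - x)" "(x - 1) * (a0 + a1) * x = d * (x - y)"
    proof -
      show xa0: "x * a0 = d * y" using R(2) x by simp
      show xax: "x * (x - 1) * ax = d * (y - x)" using R(3) x by simp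
      show "(x - 1) * (a0 + a1) * x = d * (x - y)" using xax R(7) by algebra
    qed
    have "(x - 1) * ((x * a0 + x * (2 * (zx * a0 - z0 * ax))) * d - x * a0 * (x * (a0 + a1) * (1 - K)))
      = (y * (x - 1) * (1 + 2 * zx) + 2 * z0 * (x - y) - (1 - K) * y * (x - y)) * (d * d)"
      using e by algebra
    then show ?thesis unfolding Y'_def times_divide_eq_right using R(1) by (simp only: nonzero_mult_div_cancel_right mult_eq_0_iff simp_thms)
  qed
  then show "exp s * (exp s - 1) * x_deriv Y s = Y s * (exp s - 1) * (1 + 2 * Ax s $ 1 $ 1)
       + 2 * A0 s $ 1 $ 1 * (exp s - Y s) - (1 - K) * Y s * (exp s - Y s)"
    using x(1) by (simp add: P x_def[symmetric] y_def[symmetric] z0_def[symmetric] zx_def[symmetric])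
qed

lemma associated_holomorphic: "Y holomorphic_on W"
  unfolding holomorphic_on_open[OF op] using associated_first_derivative(1) by blast

text \<open>The first-order relation holds on all of \<open>W\<close>, so its two sides may be
  differentiated once more; this gives the second derivative in terms of the scalars in
  \<open>PVI_of_scalar_identities\<close>.\<close>

lemma associated_PVI:
  assumes s: "s \<in> W" and ne: "Y s \<notin> {0, 1, exp s}"
    and par: "\<alpha> = (K - 1)^2 / 2" "\<beta> = - (\<theta>0^2 / 2)" "\<gamma> = \<theta>1^2 / 2" "\<delta> = (1 - \<theta>x^2) / 2"
  shows "x_deriv (x_deriv Y) s = PVI_rhs \<alpha> \<beta> \<gamma> \<delta> (exp s) (Y s) (x_deriv Y s)"
proof -
  define x y d P Q where "x = exp s" and "y = Y s" and "d = assoc_denom A0 A1 s" and "P = x_deriv Y s" and "Q = x_deriv (x_deriv Y) s"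
  define a0 ax a1 z0 zx z1 b0 bx b1 where "a0 = A0 s $ 1 $ 2" and "ax = Ax s $ 1 $ 2" and "a1 = A1 s $ 1 $ 2"
    and "z0 = A0 s $ 1 $ 1" and "zx = Ax s $ 1 $ 1" and "z1 = A1 s $ 1 $ 1"
    and "b0 = A0 s $ 2 $ 1" and "bx = Ax s $ 2 $ 1" and "b1 = A1 s $ 2 $ 1"
  note R = residue_scalars[OF s, folded x_def y_def d_def a0_def ax_def a1_def z0_def zx_def z1_def b0_def bx_def b1_def]
  have x: "x \<noteq> 0" "x \<noteq> 1" "x - 1 \<noteq> 0" "1 - x \<noteq> 0" using x1[rule_format, OF s] by (auto simp: x_def)
  \<comment> \<open>Scaled by the denominator \<open>d\<close>, the lower entries become invariant
    under diagonal conjugation.\<close>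
  define u v where "u = bx * d / (x * (x - 1))" and "v = b0 * d / (x * (x - 1))"
  define z0d z1d zxd where "z0d = (ax * b0 - a0 * bx) / x" and "z1d = (a1 * bx - ax * b1) / (1 - x)" and "zxd = - z0d - z1d"
  have prods: "a0 * b0 = y * (x - 1) * v" "ax * bx = (y - x) * u" "ax * b0 = (y - x) * v" "a0 * bx = y * (x - 1) * u"
    "a1 * bx = (1 - y) * x * u" "a1 * b0 = (1 - y) * x * v"
    unfolding R(2-4) u_def v_def using x by simp_all
  have b1: "b1 = - b0 - bx" using R(6) by algebra
  have axb1: "- (ax * b1) = (y - x) * (v + u)" "a1 * b1 = (y - 1) * x * (u + v)" unfolding b1 using prods by algebra+
  have D0: "((\<lambda>s. A0 s $ 1 $ 1) has_field_derivative x * z0d) (at s)"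
    by (rule DERIV_cong[OF schlesinger_derivs(1)[OF sys op s x1[rule_format, OF s]]])
       (use x in \<open>simp add: commutator_nth z0d_def a0_def ax_def b0_def bx_def mult_ac\<close>)
  have Dx: "((\<lambda>s. Ax s $ 1 $ 1) has_field_derivative x * zxd) (at s)"
  proof (rule DERIV_cong[OF schlesinger_derivs(3)[OF sys op s x1[rule_format, OF s]]])
    define k where "k = x / (1 - x)"
    have k: "x / (x - 1) = - k" using x unfolding k_def by (simp add: divide_simps) (simp add: algebra_simps)
    have "x * zxd = - (x * z0d) - x * z1d" by (simp add: zxd_def right_diff_distrib)
    also have "x * z0d = ax * b0 - a0 * bx" using x by (simp add: z0d_def)
    also have "x * z1d = k * (a1 * bx - ax * b1)" by (simp add: z1d_def k_def)
    finally show "commutator (A0 s) (Ax s) $ 1 $ 1 + exp s / (exp s - 1) * commutator (A1 s) (Ax s) $ 1 $ 1 = x * zxd"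
      unfolding commutator_nth x_def[symmetric] k a0_def[symmetric] ax_def[symmetric] a1_def[symmetric]
        b0_def[symmetric] bx_def[symmetric] b1_def[symmetric]
      by (simp add: algebra_simps)
  qed
  have DY: "(Y has_field_derivative x * P) (at s)" using associated_first_derivative(1)[OF s] by (simp add: x_def P_def)
  have DP: "(x_deriv Y has_field_derivative x * Q) (at s)"
  proof -
    have "x_deriv Y holomorphic_on W" unfolding x_deriv_def
      by (intro holomorphic_intros holomorphic_deriv associated_holomorphic op) simp
    from holomorphic_derivI[OF this op s] show ?thesis by (simp add: Q_def x_deriv_def[of "x_deriv Y"] x_def)
  qed
  have DL: "((\<lambda>s. exp s * (exp s - 1) * x_deriv Y s) has_field_derivative x * ((2 * x - 1) * P + x * (x - 1) * Q)) (at s)"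
    by (rule DERIV_cong, (rule derivative_eq_intros refl DP)+) (simp add: x_def[symmetric] P_def[symmetric] algebra_simps)
  have DR: "((\<lambda>s. Y s * (exp s - 1) * (1 + 2 * Ax s $ 1 $ 1) + 2 * A0 s $ 1 $ 1 * (exp s - Y s) - (1 - K) * Y s * (exp s - Y s))
     has_field_derivative x * ((P * (x - 1) + y) * (1 + 2 * zx) + 2 * y * (x - 1) * zxd + 2 * z0d * (x - y) + 2 * z0 * (1 - P)
       - (1 - K) * (P * (x - y) + y * (1 - P)))) (at s)"
    by (rule DERIV_cong, (rule derivative_eq_intros refl DY D0 Dx)+)
      (simp add: x_def[symmetric] y_def[symmetric] z0_def[symmetric] zx_def[symmetric] algebra_simps)
  have "((\<lambda>s. exp s * (exp s - 1) * x_deriv Y s) has_field_derivative x * ((P * (x - 1) + y) * (1 + 2 * zx) + 2 * y * (x - 1) * zxd + 2 * z0d * (x - y) + 2 * z0 * (1 - P)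
       - (1 - K) * (P * (x - y) + y * (1 - P)))) (at s)"
    by (rule has_field_derivative_transform_within_open[OF DR op s]) (simp only: associated_first_derivative(2))
  from DERIV_unique[OF DL this] have eqQ: "(2 * x - 1) * P + x * (x - 1) * Q =
       (P * (x - 1) + y) * (1 + 2 * zx) + 2 * y * (x - 1) * zxd + 2 * z0d * (x - y) + 2 * z0 * (1 - P)
       - (1 - K) * (P * (x - y) + y * (1 - P))" using x(1) by simp
  have "Q = PVI_rhs \<alpha> \<beta> \<gamma> \<delta> x y P"
  proof (rule PVI_of_scalar_identities[where K = K and ?z0.0 = z0 and zx = zx and ?z1.0 = z1 and u = u and v = v and z0d = z0d and z1d = z1d and zxd = zxd])
    show "y \<noteq> 0" "y \<noteq> 1" "y \<noteq> x" using ne by (auto simp: y_def x_def)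
    show "K = -2 * (z0 + zx + z1)" using R(5) by simp
    show "x * (x - 1) * P = y * (x - 1) * (1 + 2 * zx) + 2 * z0 * (x - y) - (1 - K) * y * (x - y)"
      using associated_first_derivative(2)[OF s] by (simp only: x_def y_def P_def z0_def zx_def)
    show "x * z0d = (y - x) * v - y * (x - 1) * u" using x(1) by (simp add: z0d_def prods)
    show "(1 - x) * z1d = (1 - y) * x * u + (y - x) * (v + u)" using x(4) axb1(1) by (simp add: z1d_def prods(5) add.commute)
    have T: "y * (x - 1) * v + z0^2 = (\<theta>0/2)^2" "(y - 1) * x * (u + v) + z1^2 = (\<theta>1/2)^2" "(y - x) * u + zx^2 = (\<theta>x/2)^2"
      using R(11-13) prods(1,2) axb1(2) by (simp_all only: add.commute)
    show "\<beta> = -2 * (y * (x - 1) * v + z0^2)" unfolding T par(2) by (simp add: power_divide)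
    show "\<gamma> = 2 * ((y - 1) * x * (u + v) + z1^2)" unfolding T par(3) by (simp add: power_divide)
    show "\<delta> = (1 - 4 * ((y - x) * u + zx^2)) / 2" unfolding T par(4) by (simp add: power_divide)
  qed (fact x eqQ par(1) zxd_def)+
  then show ?thesis by (simp add: Q_def P_def x_def y_def)
qed

end

text \<open>Both systems satisfy the same scalar relations with the same \<open>y\<close> and
  \<open>x_deriv Y\<close>. Away from the values \<open>0\<close>, \<open>1\<close>,
  \<open>x\<close> these determine the residues up to the ratio \<open>e / d\<close> of the two
  denominators, which acts as a diagonal conjugation.\<close>

theorem associated_trace_unique:
  assumes sysA: "schlesinger_system \<theta>0 \<theta>x \<theta>1 K A0 Ax A1 W" "PVI_associated A0 A1 Y W"
    and sysB: "schlesinger_system \<theta>0 \<theta>x \<theta>1 K B0 Bx B1 W" "PVI_associated B0 B1 Y W"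
    and op: "open W" and x1: "\<forall>s\<in>W. exp s \<noteq> 1" and K: "K \<noteq> 0"
    and s: "s \<in> W" and ne: "Y s \<notin> {0, 1, exp s}" and r: "norm (exp s) < r" "r < 1"
  shows "trace (fuchsian_transp (B0 s) (Bx s) (B1 s) (exp s) (circ r)) = trace (fuchsian_transp (A0 s) (Ax s) (A1 s) (exp s) (circ r))"
proof -
  define d e where "d = assoc_denom A0 A1 s" and "e = assoc_denom B0 B1 s"
  note RA = residue_scalars[OF sysA op x1 s, folded d_def] and RB = residue_scalars[OF sysB op x1 s, folded e_def]
  have de: "d \<noteq> 0" "e \<noteq> 0" using RA(1) RB(1) by auto
  have "B0 s $ 1 $ 1 = A0 s $ 1 $ 1 \<and> Bx s $ 1 $ 1 = Ax s $ 1 $ 1 \<and> B1 s $ 1 $ 1 = A1 s $ 1 $ 1 \<and>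
     e * B0 s $ 2 $ 1 = d * A0 s $ 2 $ 1 \<and> e * Bx s $ 2 $ 1 = d * Ax s $ 2 $ 1 \<and> e * B1 s $ 2 $ 1 = d * A1 s $ 2 $ 1"
  proof (rule residues_unique[where x = "exp s" and y = "Y s" and K = K and P = "x_deriv Y s"
        and ?T0.0 = "(\<theta>0/2)^2" and Tx = "(\<theta>x/2)^2" and ?T1.0 = "(\<theta>1/2)^2"])
    show "Y s \<noteq> 0" "Y s \<noteq> 1" "Y s \<noteq> exp s" "exp s \<noteq> 0" using ne by auto
    show "exp s \<noteq> 1" by (rule x1[rule_format, OF s])
  qed (fact K de RA(5,6) RB(5,6) associated_first_derivative(2)[OF sysA op x1 s] associated_first_derivative(2)[OF sysB op x1 s]
        RA(11,12,13)[unfolded RA(2-4)] RB(11,12,13)[unfolded RB(2-4)])+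
  then show ?thesis using de
    by (intro trace_transp_diagonal_conj[where c = "e / d", OF _ r RA(8-10) RB(8-10)])
      (simp_all add: RA(2-4) RB(2-4))
qed

section \<open>The behavior at $x = 0$\<close>

lemma cosh_gt: "u \<noteq> 0 \<Longrightarrow> exp u + exp (- u) > (2::real)"
proof -
  assume u: "u \<noteq> 0"
  have "exp (u/2) \<noteq> exp (- u/2)" using u by simp
  then have "(exp (u/2) - exp (- u/2))^2 > 0" by simp
  also have "(exp (u/2) - exp (- u/2))^2 = exp (u/2) * exp (u/2) + exp (- u/2) * exp (- u/2) - 2 * (exp (u/2) * exp (- u/2))"
    by (simp add: power2_eq_square algebra_simps)
  also have "\<dots> = exp u + exp (- u) - 2" by (simp flip: exp_add)
  finally show ?thesis by simp
qed

lemma two_cos_imaginary: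
  assumes "Re \<sigma> = 0" "\<sigma> \<noteq> 0"
  shows "2 * cos (of_real pi * \<sigma>) \<in> \<real>" "Re (2 * cos (of_real pi * \<sigma>)) > 2"
proof -
  define u where "u = pi * Im \<sigma>"
  have "Im \<sigma> \<noteq> 0" using assms by (simp add: complex_eq_iff)
  then have u: "u \<noteq> 0" by (simp add: u_def)
  have "\<sigma> = \<i> * of_real (Im \<sigma>)" using assms(1) by (simp add: complex_eq_iff)
  then have "of_real pi * \<sigma> = \<i> * of_real u" by (simp add: u_def mult_ac)
  then have "cos (of_real pi * \<sigma>) = (exp (\<i> * (\<i> * of_real u)) + exp (- (\<i> * (\<i> * of_real u)))) / 2" by (simp only: cos_exp_eq)
  also have "\<i> * (\<i> * of_real u) = of_real (- u)" by (simp flip: mult.assoc)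
  finally have f: "cos (of_real pi * \<sigma>) = (exp (of_real (- u)) + exp (- of_real (- u))) / 2" .
  have "2 * cos (of_real pi * \<sigma>) = of_real (exp u + exp (- u))" unfolding f by (simp add: exp_of_real[symmetric])
  then show "2 * cos (of_real pi * \<sigma>) \<in> \<real>" "Re (2 * cos (of_real pi * \<sigma>)) > 2" using cosh_gt[OF u] by (simp_all only: Reals_of_real Re_complex_of_real)
qed

text \<open>A continuous function on the line with values in a finite set is constant, and the sine
  would take one value at the arguments \<open>\<phi>\<close>, \<open>\<phi> + pi/2\<close> and
  \<open>\<phi> + pi\<close>, so sine and cosine of \<open>\<phi>\<close> would both vanish.\<close>

lemma sine_leading_term_nonconstant:
  fixes A B \<phi> :: complex and \<kappa> :: real
  assumes A: "A \<noteq> 0" and \<kappa>: "\<kappa> \<noteq> 0"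
  shows "\<exists>u::real. \<i> * A * sin (of_real (\<kappa> * u) + \<phi>) + B \<notin> {0, 1}"
proof (rule ccontr)
  let ?L = "\<lambda>u::real. \<i> * A * sin (of_real (\<kappa> * u) + \<phi>) + B"
  assume "\<not> ?thesis"
  then have "range ?L \<subseteq> {0, 1}" by blast
  then have "finite (range ?L)" by (rule finite_subset) simp
  moreover have "connected (range ?L)" by (intro connected_continuous_image continuous_intros) simp
  ultimately obtain c where "range ?L = {c}" using connected_finite_iff_sing by blast
  then have L: "?L u = c" for u by blast
  define k where "k = (c - B) / (\<i> * A)"
  have k: "sin (of_real v + \<phi>) = k" for v
    using L[of "v / \<kappa>"] A \<kappa> by (simp add: k_def field_simps)
  have "sin \<phi> = k" using k[of 0] by simp
  moreover have "- sin \<phi> = k" using k[of pi] by (simp add: sin_add sin_of_real cos_of_real)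
  moreover have "cos \<phi> = k" using k[of "pi/2"] by (simp add: sin_add)
  ultimately have "sin \<phi> = 0" "cos \<phi> = 0" by auto
  then show False using sin_cos_squared_add[of \<phi>] by simp
qed

text \<open>The leading term is periodic along the real \<open>s\<close>-axis, while \<open>\<delta>s\<close> tends to zero.\<close>

lemma generic_points:
  fixes Y \<delta>s :: "complex \<Rightarrow> complex"
  assumes A: "A \<noteq> 0" and \<sigma>: "Re \<sigma> = 0" "\<sigma> \<noteq> 0" and \<Theta>: "\<Theta> > 0"
    and Y: "\<And>s. s \<in> log_sector \<epsilon> \<Theta> \<Longrightarrow> Y s = exp s * (\<i> * A * sin (\<i> * \<sigma> * s + \<phi>) + B + \<delta>s s)"
    and \<delta>s: "\<And>s. s \<in> log_sector \<epsilon> \<Theta> \<Longrightarrow> norm (\<delta>s s) \<le> C * norm (exp s)"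
  shows "\<exists>s\<in>log_sector \<epsilon> \<Theta>. Y s \<notin> {0, 1, exp s}"
proof -
  define \<kappa> where "\<kappa> = - Im \<sigma>"
  have i\<sigma>: "\<i> * \<sigma> = of_real \<kappa>" using \<sigma>(1) by (simp add: complex_eq_iff \<kappa>_def)
  have \<kappa>: "\<kappa> \<noteq> 0" using \<sigma> by (simp add: \<kappa>_def complex_eq_iff)
  obtain u where u: "\<i> * A * sin (of_real (\<kappa> * u) + \<phi>) + B \<notin> {0, 1}" using sine_leading_term_nonconstant[OF A \<kappa>] by blast
  define L where "L = \<i> * A * sin (of_real (\<kappa> * u) + \<phi>) + B"
  define e where "e = min (norm L) (norm (L - 1))"
  have e: "e > 0" "e \<le> norm L" "e \<le> norm (L - 1)" proof -
    have "L \<noteq> 0" "L \<noteq> 1" using u unfolding L_def by auto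
    then show "e > 0" "e \<le> norm L" "e \<le> norm (L - 1)" by (auto simp: e_def)
  qed
  \<comment> \<open>A bound for \<open>norm x\<close> under which the remainder stays below
    \<open>e\<close>, so that the bracket misses \<open>0\<close> and \<open>1\<close>, and under
    which \<open>Y\<close> itself has modulus below 1.\<close>
  define \<eta> where "\<eta> = min (e / (2 * (\<bar>C\<bar> + 1))) (1 / (2 * (norm L + e + 1)))"
  have pos: "2 * (\<bar>C\<bar> + 1) > 0" "2 * (norm L + e + 1) > 0" proof -
    have "\<bar>C\<bar> + 1 > 0" by (rule add_nonneg_pos[OF abs_ge_zero zero_less_one])
    then show "2 * (\<bar>C\<bar> + 1) > 0" by simp
    have "norm L + e + 1 > 0" using e(1) by (intro add_nonneg_pos add_nonneg_nonneg) auto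
    then show "2 * (norm L + e + 1) > 0" by simp
  qed
  have \<eta>: "\<eta> > 0" "\<bar>C\<bar> * \<eta> < e" "\<eta> * (norm L + e) < 1"
  proof -
    show \<eta>0: "\<eta> > 0" unfolding \<eta>_def min_less_iff_conj using pos e(1) by (intro conjI divide_pos_pos) simp_all
    have "\<eta> \<le> e / (2 * (\<bar>C\<bar> + 1))" "\<eta> \<le> 1 / (2 * (norm L + e + 1))" by (simp_all add: \<eta>_def)
    then have h: "\<eta> * (2 * (\<bar>C\<bar> + 1)) \<le> e" "\<eta> * (2 * (norm L + e + 1)) \<le> 1" using pos by (simp_all add: pos_le_divide_eq)
    have h0: "\<bar>C\<bar> * \<eta> \<ge> 0" "\<eta> * (norm L + e) \<ge> 0" using \<eta>0 e(1) by simp_all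
    have "\<eta> * (2 * (\<bar>C\<bar> + 1)) = 2 * (\<bar>C\<bar> * \<eta>) + 2 * \<eta>" "\<eta> * (2 * (norm L + e + 1)) = 2 * (\<eta> * (norm L + e)) + 2 * \<eta>"
      by (simp_all add: algebra_simps)
    then have "2 * (\<bar>C\<bar> * \<eta>) + 2 * \<eta> \<le> e" "2 * (\<eta> * (norm L + e)) + 2 * \<eta> \<le> 1" using h by simp_all
    moreover have "z < c" if "2 * z + 2 * \<eta> \<le> c" "z \<ge> 0" for z c :: real using that \<eta>0 by linarith
    ultimately show "\<bar>C\<bar> * \<eta> < e" "\<eta> * (norm L + e) < 1" using h0 by blast+
  qed
  define P where "P = 2 * pi / \<bar>\<kappa>\<bar>"
  have "P > 0" using \<kappa> by (simp add: P_def)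
  then obtain n :: nat where n: "u - min (ln \<epsilon>) (ln \<eta>) < of_nat n * P" using ex_less_of_nat_mult by blast
  define t where "t = u - of_nat n * P"
  have t: "t < ln \<epsilon>" "t < ln \<eta>" using n by (auto simp: t_def)
  have S: "of_real t \<in> log_sector \<epsilon> \<Theta>" by (rule log_sector_real[OF \<Theta> t(1)])
  have x: "norm (exp (complex_of_real t)) < \<eta>"
  proof -
    have "exp t < exp (ln \<eta>)" using t(2) by (simp only: exp_less_cancel_iff)
    then show ?thesis using \<eta>(1) by (simp add: norm_exp_eq_Re)
  qed
  define m :: int where "m = (if \<kappa> > 0 then - int n else int n)"
  have "\<kappa> * t = \<kappa> * u + of_int m * (2 * pi)"
    using \<kappa> by (auto simp: t_def P_def m_def right_diff_distrib abs_if)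
  then have "complex_of_real (\<kappa> * t) = complex_of_real (\<kappa> * u) + of_int m * (2 * of_real pi)"
    by (metis of_real_add of_real_mult of_real_of_int_eq of_real_numeral)
  moreover have "\<i> * \<sigma> * of_real t = complex_of_real (\<kappa> * t)" unfolding i\<sigma> by simp
  ultimately have arg: "\<i> * \<sigma> * of_real t + \<phi> = (complex_of_real (\<kappa> * u) + \<phi>) + of_int m * (2 * of_real pi)"
    by (simp only: add_ac)
  have "sin (\<i> * \<sigma> * of_real t + \<phi>) = sin (of_real (\<kappa> * u) + \<phi>)"
    unfolding arg by (rule sin.plus_of_int)
  then have Yt: "Y (of_real t) = exp (of_real t) * (L + \<delta>s (of_real t))" using Y[OF S] by (simp add: L_def)
  have d: "norm (\<delta>s (of_real t)) < e"
  proof -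
    have "norm (\<delta>s (of_real t)) \<le> C * norm (exp (complex_of_real t))" by (rule \<delta>s[OF S])
    also have "\<dots> \<le> \<bar>C\<bar> * \<eta>" using x by (intro mult_mono) auto
    finally show ?thesis using \<eta>(2) by linarith
  qed
  have "L + \<delta>s (of_real t) \<noteq> 0" using d e(2) by (metis add_eq_0_iff norm_minus_cancel not_less)
  moreover have "L + \<delta>s (of_real t) \<noteq> 1"
  proof
    assume "L + \<delta>s (of_real t) = 1"
    then have "L - 1 = - \<delta>s (of_real t)" by algebra
    then show False using d e(3) by simp
  qed
  moreover have "Y (of_real t) \<noteq> 1"
  proof -
    have "norm (L + \<delta>s (of_real t)) \<le> norm L + e" using d norm_triangle_ineq[of L "\<delta>s (of_real t)"] by linarith
    then have "norm (Y (of_real t)) \<le> \<eta> * (norm L + e)"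
      unfolding Yt norm_mult using x \<eta>(1) by (intro mult_mono) auto
    then show ?thesis using \<eta>(3) by auto
  qed
  ultimately show ?thesis using Yt S by (intro bexI[of _ "of_real t"]) auto
qed

section \<open>The two forms of the expansion\<close>

lemma sum_shift_int:
  fixes f :: "int \<Rightarrow> complex"
  shows "(\<Sum>k\<le>2 * n + 2. f (int k - int n - 1)) = (\<Sum>m = - int n - 1..int n + 1. f m)"
  by (rule sum.reindex_bij_witness[of _ "\<lambda>m. nat (m + int n + 1)" "\<lambda>k. int k - int n - 1"]) auto

text \<open>From \<open>v * w = x\<close> one gets \<open>v^n * w^k / w = x^n * w^(k-n-1)\<close>,
  so the new index is \<open>m = k - n - 1\<close>.\<close>

lemma term_as_double_sum:
  assumes y: "degree_bound 2 y"
  shows "poly (fps_nth y n) (exp (\<sigma> * s)) * exp ((1 - \<sigma>) * s) ^ n / exp (\<sigma> * s) =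
    exp s ^ n * (\<Sum>m = - int n - 1..int n + 1. coeff (fps_nth y n) (nat (m + int n + 1)) * exp (of_int m * \<sigma> * s))"
proof -
  have deg: "degree (fps_nth y n) \<le> 2 * n + 2" using y by (simp add: degree_bound_def)
  have "poly (fps_nth y n) z = (\<Sum>k\<le>2 * n + 2. coeff (fps_nth y n) k * z ^ k)" for z
    unfolding poly_altdef using deg by (intro sum.mono_neutral_left) (auto simp: coeff_eq_0)
  then have "poly (fps_nth y n) (exp (\<sigma> * s)) * exp ((1 - \<sigma>) * s) ^ n / exp (\<sigma> * s)
      = (\<Sum>k\<le>2 * n + 2. coeff (fps_nth y n) k * (exp (\<sigma> * s) ^ k * exp ((1 - \<sigma>) * s) ^ n / exp (\<sigma> * s)))"
    by (simp only: sum_distrib_right sum_divide_distrib mult.assoc times_divide_eq_right)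
  also have "\<dots> = (\<Sum>k\<le>2 * n + 2. exp s ^ n * (coeff (fps_nth y n) (nat ((int k - int n - 1) + int n + 1)) * exp (of_int (int k - int n - 1) * \<sigma> * s)))"
  proof (rule sum.cong[OF refl])
    fix k
    have "exp (\<sigma> * s) ^ k * exp ((1 - \<sigma>) * s) ^ n / exp (\<sigma> * s) = exp s ^ n * exp (of_int (int k - int n - 1) * \<sigma> * s)"
      by (simp add: exp_of_nat_mult[symmetric] exp_add[symmetric] exp_diff[symmetric] algebra_simps)
    then show "coeff (fps_nth y n) k * (exp (\<sigma> * s) ^ k * exp ((1 - \<sigma>) * s) ^ n / exp (\<sigma> * s)) =
        exp s ^ n * (coeff (fps_nth y n) (nat ((int k - int n - 1) + int n + 1)) * exp (of_int (int k - int n - 1) * \<sigma> * s))"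
      by (simp add: mult_ac)
  qed
  also have "\<dots> = (\<Sum>m = - int n - 1..int n + 1. exp s ^ n * (coeff (fps_nth y n) (nat (m + int n + 1)) * exp (of_int m * \<sigma> * s)))"
    by (rule sum_shift_int[where f = "\<lambda>m. exp s ^ n * (coeff (fps_nth y n) (nat (m + int n + 1)) * exp (of_int m * \<sigma> * s))"])
  finally show ?thesis unfolding sum_distrib_left .
qed

text \<open>Writing \<open>x^n = v^n * w^n\<close> shifts the inner index by
  \<open>n\<close>.\<close>

lemma double_sum_forms:
  "(\<Sum>m1 = -1..2 * int n + 1. b n (m1 - int n) * exp (of_int m1 * \<sigma> * s) * exp (of_nat n * (1 - \<sigma>) * s)) =
    exp s ^ n * (\<Sum>m = - int n - 1..int n + 1. b n m * exp (of_int m * \<sigma> * s))" for b :: "nat \<Rightarrow> int \<Rightarrow> complex"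
proof -
  have "(\<Sum>m1 = -1..2 * int n + 1. b n (m1 - int n) * exp (of_int m1 * \<sigma> * s) * exp (of_nat n * (1 - \<sigma>) * s))
     = (\<Sum>m = - int n - 1..int n + 1. exp s ^ n * (b n m * exp (of_int m * \<sigma> * s)))"
  proof (rule sum.reindex_bij_witness[of _ "\<lambda>m. m + int n" "\<lambda>m. m - int n"])
    fix m1 :: int
    have "exp (of_int m1 * \<sigma> * s) * exp (of_nat n * (1 - \<sigma>) * s) = exp s ^ n * exp (of_int (m1 - int n) * \<sigma> * s)"
      by (simp add: exp_of_nat_mult[symmetric] exp_add[symmetric] algebra_simps)
    then show "exp s ^ n * (b n (m1 - int n) * exp (of_int (m1 - int n) * \<sigma> * s)) = b n (m1 - int n) * exp (of_int m1 * \<sigma> * s) * exp (of_nat n * (1 - \<sigma>) * s)"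
      by (simp add: mult_ac)
  qed auto
  then show ?thesis by (simp add: sum_distrib_left)
qed

lemma norm_inverse_exp_sector:
  assumes "Re \<sigma> = 0" "\<Theta> > 0" "\<bar>Im s\<bar> < \<Theta>"
  shows "norm (1 / exp (\<sigma> * s)) \<le> exp (norm \<sigma> * \<Theta>)"
proof -
  have "\<bar>Re (\<sigma> * s)\<bar> = \<bar>Im \<sigma>\<bar> * \<bar>Im s\<bar>" using assms(1) by (simp add: abs_mult)
  also have "\<dots> \<le> norm \<sigma> * \<Theta>" using assms abs_Im_le_cmod[of \<sigma>] by (intro mult_mono) auto
  finally have "- Re (\<sigma> * s) \<le> norm \<sigma> * \<Theta>" by linarith
  then have "exp (- Re (\<sigma> * s)) \<le> exp (norm \<sigma> * \<Theta>)" by (simp only: exp_le_cancel_iff)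
  then show ?thesis by (simp only: norm_divide norm_exp_eq_Re exp_minus norm_one inverse_eq_divide)
qed

lemma eventually_log_sector: "\<epsilon> > 0 \<Longrightarrow> eventually (\<lambda>s. s \<in> log_sector \<epsilon> \<Theta>) (at_log_zero \<Theta>)"
  unfolding at_log_zero_def eventually_inf_principal eventually_filtercomap log_sector_def
  by (intro exI[of _ "\<lambda>t. t < ln \<epsilon>"]) (auto intro: eventually_gt_at_bot eventually_at_bot_dense[THEN iffD2])

section \<open>Constancy and value of the trace on a sector\<close>

lemma trace_limit_constant:
  assumes sys: "schlesinger_system \<theta>0 \<theta>x \<theta>1 \<theta>inf A0 Ax A1 (log_sector \<epsilon> \<Theta>)" and \<Theta>: "\<Theta> > 0" and \<epsilon>: "0 < \<epsilon>" "\<epsilon> < r" "r < 1"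
  shows "\<exists>c. \<forall>s\<in>log_sector \<epsilon> \<Theta>. trace (fuchsian_transp (A0 s) (Ax s) (A1 s) (exp s) (circ r)) = c"
proof -
  have r: "norm (exp s) < r" if "s \<in> log_sector \<epsilon> \<Theta>" for s using log_sector_norm_exp[OF \<epsilon>(1) that] \<epsilon>(2) by linarith
  show ?thesis
    using has_field_derivative_zero_constant[OF log_sector_props(2), of \<epsilon> \<Theta> "\<lambda>s. trace (fuchsian_transp (A0 s) (Ax s) (A1 s) (exp s) (circ r))"]
      isomonodromy_circ[OF sys log_sector_props(1) r \<epsilon>(3)] has_field_derivative_at_within by blast
qed

text \<open>The trace along the fixed circle is constant, so one point is enough. At a real
  \<open>s\<close> far to the left the circle of radius \<open>sqrt (norm x)\<close> has nearly the
  limiting trace, and being admissible for the same \<open>x\<close> it has the same trace as the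
  fixed circle.\<close>

lemma trace_limit_value:
  assumes sys: "schlesinger_system \<theta>0 \<theta>x \<theta>1 \<theta>inf A0 Ax A1 (log_sector \<epsilon> \<Theta>)" and \<Theta>: "\<Theta> > 0" and \<epsilon>: "0 < \<epsilon>" "\<epsilon> < r" "r < 1"
    and \<Lambda>: "trace \<Lambda> = 0" "det \<Lambda> = - (\<sigma>^2 / 4)" "\<sigma> \<noteq> 0"
    and b: "\<And>s i j. s \<in> log_sector \<epsilon> \<Theta> \<Longrightarrow> norm (Ax s $ i $ j) \<le> C \<and> norm (A1 s $ i $ j) \<le> C \<and>
           norm (A0 s $ i $ j + Ax s $ i $ j - \<Lambda> $ i $ j) \<le> C * norm (exp s)"
    and s: "s \<in> log_sector \<epsilon> \<Theta>"
  shows "trace (fuchsian_transp (A0 s) (Ax s) (A1 s) (exp s) (circ r)) = 2 * cos (of_real pi * \<sigma>)"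
proof -
  obtain c where c: "\<And>s. s \<in> log_sector \<epsilon> \<Theta> \<Longrightarrow> trace (fuchsian_transp (A0 s) (Ax s) (A1 s) (exp s) (circ r)) = c"
    using trace_limit_constant[OF sys \<Theta> \<epsilon>] by blast
  have C: "C \<ge> 0" using b[OF s, of 1 1] norm_ge_zero order_trans by blast
  have "norm (c - 2 * cos (of_real pi * \<sigma>)) \<le> 0 + e" if e: "e > 0" for e
  proof -
    obtain \<delta> where \<delta>: "\<delta> > 0" and lim: "\<And>A0 Ax A1 x M. 0 < norm x \<and> norm x < 1 \<and>
     (\<forall>i j. norm (Ax $ i $ j) \<le> M \<and> norm (A1 $ i $ j) \<le> M \<and> norm (A0 $ i $ j + Ax $ i $ j - \<Lambda> $ i $ j) \<le> \<delta>) \<and>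
     M * (2 * sqrt (norm x)) \<le> \<delta> * (1 - sqrt (norm x)) \<Longrightarrow>
     norm (trace (fuchsian_transp A0 Ax A1 x (circ (sqrt (norm x)))) - 2 * cos (of_real pi * \<sigma>)) \<le> e"
      using trace_transp_limit[OF \<Lambda> e] by blast
    \<comment> \<open>A bound for \<open>sqrt (norm x)\<close> that meets both smallness conditions
      of \<open>trace_transp_limit\<close>; the point \<open>t\<close> is then placed so far to the
      left that \<open>exp (t / 2) \<le> q0\<close>.\<close>
    define q0 where "q0 = min (1/2) (\<delta> / (4 * (C + 1)))"
    define t where "t = min (2 * ln q0) (ln \<epsilon> - 1)"
    have q0: "q0 > 0" "q0 \<le> 1/2" "C * q0 \<le> \<delta> / 4"
    proof -
      show q: "q0 > 0" using \<delta> C by (simp add: q0_def)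
      show "q0 \<le> 1/2" unfolding q0_def by (rule min.cobounded1)
      have "q0 \<le> \<delta> / (4 * (C + 1))" by (simp add: q0_def)
      then have "4 * (C * q0) + 4 * q0 \<le> \<delta>" using C by (simp add: pos_le_divide_eq algebra_simps)
      then show "C * q0 \<le> \<delta> / 4" using q by linarith
    qed
    define x where "x = exp (complex_of_real t)"
    define q where "q = exp (t / 2)"
    have nx: "norm x = q * q" by (simp add: x_def q_def norm_exp_eq_Re flip: exp_add)
    have sq: "sqrt (norm x) = q" by (simp add: nx q_def)
    have "q \<le> exp (ln q0)" unfolding q_def by (simp add: t_def)
    then have q: "0 < q" "q \<le> q0" "q \<le> 1/2" using q0 by (auto simp: q_def)
    have qq: "q * q \<le> q * (1/2)" using q by (intro mult_left_mono) auto
    have Cq: "C * q \<le> \<delta> / 4" using mult_left_mono[OF q(2) C] q0(3) by linarith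
    have S: "of_real t \<in> log_sector \<epsilon> \<Theta>" by (rule log_sector_real[OF \<Theta>]) (simp add: t_def)
    note bt = b[OF S, folded x_def]
    have "C * norm x \<le> C * q" unfolding nx using qq q C by (intro mult_left_mono) auto
    then have "C * norm x \<le> \<delta>" using Cq \<delta> by linarith
    then have b3: "\<forall>i j. norm (Ax (of_real t) $ i $ j) \<le> C \<and> norm (A1 (of_real t) $ i $ j) \<le> C \<and>
        norm (A0 (of_real t) $ i $ j + Ax (of_real t) $ i $ j - \<Lambda> $ i $ j) \<le> \<delta>" using bt order_trans by blast
    have "\<delta> * (1/2) \<le> \<delta> * (1 - q)" using \<delta> q by (intro mult_left_mono) auto
    then have b4: "C * (2 * sqrt (norm x)) \<le> \<delta> * (1 - sqrt (norm x))" unfolding sq using Cq by linarith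
    have n1: "0 < norm x" "norm x < q" "q < 1" "norm x < 1" proof -
      have "q * q < q" "q * q > 0" using qq q by simp_all
      then show "0 < norm x" "norm x < q" "q < 1" "norm x < 1" unfolding nx using q by linarith+
    qed
    have "norm (trace (fuchsian_transp (A0 (of_real t)) (Ax (of_real t)) (A1 (of_real t)) x (circ q)) - 2 * cos (of_real pi * \<sigma>)) \<le> e"
      using lim[of x "Ax (of_real t)" C "A1 (of_real t)" "A0 (of_real t)"] n1 b3 b4 unfolding sq by blast
    moreover have "trace (fuchsian_transp (A0 (of_real t)) (Ax (of_real t)) (A1 (of_real t)) x (circ q))
       = trace (fuchsian_transp (A0 (of_real t)) (Ax (of_real t)) (A1 (of_real t)) x (circ r))"
    proof (rule trace_fuchsian_transp_eq)
      show "x \<noteq> 0" using n1(1) by auto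
      show "ccw_loop_around (circ q) (closed_segment 0 x) {1}" by (rule circ_admissible[OF n1(2,3)])
      show "ccw_loop_around (circ r) (closed_segment 0 x) {1}"
        by (rule circ_admissible[OF _ \<epsilon>(3)]) (use log_sector_norm_exp[OF \<epsilon>(1) S] \<epsilon>(2) in \<open>simp add: x_def\<close>)
    qed
    ultimately show ?thesis using c[OF S] by (simp add: x_def)
  qed
  then have "norm (c - 2 * cos (of_real pi * \<sigma>)) \<le> 0" by (rule field_le_epsilon)
  then show ?thesis using c[OF s] by simp
qed

theorem proposition3:
  fixes \<alpha> \<beta> \<gamma> \<delta> \<theta>0 \<theta>x \<theta>1 \<theta>inf \<sigma> \<phi> A B rt :: complex
  assumes "\<theta>0^2 = - 2 * \<beta>" and "\<theta>x^2 = 1 - 2 * \<delta>" and "\<theta>1^2 = 2 * \<gamma>"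
    and "(\<theta>inf - 1)^2 = 2 * \<alpha>" and "\<theta>inf \<noteq> 0"
    and "Re \<sigma> = 0" and "\<sigma> \<noteq> 0"
    and "B = (\<theta>0^2 - \<theta>x^2 + \<sigma>^2) / (2 * \<sigma>^2)"
    and "rt^2 = (\<sigma>^2 - (\<theta>0 + \<theta>x)^2) * ((\<theta>0 - \<theta>x)^2 - \<sigma>^2)"
    and "A = rt / (2 * \<sigma>^2)"
    and "A \<noteq> 0"
  shows "B = (\<sigma>^2 - 2 * \<beta> - 1 + 2 * \<delta>) / (2 * \<sigma>^2) \<and>
    A^2 = \<theta>0^2 / \<sigma>^2 - B^2 \<and>
    A^2 = - 2 * \<beta> / \<sigma>^2 - B^2 \<and>
    \<sigma> \<notin> {\<theta>0 + \<theta>x, - (\<theta>0 + \<theta>x), \<theta>0 - \<theta>x, - (\<theta>0 - \<theta>x)} \<and>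
    (\<exists>(Y :: complex \<Rightarrow> complex) (\<delta>s :: complex \<Rightarrow> complex)
      (b :: nat \<Rightarrow> int \<Rightarrow> complex) (a :: int \<Rightarrow> nat \<Rightarrow> complex).
      (\<forall>m1 m2. a m1 m2 = b m2 (m1 - int m2)) \<and>
      (\<forall>\<Theta>>0. \<delta>s \<in> O[at_log_zero \<Theta>](\<lambda>s. exp s)) \<and>
      (\<forall>\<Theta>>0. \<exists>\<epsilon>. 0 < \<epsilon> \<and> \<epsilon> < 1 \<and>
        PVI_solution_on \<alpha> \<beta> \<gamma> \<delta> Y (log_sector \<epsilon> \<Theta>) \<and>
        (\<forall>s \<in> log_sector \<epsilon> \<Theta>.
          Y s = exp s * (\<i> * A * sin (\<i> * \<sigma> * s + \<phi>) + B + \<delta>s s) \<and>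
          (\<lambda>k. let n = Suc k in
             exp s ^ n * (\<Sum>m = - int n - 1..int n + 1. b n m * exp (of_int m * \<sigma> * s)))
            sums \<delta>s s \<and>
          (\<lambda>k. let m2 = Suc k in
             \<Sum>m1 = -1..2 * int m2 + 1.
               a m1 m2 * exp (of_int m1 * \<sigma> * s) * exp (of_nat m2 * (1 - \<sigma>) * s))
            sums \<delta>s s) \<and>
        (\<exists>A0 Ax A1. schlesinger_system \<theta>0 \<theta>x \<theta>1 \<theta>inf A0 Ax A1 (log_sector \<epsilon> \<Theta>) \<and>
           PVI_associated A0 A1 Y (log_sector \<epsilon> \<Theta>)) \<and>
        (\<forall>A0 Ax A1. schlesinger_system \<theta>0 \<theta>x \<theta>1 \<theta>inf A0 Ax A1 (log_sector \<epsilon> \<Theta>) \<and>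
           PVI_associated A0 A1 Y (log_sector \<epsilon> \<Theta>) \<longrightarrow>
           (\<forall>s \<in> log_sector \<epsilon> \<Theta>. \<forall>p.
              is_p0x (A0 s) (Ax s) (A1 s) (exp s) p \<longleftrightarrow> p = 2 * cos (of_real pi * \<sigma>))))) \<and>
    2 * cos (of_real pi * \<sigma>) \<in> \<real> \<and> Re (2 * cos (of_real pi * \<sigma>)) > 2"
proof -
  have s0: "\<sigma> \<noteq> 0" and re: "Re \<sigma> = 0" and A0: "A \<noteq> 0" by fact+
  have B1: "B = (\<sigma>^2 - 2 * \<beta> - 1 + 2 * \<delta>) / (2 * \<sigma>^2)"
    using assms(1,2,8) by simp
  have A2: "A^2 = \<theta>0^2 / \<sigma>^2 - B^2"
  proof -
    have "rt^2 = 4 * \<sigma>^2 * \<theta>0^2 - (\<theta>0^2 - \<theta>x^2 + \<sigma>^2)^2" unfolding assms(9) by algebra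
    then have "A^2 = (4 * \<sigma>^2 * \<theta>0^2 - (\<theta>0^2 - \<theta>x^2 + \<sigma>^2)^2) / (2 * \<sigma>^2)^2"
      unfolding assms(10) by (simp only: power_divide)
    also have "\<dots> = 4 * \<sigma>^2 * \<theta>0^2 / (2 * \<sigma>^2)^2 - B^2" unfolding assms(8) power_divide diff_divide_distrib ..
    also have "4 * \<sigma>^2 * \<theta>0^2 / (2 * \<sigma>^2)^2 = \<theta>0^2 / \<sigma>^2" using s0 by (simp add: field_simps power2_eq_square)
    finally show ?thesis .
  qed
  have A3: "A^2 = - 2 * \<beta> / \<sigma>^2 - B^2" using A2 assms(1) by simp
  have notin: "\<sigma> \<notin> {\<theta>0 + \<theta>x, - (\<theta>0 + \<theta>x), \<theta>0 - \<theta>x, - (\<theta>0 - \<theta>x)}"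
  proof
    assume "\<sigma> \<in> {\<theta>0 + \<theta>x, - (\<theta>0 + \<theta>x), \<theta>0 - \<theta>x, - (\<theta>0 - \<theta>x)}"
    then have "\<sigma>^2 = (\<theta>0 + \<theta>x)^2 \<or> \<sigma>^2 = (\<theta>0 - \<theta>x)^2" by (auto simp: power2_eq_iff)
    then have "rt^2 = 0" unfolding assms(9) by auto
    then show False using A0 assms(10) by simp
  qed
  obtain y \<Lambda> where y: "degree_bound 2 y"
    and lead: "\<And>s. poly (fps_nth y 0) (exp (\<sigma> * s)) = exp (\<sigma> * s) * (\<i> * A * sin (\<i> * \<sigma> * s + \<phi>) + B)"
    and \<Lambda>: "trace \<Lambda> = 0" "det \<Lambda> = - (\<sigma>^2 / 4)"
    and sol: "\<And>\<Theta>. \<Theta> > 0 \<Longrightarrow> \<exists>\<epsilon> C. 0 < \<epsilon> \<and> \<epsilon> < 1 \<and>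
      (\<forall>s\<in>log_sector \<epsilon> \<Theta>.
        (\<lambda>n. poly (fps_nth y n) (exp (\<sigma> * s)) * exp ((1 - \<sigma>) * s) ^ n) sums ev \<sigma> y s \<and>
        norm (ev \<sigma> y s - poly (fps_nth y 0) (exp (\<sigma> * s))) \<le> C * norm (exp s)) \<and>
      (\<exists>A0 Ax A1. schlesinger_system \<theta>0 \<theta>x \<theta>1 \<theta>inf A0 Ax A1 (log_sector \<epsilon> \<Theta>) \<and>
        PVI_associated A0 A1 (\<lambda>s. exp s * (ev \<sigma> y s / exp (\<sigma> * s))) (log_sector \<epsilon> \<Theta>) \<and>
        (\<forall>s\<in>log_sector \<epsilon> \<Theta>. \<forall>i j. norm (Ax s $ i $ j) \<le> C \<and> norm (A1 s $ i $ j) \<le> C \<and>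
           norm (A0 s $ i $ j + Ax s $ i $ j - \<Lambda> $ i $ j) \<le> C * norm (exp s)))"
    using analytic_solution[OF assms(5) re s0 assms(8) A2, of \<phi>] by blast
  define Y where "Y = (\<lambda>s. exp s * (ev \<sigma> y s / exp (\<sigma> * s)))"
  \<comment> \<open>All terms of order at least one in \<open>v\<close>; the term of order zero has
    become the sine and \<open>B\<close>.\<close>
  define \<delta>s where "\<delta>s = (\<lambda>s. (ev \<sigma> y s - poly (fps_nth y 0) (exp (\<sigma> * s))) / exp (\<sigma> * s))"
  \<comment> \<open>The shift by \<open>n + 1\<close> accounts for the division by \<open>w\<close>
    and for \<open>v^n = x^n / w^n\<close>.\<close>
  define b where "b = (\<lambda>n m. coeff (fps_nth y n) (nat (m + int n + 1)))"
  define a where "a = (\<lambda>m1 m2. b m2 (m1 - int m2))"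
  have Ys: "Y s = exp s * (\<i> * A * sin (\<i> * \<sigma> * s + \<phi>) + B + \<delta>s s)" for s
    unfolding Y_def \<delta>s_def lead by (simp add: diff_divide_distrib)
  have \<delta>b: "norm (\<delta>s s) \<le> (C * exp (norm \<sigma> * \<Theta>)) * norm (exp s)"
    if \<Theta>: "\<Theta> > 0" and c: "\<And>s. s \<in> log_sector \<epsilon> \<Theta> \<Longrightarrow> norm (ev \<sigma> y s - poly (fps_nth y 0) (exp (\<sigma> * s))) \<le> C * norm (exp s)"
      and s: "s \<in> log_sector \<epsilon> \<Theta>" for \<Theta> C \<epsilon> s
  proof -
    have "\<bar>Im s\<bar> < \<Theta>" using s by (simp add: log_sector_def)
    note w = norm_inverse_exp_sector[OF re \<Theta> this]
    have "norm (\<delta>s s) = norm (ev \<sigma> y s - poly (fps_nth y 0) (exp (\<sigma> * s))) * norm (1 / exp (\<sigma> * s))"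
      by (simp add: \<delta>s_def norm_divide)
    also have "\<dots> \<le> (C * norm (exp s)) * exp (norm \<sigma> * \<Theta>)"
      using c[OF s] w by (intro mult_mono) (auto intro: order_trans[OF norm_ge_zero])
    finally show ?thesis by (simp only: mult_ac)
  qed
  have O: "\<delta>s \<in> O[at_log_zero \<Theta>](\<lambda>s. exp s)" if \<Theta>: "\<Theta> > 0" for \<Theta>
  proof -
    obtain \<epsilon> C where \<epsilon>: "0 < \<epsilon>" and c: "\<And>s. s \<in> log_sector \<epsilon> \<Theta> \<Longrightarrow> norm (ev \<sigma> y s - poly (fps_nth y 0) (exp (\<sigma> * s))) \<le> C * norm (exp s)"
      using sol[OF \<Theta>] by blast
    show ?thesis
      by (rule bigoI[of _ "C * exp (norm \<sigma> * \<Theta>)"], rule eventually_mono[OF eventually_log_sector[OF \<epsilon>]], rule \<delta>b[OF \<Theta> c])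
  qed
  have main: "\<exists>\<epsilon>. 0 < \<epsilon> \<and> \<epsilon> < 1 \<and>
        PVI_solution_on \<alpha> \<beta> \<gamma> \<delta> Y (log_sector \<epsilon> \<Theta>) \<and>
        (\<forall>s \<in> log_sector \<epsilon> \<Theta>.
          Y s = exp s * (\<i> * A * sin (\<i> * \<sigma> * s + \<phi>) + B + \<delta>s s) \<and>
          (\<lambda>k. let n = Suc k in
             exp s ^ n * (\<Sum>m = - int n - 1..int n + 1. b n m * exp (of_int m * \<sigma> * s)))
            sums \<delta>s s \<and>
          (\<lambda>k. let m2 = Suc k in
             \<Sum>m1 = -1..2 * int m2 + 1.
               a m1 m2 * exp (of_int m1 * \<sigma> * s) * exp (of_nat m2 * (1 - \<sigma>) * s))
            sums \<delta>s s) \<and>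
        (\<exists>A0 Ax A1. schlesinger_system \<theta>0 \<theta>x \<theta>1 \<theta>inf A0 Ax A1 (log_sector \<epsilon> \<Theta>) \<and>
           PVI_associated A0 A1 Y (log_sector \<epsilon> \<Theta>)) \<and>
        (\<forall>A0 Ax A1. schlesinger_system \<theta>0 \<theta>x \<theta>1 \<theta>inf A0 Ax A1 (log_sector \<epsilon> \<Theta>) \<and>
           PVI_associated A0 A1 Y (log_sector \<epsilon> \<Theta>) \<longrightarrow>
           (\<forall>s \<in> log_sector \<epsilon> \<Theta>. \<forall>p.
              is_p0x (A0 s) (Ax s) (A1 s) (exp s) p \<longleftrightarrow> p = 2 * cos (of_real pi * \<sigma>)))" if \<Theta>: "\<Theta> > 0" for \<Theta>
  proof -
    obtain \<epsilon> C where \<epsilon>: "0 < \<epsilon>" "\<epsilon> < 1"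
      and ser: "\<forall>s\<in>log_sector \<epsilon> \<Theta>.
        (\<lambda>n. poly (fps_nth y n) (exp (\<sigma> * s)) * exp ((1 - \<sigma>) * s) ^ n) sums ev \<sigma> y s \<and>
        norm (ev \<sigma> y s - poly (fps_nth y 0) (exp (\<sigma> * s))) \<le> C * norm (exp s)"
      and ex: "\<exists>A0 Ax A1. schlesinger_system \<theta>0 \<theta>x \<theta>1 \<theta>inf A0 Ax A1 (log_sector \<epsilon> \<Theta>) \<and>
        PVI_associated A0 A1 Y (log_sector \<epsilon> \<Theta>) \<and>
        (\<forall>s\<in>log_sector \<epsilon> \<Theta>. \<forall>i j. norm (Ax s $ i $ j) \<le> C \<and> norm (A1 s $ i $ j) \<le> C \<and>
           norm (A0 s $ i $ j + Ax s $ i $ j - \<Lambda> $ i $ j) \<le> C * norm (exp s))"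
      using sol[OF \<Theta>, folded Y_def] by (elim exE conjE) blast
    note sm = ser[rule_format, THEN conjunct1] and c = ser[rule_format, THEN conjunct2]
    obtain A0 Ax A1 where sys: "schlesinger_system \<theta>0 \<theta>x \<theta>1 \<theta>inf A0 Ax A1 (log_sector \<epsilon> \<Theta>)"
      and assoc: "PVI_associated A0 A1 Y (log_sector \<epsilon> \<Theta>)"
      and bd': "\<forall>s\<in>log_sector \<epsilon> \<Theta>. \<forall>i j. norm (Ax s $ i $ j) \<le> C \<and> norm (A1 s $ i $ j) \<le> C \<and>
           norm (A0 s $ i $ j + Ax s $ i $ j - \<Lambda> $ i $ j) \<le> C * norm (exp s)"
      using ex by (elim exE conjE) blast
    note bd = bd'[rule_format]
    let ?S = "log_sector \<epsilon> \<Theta>"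
    have x1: "\<forall>s\<in>?S. exp s \<noteq> 1"
    proof
      fix s assume s: "s \<in> ?S"
      have "norm (exp s) < 1" using log_sector_norm_exp[OF \<epsilon>(1) s] \<epsilon>(2) by linarith
      then show "exp s \<noteq> 1" by (metis less_irrefl norm_one)
    qed
    note op = log_sector_props(1)[of \<epsilon> \<Theta>]
    have "\<exists>s\<in>?S. Y s \<notin> {0, 1, exp s}"
      by (rule generic_points[OF A0 re s0 \<Theta>, where \<delta>s = \<delta>s, OF Ys \<delta>b[OF \<Theta> c]])
    \<comment> \<open>The generic point has two uses: it shows that \<open>Y\<close> is not
      identically \<open>0\<close>, \<open>1\<close> or \<open>x\<close>, and it is the place where
      an arbitrary associated system is compared with the constructed one.\<close>
    then obtain s1 where s1: "s1 \<in> ?S" "Y s1 \<notin> {0, 1, exp s1}" by (elim bexE) rule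
    have "PVI_solution_on \<alpha> \<beta> \<gamma> \<delta> Y ?S"
      unfolding PVI_solution_on_def
    proof (intro conjI ballI impI)
      show "open ?S" "connected ?S" by (rule log_sector_props)+
      show "Y holomorphic_on ?S" by (rule associated_holomorphic[OF sys assoc op x1])
      show "\<exists>s\<in>?S. Y s \<notin> {0, 1, exp s}" using s1 by blast
      show "x_deriv (x_deriv Y) s = PVI_rhs \<alpha> \<beta> \<gamma> \<delta> (exp s) (Y s) (x_deriv Y s)"
        if "s \<in> ?S" "Y s \<notin> {0, 1, exp s}" for s
        by (rule associated_PVI[OF sys assoc op x1 that]) (use assms(1-4) in simp_all)
    qed
    moreover have "\<forall>s \<in> ?S.
          Y s = exp s * (\<i> * A * sin (\<i> * \<sigma> * s + \<phi>) + B + \<delta>s s) \<and>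
          (\<lambda>k. let n = Suc k in
             exp s ^ n * (\<Sum>m = - int n - 1..int n + 1. b n m * exp (of_int m * \<sigma> * s)))
            sums \<delta>s s \<and>
          (\<lambda>k. let m2 = Suc k in
             \<Sum>m1 = -1..2 * int m2 + 1.
               a m1 m2 * exp (of_int m1 * \<sigma> * s) * exp (of_nat m2 * (1 - \<sigma>) * s))
            sums \<delta>s s"
    proof
      fix s assume s: "s \<in> ?S"
      let ?t = "\<lambda>n. poly (fps_nth y n) (exp (\<sigma> * s)) * exp ((1 - \<sigma>) * s) ^ n"
      have "(\<lambda>k. ?t (Suc k)) sums (ev \<sigma> y s - ?t 0)" by (rule iffD2[OF sums_Suc_iff[of ?t]]) (use sm[OF s] in simp)
      from sums_divide[OF this, of "exp (\<sigma> * s)"]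
      have 1: "(\<lambda>k. exp s ^ Suc k * (\<Sum>m = - int (Suc k) - 1..int (Suc k) + 1. b (Suc k) m * exp (of_int m * \<sigma> * s))) sums \<delta>s s"
        unfolding term_as_double_sum[OF y] b_def \<delta>s_def by (simp only: power_0 mult_1_right)
      have 2: "(\<lambda>k. \<Sum>m1 = -1..2 * int (Suc k) + 1. a m1 (Suc k) * exp (of_int m1 * \<sigma> * s) * exp (of_nat (Suc k) * (1 - \<sigma>) * s)) sums \<delta>s s"
        unfolding a_def double_sum_forms by (rule 1)
      show "Y s = exp s * (\<i> * A * sin (\<i> * \<sigma> * s + \<phi>) + B + \<delta>s s) \<and>
          (\<lambda>k. let n = Suc k in exp s ^ n * (\<Sum>m = - int n - 1..int n + 1. b n m * exp (of_int m * \<sigma> * s))) sums \<delta>s s \<and>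
          (\<lambda>k. let m2 = Suc k in \<Sum>m1 = -1..2 * int m2 + 1. a m1 m2 * exp (of_int m1 * \<sigma> * s) * exp (of_nat m2 * (1 - \<sigma>) * s)) sums \<delta>s s"
        unfolding Let_def using Ys[of s] 1 2 by blast
    qed
    moreover have "is_p0x (B0 s) (Bx s) (B1 s) (exp s) p \<longleftrightarrow> p = 2 * cos (of_real pi * \<sigma>)"
      if B: "schlesinger_system \<theta>0 \<theta>x \<theta>1 \<theta>inf B0 Bx B1 ?S" "PVI_associated B0 B1 Y ?S" and s: "s \<in> ?S" for B0 Bx B1 s p
    proof -
      \<comment> \<open>A radius between \<open>\<epsilon>\<close> and 1 makes one circle admissible
        for all points of the sector.\<close>
      define r where "r = (1 + \<epsilon>) / 2"
      have r: "\<epsilon> < r" "r < 1" using \<epsilon> by (auto simp: r_def)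
      have xr: "norm (exp s) < r" if "s \<in> ?S" for s using log_sector_norm_exp[OF \<epsilon>(1) that] r by linarith
      obtain k where k: "\<And>s. s \<in> ?S \<Longrightarrow> trace (fuchsian_transp (B0 s) (Bx s) (B1 s) (exp s) (circ r)) = k"
        using trace_limit_constant[OF B(1) \<Theta> \<epsilon>(1) r] by blast
      \<comment> \<open>At the given \<open>s\<close> the solution may take one of the exceptional
        values, where \<open>residues_unique\<close> does not apply; the constancy of the trace
        moves the comparison to \<open>s1\<close>.\<close>
      have "k = trace (fuchsian_transp (A0 s1) (Ax s1) (A1 s1) (exp s1) (circ r))"
        unfolding k[OF s1(1), symmetric]
        by (rule associated_trace_unique[OF sys assoc B op x1 assms(5) s1 xr[OF s1(1)] r(2)])
      also have "\<dots> = 2 * cos (of_real pi * \<sigma>)" by (rule trace_limit_value[OF sys \<Theta> \<epsilon>(1) r \<Lambda> s0 bd s1(1)])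
      finally have "trace (fuchsian_transp (B0 s) (Bx s) (B1 s) (exp s) (circ r)) = 2 * cos (of_real pi * \<sigma>)" using k[OF s] by simp
      moreover have "norm (exp s) < 1" using xr[OF s] r by linarith
      ultimately show ?thesis
        using is_p0x_iff_trace[OF exp_not_eq_zero _ circ_admissible[OF xr[OF s] r(2)], of "B0 s" "Bx s" "B1 s" p] by simp
    qed
    ultimately show ?thesis using \<epsilon> sys assoc
      by (intro exI[of _ \<epsilon>]) blast
  qed
  have ab: "\<forall>m1 m2. a m1 m2 = b m2 (m1 - int m2)" by (simp add: a_def)
  have ex: "\<exists>(Y :: complex \<Rightarrow> complex) (\<delta>s :: complex \<Rightarrow> complex)
      (b :: nat \<Rightarrow> int \<Rightarrow> complex) (a :: int \<Rightarrow> nat \<Rightarrow> complex). 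
      (\<forall>m1 m2. a m1 m2 = b m2 (m1 - int m2)) \<and>
      (\<forall>\<Theta>>0. \<delta>s \<in> O[at_log_zero \<Theta>](\<lambda>s. exp s)) \<and>
      (\<forall>\<Theta>>0. \<exists>\<epsilon>. 0 < \<epsilon> \<and> \<epsilon> < 1 \<and>
        PVI_solution_on \<alpha> \<beta> \<gamma> \<delta> Y (log_sector \<epsilon> \<Theta>) \<and>
        (\<forall>s \<in> log_sector \<epsilon> \<Theta>.
          Y s = exp s * (\<i> * A * sin (\<i> * \<sigma> * s + \<phi>) + B + \<delta>s s) \<and>
          (\<lambda>k. let n = Suc k in
             exp s ^ n * (\<Sum>m = - int n - 1..int n + 1. b n m * exp (of_int m * \<sigma> * s)))
            sums \<delta>s s \<and>
          (\<lambda>k. let m2 = Suc k in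
             \<Sum>m1 = -1..2 * int m2 + 1.
               a m1 m2 * exp (of_int m1 * \<sigma> * s) * exp (of_nat m2 * (1 - \<sigma>) * s))
            sums \<delta>s s) \<and>
        (\<exists>A0 Ax A1. schlesinger_system \<theta>0 \<theta>x \<theta>1 \<theta>inf A0 Ax A1 (log_sector \<epsilon> \<Theta>) \<and>
           PVI_associated A0 A1 Y (log_sector \<epsilon> \<Theta>)) \<and>
        (\<forall>A0 Ax A1. schlesinger_system \<theta>0 \<theta>x \<theta>1 \<theta>inf A0 Ax A1 (log_sector \<epsilon> \<Theta>) \<and>
           PVI_associated A0 A1 Y (log_sector \<epsilon> \<Theta>) \<longrightarrow>
           (\<forall>s \<in> log_sector \<epsilon> \<Theta>. \<forall>p.
              is_p0x (A0 s) (Ax s) (A1 s) (exp s) p \<longleftrightarrow> p = 2 * cos (of_real pi * \<sigma>))))"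
    apply (rule exI[of _ Y], rule exI[of _ \<delta>s], rule exI[of _ b], rule exI[of _ a])
    apply (rule conjI, rule ab, rule conjI, intro allI impI, erule O)
    apply (intro allI impI, erule main)
    done
  show ?thesis using B1 A2 A3 notin ex two_cos_imaginary[OF re s0] by (intro conjI)
qed

end
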